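(* Let $(A,\varphi_1,\varphi_2)$ be a real second-order noncommutative probability space with involution $x\mapsto x^t$, and let $A_1,\dots,A_m\subseteq A$ be subalgebras. Then $A_1,\dots,A_m$ are real second-order free if and only if all mixed free cumulants $\kappa_n$ and all mixed real second-order cumulants $\kappa_{p,q}$ vanish. (A cumulant is mixed if its arguments are taken from $A_1\cup\dots\cup A_m$ and include at least one element from each of more than one of the subalgebras.)
   Context: A real second-order noncommutative probability space is a unital complex algebra $A$ with an involution $x\mapsto x^t$ satisfying $(xy)^t=y^tx^t$, a linear functional $\varphi_1:A\to\mathbb{C}$ with $\varphi_1(1)=1$, and a bilinear $\varphi_2:A\times A\to\mathbb{C}$ which vanishes when either argument is $1$; the values of $\varphi_1$ and $\varphi_2$ are unchanged when any argument $x$ is replaced by $x^t$. Permutations and partitions. $[n]=\{1,\dots,n\}$, $[m,n]=\{m,\dots,n\}$. $\#(\pi)$ is the number of cycles of a permutation $\pi$, and $\Pi(\pi)$ is the partition of its domain into cycles. Partitions are ordered by $\mathcal U\preceq\mathcal V$ if every block of $\mathcal U$ is contained in a block of $\mathcal V$. Let $\tau_n=(1,\dots,n)$ and $\tau_{p,q}=(1,\dots,p)(p+1,\dots,p+q)$. - $S_{\mathrm{nc}}(n)$: permutations $\pi$ of $[n]$ with $\#(\pi)+\#(\pi^{-1}\tau_n)=n+1$. - $S_{\mathrm{disc-nc}}(p,q)$: permutations $\pi$ of $[p+q]$ with $\Pi(\pi)\preceq\Pi(\tau_{p,q})$ and $\#(\pi)+\#(\pi^{-1}\tau_{p,q})=p+q+2$.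 - $S_{\mathrm{ann-nc}}(p,q)$: permutations $\pi$ of $[p+q]$ such that some cycle of $\pi$ meets both $[p]$ and $[p+1,p+q]$, and $\#(\pi)+\#(\pi^{-1}\tau_{p,q})=p+q$. - $\mathit{PS}'(p,q)$: pairs $(\mathcal U,\pi)$ with $\pi\in S_{\mathrm{disc-nc}}(p,q)$ and $\mathcal U\succeq\Pi(\pi)$ a partition of $[p+q]$ each of whose blocks is a single cycle of $\pi$, except for one block $U$ (the nontrivial block) which is the union of exactly two cycles of $\pi$, one contained in $[p]$ and the other in $[p+1,p+q]$. Cycles are written starting from their smallest element. Free cumulants. The $\kappa_n:A^n\to\mathbb{C}$ are the multilinear functionals determined recursively by $\varphi_1(x_1\cdots x_n)=\sum_{\pi\in S_{\mathrm{nc}}(n)}\kappa_\pi(x_1,\dots,x_n)$, where for any permutation $\pi$ of a subset of $[n]$, $\kappa_\pi(x_1,\dots,x_n)=\prod_{(c_1,\dots,c_k)}\kappa_k(x_{c_1},\dots,x_{c_k})$, the product being over the cycles of $\pi$. Real second-order cumulants. The $\kappa_{p,q}:A^{p+q}\to\mathbb{C}$ ($p,q\ge1$) are the multilinear functionals determined recursively by $$\varphi_2(x_1\cdots x_p,\,y_1\cdots y_q)=\sum_{\pi\in S_{\mathrm{ann-nc}}(p,q)}\kappa_\pi(x_1,\dots,x_p,y_1,\dots,y_q)+\sum_{\pi\in S_{\mathrm{ann-nc}}(p,q)}\kappa_\pi(x_1,\dots,x_p,y_q^t,\dots,y_1^t)+\sum_{(\mathcal U,\pi)\in\mathit{PS}'(p,q)}\kappa_{(\mathcal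 U,\pi)}(x_1,\dots,x_p,y_1,\dots,y_q),$$ where, if $U$ is the nontrivial block of $\mathcal U$ and $\pi|_U=(c_1,\dots,c_r)(p+d_1,\dots,p+d_s)$, $$\kappa_{(\mathcal U,\pi)}(x_1,\dots,x_p,y_1,\dots,y_q)=\kappa_{\pi|_{[p+q]\setminus U}}(x_1,\dots,x_p,y_1,\dots,y_q)\,\kappa_{r,s}(x_{c_1},\dots,x_{c_r},y_{d_1},\dots,y_{d_s}).$$ Freeness. $x\in A$ is centred if $\varphi_1(x)=0$. Elements $x_1,\dots,x_p\in A_1\cup\dots\cup A_m$ are alternating if $x_i$ comes from a different subalgebra from $x_{i+1}$ for $i=1,\dots,p-1$, and cyclically alternating if in addition $x_p$ comes from a different subalgebra from $x_1$. The subalgebras are free if $\varphi_1(x_1\cdots x_p)=0$ for all centred alternating $x_1,\dots,x_p$. They are real second-order free if they are free and, for all $x_1,\dots,x_p$ and $y_1,\dots,y_q$ centred and cyclically alternating, $$\varphi_2(x_1\cdots x_p,\,y_1\cdots y_q)=\begin{cases}\displaystyle\sum_{k=1}^p\prod_{i=1}^p\varphi_1(x_iy_{k-i})+\sum_{k=1}^p\prod_{i=1}^p\varphi_1(x_iy_{k+i}^t),&p=q,\\ 0,&p\ne q,\end{cases}$$ with indices of $y$ taken modulo $p$.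
   Formalization: Added, as the claim fails otherwise: φ1 is tracial and φ2 tracial in each argument; the subalgebras contain 1 and are closed under t; a single element counts as cyclically alternating, and for p=q=1 the φ2 condition is imposed only for x, y from different subalgebras. *)

theory Defs
  imports Complex_Main "HOL-Combinatorics.Cycles" "HOL-Combinatorics.Orbits" "HOL-Library.Disjoint_Sets"
begin

section \<open>Probability spaces\<close>

text \<open>
  The transpose is complex-linear (not conjugate-linear), as is forced by the invariance of the
  linear functional \<open>\<phi>\<^sub>1\<close>. As usual for second-order spaces, \<open>\<phi>\<^sub>1\<close> is tracial and \<open>\<phi>\<^sub>2\<close> is tracial
  in each argument; the definition of second-order freeness depends on this, as it constrains \<open>\<phi>\<^sub>2\<close>
  only on cyclically alternating products. No symmetry of \<open>\<phi>\<^sub>2\<close> is assumed.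
\<close>

locale real_second_order_ncps = vector_space scale
  for scale :: "complex \<Rightarrow> 'a :: ring_1 \<Rightarrow> 'a" +
  fixes tr :: "'a \<Rightarrow> 'a" and \<phi>1 :: "'a \<Rightarrow> complex" and \<phi>2 :: "'a \<Rightarrow> 'a \<Rightarrow> complex"
  assumes scale_mult_left: "scale c (x * y) = scale c x * y"
    and scale_mult_right: "scale c (x * y) = x * scale c y"
    and tr_linear: "Vector_Spaces.linear scale scale tr"
    and tr_tr: "tr (tr x) = x"
    and tr_mult: "tr (x * y) = tr y * tr x"
    and \<phi>1_linear: "Vector_Spaces.linear scale (*) \<phi>1"
    and \<phi>1_one: "\<phi>1 1 = 1"
    and \<phi>1_tracial: "\<phi>1 (x * y) = \<phi>1 (y * x)"
    and \<phi>1_tr: "\<phi>1 (tr x) = \<phi>1 x"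
    and \<phi>2_linear_left: "Vector_Spaces.linear scale (*) (\<lambda>x. \<phi>2 x y)"
    and \<phi>2_linear_right: "Vector_Spaces.linear scale (*) (\<phi>2 x)"
    and \<phi>2_one_left: "\<phi>2 1 y = 0"
    and \<phi>2_one_right: "\<phi>2 x 1 = 0"
    and \<phi>2_tracial_left: "\<phi>2 (x * y) z = \<phi>2 (y * x) z"
    and \<phi>2_tracial_right: "\<phi>2 z (x * y) = \<phi>2 z (y * x)"
    and \<phi>2_tr_left: "\<phi>2 (tr x) y = \<phi>2 x y"
    and \<phi>2_tr_right: "\<phi>2 x (tr y) = \<phi>2 x y"

text \<open>Subalgebras are taken in the category of unital algebras with involution.\<close>

definition involutive_subalgebra ::
    "(complex \<Rightarrow> 'a \<Rightarrow> 'a) \<Rightarrow> ('a \<Rightarrow> 'a) \<Rightarrow> ('a :: ring_1) set \<Rightarrow> bool" where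
  "involutive_subalgebra scale tr B \<longleftrightarrow>
     module.subspace scale B \<and> 1 \<in> B \<and> (\<forall>x\<in>B. \<forall>y\<in>B. x * y \<in> B) \<and> (\<forall>x\<in>B. tr x \<in> B)"


section \<open>Noncrossing permutations and partitioned permutations\<close>

definition cycle_partition :: "('b \<Rightarrow> 'b) \<Rightarrow> 'b set \<Rightarrow> 'b set set" where
  "cycle_partition \<pi> S = orbit \<pi> ` S"

definition num_cycles :: "('b \<Rightarrow> 'b) \<Rightarrow> 'b set \<Rightarrow> nat" where
  "num_cycles \<pi> S = card (cycle_partition \<pi> S)"

definition tau :: "nat \<Rightarrow> nat \<Rightarrow> nat" where
  "tau n = cycle_of_list [1..<Suc n]"

definition tau2 :: "nat \<Rightarrow> nat \<Rightarrow> nat \<Rightarrow> nat" where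
  "tau2 p q = cycle_of_list [1..<Suc p] \<circ> cycle_of_list [Suc p..<Suc (p + q)]"

definition S_nc :: "nat \<Rightarrow> (nat \<Rightarrow> nat) set" where
  "S_nc n = {\<pi>. \<pi> permutes {1..n} \<and>
     num_cycles \<pi> {1..n} + num_cycles (inv \<pi> \<circ> tau n) {1..n} = n + 1}"

definition S_disc_nc :: "nat \<Rightarrow> nat \<Rightarrow> (nat \<Rightarrow> nat) set" where
  "S_disc_nc p q = {\<pi>. \<pi> permutes {1..p+q} \<and>
     refines {1..p+q} (cycle_partition \<pi> {1..p+q}) (cycle_partition (tau2 p q) {1..p+q}) \<and>
     num_cycles \<pi> {1..p+q} + num_cycles (inv \<pi> \<circ> tau2 p q) {1..p+q} = p + q + 2}"

definition S_ann_nc :: "nat \<Rightarrow> nat \<Rightarrow> (nat \<Rightarrow> nat) set" where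
  "S_ann_nc p q = {\<pi>. \<pi> permutes {1..p+q} \<and>
     (\<exists>C\<in>cycle_partition \<pi> {1..p+q}. C \<inter> {1..p} \<noteq> {} \<and> C \<inter> {p+1..p+q} \<noteq> {}) \<and>
     num_cycles \<pi> {1..p+q} + num_cycles (inv \<pi> \<circ> tau2 p q) {1..p+q} = p + q}"

definition PS' :: "nat \<Rightarrow> nat \<Rightarrow> (nat set set \<times> (nat \<Rightarrow> nat)) set" where
  "PS' p q = {(\<U>, \<pi>). \<pi> \<in> S_disc_nc p q \<and> refines {1..p+q} (cycle_partition \<pi> {1..p+q}) \<U> \<and>
     (\<exists>U\<in>\<U>. \<U> - {U} \<subseteq> cycle_partition \<pi> {1..p+q} \<and>
        (\<exists>C\<in>cycle_partition \<pi> {1..p+q}. \<exists>D\<in>cycle_partition \<pi> {1..p+q}.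
           C \<subseteq> {1..p} \<and> D \<subseteq> {p+1..p+q} \<and> U = C \<union> D))}"

text \<open>For \<open>(\<U>, \<pi>) \<in> PS' p q\<close> the nontrivial block is the only block that is not a cycle of \<open>\<pi>\<close>.\<close>

definition nontrivial_block :: "nat set set \<Rightarrow> (nat \<Rightarrow> nat) \<Rightarrow> nat set" where
  "nontrivial_block \<U> \<pi> = (THE U. U \<in> \<U> \<and> (\<forall>c\<in>U. U \<noteq> orbit \<pi> c))"


section \<open>Cumulants\<close>

text \<open>
  A sequence of multilinear functionals \<open>\<kappa>\<^sub>n\<close> is a single function on lists, evaluated at lists of
  length \<open>n\<close>, and a family \<open>\<kappa>\<^sub>p\<^sub>,\<^sub>q\<close> a function of two lists. \<open>cycle_args zs \<pi> C\<close> lists the arguments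
  \<open>z\<^sub>c\<close> (numbered from 1) along the cycle \<open>C\<close> of \<open>\<pi>\<close>, started at its smallest element.
\<close>

definition cycle_args :: "'a list \<Rightarrow> (nat \<Rightarrow> nat) \<Rightarrow> nat set \<Rightarrow> 'a list" where
  "cycle_args zs \<pi> C = map (\<lambda>c. zs ! (c - 1)) (support \<pi> (Min C))"

definition cumulant_perm ::
    "('a list \<Rightarrow> complex) \<Rightarrow> nat set \<Rightarrow> (nat \<Rightarrow> nat) \<Rightarrow> 'a list \<Rightarrow> complex" where
  "cumulant_perm \<kappa> S \<pi> zs = (\<Prod>C\<in>cycle_partition \<pi> S. \<kappa> (cycle_args zs \<pi> C))"

definition cumulant_PS ::
    "('a list \<Rightarrow> complex) \<Rightarrow> ('a list \<Rightarrow> 'a list \<Rightarrow> complex) \<Rightarrow>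
     nat set set \<times> (nat \<Rightarrow> nat) \<Rightarrow> 'a list \<Rightarrow> 'a list \<Rightarrow> complex" where
  "cumulant_PS \<kappa> \<kappa>2 = (\<lambda>(\<U>, \<pi>) xs ys.
     (let p = length xs; q = length ys; U = nontrivial_block \<U> \<pi> in
       cumulant_perm \<kappa> ({1..p+q} - U) \<pi> (xs @ ys) *
       \<kappa>2 (cycle_args (xs @ ys) \<pi> (U \<inter> {1..p})) (cycle_args (xs @ ys) \<pi> (U \<inter> {p+1..p+q}))))"

text \<open>
  The moment-cumulant relations have exactly one solution (up to the irrelevant values at empty
  argument lists; see the lemmas below), and its multilinearity is a consequence of the recursion.
\<close>

definition free_cumulants :: "('a :: monoid_mult \<Rightarrow> complex) \<Rightarrow> ('a list \<Rightarrow> complex) \<Rightarrow> bool" where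
  "free_cumulants \<phi>1 \<kappa> \<longleftrightarrow>
     (\<forall>xs. xs \<noteq> [] \<longrightarrow>
        \<phi>1 (prod_list xs) = (\<Sum>\<pi>\<in>S_nc (length xs). cumulant_perm \<kappa> {1..length xs} \<pi> xs))"

definition real_second_order_cumulants ::
    "('a :: monoid_mult \<Rightarrow> 'a) \<Rightarrow> ('a \<Rightarrow> 'a \<Rightarrow> complex) \<Rightarrow>
     ('a list \<Rightarrow> complex) \<Rightarrow> ('a list \<Rightarrow> 'a list \<Rightarrow> complex) \<Rightarrow> bool" where
  "real_second_order_cumulants tr \<phi>2 \<kappa> \<kappa>2 \<longleftrightarrow>
     (\<forall>xs ys. xs \<noteq> [] \<longrightarrow> ys \<noteq> [] \<longrightarrow>
        (let p = length xs; q = length ys in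
          \<phi>2 (prod_list xs) (prod_list ys) =
            (\<Sum>\<pi>\<in>S_ann_nc p q. cumulant_perm \<kappa> {1..p+q} \<pi> (xs @ ys)) +
            (\<Sum>\<pi>\<in>S_ann_nc p q. cumulant_perm \<kappa> {1..p+q} \<pi> (xs @ map tr (rev ys))) +
            (\<Sum>V\<in>PS' p q. cumulant_PS \<kappa> \<kappa>2 V xs ys)))"


section \<open>Freeness\<close>

text \<open>
  The subalgebras are \<open>A 1, \<dots>, A m\<close>. The list \<open>js\<close> records, for each element of \<open>xs\<close>, which
  subalgebra it is regarded as coming from.
\<close>

definition comes_from :: "(nat \<Rightarrow> 'a set) \<Rightarrow> nat \<Rightarrow> nat list \<Rightarrow> 'a list \<Rightarrow> bool" where
  "comes_from A m js xs \<longleftrightarrow> set js \<subseteq> {1..m} \<and> list_all2 (\<lambda>j x. x \<in> A j) js xs"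

definition centred :: "('a \<Rightarrow> complex) \<Rightarrow> 'a \<Rightarrow> bool" where
  "centred \<phi>1 x \<longleftrightarrow> \<phi>1 x = 0"

definition alternating :: "nat list \<Rightarrow> bool" where
  "alternating js \<longleftrightarrow> distinct_adj js"

text \<open>
  A single element is cyclically alternating: it has no neighbour other than itself.
\<close>

definition cyclically_alternating :: "nat list \<Rightarrow> bool" where
  "cyclically_alternating js \<longleftrightarrow> alternating js \<and> (length js \<ge> 2 \<longrightarrow> last js \<noteq> hd js)"

definition free_subalgebras ::
    "('a :: monoid_mult \<Rightarrow> complex) \<Rightarrow> (nat \<Rightarrow> 'a set) \<Rightarrow> nat \<Rightarrow> bool" where
  "free_subalgebras \<phi>1 A m \<longleftrightarrow>
     (\<forall>js xs. xs \<noteq> [] \<longrightarrow> comes_from A m js xs \<longrightarrow> alternating js \<longrightarrow> (\<forall>x\<in>set xs. centred \<phi>1 x) \<longrightarrow>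
        \<phi>1 (prod_list xs) = 0)"

text \<open>\<open>cyc_nth ys j\<close> is \<open>y\<^sub>j\<close>, with the index \<open>j\<close> in \<open>1, \<dots>, length ys\<close> taken modulo \<open>length ys\<close>.\<close>

definition cyc_nth :: "'a list \<Rightarrow> int \<Rightarrow> 'a" where
  "cyc_nth ys j = ys ! nat ((j - 1) mod int (length ys))"

text \<open>
  When \<open>p = q = 1\<close>, the condition is imposed only for \<open>x\<^sub>1\<close> and \<open>y\<^sub>1\<close> from different subalgebras
  (where it says \<open>\<phi>\<^sub>2(x\<^sub>1, y\<^sub>1) = 0\<close>), since otherwise it would prescribe \<open>\<phi>\<^sub>2\<close> within one subalgebra.
\<close>

definition real_second_order_free ::
    "('a :: monoid_mult \<Rightarrow> 'a) \<Rightarrow> ('a \<Rightarrow> complex) \<Rightarrow> ('a \<Rightarrow> 'a \<Rightarrow> complex) \<Rightarrow>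
     (nat \<Rightarrow> 'a set) \<Rightarrow> nat \<Rightarrow> bool" where
  "real_second_order_free tr \<phi>1 \<phi>2 A m \<longleftrightarrow>
     free_subalgebras \<phi>1 A m \<and>
     (\<forall>js xs ks ys. xs \<noteq> [] \<longrightarrow> ys \<noteq> [] \<longrightarrow>
        comes_from A m js xs \<longrightarrow> comes_from A m ks ys \<longrightarrow>
        cyclically_alternating js \<longrightarrow> cyclically_alternating ks \<longrightarrow>
        (length xs = 1 \<and> length ys = 1 \<longrightarrow> js \<noteq> ks) \<longrightarrow>
        (\<forall>x\<in>set xs. centred \<phi>1 x) \<longrightarrow> (\<forall>y\<in>set ys. centred \<phi>1 y) \<longrightarrow>
        (let p = length xs; q = length ys in
          \<phi>2 (prod_list xs) (prod_list ys) =
            (if p = q then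
               (\<Sum>k=1..p. \<Prod>i=1..p. \<phi>1 (cyc_nth xs (int i) * cyc_nth ys (int k - int i))) +
               (\<Sum>k=1..p. \<Prod>i=1..p. \<phi>1 (cyc_nth xs (int i) * tr (cyc_nth ys (int k + int i))))
             else 0)))"

definition mixed_free_cumulants_vanish ::
    "('a list \<Rightarrow> complex) \<Rightarrow> (nat \<Rightarrow> 'a set) \<Rightarrow> nat \<Rightarrow> bool" where
  "mixed_free_cumulants_vanish \<kappa> A m \<longleftrightarrow>
     (\<forall>js xs. comes_from A m js xs \<longrightarrow> card (set js) > 1 \<longrightarrow> \<kappa> xs = 0)"

definition mixed_second_order_cumulants_vanish ::
    "('a list \<Rightarrow> 'a list \<Rightarrow> complex) \<Rightarrow> (nat \<Rightarrow> 'a set) \<Rightarrow> nat \<Rightarrow> bool" where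
  "mixed_second_order_cumulants_vanish \<kappa>2 A m \<longleftrightarrow>
     (\<forall>js xs ks ys. xs \<noteq> [] \<longrightarrow> ys \<noteq> [] \<longrightarrow> comes_from A m js xs \<longrightarrow> comes_from A m ks ys \<longrightarrow>
        card (set js \<union> set ks) > 1 \<longrightarrow> \<kappa>2 xs ys = 0)"

section \<open>Existence and uniqueness of the cumulants\<close>

lemma orbit_cycle_list:
  assumes cs: "distinct cs" "cs \<noteq> []"
    and f: "\<And>i. i < length cs \<Longrightarrow> f (cs ! i) = cs ! (Suc i mod length cs)"
  shows "support f (hd cs) = cs" and "x \<in> set cs \<Longrightarrow> orbit f x = set cs"
proof -
  let ?l = "length cs"
  have l: "?l > 0" using cs by simp
  have hd: "hd cs = cs ! 0" using cs by (simp add: hd_conv_nth)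
  have pw: "(f ^^ n) (cs ! i) = cs ! ((i + n) mod ?l)" if "i < ?l" for n i
  proof (induction n)
    case (Suc n)
    have "(f ^^ Suc n) (cs ! i) = f (cs ! ((i + n) mod ?l))" using Suc by simp
    also have "\<dots> = cs ! (Suc ((i + n) mod ?l) mod ?l)" using l by (intro f) simp
    also have "\<dots> = cs ! ((i + Suc n) mod ?l)" by (simp add: mod_Suc_eq)
    finally show ?case .
  qed (use that in simp)
  have "least_power f (hd cs) = ?l"
    unfolding least_power_def
  proof (rule Least_equality)
    show "(f ^^ ?l) (hd cs) = hd cs \<and> 0 < ?l" using pw[of 0 ?l] l hd by simp
  next
    fix n assume n: "(f ^^ n) (hd cs) = hd cs \<and> 0 < n"
    then have "cs ! (n mod ?l) = cs ! 0" using pw[of 0 n] l hd by simp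
    then have "n mod ?l = 0" using nth_eq_iff_index_eq[OF cs(1), of "n mod ?l" 0] l by simp
    then show "?l \<le> n" using n by (meson dvd_imp_le mod_eq_0_iff_dvd)
  qed
  moreover have "(f ^^ i) (hd cs) = cs ! i" if "i < ?l" for i
    using pw[of 0 i] that l hd by simp
  ultimately show "support f (hd cs) = cs" by (auto intro: nth_equalityI)
  assume "x \<in> set cs"
  then obtain i where i: "i < ?l" "x = cs ! i" by (metis in_set_conv_nth)
  show "orbit f x = set cs"
  proof
    show "orbit f x \<subseteq> set cs" using pw[OF i(1)] i l by (auto simp: orbit_altdef)
    show "set cs \<subseteq> orbit f x"
    proof
      fix y assume "y \<in> set cs"
      then obtain j where j: "j < ?l" "y = cs ! j" by (metis in_set_conv_nth)
      have "(f ^^ (?l + j - i + ?l)) x = cs ! ((i + (?l + j - i + ?l)) mod ?l)" using pw[OF i(1)] i by simp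
      also have "i + (?l + j - i + ?l) = j + ?l * 2" using i by simp
      also have "cs ! ((j + ?l * 2) mod ?l) = y" using j by simp
      finally have "y = (f ^^ (?l + j - i + ?l)) x" by simp
      then show "y \<in> orbit f x" using l unfolding orbit_altdef by blast
    qed
  qed
qed

lemma cycle_of_list_nth:
  assumes "distinct cs" "i < length cs"
  shows "cycle_of_list cs (cs ! i) = cs ! (Suc i mod length cs)"
proof -
  have "map (cycle_of_list cs) cs ! i = rotate1 cs ! i"
    using cyclic_rotation[OF assms(1), of 1] by simp
  then show ?thesis using assms by (simp add: nth_rotate1)
qed

lemma cycle_partition_facts:
  fixes \<pi> :: "nat \<Rightarrow> nat"
  assumes "\<pi> permutes S" "finite S" "C \<in> cycle_partition \<pi> S"
  shows "C \<subseteq> S" "C \<noteq> {}" "finite C" "x \<in> C \<Longrightarrow> orbit \<pi> x = C"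
    "set (support \<pi> (Min C)) = C" "length (cycle_args zs \<pi> C) = card C" 
proof -
  have perm: "permutation \<pi>" using assms by (auto simp: permutation_permutes)
  obtain y where y: "y \<in> S" "C = orbit \<pi> y" using assms by (auto simp: cycle_partition_def)
  show C: "C \<subseteq> S" using permutes_orbit_subset[OF assms(1) y(1)] y(2) by simp
  show ne: "C \<noteq> {}" using y(2) orbit_nonempty[of \<pi> y] by simp
  show fin: "finite C" using C assms finite_subset by blast
  have cyc: "cyclic_on \<pi> C" using cyclic_on_orbit'[OF perm, of y] y(2) by simp
  show orb: "orbit \<pi> x = C" if "x \<in> C" for x using orbit_cyclic_eq3[OF _ that] cyc by blast
  have "Min C \<in> C" using fin ne by simp
  then have "C = range (\<lambda>i. (\<pi> ^^ i) (Min C))"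
    using orb[of "Min C"] orbit_altdef_permutation[OF perm, of "Min C"]
    by (simp add: full_SetCompr_eq)
  then show st: "set (support \<pi> (Min C)) = C" using support_set[OF perm, of "Min C"] by simp
  show "length (cycle_args zs \<pi> C) = card C"
    using distinct_card[OF cycle_of_permutation[OF perm, of "Min C"]] st
    by (simp add: cycle_args_def)
qed

lemma cycle_partition_disjoint:
  fixes \<pi> :: "nat \<Rightarrow> nat"
  assumes "\<pi> permutes S" "finite S" "C \<in> cycle_partition \<pi> S" "D \<in> cycle_partition \<pi> S"
    "x \<in> C" "x \<in> D"
  shows "C = D"
  using cycle_partition_facts(4)[OF assms(1,2,3,5)] cycle_partition_facts(4)[OF assms(1,2,4,6)]
  by simp

lemma num_cycles_id: "num_cycles id S = card S"
proof -
  have "orbit id x = {x}" for x :: 'a by (simp add: orbit_eq_singleton_iff)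
  then have "cycle_partition id S = (\<lambda>x. {x}) ` S" by (simp add: cycle_partition_def)
  then show ?thesis by (simp add: num_cycles_def card_image)
qed

lemma num_cycles_max:
  assumes "\<sigma> permutes S" "finite S" "num_cycles \<sigma> S = card S"
  shows "\<sigma> = id"
proof
  fix x
  have inj: "inj_on (orbit \<sigma>) S"
    using assms by (simp add: num_cycles_def cycle_partition_def eq_card_imp_inj_on)
  show "\<sigma> x = id x"
  proof (cases "x \<in> S")
    case True
    moreover have "\<sigma> x \<in> S" using assms True by (simp add: permutes_in_image)
    moreover have "orbit \<sigma> (\<sigma> x) = orbit \<sigma> x"
      using assms by (intro permutation_orbit_step) (auto simp: permutation_permutes)
    ultimately show ?thesis using inj by (simp add: inj_on_def)
  qed (use assms in \<open>simp add: permutes_def\<close>)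
qed

lemma inv_comp_eq_id:
  assumes "\<pi> permutes S" "inv \<pi> \<circ> \<tau> = id"
  shows "\<pi> = \<tau>"
proof -
  have "\<pi> \<circ> (inv \<pi> \<circ> \<tau>) = \<tau>" using permutes_inv_o(1)[OF assms(1)] by (simp add: o_assoc)
  then show ?thesis using assms by simp
qed

lemma tau_facts:
  assumes "n > 0"
  shows "tau n permutes {1..n}" "cycle_partition (tau n) {1..n} = {{1..n}}"
    "support (tau n) 1 = [1..<Suc n]" "tau n \<in> S_nc n"
proof -
  let ?cs = "[1..<Suc n]"
  have cs: "distinct ?cs" "?cs \<noteq> []" "hd ?cs = 1" "set ?cs = {1..n}"
    using assms by (auto simp: hd_conv_nth simp del: upt_Suc)
  note nth = cycle_of_list_nth[OF cs(1), folded tau_def]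
  show p: "tau n permutes {1..n}" using cycle_permutes[of ?cs] cs unfolding tau_def by simp
  show "support (tau n) 1 = ?cs" using orbit_cycle_list(1)[OF cs(1,2) nth] cs by simp
  have "orbit (tau n) x = {1..n}" if "x \<in> {1..n}" for x
    using orbit_cycle_list(2)[OF cs(1,2) nth, of x] cs(4) that by blast
  then show cp: "cycle_partition (tau n) {1..n} = {{1..n}}"
    using assms image_constant[of 1 "{1..n}" "{1..n}"] by (auto simp: cycle_partition_def cong: image_cong_simp)
  show "tau n \<in> S_nc n"
    using p cp num_cycles_id[of "{1..n}"]
    by (simp add: S_nc_def num_cycles_def permutes_inv_o)
qed

lemma cumulant_perm_tau:
  assumes "xs \<noteq> []"
  shows "cumulant_perm \<kappa> {1..length xs} (tau (length xs)) xs = \<kappa> xs"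
proof -
  let ?n = "length xs"
  have n: "?n > 0" using assms by simp
  have "Min {1..?n} = 1" using n by (intro Min_eqI) (auto simp: Suc_le_eq)
  then have "cycle_args xs (tau ?n) {1..?n} = map (\<lambda>c. xs ! (c - 1)) [1..<Suc ?n]"
    using tau_facts(3)[OF n] unfolding cycle_args_def by simp
  also have "\<dots> = xs" by (rule nth_equalityI) (simp_all del: upt_Suc)
  finally show ?thesis using tau_facts(2)[OF n] by (simp add: cumulant_perm_def)
qed

lemma cycle_args_shorter:
  assumes "\<pi> \<in> S_nc (length xs)" "\<pi> \<noteq> tau (length xs)" "C \<in> cycle_partition \<pi> {1..length xs}"
  shows "length (cycle_args xs \<pi> C) < length xs" "cycle_args xs \<pi> C \<noteq> []"
proof -
  let ?n = "length xs"
  have p: "\<pi> permutes {1..?n}" using assms by (simp add: S_nc_def)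
  note C = cycle_partition_facts[OF p _ assms(3)]
  show "cycle_args xs \<pi> C \<noteq> []" using C(2,3,6) by (metis card_0_eq finite_atLeastAtMost list.size(3))
  have n: "?n > 0" using C by (cases "xs = []") auto
  show "length (cycle_args xs \<pi> C) < length xs"
  proof (rule ccontr)
    assume "\<not> ?thesis"
    then have "card C \<ge> card {1..?n}" using C(6)[of xs] by simp
    then have C_eq: "C = {1..?n}" using C(1) by (meson card_seteq finite_atLeastAtMost)
    then have "cycle_partition \<pi> {1..?n} = {C}"
      using C(4) assms(3) by (auto simp: cycle_partition_def)
    then have "num_cycles (inv \<pi> \<circ> tau ?n) {1..?n} = card {1..?n}"
      using assms(1) by (simp add: S_nc_def num_cycles_def)
    moreover have "inv \<pi> \<circ> tau ?n permutes {1..?n}"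
      using p tau_facts(1)[OF n] by (simp add: permutes_compose permutes_inv)
    ultimately have "inv \<pi> \<circ> tau ?n = id" by (intro num_cycles_max) auto
    then show False using inv_comp_eq_id p assms(2) by blast
  qed
qed

lemma finite_S_nc: "finite (S_nc n)"
  by (rule finite_subset[OF _ finite_permutations[of "{1..n}"]]) (auto simp: S_nc_def)

lemma free_cumulants_iff:
  "free_cumulants \<phi>1 \<kappa> \<longleftrightarrow> (\<forall>xs. xs \<noteq> [] \<longrightarrow> \<kappa> xs = \<phi>1 (prod_list xs) -
     (\<Sum>\<pi>\<in>S_nc (length xs) - {tau (length xs)}. cumulant_perm \<kappa> {1..length xs} \<pi> xs))"
proof -
  have "(\<Sum>\<pi>\<in>S_nc (length xs). cumulant_perm \<kappa> {1..length xs} \<pi> xs) = \<kappa> xs +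
     (\<Sum>\<pi>\<in>S_nc (length xs) - {tau (length xs)}. cumulant_perm \<kappa> {1..length xs} \<pi> xs)"
    if "xs \<noteq> []" for xs
    using that tau_facts(4)[of "length xs"] cumulant_perm_tau[OF that, of \<kappa>]
    by (simp add: sum.remove[OF finite_S_nc, of "tau (length xs)"])
  then show ?thesis by (auto simp: free_cumulants_def)
qed

lemma cumulant_perm_cong:
  assumes "\<And>C. C \<in> cycle_partition \<pi> S \<Longrightarrow> \<kappa> (cycle_args zs \<pi> C) = \<kappa>' (cycle_args zs \<pi> C)"
  shows "cumulant_perm \<kappa> S \<pi> zs = cumulant_perm \<kappa>' S \<pi> zs"
  using assms unfolding cumulant_perm_def by (rule prod.cong[OF refl])

lemma free_cumulants_exist: "\<exists>\<kappa>. free_cumulants \<phi>1 \<kappa>"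
proof -
  define F where "F \<kappa> xs = \<phi>1 (prod_list xs) -
     (\<Sum>\<pi>\<in>S_nc (length xs) - {tau (length xs)}. cumulant_perm \<kappa> {1..length xs} \<pi> xs)" for \<kappa> xs
  let ?\<kappa> = "wfrec (measure length) F"
  have "?\<kappa> xs = F ?\<kappa> xs" for xs
  proof -
    have "?\<kappa> xs = F (cut ?\<kappa> (measure length) xs) xs" by (intro wfrec) simp
    also have "\<dots> = F ?\<kappa> xs" unfolding F_def
      by (intro arg_cong2[where f = minus] refl sum.cong cumulant_perm_cong cut_apply)
        (use cycle_args_shorter in auto)
    finally show ?thesis .
  qed
  then show ?thesis unfolding free_cumulants_iff F_def by blast
qed

lemma free_cumulants_unique:
  assumes "free_cumulants \<phi>1 \<kappa>" "free_cumulants \<phi>1 \<kappa>'" "xs \<noteq> []"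
  shows "\<kappa> xs = \<kappa>' xs"
  using assms(3)
proof (induction xs rule: length_induct)
  case (1 xs)
  have "(\<Sum>\<pi>\<in>S_nc (length xs) - {tau (length xs)}. cumulant_perm \<kappa> {1..length xs} \<pi> xs) =
        (\<Sum>\<pi>\<in>S_nc (length xs) - {tau (length xs)}. cumulant_perm \<kappa>' {1..length xs} \<pi> xs)"
  proof (intro sum.cong refl cumulant_perm_cong)
    fix \<pi> C
    assume "\<pi> \<in> S_nc (length xs) - {tau (length xs)}" "C \<in> cycle_partition \<pi> {1..length xs}"
    then have "length (cycle_args xs \<pi> C) < length xs" "cycle_args xs \<pi> C \<noteq> []"
      using cycle_args_shorter[of \<pi> xs C] by (blast, blast)
    then show "\<kappa> (cycle_args xs \<pi> C) = \<kappa>' (cycle_args xs \<pi> C)" using 1 by blast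
  qed
  then show ?case using assms(1,2) 1(2) by (simp add: free_cumulants_iff)
qed

lemma tau2_facts:
  assumes "p > 0" "q > 0"
  shows "tau2 p q permutes {1..p+q}"
    "cycle_partition (tau2 p q) {1..p+q} = {{1..p}, {p+1..p+q}}"
    "support (tau2 p q) 1 = [1..<Suc p]" "support (tau2 p q) (p + 1) = [Suc p..<Suc (p + q)]"
    "tau2 p q \<in> S_disc_nc p q" "x \<in> {1..p} \<Longrightarrow> orbit (tau2 p q) x = {1..p}"
    "x \<in> {p+1..p+q} \<Longrightarrow> orbit (tau2 p q) x = {p+1..p+q}"
proof -
  let ?cs = "[1..<Suc p]" and ?ds = "[Suc p..<Suc (p + q)]"
  have cs: "distinct ?cs" "?cs \<noteq> []" "hd ?cs = 1" "set ?cs = {1..p}"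
    using assms by (auto simp: hd_conv_nth simp del: upt_Suc)
  have ds: "distinct ?ds" "?ds \<noteq> []" "hd ?ds = p + 1" "set ?ds = {p+1..p+q}"
    using assms by (auto simp: hd_conv_nth simp del: upt_Suc)
  have tau1: "tau2 p q (?cs ! i) = ?cs ! (Suc i mod length ?cs)" if "i < length ?cs" for i
  proof -
    have "?cs ! i \<notin> set ?ds" using that by (auto simp del: upt_Suc)
    then show ?thesis using that cycle_of_list_nth[OF cs(1) that]
      unfolding tau2_def by (simp add: id_outside_supp del: upt_Suc)
  qed
  have tau2: "tau2 p q (?ds ! i) = ?ds ! (Suc i mod length ?ds)" if "i < length ?ds" for i
  proof -
    have "?ds ! (Suc i mod length ?ds) \<in> set ?ds" using that by (intro nth_mem mod_less_divisor) linarith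
    then have "?ds ! (Suc i mod length ?ds) \<notin> set ?cs" unfolding cs(4) ds(4) atLeastAtMost_iff by linarith
    then show ?thesis using that cycle_of_list_nth[OF ds(1) that]
      unfolding tau2_def by (simp add: id_outside_supp del: upt_Suc)
  qed
  show p: "tau2 p q permutes {1..p+q}" unfolding tau2_def
    using permutes_subset[OF cycle_permutes[of ?cs], of "{1..p+q}"]
      permutes_subset[OF cycle_permutes[of ?ds], of "{1..p+q}"]
    unfolding cs(4) ds(4) by (intro permutes_compose) auto
  show "support (tau2 p q) 1 = ?cs" using orbit_cycle_list(1)[OF cs(1,2) tau1] cs(3) by simp
  show "support (tau2 p q) (p + 1) = ?ds" using orbit_cycle_list(1)[OF ds(1,2) tau2] ds(3) by simp
  show o1: "orbit (tau2 p q) x = {1..p}" if "x \<in> {1..p}" for x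
    using orbit_cycle_list(2)[OF cs(1,2) tau1, of x] cs(4) that by blast
  show o2: "orbit (tau2 p q) x = {p+1..p+q}" if "x \<in> {p+1..p+q}" for x
    using orbit_cycle_list(2)[OF ds(1,2) tau2, of x] ds(4) that by blast
  have "{1..p+q} = {1..p} \<union> {p+1..p+q}" by auto
  then have "cycle_partition (tau2 p q) {1..p+q} =
      orbit (tau2 p q) ` {1..p} \<union> orbit (tau2 p q) ` {p+1..p+q}"
    unfolding cycle_partition_def by blast
  also have "orbit (tau2 p q) ` {1..p} = {{1..p}}" using o1 assms by (intro equalityI subsetI) force+
  also have "orbit (tau2 p q) ` {p+1..p+q} = {{p+1..p+q}}"
    using o2 assms by (intro equalityI subsetI) force+
  finally show cp: "cycle_partition (tau2 p q) {1..p+q} = {{1..p}, {p+1..p+q}}" by auto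
  have "partition_on {1..p+q} {{1..p}, {p+1..p+q}}"
    using assms by (auto simp: partition_on_def disjoint_def)
  moreover have "1 \<in> {1..p}" "1 \<notin> {p+1..p+q}" using assms by auto
  then have "{1..p} \<noteq> {p+1..p+q}" by blast
  ultimately show "tau2 p q \<in> S_disc_nc p q"
    using p cp num_cycles_id[of "{1..p+q}"]
    by (simp add: S_disc_nc_def num_cycles_def permutes_inv_o refines_refl)
qed

lemma PS'_cases:
  assumes "(\<U>, \<pi>) \<in> PS' p q"
  obtains C D where "C \<in> cycle_partition \<pi> {1..p+q}" "D \<in> cycle_partition \<pi> {1..p+q}"
    "C \<subseteq> {1..p}" "D \<subseteq> {p+1..p+q}" "nontrivial_block \<U> \<pi> = C \<union> D" "C \<union> D \<in> \<U>"
    "\<U> - {C \<union> D} \<subseteq> cycle_partition \<pi> {1..p+q}" "\<pi> permutes {1..p+q}"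
proof -
  obtain C D where CD: "C \<in> cycle_partition \<pi> {1..p+q}" "D \<in> cycle_partition \<pi> {1..p+q}"
    "C \<subseteq> {1..p}" "D \<subseteq> {p+1..p+q}" "C \<union> D \<in> \<U>" "\<U> - {C \<union> D} \<subseteq> cycle_partition \<pi> {1..p+q}"
    using assms by (auto simp: PS'_def)
  have p: "\<pi> permutes {1..p+q}" using assms by (auto simp: PS'_def S_disc_nc_def)
  note C = cycle_partition_facts[OF p _ CD(1)] and D = cycle_partition_facts[OF p _ CD(2)]
  have "nontrivial_block \<U> \<pi> = C \<union> D"
    unfolding nontrivial_block_def
  proof (rule the_equality)
    have disj: "C \<inter> D = {}" using CD(3,4) by fastforce
    show "C \<union> D \<in> \<U> \<and> (\<forall>c\<in>C \<union> D. C \<union> D \<noteq> orbit \<pi> c)"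
    proof (intro conjI ballI)
      fix c assume "c \<in> C \<union> D"
      then have "orbit \<pi> c = C \<or> orbit \<pi> c = D" using C(4) D(4) by blast
      then show "C \<union> D \<noteq> orbit \<pi> c" using disj C(2) D(2) by blast
    qed (use CD in auto)
  next
    fix U assume U: "U \<in> \<U> \<and> (\<forall>c\<in>U. U \<noteq> orbit \<pi> c)"
    show "U = C \<union> D"
    proof (rule ccontr)
      assume "U \<noteq> C \<union> D"
      then have cp: "U \<in> cycle_partition \<pi> {1..p+q}" using U CD by auto
      obtain c where "c \<in> U" using cycle_partition_facts(2)[OF p _ cp] by blast
      then show False using U cycle_partition_facts(4)[OF p _ cp] by auto
    qed
  qed
  then show thesis using that[of C D] CD p by blast
qed

lemma PS'_top:
  assumes "p > 0" "q > 0"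
  shows "({{1..p+q}}, tau2 p q) \<in> PS' p q" "nontrivial_block {{1..p+q}} (tau2 p q) = {1..p+q}"
proof -
  have "partition_on {1..p+q} {{1..p+q}}" using assms by (auto simp: partition_on_def)
  moreover have "partition_on {1..p+q} {{1..p}, {p+1..p+q}}"
    using tau2_facts(2,5)[OF assms] by (auto simp: S_disc_nc_def refines_def)
  ultimately have "refines {1..p+q} {{1..p}, {p+1..p+q}} {{1..p+q}}"
    by (auto simp: refines_def)
  moreover have "{1..p+q} = {1..p} \<union> {p+1..p+q}" by auto
  ultimately show in_PS: "({{1..p+q}}, tau2 p q) \<in> PS' p q"
    unfolding PS'_def mem_Collect_eq split tau2_facts(2)[OF assms]
    using tau2_facts(5)[OF assms] by blast
  obtain C D where CD: "nontrivial_block {{1..p+q}} (tau2 p q) = C \<union> D" "C \<union> D \<in> {{1..p+q}}"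
    using in_PS by (rule PS'_cases)
  show "nontrivial_block {{1..p+q}} (tau2 p q) = {1..p+q}"
    unfolding CD(1) using CD(2) by (rule singletonD)
qed

lemma cumulant_PS_top:
  assumes "xs \<noteq> []" "ys \<noteq> []"
  defines "p \<equiv> length xs" and "q \<equiv> length ys"
  shows "cumulant_PS \<kappa> \<kappa>2 ({{1..p+q}}, tau2 p q) xs ys = \<kappa>2 xs ys"
proof -
  have pq: "p > 0" "q > 0" using assms by auto
  have "Min {1..p} = 1" "Min {p+1..p+q} = p + 1" using pq by (auto intro!: Min_eqI)
  then have "cycle_args (xs @ ys) (tau2 p q) {1..p} = map (\<lambda>c. (xs @ ys) ! (c - 1)) [1..<Suc p]"
    "cycle_args (xs @ ys) (tau2 p q) {p+1..p+q} =
       map (\<lambda>c. (xs @ ys) ! (c - 1)) [Suc p..<Suc (p + q)]"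
    using tau2_facts(3,4)[OF pq] unfolding cycle_args_def by simp_all
  moreover have "map (\<lambda>c. (xs @ ys) ! (c - 1)) [1..<Suc p] = xs"
    by (rule nth_equalityI) (auto simp: p_def nth_append simp del: upt_Suc)
  moreover have "map (\<lambda>c. (xs @ ys) ! (c - 1)) [Suc p..<Suc (p + q)] = ys"
    by (rule nth_equalityI) (auto simp: p_def q_def nth_append simp del: upt_Suc)
  moreover have "{1..p+q} \<inter> {1..p} = {1..p}" "{1..p+q} \<inter> {p+1..p+q} = {p+1..p+q}" by auto
  ultimately show ?thesis
    unfolding cumulant_PS_def Let_def split p_def[symmetric] q_def[symmetric] PS'_top(2)[OF pq]
    by (simp only: Diff_cancel cumulant_perm_def cycle_partition_def image_empty prod.empty mult_1)
qed

lemma PS'_args_shorter: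
  assumes "(\<U>, \<pi>) \<in> PS' (length xs) (length ys)"
    "(\<U>, \<pi>) \<noteq> ({{1..length xs + length ys}}, tau2 (length xs) (length ys))"
  defines "p \<equiv> length xs" and "q \<equiv> length ys" and "U \<equiv> nontrivial_block \<U> \<pi>"
  defines "as \<equiv> cycle_args (xs @ ys) \<pi> (U \<inter> {1..p})"
    and "bs \<equiv> cycle_args (xs @ ys) \<pi> (U \<inter> {p+1..p+q})"
  shows "length as + length bs < length xs + length ys" "as \<noteq> []" "bs \<noteq> []"
proof -
  have "(\<U>, \<pi>) \<in> PS' p q" using assms(1) by (simp add: p_def q_def)
  then obtain C D where CD0: "C \<in> cycle_partition \<pi> {1..p+q}" "D \<in> cycle_partition \<pi> {1..p+q}"
    "C \<subseteq> {1..p}" "D \<subseteq> {p+1..p+q}" "nontrivial_block \<U> \<pi> = C \<union> D" "C \<union> D \<in> \<U>"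
    and p: "\<pi> permutes {1..p+q}"
    by (rule PS'_cases)
  have U: "U = C \<union> D" unfolding U_def by (rule CD0(5))
  note CD = CD0(1-4) U CD0(6)[folded U]
  note C = cycle_partition_facts[OF p _ CD(1)] and D = cycle_partition_facts[OF p _ CD(2)]
  have UC: "U \<inter> {1..p} = C" "U \<inter> {p+1..p+q} = D" using CD(3-5) by fastforce+
  have len: "length as = card C" "length bs = card D"
    unfolding as_def bs_def UC using C(6) D(6) by auto
  show "as \<noteq> []" "bs \<noteq> []"
    using len card_gt_0_iff[of C] card_gt_0_iff[of D] C(2,3) D(2,3) by auto
  have le: "card C \<le> p" "card D \<le> q"
    using card_mono[OF _ CD(3)] card_mono[OF _ CD(4)] by simp_all
  show "length as + length bs < length xs + length ys"
  proof (rule ccontr)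
    assume "\<not> ?thesis"
    then have "card C = p" "card D = q" using len le unfolding p_def q_def by linarith+
    then have CD_eq: "C = {1..p}" "D = {p+1..p+q}"
      using card_subset_eq[OF _ CD(3)] card_subset_eq[OF _ CD(4)] by simp_all
    have pq: "p > 0" "q > 0" using CD_eq C(2) D(2) by auto
    have all: "{1..p+q} = C \<union> D" using CD_eq by auto
    have "cycle_partition \<pi> {1..p+q} = {C, D}"
    proof
      show "cycle_partition \<pi> {1..p+q} \<subseteq> {C, D}"
        using C(4)[OF finite_atLeastAtMost] D(4)[OF finite_atLeastAtMost]
        unfolding cycle_partition_def all by blast
    qed (use CD(1,2) in blast)
    moreover have "1 \<in> C" "1 \<notin> D" using CD_eq pq by auto
    then have "C \<noteq> D" by blast
    ultimately have "num_cycles \<pi> {1..p+q} = 2" by (simp add: num_cycles_def)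
    moreover have "\<pi> \<in> S_disc_nc p q" using assms(1) by (auto simp: PS'_def p_def q_def)
    ultimately have "num_cycles (inv \<pi> \<circ> tau2 p q) {1..p+q} = card {1..p+q}"
      by (simp add: S_disc_nc_def)
    moreover have "inv \<pi> \<circ> tau2 p q permutes {1..p+q}"
      using p tau2_facts(1)[OF pq] by (simp add: permutes_compose permutes_inv)
    ultimately have "inv \<pi> \<circ> tau2 p q = id" by (intro num_cycles_max) auto
    then have "\<pi> = tau2 p q" using inv_comp_eq_id p by blast
    moreover have "\<U> = {{1..p+q}}"
    proof -
      have po: "partition_on {1..p+q} \<U>"
        using assms(1) by (auto simp: PS'_def p_def q_def refines_def)
      have "V = U" if "V \<in> \<U>" for V
      proof (rule ccontr)
        assume "V \<noteq> U"
        then have "V \<inter> U = {}" using po that CD(6) by (auto simp: partition_on_def disjoint_def)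
        moreover have "V \<noteq> {}" "V \<subseteq> {1..p+q}" using po that by (auto simp: partition_on_def)
        ultimately show False using all CD(5) by blast
      qed
      then show ?thesis using CD(5,6) all by auto
    qed
    ultimately show False using assms(2) by (simp add: p_def q_def)
  qed
qed

lemma finite_PS': "finite (PS' p q)"
proof (rule finite_subset)
  show "PS' p q \<subseteq> Pow (Pow {1..p+q}) \<times> {\<pi>. \<pi> permutes {1..p+q}}"
  proof clarify
    fix \<U> \<pi> assume "(\<U>, \<pi>) \<in> PS' p q"
    then have "\<pi> permutes {1..p+q}" "partition_on {1..p+q} \<U>"
      unfolding PS'_def S_disc_nc_def refines_def by blast+
    then show "\<U> \<in> Pow (Pow {1..p+q}) \<and> \<pi> \<in> {\<pi>. \<pi> permutes {1..p+q}}"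
      unfolding partition_on_def by blast
  qed
qed (simp add: finite_permutations)

lemma real_second_order_cumulants_iff:
  "real_second_order_cumulants tr \<phi>2 \<kappa> \<kappa>2 \<longleftrightarrow>
     (\<forall>xs ys. xs \<noteq> [] \<longrightarrow> ys \<noteq> [] \<longrightarrow>
        (let p = length xs; q = length ys in
          \<kappa>2 xs ys = \<phi>2 (prod_list xs) (prod_list ys) -
            (\<Sum>\<pi>\<in>S_ann_nc p q. cumulant_perm \<kappa> {1..p+q} \<pi> (xs @ ys)) -
            (\<Sum>\<pi>\<in>S_ann_nc p q. cumulant_perm \<kappa> {1..p+q} \<pi> (xs @ map tr (rev ys))) -
            (\<Sum>V\<in>PS' p q - {({{1..p+q}}, tau2 p q)}. cumulant_PS \<kappa> \<kappa>2 V xs ys)))"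
proof -
  have "(\<Sum>V\<in>PS' p q. cumulant_PS \<kappa> \<kappa>2 V xs ys) = \<kappa>2 xs ys +
     (\<Sum>V\<in>PS' p q - {({{1..p+q}}, tau2 p q)}. cumulant_PS \<kappa> \<kappa>2 V xs ys)"
    if "xs \<noteq> []" "ys \<noteq> []" "p = length xs" "q = length ys" for xs ys p q
    using that PS'_top(1)[of p q] cumulant_PS_top[OF that(1,2), of \<kappa> \<kappa>2]
    by (simp add: sum.remove[OF finite_PS', of "({{1..p+q}}, tau2 p q)"])
  then show ?thesis
    unfolding real_second_order_cumulants_def Let_def
    by (intro iff_allI imp_cong refl) (auto simp: algebra_simps)
qed

lemma cumulant_PS_cong:
  assumes "(\<U>, \<pi>) \<in> PS' (length xs) (length ys)"
    "(\<U>, \<pi>) \<noteq> ({{1..length xs + length ys}}, tau2 (length xs) (length ys))"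
    and "\<And>as bs. \<lbrakk>length as + length bs < length xs + length ys; as \<noteq> []; bs \<noteq> []\<rbrakk> \<Longrightarrow>
           \<kappa>2 as bs = \<kappa>2' as bs"
  shows "cumulant_PS \<kappa> \<kappa>2 (\<U>, \<pi>) xs ys = cumulant_PS \<kappa> \<kappa>2' (\<U>, \<pi>) xs ys"
  using assms(3)[OF PS'_args_shorter[OF assms(1,2)]] by (simp add: cumulant_PS_def Let_def)

lemma real_second_order_cumulants_exist: "\<exists>\<kappa>2. real_second_order_cumulants tr \<phi>2 \<kappa> \<kappa>2"
proof -
  define F where "F \<kappa>2 = (\<lambda>(xs, ys). let p = length xs; q = length ys in
     \<phi>2 (prod_list xs) (prod_list ys) -
     (\<Sum>\<pi>\<in>S_ann_nc p q. cumulant_perm \<kappa> {1..p+q} \<pi> (xs @ ys)) -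
     (\<Sum>\<pi>\<in>S_ann_nc p q. cumulant_perm \<kappa> {1..p+q} \<pi> (xs @ map tr (rev ys))) -
     (\<Sum>V\<in>PS' p q - {({{1..p+q}}, tau2 p q)}. cumulant_PS \<kappa> (curry \<kappa>2) V xs ys))" for \<kappa>2
  let ?R = "measure (\<lambda>(xs, ys). length xs + length ys)"
  let ?\<kappa> = "wfrec ?R F"
  have "?\<kappa> (xs, ys) = F ?\<kappa> (xs, ys)" for xs ys
  proof -
    have "?\<kappa> (xs, ys) = F (cut ?\<kappa> ?R (xs, ys)) (xs, ys)" by (intro wfrec) simp
    also have "\<dots> = F ?\<kappa> (xs, ys)"
    proof -
      have "cumulant_PS \<kappa> (curry (cut ?\<kappa> ?R (xs, ys))) V xs ys = cumulant_PS \<kappa> (curry ?\<kappa>) V xs ys"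
        if "V \<in> PS' (length xs) (length ys) -
          {({{1..length xs + length ys}}, tau2 (length xs) (length ys))}" for V
        using that by (cases V) (auto intro!: cumulant_PS_cong cut_apply)
      then show ?thesis by (simp add: F_def Let_def)
    qed
    finally show ?thesis .
  qed
  then have "real_second_order_cumulants tr \<phi>2 \<kappa> (curry ?\<kappa>)"
    unfolding real_second_order_cumulants_iff by (simp add: F_def Let_def)
  then show ?thesis by blast
qed

lemma real_second_order_cumulants_unique:
  assumes "real_second_order_cumulants tr \<phi>2 \<kappa> \<kappa>2" "real_second_order_cumulants tr \<phi>2 \<kappa> \<kappa>2'"
    "xs \<noteq> []" "ys \<noteq> []"
  shows "\<kappa>2 xs ys = \<kappa>2' xs ys"
  using assms(3,4)
proof (induction "length xs + length ys" arbitrary: xs ys rule: less_induct)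
  case less
  let ?p = "length xs" and ?q = "length ys"
  have "(\<Sum>V\<in>PS' ?p ?q - {({{1..?p+?q}}, tau2 ?p ?q)}. cumulant_PS \<kappa> \<kappa>2 V xs ys) =
        (\<Sum>V\<in>PS' ?p ?q - {({{1..?p+?q}}, tau2 ?p ?q)}. cumulant_PS \<kappa> \<kappa>2' V xs ys)"
  proof (intro sum.cong refl)
    fix V assume "V \<in> PS' ?p ?q - {({{1..?p+?q}}, tau2 ?p ?q)}"
    then show "cumulant_PS \<kappa> \<kappa>2 V xs ys = cumulant_PS \<kappa> \<kappa>2' V xs ys"
      by (cases V) (auto intro!: cumulant_PS_cong less(1))
  qed
  then show ?case
    using assms(1,2) less(2,3) by (simp add: real_second_order_cumulants_iff Let_def)
qed

end

theory Submission
  imports Defs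
begin

text \<open>
  All three families of diagrams are permutations \<open>\<pi>\<close> with a prescribed value of
  \<open>#(\<pi>) + #(\<pi>\<^sup>-\<^sup>1\<tau>)\<close>. Writing \<open>\<pi> = \<sigma> \<circ> (i k)\<close> with \<open>\<sigma> i = \<tau> i\<close> groups the diagrams on
  \<open>\<dots>, x\<^sub>i, x\<^sub>i\<^sub>+\<^sub>1, \<dots>\<close> according to the diagram \<open>\<sigma>\<close> in which these two arguments have been multiplied.
  Comparing the moment-cumulant relations for the two argument lists then gives, by induction on the length, the
  formulas for cumulants one of whose arguments is a product of two factors. They reduce a mixed
  cumulant with cyclically adjacent arguments from the same subalgebra to shorter mixed cumulants;
  cumulants with an argument 1 vanish, so the remaining cyclically alternating arguments may be centred.

  For centred, cyclically alternating arguments and vanishing (shorter) mixed cumulants, a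
  noncrossing or disc diagram other than the top one has a fixed point or a cycle through two
  neighbours, hence contributes nothing. A contributing annular diagram has no fixed points, and neither has
  its complement \<open>\<pi>\<^sup>-\<^sup>1\<tau>\<close>; counting cycles, both are involutions, so \<open>p = q\<close> and the diagram consists of
  \<open>p\<close> parallel spokes. These are exactly the terms in the definition of second-order freeness, so
  that condition says that the corresponding cumulant vanishes.
\<close>

section \<open>Cycles of permutations\<close>

text \<open>Multiplying two neighbours deletes the label \<open>\<tau> i\<close>, so the diagrams do
  not stay on \<open>{1..n}\<close>: all sums are taken over an arbitrary finite label set with an
  arbitrary \<open>\<tau>\<close>, and relabelling leads back to lists. Relabelling does not respect
  smallest elements, where cycles start, so rotation invariance of the cumulants has to come first;
  it follows from traciality by an induction of its own. At second order an annular diagram can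
  arise from a disc diagram by joining \<open>i\<close> to a label of the other circle. These joined
  diagrams are the extra first-order terms in the product formula for \<open>\<kappa>2\<close>; the
  rest of that formula is the derivative of the first-order one, because the disc sum is a
  derivative of a product over cycles. The transposed annular sum is put on the same labels by
  inverting \<open>\<tau>\<close> on the second circle, and then has the same disc diagrams behind
  it. Only the first argument list is treated: \<open>\<phi>2\<close> is not assumed symmetric, but
  the data with its arguments exchanged satisfy the same assumptions.\<close>

definition cyc :: "('b \<Rightarrow> 'b) \<Rightarrow> 'b \<Rightarrow> 'b list" where
  "cyc f x = support f x"

lemma distinct_cyc: "permutation f \<Longrightarrow> distinct (cyc f x)"
  unfolding cyc_def by (rule cycle_of_permutation)

text \<open>The criterion by which cycles are identified below: it is enough to exhibit a distinct
  list that \<open>f\<close> maps to its own rotation, without computing powers of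
  \<open>f\<close>.\<close>

lemma cyc_unique:
  assumes "distinct cs" "cs \<noteq> []" "map f cs = rotate1 cs"
  shows "cyc f (hd cs) = cs" "x \<in> set cs \<Longrightarrow> orbit f x = set cs"
proof -
  have f: "f (cs ! i) = cs ! (Suc i mod length cs)" if "i < length cs" for i
    using arg_cong[OF assms(3), of "\<lambda>l. l ! i"] that by (simp add: nth_rotate1)
  show "cyc f (hd cs) = cs" "x \<in> set cs \<Longrightarrow> orbit f x = set cs"
    using orbit_cycle_list[OF assms(1,2) f] unfolding cyc_def by blast+
qed

lemma cyc_Cons:
  assumes "permutation f"
  obtains w where "cyc f x = x # w"
proof -
  have "least_power f x > 0" using least_power_of_permutation[OF assms] by blast
  then have "[0..<least_power f x] = 0 # [1..<least_power f x]" by (simp add: upt_conv_Cons)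
  then show thesis using that unfolding cyc_def by simp
qed

lemma hd_cyc: "permutation f \<Longrightarrow> hd (cyc f x) = x"
  by (rule cyc_Cons[of f x]) simp_all

lemma cyc_nonempty: "permutation f \<Longrightarrow> cyc f x \<noteq> []"
  by (rule cyc_Cons[of f x]) simp_all

lemma map_cyc:
  assumes "permutation f"
  shows "map f (cyc f x) = rotate1 (cyc f x)"
proof (rule nth_equalityI)
  fix j assume "j < length (map f (cyc f x))"
  then have j: "j < least_power f x" by (simp add: cyc_def)
  have "(f ^^ Suc j) x = (f ^^ (Suc j mod least_power f x)) x"
  proof (cases "Suc j = least_power f x")
    case True
    then show ?thesis using least_power_of_permutation(1)[OF assms, of x] by simp
  next
    case False
    then show ?thesis using j by simp
  qed
  then show "map f (cyc f x) ! j = rotate1 (cyc f x) ! j"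
    using j by (simp add: cyc_def nth_rotate1)
qed simp

lemma set_cyc:
  assumes "permutation f"
  shows "set (cyc f x) = orbit f x"
proof -
  obtain w where w: "cyc f x = x # w" by (rule cyc_Cons[OF assms])
  have "distinct (x # w)" "map f (x # w) = rotate1 (x # w)"
    using distinct_cyc[OF assms, of x] map_cyc[OF assms, of x] unfolding w .
  then show ?thesis using cyc_unique(2)[of "x # w" f x] unfolding w by simp
qed

lemma last_cyc:
  assumes "permutation f"
  shows "f (last (cyc f x)) = x" "last (cyc f (f x)) = x"
proof -
  have *: "f (last (cyc f y)) = y" for y
  proof -
    obtain w where w: "cyc f y = y # w" by (rule cyc_Cons[OF assms])
    have "last (map f (y # w)) = f (last (y # w))" by (rule last_map) simp
    moreover have "map f (y # w) = w @ [y]" using map_cyc[OF assms, of y] unfolding w by simp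
    ultimately show ?thesis unfolding w by (metis last_snoc)
  qed
  show "f (last (cyc f x)) = x" by (rule *)
  have "inj f" using assms by (simp add: permutation_bijective bij_is_inj)
  then show "last (cyc f (f x)) = x" using *[of "f x"] by (simp add: inj_eq)
qed

lemma cyc_cong:
  assumes "permutation f" "\<And>y. y \<in> orbit f x \<Longrightarrow> g y = f y"
  shows "cyc g x = cyc f x" "orbit g x = orbit f x"
proof -
  let ?cs = "cyc f x"
  have d: "distinct ?cs" "?cs \<noteq> []" by (rule distinct_cyc[OF assms(1)], rule cyc_nonempty[OF assms(1)])
  have "map g ?cs = map f ?cs" using assms(2) set_cyc[OF assms(1), of x] by (intro map_cong) auto
  then have "map g ?cs = rotate1 ?cs" by (rule trans[OF _ map_cyc[OF assms(1)]])
  note u = cyc_unique[OF d this]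
  show "cyc g x = ?cs" using u(1) unfolding hd_cyc[OF assms(1)] .
  have "x \<in> set ?cs" using permutation_self_in_orbit[OF assms(1)] set_cyc[OF assms(1)] by blast
  then show "orbit g x = orbit f x" using u(2)[of x] unfolding set_cyc[OF assms(1)] by blast
qed

lemma orbit_eq: "permutation f \<Longrightarrow> y \<in> orbit f x \<Longrightarrow> orbit f y = orbit f x"
  by (rule orbit_cyclic_eq3[OF cyclic_on_orbit'])

lemma orbit_disjoint: "permutation f \<Longrightarrow> y \<notin> orbit f x \<Longrightarrow> orbit f y \<inter> orbit f x = {}"
proof (rule equals0I)
  fix z assume "permutation f" "y \<notin> orbit f x" "z \<in> orbit f y \<inter> orbit f x"
  then show False
    using orbit_eq[of f z y] orbit_eq[of f z x] permutation_self_in_orbit[of f y] by simp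
qed

lemma cyc_rotate:
  assumes "permutation f" "y \<in> orbit f x"
  obtains n where "cyc f y = rotate n (cyc f x)"
proof -
  let ?cs = "cyc f x"
  have d: "distinct ?cs" "?cs \<noteq> []" by (rule distinct_cyc[OF assms(1)], rule cyc_nonempty[OF assms(1)])
  have "y \<in> set ?cs" using assms set_cyc by fast
  then obtain n where n: "n < length ?cs" "?cs ! n = y" by (metis in_set_conv_nth)
  let ?r = "rotate n ?cs"
  have "map f ?r = rotate n (map f ?cs)" by (simp add: rotate_map)
  also have "\<dots> = rotate1 ?r" using map_cyc[OF assms(1)] by (simp add: rotate1_rotate_swap)
  finally have "cyc f (hd ?r) = ?r" by (intro cyc_unique(1)) (use d in auto)
  moreover have "hd ?r = y" using n d hd_rotate_conv_nth[of ?cs n] by simp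
  ultimately show thesis using that by auto
qed

lemma transpose_eqs:
  assumes "\<pi> = \<sigma> \<circ> transpose i k"
  shows "\<pi> i = \<sigma> k" "\<pi> k = \<sigma> i" "x \<noteq> i \<Longrightarrow> x \<noteq> k \<Longrightarrow> \<pi> x = \<sigma> x"
  using assms by (auto simp: transpose_def)

lemma permutation_comp_transpose:
  "permutation \<sigma> \<Longrightarrow> permutation (\<sigma> \<circ> transpose i k)"
  by (rule permutation_compose[OF _ permutation_swap_id])

text \<open>With \<open>k = last u\<close>, composing with the transposition redirects
  \<open>i\<close> to the old successor of \<open>k\<close>, and \<open>k\<close> to the old
  successor of \<open>i\<close>, which is \<open>hd u\<close>. The cycle is thus cut behind
  \<open>i\<close> and behind \<open>k\<close>.\<close>

lemma cyc_split:
  assumes "permutation \<sigma>" "cyc \<sigma> i = i # u @ v" "u \<noteq> []" "\<pi> = \<sigma> \<circ> transpose i (last u)"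
  shows "cyc \<pi> i = i # v" "cyc \<pi> (hd u) = u"
    and "orbit \<pi> i = set (i # v)" "x \<in> set u \<Longrightarrow> orbit \<pi> x = set u"
    and "x \<notin> set (i # u @ v) \<Longrightarrow> cyc \<pi> x = cyc \<sigma> x"
    and "x \<notin> set (i # u @ v) \<Longrightarrow> orbit \<pi> x = orbit \<sigma> x"
proof -
  obtain u' k where u: "u = u' @ [k]" using assms(3) by (metis rev_exhaust)
  have k: "last u = k" unfolding u by simp
  note p = transpose_eqs[OF assms(4)[unfolded k]]
  have d: "distinct (i # u @ v)" using distinct_cyc[OF assms(1), of i] assms(2) by simp
  have m: "map \<sigma> (i # u @ v) = u @ v @ [i]" using map_cyc[OF assms(1), of i] assms(2) by simp
  have m1: "map \<sigma> (i # u') = u' @ [k]" "map \<sigma> (k # v) = v @ [i]"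
  proof -
    have "map \<sigma> (i # u') @ map \<sigma> (k # v) = (u' @ [k]) @ (v @ [i])" using m unfolding u by simp
    then show "map \<sigma> (i # u') = u' @ [k]" "map \<sigma> (k # v) = v @ [i]"
      by (subst (asm) append_eq_append_conv; simp)+
  qed
  have v: "map \<pi> v = map \<sigma> v" using d unfolding u by (intro map_cong refl p(3)) auto
  have u': "map \<pi> u' = map \<sigma> u'" using d unfolding u by (intro map_cong refl p(3)) auto
  have r1: "map \<pi> (i # v) = rotate1 (i # v)" using m1(2) unfolding list.map p(1) v by simp
  have "map \<pi> u = map \<sigma> u' @ [\<sigma> i]" unfolding u map_append u' using p(2) by simp
  also have "\<dots> = rotate1 u"
  proof (cases u')
    case Nil
    then show ?thesis using m1(1) u by simp
  next
    case (Cons c w)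
    then show ?thesis using m1(1) u by simp
  qed
  finally have r2: "map \<pi> u = rotate1 u" .
  show "cyc \<pi> i = i # v" "orbit \<pi> i = set (i # v)"
    using cyc_unique[OF _ _ r1] d by auto
  show "cyc \<pi> (hd u) = u" "x \<in> set u \<Longrightarrow> orbit \<pi> x = set u"
    using cyc_unique[OF _ assms(3) r2] d by auto
  have c: "\<pi> y = \<sigma> y" if "x \<notin> set (i # u @ v)" "y \<in> orbit \<sigma> x" for y
  proof -
    have orb: "orbit \<sigma> i = set (i # u @ v)"
      using set_cyc[OF assms(1), of i] unfolding assms(2) by (rule sym)
    then have "x \<notin> orbit \<sigma> i" using that(1) by blast
    then have "orbit \<sigma> x \<inter> orbit \<sigma> i = {}" by (rule orbit_disjoint[OF assms(1)])
    then have "y \<notin> set (i # u @ v)" using that(2) orb by blast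
    then show ?thesis using p(3) unfolding u by auto
  qed
  show "x \<notin> set (i # u @ v) \<Longrightarrow> cyc \<pi> x = cyc \<sigma> x"
    "x \<notin> set (i # u @ v) \<Longrightarrow> orbit \<pi> x = orbit \<sigma> x"
    using cyc_cong[OF assms(1) c] by blast+
qed

text \<open>The inverse operation to \<open>cyc_split\<close>. The inserted cycle is read from
  \<open>\<pi> k\<close>, so that it ends in \<open>k\<close>, from where the joined cycle continues
  with \<open>v\<close>.\<close>

lemma cyc_join:
  assumes "permutation \<pi>" "cyc \<pi> i = i # v" "k \<notin> orbit \<pi> i" "\<sigma> = \<pi> \<circ> transpose i k"
  defines "u \<equiv> cyc \<pi> (\<pi> k)"
  shows "cyc \<sigma> i = i # u @ v" "u \<noteq> []" "last u = k" "orbit \<sigma> i = orbit \<pi> i \<union> orbit \<pi> k"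
    "set u = orbit \<pi> k"
proof -
  show last: "last u = k" unfolding u_def by (rule last_cyc(2)[OF assms(1)])
  show ne: "u \<noteq> []" unfolding u_def by (rule cyc_nonempty[OF assms(1)])
  show su: "set u = orbit \<pi> k" unfolding u_def set_cyc[OF assms(1)]
    by (rule permutation_orbit_step[OF assms(1)])
  then obtain u' where u: "u = u' @ [k]" using ne last by (metis append_butlast_last_id)
  have sv: "set (i # v) = orbit \<pi> i" using set_cyc[OF assms(1), of i] assms(2) by simp
  have dis: "set u \<inter> set (i # v) = {}" unfolding su sv by (rule orbit_disjoint[OF assms(1,3)])
  have d: "distinct (i # u @ v)"
    using dis distinct_cyc[OF assms(1), of i] distinct_cyc[OF assms(1), of "\<pi> k"]
    unfolding assms(2) u_def[symmetric] by auto
  note p = transpose_eqs[OF assms(4)]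
  have v: "map \<sigma> v = map \<pi> v" using d unfolding u by (intro map_cong refl p(3)) auto
  have u': "map \<sigma> u' = map \<pi> u'" using d unfolding u by (intro map_cong refl p(3)) auto
  have mv: "map \<pi> (i # v) = v @ [i]" using map_cyc[OF assms(1), of i] assms(2) by simp
  have mu: "map \<pi> u = rotate1 u" unfolding u_def by (rule map_cyc[OF assms(1)])
  have "map \<sigma> (i # u @ v) = (\<pi> k # map \<pi> u') @ map \<pi> (i # v)"
    unfolding u list.map map_append v u' p(1) using p(2) by simp
  also have "\<pi> k # map \<pi> u' = u"
  proof (cases u')
    case Nil
    then show ?thesis using mu u by simp
  next
    case (Cons c w)
    then show ?thesis using mu u by simp
  qed
  finally have "map \<sigma> (i # u @ v) = rotate1 (i # u @ v)" using mv by simp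
  note un = cyc_unique[OF d _ this]
  show "cyc \<sigma> i = i # u @ v" using un(1) by simp
  show "orbit \<sigma> i = orbit \<pi> i \<union> orbit \<pi> k" using un(2)[of i] su sv by auto
qed

lemma finite_cycle_partition: "finite S \<Longrightarrow> finite (cycle_partition f S)"
  by (simp add: cycle_partition_def)

text \<open>All cycles other than that of \<open>i\<close> are common to both permutations, and that
  of \<open>i\<close> is replaced by the two pieces of \<open>cyc_split\<close>.\<close>

lemma num_cycles_split:
  assumes "\<sigma> permutes S" "finite S" "i \<in> S" "k \<in> orbit \<sigma> i" "k \<noteq> i"
  shows "num_cycles (\<sigma> \<circ> transpose i k) S = Suc (num_cycles \<sigma> S)" "k \<notin> orbit (\<sigma> \<circ> transpose i k) i"
proof -
  have perm: "permutation \<sigma>" using assms(1,2) by (auto simp: permutation_permutes)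
  obtain w where w: "cyc \<sigma> i = i # w" by (rule cyc_Cons[OF perm])
  have orb: "orbit \<sigma> i = set (i # w)" using set_cyc[OF perm, of i] w by simp
  then have "k \<in> set w" using assms by auto
  then obtain u' v where "w = u' @ k # v" by (metis split_list)
  then obtain u where u: "w = u @ v" "u \<noteq> []" "last u = k" "u = u' @ [k]" by auto
  have s: "cyc \<sigma> i = i # u @ v" using w u by simp
  let ?\<pi> = "\<sigma> \<circ> transpose i k"
  note sp = cyc_split[OF perm s u(2), of ?\<pi>, unfolded u(3), OF refl]
  have d: "distinct (i # u @ v)" using distinct_cyc[OF perm, of i] s by simp
  show nk: "k \<notin> orbit ?\<pi> i" using sp(3) d u(4) by auto
  let ?T = "S - set (i # u @ v)"
  let ?R = "orbit \<sigma> ` ?T"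
  have sub: "set (i # u @ v) \<subseteq> S" using permutes_orbit_subset[OF assms(1,3)] orb u(1) by auto
  have cs: "cycle_partition \<sigma> S = insert (set (i # u @ v)) ?R"
  proof -
    have "orbit \<sigma> ` set (i # u @ v) = {set (i # u @ v)}"
      using orbit_eq[OF perm, of _ i] orb u(1) by (intro equalityI subsetI) (auto simp: image_iff)
    moreover have "S = set (i # u @ v) \<union> ?T" using sub by auto
    ultimately show ?thesis unfolding cycle_partition_def by (metis image_Un insert_is_Un)
  qed
  have cp: "cycle_partition ?\<pi> S = insert (set (i # v)) (insert (set u) ?R)"
  proof -
    have "permutation ?\<pi>" by (rule permutation_comp_transpose[OF perm])
    then have "orbit ?\<pi> ` set (i # v) = {set (i # v)}"
      using orbit_eq[of ?\<pi> _ i] sp(3) by (intro equalityI subsetI) (auto simp: image_iff)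
    moreover have "orbit ?\<pi> ` set u = {set u}" using sp(4) hd_in_set[OF u(2)]
      by (intro equalityI subsetI) (auto simp: image_iff)
    moreover have "orbit ?\<pi> ` ?T = ?R" using sp(6) by (intro image_cong) auto
    moreover have "S = set (i # v) \<union> (set u \<union> ?T)" using sub by auto
    ultimately show ?thesis unfolding cycle_partition_def by (metis image_Un insert_is_Un)
  qed
  have R: "C \<inter> set (i # u @ v) = {} \<and> C \<noteq> {}" if C: "C \<in> ?R" for C
  proof -
    obtain x where x: "x \<in> ?T" "C = orbit \<sigma> x" using C by auto
    then have "x \<notin> orbit \<sigma> i" using orb u(1) by auto
    then show ?thesis using orbit_disjoint[OF perm] x orb u(1) orbit_nonempty by metis
  qed
  have f: "finite ?R" using assms(2) by simp
  have n1: "set (i # u @ v) \<notin> ?R" using R by force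
  have n2: "set u \<notin> ?R" "set (i # v) \<notin> ?R" using R u(2) by force+
  have n3: "set (i # v) \<noteq> set u" using d by auto
  have "num_cycles \<sigma> S = Suc (card ?R)" unfolding num_cycles_def cs
    using card_insert_disjoint[OF f n1] by simp
  moreover have "num_cycles ?\<pi> S = Suc (Suc (card ?R))" unfolding num_cycles_def cp
    using card_insert_disjoint[OF f n2(1)] card_insert_disjoint[of "insert (set u) ?R" "set (i # v)"] n2 n3 f
    by simp
  ultimately show "num_cycles ?\<pi> S = Suc (num_cycles \<sigma> S)" by simp
qed

text \<open>Composing once more with the same transposition undoes the join, which reduces the count
  to \<open>num_cycles_split\<close>.\<close>

lemma num_cycles_join:
  assumes "\<sigma> permutes S" "finite S" "i \<in> S" "k \<in> S" "k \<notin> orbit \<sigma> i"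
  shows "Suc (num_cycles (\<sigma> \<circ> transpose i k) S) = num_cycles \<sigma> S" "k \<in> orbit (\<sigma> \<circ> transpose i k) i"
proof -
  have perm: "permutation \<sigma>" using assms(1,2) by (auto simp: permutation_permutes)
  let ?\<pi> = "\<sigma> \<circ> transpose i k"
  obtain v where "cyc \<sigma> i = i # v" by (rule cyc_Cons[OF perm])
  note j = cyc_join[OF perm this assms(5) refl]
  show k: "k \<in> orbit ?\<pi> i" using j(4) permutation_self_in_orbit[OF perm, of k] by blast
  have "k \<noteq> i" using assms(5) permutation_self_in_orbit[OF perm, of i] by blast
  moreover have "?\<pi> permutes S" using assms by (intro permutes_compose permutes_swap_id)
  ultimately have "num_cycles (?\<pi> \<circ> transpose i k) S = Suc (num_cycles ?\<pi> S)"
    using num_cycles_split(1)[OF _ assms(2,3) k] by blast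
  moreover have "?\<pi> \<circ> transpose i k = \<sigma>" by (simp add: comp_assoc)
  ultimately show "Suc (num_cycles ?\<pi> S) = num_cycles \<sigma> S" by simp
qed

text \<open>Triangle inequality for the length \<open>card S - num_cycles f S\<close>, the least
  number of transpositions with product \<open>f\<close>. Induction on the length of \<epsilon>:
  splitting off \<open>\<epsilon> a\<close> shortens \<epsilon> by one, while a transposition
  changes the number of cycles of \<open>\<sigma> \<circ> \<epsilon>\<close> by only one.\<close>

lemma num_cycles_triangle:
  assumes "\<epsilon> permutes S" "finite S" "\<sigma> permutes S"
  shows "num_cycles \<sigma> S + num_cycles \<epsilon> S \<le> card S + num_cycles (\<sigma> \<circ> \<epsilon>) S"
  using assms(1)
proof (induction "card S - num_cycles \<epsilon> S" arbitrary: \<epsilon> rule: less_induct)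
  case less
  have le: "num_cycles f S \<le> card S" for f :: "'a \<Rightarrow> 'a"
    unfolding num_cycles_def cycle_partition_def by (rule card_image_le[OF assms(2)])
  show ?case
  proof (cases "\<epsilon> = id")
    case True
    then show ?thesis using num_cycles_id[of S] by simp
  next
    case False
    then obtain a where a: "\<epsilon> a \<noteq> a" by (auto simp: fun_eq_iff)
    then have aS: "a \<in> S" using less.prems by (metis permutes_not_in)
    let ?b = "\<epsilon> a"
    let ?e = "\<epsilon> \<circ> transpose a ?b"
    have bS: "?b \<in> S" using aS less.prems by (simp add: permutes_in_image)
    have e: "?e permutes S" using less.prems aS bS by (intro permutes_compose permutes_swap_id)
    have n: "num_cycles ?e S = Suc (num_cycles \<epsilon> S)"
      using num_cycles_split(1)[OF less.prems assms(2) aS, of ?b] a by (simp add: orbit.base)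
    have IH: "num_cycles \<sigma> S + num_cycles ?e S \<le> card S + num_cycles (\<sigma> \<circ> ?e) S"
      using n le[of ?e] by (intro less.hyps[OF _ e]) linarith
    have p: "\<sigma> \<circ> \<epsilon> permutes S" using assms less.prems by (intro permutes_compose)
    have "num_cycles (\<sigma> \<circ> \<epsilon> \<circ> transpose a ?b) S \<le> Suc (num_cycles (\<sigma> \<circ> \<epsilon>) S)"
    proof (cases "?b \<in> orbit (\<sigma> \<circ> \<epsilon>) a")
      case True
      then show ?thesis using num_cycles_split(1)[OF p assms(2) aS True a] by simp
    next
      case False
      then show ?thesis using num_cycles_join(1)[OF p assms(2) aS bS False] by simp
    qed
    then show ?thesis using IH n by (simp add: comp_assoc)
  qed
qed

section \<open>Permutations of prescribed genus\<close>

lemma permutes_permutation: "\<pi> permutes S \<Longrightarrow> finite S \<Longrightarrow> permutation \<pi>"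
  by (auto simp: permutation_permutes)

section \<open>Cycle counts under conjugation and inversion\<close>

lemma permutation_conj:
  assumes "permutation f" "bij (g :: 'a \<Rightarrow> 'a)"
  shows "permutation (g \<circ> f \<circ> inv g)"
proof -
  have "{x. (g \<circ> f \<circ> inv g) x \<noteq> x} \<subseteq> g ` {x. f x \<noteq> x}"
  proof
    fix x assume "x \<in> {x. (g \<circ> f \<circ> inv g) x \<noteq> x}"
    then have "g (f (inv g x)) \<noteq> x" by simp
    moreover have "g (inv g x) = x" using assms(2) by (simp add: bij_is_surj surj_f_inv_f)
    ultimately have "f (inv g x) \<noteq> inv g x" by metis
    then show "x \<in> g ` {x. f x \<noteq> x}" using \<open>g (inv g x) = x\<close> by force
  qed
  moreover have "finite {x. f x \<noteq> x}" using assms(1) by (simp add: permutation)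
  ultimately have "finite {x. (g \<circ> f \<circ> inv g) x \<noteq> x}" by (meson finite_imageI finite_subset)
  moreover have "bij (g \<circ> f \<circ> inv g)"
    using assms by (intro bij_comp) (auto simp: permutation bij_imp_bij_inv)
  ultimately show ?thesis by (simp add: permutation)
qed

lemma cyc_conj:
  fixes g :: "'b \<Rightarrow> 'b"
  assumes "permutation f" "bij g"
  shows "cyc (g \<circ> f \<circ> inv g) (g x) = map g (cyc f x)" "orbit (g \<circ> f \<circ> inv g) (g x) = g ` orbit f x"
proof -
  let ?cs = "map g (cyc f x)"
  have inj: "inj g" using assms(2) by (rule bij_is_inj)
  have d: "distinct ?cs" "?cs \<noteq> []"
    using distinct_cyc[OF assms(1), of x] inj cyc_nonempty[OF assms(1), of x]
    by (simp_all add: distinct_map inj_on_subset[OF inj])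
  have "map (g \<circ> f \<circ> inv g) ?cs = map g (map f (cyc f x))"
    unfolding list.map_comp by (intro map_cong refl) (simp add: inj)
  also have "\<dots> = rotate1 ?cs" unfolding map_cyc[OF assms(1)] by (simp add: rotate1_map)
  finally have m: "map (g \<circ> f \<circ> inv g) ?cs = rotate1 ?cs" .
  have "hd ?cs = g x" using hd_cyc[OF assms(1), of x] cyc_nonempty[OF assms(1), of x] by (simp add: hd_map)
  then show c: "cyc (g \<circ> f \<circ> inv g) (g x) = ?cs" using cyc_unique(1)[OF d m] by simp
  show "orbit (g \<circ> f \<circ> inv g) (g x) = g ` orbit f x"
    using set_cyc[OF permutation_conj[OF assms], of "g x"] set_cyc[OF assms(1), of x] unfolding c by simp
qed

lemma num_cycles_conj:
  fixes g :: "'b \<Rightarrow> 'b"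
  assumes "permutation f" "bij g"
  shows "num_cycles (g \<circ> f \<circ> inv g) (g ` S) = num_cycles f S"
proof -
  have "cycle_partition (g \<circ> f \<circ> inv g) (g ` S) = (`) g ` cycle_partition f S"
    unfolding cycle_partition_def image_image cyc_conj(2)[OF assms] by simp
  moreover have "inj_on ((`) g) X" for X
    using inj_on_image[of g UNIV] assms(2) by (metis bij_is_inj inj_image_eq_iff inj_onI)
  ultimately show ?thesis unfolding num_cycles_def by (simp add: card_image)
qed

lemma num_cycles_inv:
  assumes "permutation f"
  shows "num_cycles (inv f) S = num_cycles f S"
  unfolding num_cycles_def cycle_partition_def orbit_inv_eq[OF assms] by simp

lemma transpose_conj:
  "transpose i k \<circ> (f :: 'a \<Rightarrow> 'a) = transpose i k \<circ> (f \<circ> transpose i k) \<circ> inv (transpose i k)"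
  by (auto simp: fun_eq_iff)

text \<open>Multiplying by a transposition on the left or on the right gives conjugate
  permutations.\<close>

lemma num_cycles_transpose_left:
  assumes "permutation f" "i \<in> S" "k \<in> S"
  shows "num_cycles (transpose i k \<circ> f) S = num_cycles (f \<circ> transpose i k) S"
proof -
  have "transpose i k ` S = S" using assms by (simp add: transpose_image_eq)
  then show ?thesis
    using num_cycles_conj[OF permutation_comp_transpose[OF assms(1), of i k], of "transpose i k" S]
    unfolding transpose_conj[symmetric] by simp
qed

lemma num_cycles_insert_fixed:
  assumes "\<rho> permutes T" "finite T" "e \<notin> T"
  shows "num_cycles \<rho> (insert e T) = Suc (num_cycles \<rho> T)"
proof -
  have "orbit \<rho> e = {e}" using assms by (simp add: orbit_eq_singleton_iff permutes_not_in)
  then have "cycle_partition \<rho> (insert e T) = insert {e} (cycle_partition \<rho> T)"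
    by (simp add: cycle_partition_def)
  moreover have "{e} \<notin> cycle_partition \<rho> T"
    using permutes_orbit_subset[OF assms(1)] assms(3) by (auto simp: cycle_partition_def)
  ultimately show ?thesis using finite_cycle_partition[OF assms(2)] by (simp add: num_cycles_def)
qed

text \<open>
  \<open>m\<close> is the number of cycles of \<open>\<tau>\<close> minus twice the genus: noncrossing permutations have \<open>m = 1\<close>,
  disc-noncrossing ones \<open>m = 2\<close> and annular-noncrossing ones \<open>m = 0\<close>.
\<close>

definition NCG :: "'b set \<Rightarrow> ('b \<Rightarrow> 'b) \<Rightarrow> nat \<Rightarrow> ('b \<Rightarrow> 'b) set" where
  "NCG S \<tau> m = {\<pi>. \<pi> permutes S \<and> num_cycles \<pi> S + num_cycles (inv \<pi> \<circ> \<tau>) S = card S + m}"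

lemma NCG_permutes: "\<pi> \<in> NCG S \<tau> m \<Longrightarrow> \<pi> permutes S"
  by (simp add: NCG_def)

lemma finite_NCG: "finite S \<Longrightarrow> finite (NCG S \<tau> m)"
  by (rule finite_subset[OF _ finite_permutations[of S]]) (auto simp: NCG_def)

text \<open>The triangle inequality for the factorization of \<tau> into \<pi> and its complement
  \<open>inv \<pi> \<circ> \<tau>\<close>. It makes \<open>NCG S \<tau> m\<close> empty when
  \<open>m\<close> exceeds the number of cycles of \<tau>, so in the extremal cases the fibres that
  raise \<open>m\<close> disappear.\<close>

lemma genus_bound:
  assumes "\<pi> permutes S" "\<tau> permutes S" "finite S"
  shows "num_cycles \<pi> S + num_cycles (inv \<pi> \<circ> \<tau>) S \<le> card S + num_cycles \<tau> S"
proof -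
  have "\<pi> \<circ> (inv \<pi> \<circ> \<tau>) = \<tau>" using permutes_inv_o(1)[OF assms(1)] by (simp add: o_assoc)
  moreover have "inv \<pi> \<circ> \<tau> permutes S" using assms by (intro permutes_compose permutes_inv)
  ultimately show ?thesis using num_cycles_triangle[of "inv \<pi> \<circ> \<tau>" S \<pi>] assms by simp
qed

lemma inv_comp_transpose:
  assumes "bij \<pi>"
  shows "inv (\<pi> \<circ> transpose i k) = transpose i k \<circ> inv \<pi>"
  using assms by (subst o_inv_distrib) auto

text \<open>Multiplying \<open>\<pi>\<close> and \<open>\<tau>\<close> by the same transposition conjugates \<open>\<pi>\<^sup>-\<^sup>1\<tau>\<close>, here with \<open>\<tau>\<close> losing a cycle.\<close>

lemma genus_bound_connected:
  assumes "\<pi> permutes S" "\<tau> permutes S" "finite S" "a \<in> S" "b \<in> orbit \<pi> a" "b \<notin> orbit \<tau> a"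
  shows "num_cycles \<pi> S + num_cycles (inv \<pi> \<circ> \<tau>) S + 2 \<le> card S + num_cycles \<tau> S"
proof -
  have b: "b \<in> S" using assms permutes_orbit_subset by fast
  have "permutation \<tau>" using assms by (simp add: permutes_permutation)
  then have "b \<noteq> a" using assms permutation_self_in_orbit by fast
  let ?t = "transpose a b"
  have t: "?t permutes S" using assms b by (intro permutes_swap_id)
  have "num_cycles (\<pi> \<circ> ?t) S = Suc (num_cycles \<pi> S)"
    using num_cycles_split(1)[OF assms(1,3,4,5)] \<open>b \<noteq> a\<close> by simp
  moreover have "Suc (num_cycles (\<tau> \<circ> ?t) S) = num_cycles \<tau> S"
    using num_cycles_join(1)[OF assms(2,3,4) b assms(6)] .
  moreover have "num_cycles (inv (\<pi> \<circ> ?t) \<circ> (\<tau> \<circ> ?t)) S = num_cycles (inv \<pi> \<circ> \<tau>) S"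
  proof -
    have e: "inv \<pi> \<circ> \<tau> permutes S" using assms by (intro permutes_compose permutes_inv)
    have "inv (\<pi> \<circ> ?t) \<circ> (\<tau> \<circ> ?t) = ?t \<circ> (inv \<pi> \<circ> \<tau>) \<circ> inv ?t"
      unfolding inv_comp_transpose[OF permutes_bij[OF assms(1)]] by (simp add: comp_assoc)
    then have "num_cycles (inv (\<pi> \<circ> ?t) \<circ> (\<tau> \<circ> ?t)) (?t ` S) = num_cycles (inv \<pi> \<circ> \<tau>) S"
      using num_cycles_conj[OF permutes_permutation[OF e assms(3)], of ?t S] by simp
    then show ?thesis using permutes_image[OF t] by simp
  qed
  moreover have "num_cycles (\<pi> \<circ> ?t) S + num_cycles (inv (\<pi> \<circ> ?t) \<circ> (\<tau> \<circ> ?t)) S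
      \<le> card S + num_cycles (\<tau> \<circ> ?t) S"
    using assms t by (intro genus_bound permutes_compose)
  ultimately show ?thesis by linarith
qed

lemma NCG_top:
  assumes "\<pi> \<in> NCG S \<tau> m" "\<tau> permutes S" "finite S" "num_cycles \<pi> S = m"
  shows "\<pi> = \<tau>"
proof -
  have "\<pi> permutes S" "num_cycles (inv \<pi> \<circ> \<tau>) S = card S" using assms by (auto simp: NCG_def)
  moreover from this have "inv \<pi> \<circ> \<tau> permutes S" using assms by (intro permutes_compose permutes_inv)
  ultimately show ?thesis using num_cycles_max inv_comp_eq_id assms(3) by blast
qed

lemma NCG_self:
  assumes "\<tau> permutes S" "num_cycles \<tau> S = m"
  shows "\<tau> \<in> NCG S \<tau> m"
  using assms num_cycles_id[of S] by (simp add: NCG_def permutes_inv_o)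

section \<open>Reindexing sums over diagrams by relabelling and by inversion\<close>

lemma sum_NCG_conj:
  fixes g :: "'b \<Rightarrow> 'b"
  assumes "bij g" "finite S" "\<tau> permutes S"
  shows "(\<Sum>\<pi>\<in>NCG (g ` S) (g \<circ> \<tau> \<circ> inv g) m. f \<pi>) = (\<Sum>\<pi>\<in>NCG S \<tau> m. f (g \<circ> \<pi> \<circ> inv g))"
proof -
  have inj: "inj g" and surj: "surj g" using bij_is_inj[OF assms(1)] bij_is_surj[OF assms(1)] .
  have cardS: "card (g ` S) = card S" using inj by (meson card_image inj_on_subset subset_UNIV)
  have permI: "f permutes T" if "bij f" "\<And>x. x \<notin> T \<Longrightarrow> f x = x" for f :: "'b \<Rightarrow> 'b" and T
    using that unfolding permutes_def by (metis bij_pointE)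
  have perm: "g \<circ> \<pi> \<circ> inv g permutes g ` S" if "\<pi> permutes S" for \<pi>
  proof (rule permI)
    show "bij (g \<circ> \<pi> \<circ> inv g)"
      by (rule bij_comp[OF bij_imp_bij_inv[OF assms(1)] bij_comp[OF permutes_bij[OF that] assms(1)]])
    fix x assume "x \<notin> g ` S"
    then have "inv g x \<notin> S" using surj_f_inv_f[OF surj, of x] imageI[of "inv g x" S g] by auto
    then show "(g \<circ> \<pi> \<circ> inv g) x = x" using that surj by (simp add: permutes_not_in surj_f_inv_f)
  qed
  have cancel: "inv g \<circ> (g \<circ> \<pi> \<circ> inv g) \<circ> g = \<pi>" for \<pi> using inj by (auto simp: fun_eq_iff)
  have cancel': "g \<circ> (inv g \<circ> \<pi> \<circ> g) \<circ> inv g = \<pi>" for \<pi>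
    using surj by (auto simp: fun_eq_iff surj_f_inv_f)
  have num: "num_cycles (g \<circ> \<pi> \<circ> inv g) (g ` S) = num_cycles \<pi> S"
    "num_cycles (inv (g \<circ> \<pi> \<circ> inv g) \<circ> (g \<circ> \<tau> \<circ> inv g)) (g ` S) = num_cycles (inv \<pi> \<circ> \<tau>) S"
    if "\<pi> permutes S" for \<pi>
  proof -
    show "num_cycles (g \<circ> \<pi> \<circ> inv g) (g ` S) = num_cycles \<pi> S"
      using num_cycles_conj[OF permutes_permutation[OF that assms(2)] assms(1)] .
    have "bij \<pi>" using that by (rule permutes_bij)
    then have "inv (g \<circ> \<pi> \<circ> inv g) = g \<circ> inv \<pi> \<circ> inv g"
      using assms(1) by (simp add: o_inv_distrib bij_comp bij_imp_bij_inv inv_inv_eq comp_assoc)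
    then have "inv (g \<circ> \<pi> \<circ> inv g) \<circ> (g \<circ> \<tau> \<circ> inv g) = g \<circ> (inv \<pi> \<circ> \<tau>) \<circ> inv g"
      using inj by (auto simp: fun_eq_iff)
    moreover have "inv \<pi> \<circ> \<tau> permutes S" using that assms by (intro permutes_compose permutes_inv)
    ultimately show "num_cycles (inv (g \<circ> \<pi> \<circ> inv g) \<circ> (g \<circ> \<tau> \<circ> inv g)) (g ` S) = num_cycles (inv \<pi> \<circ> \<tau>) S"
      using num_cycles_conj[OF permutes_permutation assms(1), of "inv \<pi> \<circ> \<tau>" S S] assms(2) by simp
  qed
  have unconj: "inv g \<circ> \<pi> \<circ> g permutes S" if "\<pi> permutes g ` S" for \<pi>
  proof (rule permI)
    show "bij (inv g \<circ> \<pi> \<circ> g)"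
      by (rule bij_comp[OF assms(1) bij_comp[OF permutes_bij[OF that] bij_imp_bij_inv[OF assms(1)]]])
    fix x assume "x \<notin> S"
    then have "g x \<notin> g ` S" using inj by (simp add: inj_image_mem_iff)
    then show "(inv g \<circ> \<pi> \<circ> g) x = x" using that inj by (simp add: permutes_not_in)
  qed
  show ?thesis
  proof (rule sum.reindex_bij_witness[where i = "\<lambda>\<pi>. g \<circ> \<pi> \<circ> inv g" and j = "\<lambda>\<pi>. inv g \<circ> \<pi> \<circ> g"])
    fix \<pi> assume \<pi>: "\<pi> \<in> NCG (g ` S) (g \<circ> \<tau> \<circ> inv g) m"
    then have p: "inv g \<circ> \<pi> \<circ> g permutes S" by (intro unconj) (rule NCG_permutes)
    show "inv g \<circ> \<pi> \<circ> g \<in> NCG S \<tau> m"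
      using \<pi> num[OF p] p unfolding NCG_def cancel' cardS by simp
  next
    fix \<pi> assume "\<pi> \<in> NCG S \<tau> m"
    then show "g \<circ> \<pi> \<circ> inv g \<in> NCG (g ` S) (g \<circ> \<tau> \<circ> inv g) m"
      using num perm unfolding NCG_def cardS by simp
  qed (simp_all only: cancel cancel')
qed

text \<open>Reflection of diagrams. The new complement \<open>\<pi> \<circ> inv \<tau>\<close> is
  the conjugate by \<pi> of \<open>inv \<tau> \<circ> \<pi>\<close>, which is the inverse of the old
  complement, so the cycle counts agree. It is used for transposed arguments.\<close>

lemma sum_NCG_inv:
  assumes "\<tau> permutes S" "finite S"
  shows "(\<Sum>\<pi>\<in>NCG S (inv \<tau>) m. f \<pi>) = (\<Sum>\<pi>\<in>NCG S \<tau> m. f (inv \<pi>))"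
proof -
  have num: "num_cycles (inv \<pi>) S + num_cycles (inv (inv \<pi>) \<circ> inv \<tau>) S =
      num_cycles \<pi> S + num_cycles (inv \<pi> \<circ> \<tau>) S" if p: "\<pi> permutes S" and t: "\<tau> permutes S" for \<pi> \<tau>
  proof -
    have bij: "bij \<pi>" "bij \<tau>" using p t by (auto intro: permutes_bij)
    have "inv \<pi> \<circ> \<tau> permutes S" using p t by (intro permutes_compose permutes_inv)
    then have e: "permutation (inv \<pi> \<circ> \<tau>)" using assms(2) by (rule permutes_permutation)
    have "inv (inv \<pi> \<circ> \<tau>) = inv \<tau> \<circ> \<pi>" using bij by (simp add: o_inv_distrib bij_imp_bij_inv inv_inv_eq)
    moreover have "inv (inv \<pi>) \<circ> inv \<tau> = \<pi> \<circ> (inv \<tau> \<circ> \<pi>) \<circ> inv \<pi>"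
      using bij permutes_inv_o[OF p] by (simp add: inv_inv_eq comp_assoc)
    moreover have "\<pi> ` S = S" using p by (rule permutes_image)
    ultimately have "num_cycles (inv (inv \<pi>) \<circ> inv \<tau>) S = num_cycles (inv (inv \<pi> \<circ> \<tau>)) S"
      using num_cycles_conj[of "inv \<tau> \<circ> \<pi>" \<pi> S] bij e permutation_inverse by metis
    then show ?thesis using num_cycles_inv[OF e] num_cycles_inv[OF permutes_permutation[OF p assms(2)]] by simp
  qed
  have ii: "inv (inv \<pi>) = \<pi>" if "\<pi> permutes S" for \<pi> using that by (simp add: permutes_bij inv_inv_eq)
  show ?thesis
  proof (rule sum.reindex_bij_witness[where i = inv and j = inv])
    fix \<pi> assume \<pi>: "\<pi> \<in> NCG S (inv \<tau>) m"
    then have p: "\<pi> permutes S" by (rule NCG_permutes)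
    show "inv (inv \<pi>) = \<pi>" using ii[OF p] .
    show "inv \<pi> \<in> NCG S \<tau> m"
      using \<pi> num[OF p permutes_inv[OF assms(1)]] unfolding ii[OF assms(1)] NCG_def
      by (simp add: permutes_inv[OF p])
    show "f (inv (inv \<pi>)) = f \<pi>" using ii[OF p] by simp
  next
    fix \<pi> assume \<pi>: "\<pi> \<in> NCG S \<tau> m"
    then have p: "\<pi> permutes S" by (rule NCG_permutes)
    show "inv (inv \<pi>) = \<pi>" using ii[OF p] .
    show "inv \<pi> \<in> NCG S (inv \<tau>) m"
      using \<pi> num[OF p assms(1)] unfolding NCG_def by (simp add: permutes_inv[OF p])
  qed
qed

text \<open>These diagrams have \<open>i\<close> directly followed by its neighbour on the circle,
  and so are the ones that survive when the two labels are merged.\<close>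

definition NCGf :: "'b set \<Rightarrow> ('b \<Rightarrow> 'b) \<Rightarrow> 'b \<Rightarrow> nat \<Rightarrow> ('b \<Rightarrow> 'b) set" where
  "NCGf S \<tau> i m = {\<sigma> \<in> NCG S \<tau> m. \<sigma> i = \<tau> i}"

text \<open>The complement of \<pi> sends \<open>i\<close> to \<open>k\<close>, so the transposition
  splits a cycle of the complement and gains one there. In \<pi> it joins two cycles if
  \<open>k\<close> lies off the cycle of \<open>i\<close>, and the total is unchanged; otherwise it
  splits a cycle of \<pi> as well, and the total grows by two.\<close>

lemma genus_step:
  assumes "\<pi> permutes S" "\<tau> permutes S" "finite S" "i \<in> S" "k \<noteq> i" "\<pi> k = \<tau> i"
  defines "\<sigma> \<equiv> \<pi> \<circ> transpose i k"
  shows "k \<notin> orbit \<pi> i \<Longrightarrow> num_cycles \<sigma> S + num_cycles (inv \<sigma> \<circ> \<tau>) S =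
      num_cycles \<pi> S + num_cycles (inv \<pi> \<circ> \<tau>) S"
    and "k \<in> orbit \<pi> i \<Longrightarrow> num_cycles \<sigma> S + num_cycles (inv \<sigma> \<circ> \<tau>) S =
      num_cycles \<pi> S + num_cycles (inv \<pi> \<circ> \<tau>) S + 2"
    and "k \<in> orbit \<sigma> i \<longleftrightarrow> k \<notin> orbit \<pi> i" "k \<in> S" "\<sigma> permutes S"
proof -
  let ?\<epsilon> = "inv \<pi> \<circ> \<tau>"
  have e: "?\<epsilon> permutes S" using assms by (intro permutes_compose permutes_inv)
  have ek: "?\<epsilon> i = k" using assms by (simp add: permutes_inv_eq)
  show k: "k \<in> S" using ek e assms(4) by (metis permutes_in_image)
  show "\<sigma> permutes S" unfolding \<sigma>_def using assms(1,4) k by (intro permutes_compose permutes_swap_id)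
  have "k \<in> orbit ?\<epsilon> i" using ek orbit.base[of ?\<epsilon> i] by simp
  then have "num_cycles (?\<epsilon> \<circ> transpose i k) S = Suc (num_cycles ?\<epsilon> S)"
    using num_cycles_split(1)[OF e assms(3,4) _ assms(5)] by blast
  then have "num_cycles (transpose i k \<circ> ?\<epsilon>) S = Suc (num_cycles ?\<epsilon> S)"
    using num_cycles_transpose_left[OF permutes_permutation[OF e assms(3)] assms(4) k] by simp
  moreover have "inv \<sigma> \<circ> \<tau> = transpose i k \<circ> ?\<epsilon>"
    unfolding \<sigma>_def inv_comp_transpose[OF permutes_bij[OF assms(1)]] by (simp add: comp_assoc)
  ultimately have *: "num_cycles (inv \<sigma> \<circ> \<tau>) S = Suc (num_cycles ?\<epsilon> S)" by simp
  show "k \<notin> orbit \<pi> i \<Longrightarrow> num_cycles \<sigma> S + num_cycles (inv \<sigma> \<circ> \<tau>) S =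
      num_cycles \<pi> S + num_cycles (inv \<pi> \<circ> \<tau>) S"
    using num_cycles_join(1)[OF assms(1,3,4) k] * unfolding \<sigma>_def by simp
  show "k \<in> orbit \<pi> i \<Longrightarrow> num_cycles \<sigma> S + num_cycles (inv \<sigma> \<circ> \<tau>) S =
      num_cycles \<pi> S + num_cycles (inv \<pi> \<circ> \<tau>) S + 2"
    using num_cycles_split(1)[OF assms(1,3,4) _ assms(5)] * unfolding \<sigma>_def by simp
  show "k \<in> orbit \<sigma> i \<longleftrightarrow> k \<notin> orbit \<pi> i"
    using num_cycles_split(2)[OF assms(1,3,4) _ assms(5)] num_cycles_join(2)[OF assms(1,3,4) k]
    unfolding \<sigma>_def by blast
qed

text \<open>
  Every \<open>\<pi>\<close> is \<open>\<sigma> \<circ> (i k)\<close> for a unique \<open>\<sigma>\<close> with \<open>\<sigma> i = \<tau> i\<close>, namely with \<open>k = \<pi>\<^sup>-\<^sup>1(\<tau> i)\<close>. The genus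
  changes only if \<open>k\<close> is in another cycle of \<open>\<sigma>\<close> than \<open>i\<close>.
\<close>

lemma sum_NCG_fibres:
  fixes f :: "('b \<Rightarrow> 'b) \<Rightarrow> 'c :: comm_monoid_add"
  assumes "\<tau> permutes S" "finite S" "i \<in> S"
  shows "(\<Sum>\<pi>\<in>NCG S \<tau> m. f \<pi>) =
    (\<Sum>\<sigma>\<in>NCGf S \<tau> i m. \<Sum>k\<in>orbit \<sigma> i. f (\<sigma> \<circ> transpose i k)) +
    (\<Sum>\<sigma>\<in>NCGf S \<tau> i (m + 2). \<Sum>k\<in>S - orbit \<sigma> i. f (\<sigma> \<circ> transpose i k))"
proof -
  define kk where "kk \<pi> = inv \<pi> (\<tau> i)" for \<pi> :: "'b \<Rightarrow> 'b"
  \<comment> \<open>By \<open>genus_step\<close>, \<open>k\<close> lies on the cycle of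
    \<open>i\<close> in \<sigma> exactly when it does not in \<pi>. The case \<open>k = i\<close>,
    where \<sigma> is \<pi> itself, belongs to \<open>A\<close>, since \<open>i\<close> lies on its
    own cycle.\<close>
  define A where "A = {\<pi> \<in> NCG S \<tau> m. kk \<pi> = i \<or> kk \<pi> \<notin> orbit \<pi> i}"
  define B where "B = {\<pi> \<in> NCG S \<tau> m. \<not> (kk \<pi> = i \<or> kk \<pi> \<notin> orbit \<pi> i)}"
  have kk: "\<pi> (kk \<pi>) = \<tau> i" if "\<pi> permutes S" for \<pi>
    using that unfolding kk_def by (simp add: permutes_inverses)
  have kk': "kk (\<sigma> \<circ> transpose i k) = k" if "\<sigma> permutes S" "k \<in> S" "\<sigma> i = \<tau> i" for \<sigma> k
  proof -
    have "\<sigma> \<circ> transpose i k permutes S" using that assms by (intro permutes_compose permutes_swap_id)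
    then show ?thesis unfolding kk_def using that by (simp add: permutes_inv_eq)
  qed
  have tt: "\<sigma> \<circ> transpose i k \<circ> transpose i k = \<sigma>" for \<sigma> :: "'b \<Rightarrow> 'b" and k by (simp add: comp_assoc)
  have fin: "finite (orbit \<sigma> i)" if "\<sigma> \<in> NCG S \<tau> n" for \<sigma> n
    using that permutes_orbit_subset[OF _ assms(3)] assms(2) NCG_permutes finite_subset by metis
  have finf: "finite (NCGf S \<tau> i n)" for n
    using finite_NCG[OF assms(2), of \<tau> n] by (simp add: NCGf_def)
  have "(\<Sum>\<pi>\<in>A. f \<pi>) = (\<Sum>(\<sigma>, k)\<in>Sigma (NCGf S \<tau> i m) (\<lambda>\<sigma>. orbit \<sigma> i). f (\<sigma> \<circ> transpose i k))"
  proof (rule sum.reindex_bij_witness[where i = "\<lambda>(\<sigma>, k). \<sigma> \<circ> transpose i k"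
        and j = "\<lambda>\<pi>. (\<pi> \<circ> transpose i (kk \<pi>), kk \<pi>)"])
    fix \<pi> assume \<pi>: "\<pi> \<in> A"
    then have p: "\<pi> permutes S" by (auto simp: A_def NCG_permutes)
    show "(case (\<pi> \<circ> transpose i (kk \<pi>), kk \<pi>) of (\<sigma>, k) \<Rightarrow> \<sigma> \<circ> transpose i k) = \<pi>" by (simp add: tt)
    show "(\<pi> \<circ> transpose i (kk \<pi>), kk \<pi>) \<in> Sigma (NCGf S \<tau> i m) (\<lambda>\<sigma>. orbit \<sigma> i)"
    proof (cases "kk \<pi> = i")
      case True
      then show ?thesis using \<pi> kk[OF p] permutation_self_in_orbit[OF permutes_permutation[OF p assms(2)]]
        by (simp add: A_def NCGf_def)
    next
      case False
      note g = genus_step[OF p assms(1,2,3) False kk[OF p]]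
      have "kk \<pi> \<notin> orbit \<pi> i" using False \<pi> by (auto simp: A_def)
      then show ?thesis using g \<pi> kk[OF p] by (simp add: A_def NCGf_def NCG_def)
    qed
    show "(case (\<pi> \<circ> transpose i (kk \<pi>), kk \<pi>) of (\<sigma>, k) \<Rightarrow> f (\<sigma> \<circ> transpose i k)) = f \<pi>" by (simp add: tt)
  next
    fix x assume "x \<in> Sigma (NCGf S \<tau> i m) (\<lambda>\<sigma>. orbit \<sigma> i)"
    then obtain \<sigma> k where x: "x = (\<sigma>, k)" "\<sigma> \<in> NCG S \<tau> m" "\<sigma> i = \<tau> i" "k \<in> orbit \<sigma> i"
      by (auto simp: NCGf_def)
    have s: "\<sigma> permutes S" using x by (simp add: NCG_permutes)
    have k: "k \<in> S" using permutes_orbit_subset[OF s assms(3)] x by blast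
    let ?\<pi> = "\<sigma> \<circ> transpose i k"
    have p: "?\<pi> permutes S" using s k assms(3) by (intro permutes_compose permutes_swap_id)
    note kk'[OF s k x(3)]
    then show "(\<lambda>\<pi>. (\<pi> \<circ> transpose i (kk \<pi>), kk \<pi>)) (case x of (\<sigma>, k) \<Rightarrow> \<sigma> \<circ> transpose i k) = x"
      unfolding x by (simp add: tt)
    show "(case x of (\<sigma>, k) \<Rightarrow> \<sigma> \<circ> transpose i k) \<in> A"
    proof (cases "k = i")
      case True
      then show ?thesis using x \<open>kk ?\<pi> = k\<close> by (simp add: A_def)
    next
      case False
      have "?\<pi> k = \<tau> i" using x(3) by simp
      note g = genus_step[OF p assms(1,2,3) False this, unfolded tt]
      have nk: "k \<notin> orbit ?\<pi> i" using g(3) x(4) by blast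
      have "?\<pi> \<in> NCG S \<tau> m" using g(1)[OF nk] p x(2) unfolding NCG_def mem_Collect_eq by metis
      then show ?thesis using nk x(1) \<open>kk ?\<pi> = k\<close> by (simp add: A_def)
    qed
  qed
  also have "\<dots> = (\<Sum>\<sigma>\<in>NCGf S \<tau> i m. \<Sum>k\<in>orbit \<sigma> i. f (\<sigma> \<circ> transpose i k))"
    by (rule sum.Sigma[symmetric]) (use fin finf in \<open>auto simp: NCGf_def\<close>)
  finally have SA: "(\<Sum>\<pi>\<in>A. f \<pi>) = (\<Sum>\<sigma>\<in>NCGf S \<tau> i m. \<Sum>k\<in>orbit \<sigma> i. f (\<sigma> \<circ> transpose i k))" .
  have "(\<Sum>\<pi>\<in>B. f \<pi>) = (\<Sum>(\<sigma>, k)\<in>Sigma (NCGf S \<tau> i (m + 2)) (\<lambda>\<sigma>. S - orbit \<sigma> i). f (\<sigma> \<circ> transpose i k))"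
  proof (rule sum.reindex_bij_witness[where i = "\<lambda>(\<sigma>, k). \<sigma> \<circ> transpose i k"
        and j = "\<lambda>\<pi>. (\<pi> \<circ> transpose i (kk \<pi>), kk \<pi>)"])
    fix \<pi> assume \<pi>: "\<pi> \<in> B"
    then have p: "\<pi> permutes S" by (auto simp: B_def NCG_permutes)
    show "(case (\<pi> \<circ> transpose i (kk \<pi>), kk \<pi>) of (\<sigma>, k) \<Rightarrow> \<sigma> \<circ> transpose i k) = \<pi>" by (simp add: tt)
    show "(\<pi> \<circ> transpose i (kk \<pi>), kk \<pi>) \<in> Sigma (NCGf S \<tau> i (m + 2)) (\<lambda>\<sigma>. S - orbit \<sigma> i)"
    proof -
      have n: "kk \<pi> \<noteq> i" "kk \<pi> \<in> orbit \<pi> i" using \<pi> by (auto simp: B_def)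
      note g = genus_step[OF p assms(1,2,3) n(1) kk[OF p]]
      show ?thesis using g n \<pi> kk[OF p] by (simp add: B_def NCGf_def NCG_def)
    qed
    show "(case (\<pi> \<circ> transpose i (kk \<pi>), kk \<pi>) of (\<sigma>, k) \<Rightarrow> f (\<sigma> \<circ> transpose i k)) = f \<pi>" by (simp add: tt)
  next
    fix x assume "x \<in> Sigma (NCGf S \<tau> i (m + 2)) (\<lambda>\<sigma>. S - orbit \<sigma> i)"
    then obtain \<sigma> k where x: "x = (\<sigma>, k)" "\<sigma> \<in> NCG S \<tau> (m + 2)" "\<sigma> i = \<tau> i" "k \<notin> orbit \<sigma> i" "k \<in> S"
      by (auto simp: NCGf_def)
    have s: "\<sigma> permutes S" using x by (simp add: NCG_permutes)
    let ?\<pi> = "\<sigma> \<circ> transpose i k"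
    have p: "?\<pi> permutes S" using s x assms(3) by (intro permutes_compose permutes_swap_id)
    note kk'[OF s x(5,3)]
    then show "(\<lambda>\<pi>. (\<pi> \<circ> transpose i (kk \<pi>), kk \<pi>)) (case x of (\<sigma>, k) \<Rightarrow> \<sigma> \<circ> transpose i k) = x"
      unfolding x by (simp add: tt)
    have ki: "k \<noteq> i" using x(4) permutation_self_in_orbit[OF permutes_permutation[OF s assms(2)]] by blast
    have "?\<pi> k = \<tau> i" using x(3) by simp
    note g = genus_step[OF p assms(1,2,3) ki this, unfolded tt]
    have ko: "k \<in> orbit ?\<pi> i" using g(3) x(4) by blast
    have "?\<pi> \<in> NCG S \<tau> m" using g(2)[OF ko] p x(2) unfolding NCG_def mem_Collect_eq by linarith
    then show "(case x of (\<sigma>, k) \<Rightarrow> \<sigma> \<circ> transpose i k) \<in> B"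
      using ko x(1) \<open>kk ?\<pi> = k\<close> ki by (simp add: B_def)
  qed
  also have "\<dots> = (\<Sum>\<sigma>\<in>NCGf S \<tau> i (m + 2). \<Sum>k\<in>S - orbit \<sigma> i. f (\<sigma> \<circ> transpose i k))"
    by (rule sum.Sigma[symmetric]) (use finf assms(2) in auto)
  finally have SB: "(\<Sum>\<pi>\<in>B. f \<pi>) =
    (\<Sum>\<sigma>\<in>NCGf S \<tau> i (m + 2). \<Sum>k\<in>S - orbit \<sigma> i. f (\<sigma> \<circ> transpose i k))" .
  have "NCG S \<tau> m = A \<union> B" "A \<inter> B = {}" by (auto simp: A_def B_def)
  then have "(\<Sum>\<pi>\<in>NCG S \<tau> m. f \<pi>) = (\<Sum>\<pi>\<in>A. f \<pi>) + (\<Sum>\<pi>\<in>B. f \<pi>)"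
    using finite_NCG[OF assms(2), of \<tau> m] by (metis finite_Un sum.union_disjoint)
  then show ?thesis using SA SB by simp
qed

text \<open>After composition with \<open>t\<close>, both \<sigma> and the complement, which gets
  conjugated by \<open>t\<close>, fix \<open>\<tau> i\<close>, so this label can be deleted. On the
  smaller set \<sigma> keeps its number of cycles, while the complement loses one; the cardinality
  drops by one too, hence \<open>m\<close> stays the same.\<close>

lemma sum_NCG_merge:
  fixes f :: "('b \<Rightarrow> 'b) \<Rightarrow> 'c :: comm_monoid_add"
  assumes "\<tau> permutes S" "finite S" "i \<in> S" "\<tau> i \<noteq> i"
  defines "t \<equiv> transpose i (\<tau> i)"
  shows "(\<Sum>\<rho>\<in>NCG (S - {\<tau> i}) (\<tau> \<circ> t) m. f \<rho>) = (\<Sum>\<sigma>\<in>NCGf S \<tau> i m. f (\<sigma> \<circ> t))"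
proof -
  let ?e = "\<tau> i"
  let ?T = "S - {?e}"
  have e: "?e \<in> S" using assms by (simp add: permutes_in_image)
  have S: "S = insert ?e ?T" using e by blast
  have tS: "t permutes S" unfolding t_def using assms(3) e by (rule permutes_swap_id)
  have tt: "\<sigma> \<circ> t \<circ> t = \<sigma>" for \<sigma> :: "'b \<Rightarrow> 'b" by (simp add: t_def comp_assoc)
  have invt: "inv t = t" by (simp add: t_def)
  have te: "t ?e = i" "t i = ?e" by (simp_all add: t_def)
  have key: "num_cycles (\<sigma> \<circ> t) ?T = num_cycles \<sigma> S"
    "Suc (num_cycles (inv (\<sigma> \<circ> t) \<circ> (\<tau> \<circ> t)) ?T) = num_cycles (inv \<sigma> \<circ> \<tau>) S"
    "\<sigma> \<circ> t permutes ?T" if s: "\<sigma> permutes S" and si: "\<sigma> i = ?e" for \<sigma>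
  proof -
    have fixes_e: "f permutes ?T" if "f permutes S" "f ?e = ?e" for f :: "'b \<Rightarrow> 'b"
      by (rule permutes_superset[OF that(1)]) (use that(2) in blast)
    show st: "\<sigma> \<circ> t permutes ?T"
      by (rule fixes_e[OF permutes_compose[OF tS s]]) (simp add: te si)
    have "?e \<in> orbit \<sigma> i" using si orbit.base[of \<sigma> i] by simp
    then have "num_cycles (\<sigma> \<circ> t) S = Suc (num_cycles \<sigma> S)"
      unfolding t_def using num_cycles_split(1)[OF s assms(2,3) _ assms(4)] by blast
    moreover have "num_cycles (\<sigma> \<circ> t) S = Suc (num_cycles (\<sigma> \<circ> t) ?T)"
      using num_cycles_insert_fixed[OF st, of ?e] assms(2) S by simp
    ultimately show "num_cycles (\<sigma> \<circ> t) ?T = num_cycles \<sigma> S" by simp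
    have tat: "\<tau> \<circ> t permutes S" using permutes_compose[OF tS assms(1)] .
    let ?\<epsilon>' = "inv (\<sigma> \<circ> t) \<circ> (\<tau> \<circ> t)"
    have e': "?\<epsilon>' = t \<circ> (inv \<sigma> \<circ> \<tau>) \<circ> inv t"
      using inv_comp_transpose[OF permutes_bij[OF s], of i ?e] unfolding invt t_def by (simp add: comp_assoc)
    have ep: "inv \<sigma> \<circ> \<tau> permutes S" using s assms by (intro permutes_compose permutes_inv)
    have "?\<epsilon>' permutes S" unfolding e' invt by (rule permutes_compose[OF tS permutes_compose[OF ep tS]])
    moreover have "?\<epsilon>' ?e = ?e"
    proof -
      have "inv \<sigma> ?e = i" using si s by (simp add: permutes_inv_eq)
      then show ?thesis unfolding e' invt using te by simp
    qed
    ultimately have "?\<epsilon>' permutes ?T" by (rule fixes_e)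
    then have "num_cycles ?\<epsilon>' S = Suc (num_cycles ?\<epsilon>' ?T)"
      using num_cycles_insert_fixed[of ?\<epsilon>' ?T ?e] assms(2) S by simp
    moreover have "num_cycles ?\<epsilon>' (t ` S) = num_cycles (inv \<sigma> \<circ> \<tau>) S"
      unfolding e' by (rule num_cycles_conj[OF permutes_permutation[OF ep assms(2)] permutes_bij[OF tS]])
    ultimately show "Suc (num_cycles ?\<epsilon>' ?T) = num_cycles (inv \<sigma> \<circ> \<tau>) S"
      using permutes_image[OF tS] by simp
  qed
  have card: "card S = Suc (card ?T)" using assms(2) e by (metis card_Suc_Diff1)
  show ?thesis
  proof (rule sum.reindex_bij_witness[where i = "\<lambda>\<sigma>. \<sigma> \<circ> t" and j = "\<lambda>\<rho>. \<rho> \<circ> t"])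
    fix \<rho> assume r: "\<rho> \<in> NCG ?T (\<tau> \<circ> t) m"
    then have rT: "\<rho> permutes ?T" by (rule NCG_permutes)
    then have "\<rho> permutes S" by (rule permutes_subset) blast
    then have s: "\<rho> \<circ> t permutes S" using tS by (intro permutes_compose)
    have "\<rho> ?e = ?e" using rT by (simp add: permutes_not_in)
    then have si: "(\<rho> \<circ> t) i = ?e" using te by simp
    show "\<rho> \<circ> t \<in> NCGf S \<tau> i m"
    proof -
      note k = key[OF s si, unfolded tt]
      have "num_cycles (\<rho> \<circ> t) S + num_cycles (inv (\<rho> \<circ> t) \<circ> \<tau>) S = card S + m"
        using k(1,2) r card unfolding NCG_def mem_Collect_eq by linarith
      then show ?thesis using s si by (simp add: NCGf_def NCG_def)
    qed
  next
    fix \<sigma> assume "\<sigma> \<in> NCGf S \<tau> i m"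
    then show "\<sigma> \<circ> t \<in> NCG ?T (\<tau> \<circ> t) m"
      using key[of \<sigma>] card unfolding NCGf_def NCG_def by auto
  qed (simp_all add: tt)
qed

section \<open>Multiplicative functions of permutations\<close>

text \<open>For a permutation of a finite set this describes the unions of cycles. Its failure on
  one circle is how annular connectedness is expressed later.\<close>

definition closed_under :: "('b \<Rightarrow> 'b) \<Rightarrow> 'b set \<Rightarrow> bool" where
  "closed_under \<pi> S \<longleftrightarrow> (\<forall>c\<in>S. \<pi> c \<in> S)"

lemma closed_under_orbit: "closed_under \<pi> S \<Longrightarrow> c \<in> S \<Longrightarrow> orbit \<pi> c \<subseteq> S"
proof
  fix x assume "closed_under \<pi> S" "c \<in> S" "x \<in> orbit \<pi> c"
  from this(3,1,2) show "x \<in> S" by induction (auto simp: closed_under_def)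
qed

lemma closed_under_permutes: "\<pi> permutes S \<Longrightarrow> closed_under \<pi> S"
  by (simp add: closed_under_def permutes_in_image)

lemma closed_under_is_orbit: "closed_under \<pi> (orbit \<pi> c)"
  by (auto simp: closed_under_def intro: orbit.step)

lemma closed_under_Un: "closed_under \<pi> A \<Longrightarrow> closed_under \<pi> B \<Longrightarrow> closed_under \<pi> (A \<union> B)"
  by (auto simp: closed_under_def)

lemma closed_under_Diff:
  assumes "permutation \<pi>" "closed_under \<pi> A" "closed_under \<pi> B"
  shows "closed_under \<pi> (A - B)"
  unfolding closed_under_def
proof safe
  fix c assume c: "c \<in> A" "c \<notin> B"
  show "\<pi> c \<in> A" using assms c by (simp add: closed_under_def)
  assume "\<pi> c \<in> B"
  then have "orbit \<pi> (\<pi> c) \<subseteq> B" by (rule closed_under_orbit[OF assms(3)])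
  then show False
    using c(2) permutation_orbit_step[OF assms(1), of c] permutation_self_in_orbit[OF assms(1), of c] by blast
qed

lemma cycle_partition_Un: "cycle_partition \<pi> (A \<union> B) = cycle_partition \<pi> A \<union> cycle_partition \<pi> B"
  by (simp add: cycle_partition_def image_Un)

lemma cycle_partition_orbit:
  assumes "permutation \<pi>"
  shows "cycle_partition \<pi> (orbit \<pi> c) = {orbit \<pi> c}"
proof -
  have "cycle_partition \<pi> (orbit \<pi> c) = (\<lambda>_. orbit \<pi> c) ` orbit \<pi> c"
    unfolding cycle_partition_def by (rule image_cong[OF refl]) (rule orbit_eq[OF assms])
  then show ?thesis using orbit_nonempty[of \<pi> c] by (simp add: image_constant_conv)
qed

lemma finite_orbit': "permutation \<pi> \<Longrightarrow> finite (orbit \<pi> c)"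
  by (rule finite_orbit[OF permutation_self_in_orbit])

lemma cycle_partition_memD:
  assumes "permutation \<pi>" "closed_under \<pi> A" "C \<in> cycle_partition \<pi> A"
  shows "C \<subseteq> A" "C \<noteq> {}" "closed_under \<pi> C" "c \<in> C \<Longrightarrow> orbit \<pi> c = C" "finite C"
proof -
  obtain x where x: "x \<in> A" "C = orbit \<pi> x" using assms(3) by (auto simp: cycle_partition_def)
  show "C \<subseteq> A" unfolding x(2) by (rule closed_under_orbit[OF assms(2) x(1)])
  show "C \<noteq> {}" unfolding x(2) by (rule orbit_nonempty)
  show "closed_under \<pi> C" unfolding x(2) by (rule closed_under_is_orbit)
  show "c \<in> C \<Longrightarrow> orbit \<pi> c = C" unfolding x(2) by (rule orbit_eq[OF assms(1)])
  show "finite C" unfolding x(2) by (rule finite_orbit'[OF assms(1)])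
qed

definition rotation_invariant :: "('a list \<Rightarrow> complex) \<Rightarrow> bool" where
  "rotation_invariant \<kappa> \<longleftrightarrow> (\<forall>xs. \<kappa> (rotate1 xs) = \<kappa> xs)"

lemma rotation_invariantD:
  assumes "rotation_invariant \<kappa>"
  shows "\<kappa> (rotate n xs) = \<kappa> xs"
  using assms by (induction n) (simp_all add: rotation_invariant_def)

text \<open>This is \<open>cumulant_perm\<close> with the arguments as a function of the labels
  instead of a list, so that labels can be deleted and renamed.\<close>

definition cycle_prod :: "('a list \<Rightarrow> complex) \<Rightarrow> (nat \<Rightarrow> 'a) \<Rightarrow> (nat \<Rightarrow> nat) \<Rightarrow> nat set \<Rightarrow> complex" where
  "cycle_prod \<kappa> z \<pi> S = (\<Prod>C\<in>cycle_partition \<pi> S. \<kappa> (map z (cyc \<pi> (Min C))))"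

lemma cycle_prod_empty [simp]: "cycle_prod \<kappa> z \<pi> {} = 1"
  by (simp add: cycle_prod_def cycle_partition_def)

text \<open>Makes the convention of starting a cycle at its smallest element harmless; neither
  relabelling nor splitting respects it.\<close>

lemma rotation_invariant_Min:
  assumes "rotation_invariant \<kappa>" "permutation \<pi>"
  shows "\<kappa> (map z (cyc \<pi> (Min (orbit \<pi> c)))) = \<kappa> (map z (cyc \<pi> c))"
proof -
  have "Min (orbit \<pi> c) \<in> orbit \<pi> c"
    using finite_orbit'[OF assms(2)] orbit_nonempty[of \<pi> c] by simp
  then obtain n where "cyc \<pi> (Min (orbit \<pi> c)) = rotate n (cyc \<pi> c)"
    by (rule cyc_rotate[OF assms(2)])
  then show ?thesis using rotation_invariantD[OF assms(1)] by (simp add: rotate_map[symmetric])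
qed

lemma cyc_cong_closed:
  assumes "permutation \<pi>" "closed_under \<pi> S" "\<And>c. c \<in> S \<Longrightarrow> \<sigma> c = \<pi> c" "c \<in> S"
  shows "cyc \<sigma> c = cyc \<pi> c" "orbit \<sigma> c = orbit \<pi> c"
proof -
  have "\<And>y. y \<in> orbit \<pi> c \<Longrightarrow> \<sigma> y = \<pi> y"
    by (rule assms(3)) (rule subsetD[OF closed_under_orbit[OF assms(2,4)]])
  note cyc_cong[OF assms(1) this]
  then show "cyc \<sigma> c = cyc \<pi> c" "orbit \<sigma> c = orbit \<pi> c" by simp_all
qed

lemma set_cyc_closed:
  assumes "permutation \<pi>" "closed_under \<pi> S" "c \<in> S"
  shows "set (cyc \<pi> c) \<subseteq> S"
  using set_cyc[OF assms(1)] closed_under_orbit[OF assms(2,3)] by simp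

lemma cycle_partition_cong_closed:
  assumes "permutation \<pi>" "closed_under \<pi> S" "\<And>c. c \<in> S \<Longrightarrow> \<sigma> c = \<pi> c"
  shows "cycle_partition \<sigma> S = cycle_partition \<pi> S"
  unfolding cycle_partition_def using cyc_cong_closed(2)[OF assms] by (intro image_cong) auto

lemma Min_cycle_mem:
  assumes "permutation \<pi>" "closed_under \<pi> S" "C \<in> cycle_partition \<pi> S"
  shows "Min C \<in> C" "Min C \<in> S"
proof -
  note C = cycle_partition_memD[OF assms]
  show "Min C \<in> C" using C(2,5) by simp
  then show "Min C \<in> S" using C(1) by blast
qed

lemma cycle_prod_cong:
  assumes "permutation \<pi>" "closed_under \<pi> S" "\<And>c. c \<in> S \<Longrightarrow> \<sigma> c = \<pi> c" "\<And>c. c \<in> S \<Longrightarrow> z' c = z c"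
  shows "cycle_prod \<kappa> z' \<sigma> S = cycle_prod \<kappa> z \<pi> S"
  unfolding cycle_prod_def
proof (rule prod.cong)
  show "cycle_partition \<sigma> S = cycle_partition \<pi> S" by (rule cycle_partition_cong_closed[OF assms(1-3)])
  fix C assume C: "C \<in> cycle_partition \<pi> S"
  have M: "Min C \<in> S" using Min_cycle_mem[OF assms(1,2) C] by blast
  have "cyc \<sigma> (Min C) = cyc \<pi> (Min C)" by (rule cyc_cong_closed(1)[OF assms(1-3) M])
  moreover have "map z' (cyc \<pi> (Min C)) = map z (cyc \<pi> (Min C))"
    using set_cyc_closed[OF assms(1,2) M] assms(4) by (intro map_cong) auto
  ultimately show "\<kappa> (map z' (cyc \<sigma> (Min C))) = \<kappa> (map z (cyc \<pi> (Min C)))" by (simp only:)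
qed

lemma cycle_partition_disjoint_closed:
  assumes "permutation \<pi>" "closed_under \<pi> A" "closed_under \<pi> B" "A \<inter> B = {}"
  shows "cycle_partition \<pi> A \<inter> cycle_partition \<pi> B = {}"
proof (rule equals0I)
  fix C assume "C \<in> cycle_partition \<pi> A \<inter> cycle_partition \<pi> B"
  then have "C \<in> cycle_partition \<pi> A" "C \<in> cycle_partition \<pi> B" by simp_all
  then have "C \<subseteq> A" "C \<subseteq> B" "C \<noteq> {}"
    using cycle_partition_memD(1,2)[OF assms(1)] assms(2,3) by blast+
  then show False using assms(4) by blast
qed

lemma cycle_prod_Un:
  assumes "permutation \<pi>" "closed_under \<pi> A" "closed_under \<pi> B" "A \<inter> B = {}" "finite A" "finite B"
  shows "cycle_prod \<kappa> z \<pi> (A \<union> B) = cycle_prod \<kappa> z \<pi> A * cycle_prod \<kappa> z \<pi> B"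
  unfolding cycle_prod_def cycle_partition_Un
  by (rule prod.union_disjoint[OF finite_cycle_partition[OF assms(5)] finite_cycle_partition[OF assms(6)]
        cycle_partition_disjoint_closed[OF assms(1-4)]])

lemma cycle_prod_orbit:
  assumes "rotation_invariant \<kappa>" "permutation \<pi>"
  shows "cycle_prod \<kappa> z \<pi> (orbit \<pi> c) = \<kappa> (map z (cyc \<pi> c))"
  unfolding cycle_prod_def cycle_partition_orbit[OF assms(2)]
  using rotation_invariant_Min[OF assms] by simp

lemma cycle_prod_remove:
  assumes "rotation_invariant \<kappa>" "permutation \<pi>" "closed_under \<pi> S" "finite S" "c \<in> S"
  shows "cycle_prod \<kappa> z \<pi> S = \<kappa> (map z (cyc \<pi> c)) * cycle_prod \<kappa> z \<pi> (S - orbit \<pi> c)"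
proof -
  have "S = orbit \<pi> c \<union> (S - orbit \<pi> c)" using closed_under_orbit[OF assms(3,5)] by blast
  then have "cycle_prod \<kappa> z \<pi> S = cycle_prod \<kappa> z \<pi> (orbit \<pi> c \<union> (S - orbit \<pi> c))" by simp
  also have "\<dots> = cycle_prod \<kappa> z \<pi> (orbit \<pi> c) * cycle_prod \<kappa> z \<pi> (S - orbit \<pi> c)"
    using assms closed_under_Diff[OF assms(2,3) closed_under_is_orbit] closed_under_is_orbit
    by (intro cycle_prod_Un finite_orbit') auto
  finally show ?thesis by (simp add: cycle_prod_orbit[OF assms(1,2)])
qed

text \<open>The derivative of \<open>cycle_prod\<close> at \<open>\<kappa>\<close> in direction \<open>h\<close>.\<close>

definition cycle_deriv ::
    "('a list \<Rightarrow> complex) \<Rightarrow> ('a list \<Rightarrow> complex) \<Rightarrow> (nat \<Rightarrow> 'a) \<Rightarrow> (nat \<Rightarrow> nat) \<Rightarrow> nat set \<Rightarrow> complex" where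
  "cycle_deriv \<kappa> h z \<pi> S =
     (\<Sum>C\<in>cycle_partition \<pi> S. h (map z (cyc \<pi> (Min C))) * cycle_prod \<kappa> z \<pi> (S - C))"

lemma cycle_deriv_cong:
  assumes "permutation \<pi>" "closed_under \<pi> S" "\<And>c. c \<in> S \<Longrightarrow> \<sigma> c = \<pi> c" "\<And>c. c \<in> S \<Longrightarrow> z' c = z c"
  shows "cycle_deriv \<kappa> h z' \<sigma> S = cycle_deriv \<kappa> h z \<pi> S"
  unfolding cycle_deriv_def
proof (rule sum.cong)
  show "cycle_partition \<sigma> S = cycle_partition \<pi> S" by (rule cycle_partition_cong_closed[OF assms(1-3)])
  fix C assume C: "C \<in> cycle_partition \<pi> S"
  have M: "Min C \<in> S" using Min_cycle_mem[OF assms(1,2) C] by blast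
  have "cyc \<sigma> (Min C) = cyc \<pi> (Min C)" by (rule cyc_cong_closed(1)[OF assms(1-3) M])
  moreover have "map z' (cyc \<pi> (Min C)) = map z (cyc \<pi> (Min C))"
    using set_cyc_closed[OF assms(1,2) M] assms(4) by (intro map_cong) auto
  moreover have "cycle_prod \<kappa> z' \<sigma> (S - C) = cycle_prod \<kappa> z \<pi> (S - C)"
    using assms cycle_partition_memD(3)[OF assms(1,2) C]
    by (intro cycle_prod_cong closed_under_Diff) auto
  ultimately show "h (map z' (cyc \<sigma> (Min C))) * cycle_prod \<kappa> z' \<sigma> (S - C) =
      h (map z (cyc \<pi> (Min C))) * cycle_prod \<kappa> z \<pi> (S - C)" by (simp only:)
qed

text \<open>The product rule.\<close>

lemma cycle_deriv_Un:
  assumes "permutation \<pi>" "closed_under \<pi> A" "closed_under \<pi> B" "A \<inter> B = {}" "finite A" "finite B"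
  shows "cycle_deriv \<kappa> h z \<pi> (A \<union> B) =
    cycle_deriv \<kappa> h z \<pi> A * cycle_prod \<kappa> z \<pi> B + cycle_prod \<kappa> z \<pi> A * cycle_deriv \<kappa> h z \<pi> B"
proof -
  have *: "(\<Sum>C\<in>cycle_partition \<pi> A. h (map z (cyc \<pi> (Min C))) * cycle_prod \<kappa> z \<pi> (A \<union> B - C)) =
      cycle_deriv \<kappa> h z \<pi> A * cycle_prod \<kappa> z \<pi> B"
    if "closed_under \<pi> A" "closed_under \<pi> B" "A \<inter> B = {}" "finite A" "finite B" for A B
    unfolding cycle_deriv_def sum_distrib_right
  proof (rule sum.cong[OF refl])
    fix C assume "C \<in> cycle_partition \<pi> A"
    note C = cycle_partition_memD[OF assms(1) that(1) this]
    have "A \<union> B - C = (A - C) \<union> B" using C(1) that(3) by blast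
    moreover have "cycle_prod \<kappa> z \<pi> ((A - C) \<union> B) = cycle_prod \<kappa> z \<pi> (A - C) * cycle_prod \<kappa> z \<pi> B"
      using that by (intro cycle_prod_Un assms(1) closed_under_Diff C(3)) auto
    ultimately show "h (map z (cyc \<pi> (Min C))) * cycle_prod \<kappa> z \<pi> (A \<union> B - C) =
        h (map z (cyc \<pi> (Min C))) * cycle_prod \<kappa> z \<pi> (A - C) * cycle_prod \<kappa> z \<pi> B" by simp
  qed
  have "cycle_deriv \<kappa> h z \<pi> (A \<union> B) =
      (\<Sum>C\<in>cycle_partition \<pi> A. h (map z (cyc \<pi> (Min C))) * cycle_prod \<kappa> z \<pi> (A \<union> B - C)) +
      (\<Sum>C\<in>cycle_partition \<pi> B. h (map z (cyc \<pi> (Min C))) * cycle_prod \<kappa> z \<pi> (A \<union> B - C))"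
    unfolding cycle_deriv_def cycle_partition_Un
    by (rule sum.union_disjoint[OF finite_cycle_partition[OF assms(5)] finite_cycle_partition[OF assms(6)]
          cycle_partition_disjoint_closed[OF assms(1-4)]])
  then show ?thesis using *[of A B] *[of B A] assms by (simp add: Un_commute Int_commute mult.commute)
qed

lemma cycle_deriv_orbit:
  assumes "rotation_invariant h" "permutation \<pi>"
  shows "cycle_deriv \<kappa> h z \<pi> (orbit \<pi> c) = h (map z (cyc \<pi> c))"
  unfolding cycle_deriv_def cycle_partition_orbit[OF assms(2)]
  using rotation_invariant_Min[OF assms] by simp

lemma cycle_deriv_remove:
  assumes "rotation_invariant \<kappa>" "rotation_invariant h" "permutation \<pi>" "closed_under \<pi> S" "finite S" "c \<in> S"
  shows "cycle_deriv \<kappa> h z \<pi> S = h (map z (cyc \<pi> c)) * cycle_prod \<kappa> z \<pi> (S - orbit \<pi> c) +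
    \<kappa> (map z (cyc \<pi> c)) * cycle_deriv \<kappa> h z \<pi> (S - orbit \<pi> c)"
proof -
  have "S = orbit \<pi> c \<union> (S - orbit \<pi> c)" using closed_under_orbit[OF assms(4,6)] by blast
  then have "cycle_deriv \<kappa> h z \<pi> S = cycle_deriv \<kappa> h z \<pi> (orbit \<pi> c \<union> (S - orbit \<pi> c))" by simp
  also have "\<dots> = cycle_deriv \<kappa> h z \<pi> (orbit \<pi> c) * cycle_prod \<kappa> z \<pi> (S - orbit \<pi> c) +
      cycle_prod \<kappa> z \<pi> (orbit \<pi> c) * cycle_deriv \<kappa> h z \<pi> (S - orbit \<pi> c)"
    using assms closed_under_Diff[OF assms(3,4) closed_under_is_orbit] closed_under_is_orbit
    by (intro cycle_deriv_Un finite_orbit') auto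
  finally show ?thesis by (simp add: cycle_prod_orbit[OF assms(1,3)] cycle_deriv_orbit[OF assms(2,3)])
qed

section \<open>Splitting and merging one cycle\<close>

context
  fixes \<sigma> :: "nat \<Rightarrow> nat" and S :: "nat set" and i :: nat
  assumes perm: "permutation \<sigma>" and closed: "closed_under \<sigma> S" and fin: "finite S" and iS: "i \<in> S"
begin

text \<open>The last two claims omit the piece \<open>u\<close> and allow other arguments: with
  \<open>u = [e]\<close> they describe the diagram in which \<open>e\<close> has been merged into
  \<open>i\<close>.\<close>

lemma cycle_prod_split:
  assumes "rotation_invariant \<kappa>" "rotation_invariant h" "cyc \<sigma> i = i # u @ v" "u \<noteq> []"
  shows "cycle_prod \<kappa> z (\<sigma> \<circ> transpose i (last u)) S =
      \<kappa> (map z (i # v)) * \<kappa> (map z u) * cycle_prod \<kappa> z \<sigma> (S - orbit \<sigma> i)"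
    and "cycle_deriv \<kappa> h z (\<sigma> \<circ> transpose i (last u)) S =
      (h (map z (i # v)) * \<kappa> (map z u) + \<kappa> (map z (i # v)) * h (map z u)) * cycle_prod \<kappa> z \<sigma> (S - orbit \<sigma> i) +
      \<kappa> (map z (i # v)) * \<kappa> (map z u) * cycle_deriv \<kappa> h z \<sigma> (S - orbit \<sigma> i)"
    and "cycle_prod \<kappa> z' (\<sigma> \<circ> transpose i (last u)) (S - set u) =
      \<kappa> (map z' (i # v)) * cycle_prod \<kappa> z' \<sigma> (S - orbit \<sigma> i)"
    and "cycle_deriv \<kappa> h z' (\<sigma> \<circ> transpose i (last u)) (S - set u) =
      h (map z' (i # v)) * cycle_prod \<kappa> z' \<sigma> (S - orbit \<sigma> i) +
      \<kappa> (map z' (i # v)) * cycle_deriv \<kappa> h z' \<sigma> (S - orbit \<sigma> i)"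
proof -
  let ?\<pi> = "\<sigma> \<circ> transpose i (last u)"
  let ?A = "orbit ?\<pi> i" and ?B = "orbit ?\<pi> (hd u)" and ?R = "S - orbit \<sigma> i"
  note sp = cyc_split[OF perm assms(3,4) refl]
  have orb: "orbit \<sigma> i = set (i # u @ v)" using set_cyc[OF perm, of i] assms(3) by simp
  have p: "permutation ?\<pi>" by (rule permutation_comp_transpose[OF perm])
  have d: "distinct (i # u @ v)" using distinct_cyc[OF perm, of i] assms(3) by simp
  have A: "?A = set (i # v)" by (rule sp(3))
  have B: "?B = set u" by (rule sp(4)) (use assms(4) in simp)
  have sub: "orbit \<sigma> i \<subseteq> S" by (rule closed_under_orbit[OF closed iS])
  have S: "S = (?A \<union> ?B) \<union> ?R" "S - set u = ?A \<union> ?R" using sub d unfolding A B orb by auto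
  have agree: "?\<pi> c = \<sigma> c" if "c \<in> ?R" for c
  proof -
    have "c \<noteq> i" "c \<noteq> last u" using that assms(4) unfolding orb by auto
    then show ?thesis by (simp add: transpose_def)
  qed
  have cR': "closed_under \<sigma> ?R" by (intro closed_under_Diff perm closed closed_under_is_orbit)
  have cR: "closed_under ?\<pi> ?R" using cR' agree unfolding closed_under_def by simp
  have cA: "closed_under ?\<pi> ?A" and cB: "closed_under ?\<pi> ?B" by (rule closed_under_is_orbit)+
  have dis: "?A \<inter> ?B = {}" "(?A \<union> ?B) \<inter> ?R = {}" "?A \<inter> ?R = {}" using d unfolding A B orb by auto
  have f: "finite ?A" "finite ?B" "finite ?R" "finite (?A \<union> ?B)" using fin unfolding A B by auto
  have KR: "cycle_prod \<kappa> y ?\<pi> ?R = cycle_prod \<kappa> y \<sigma> ?R" for y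
    by (rule cycle_prod_cong[OF perm cR' agree refl])
  have DR: "cycle_deriv \<kappa> h y ?\<pi> ?R = cycle_deriv \<kappa> h y \<sigma> ?R" for y
    by (rule cycle_deriv_cong[OF perm cR' agree refl])
  have KA: "cycle_prod \<kappa> y ?\<pi> ?A = \<kappa> (map y (i # v))" for y
    unfolding cycle_prod_orbit[OF assms(1) p] sp(1) ..
  have KB: "cycle_prod \<kappa> y ?\<pi> ?B = \<kappa> (map y u)" for y
    unfolding cycle_prod_orbit[OF assms(1) p] sp(2) ..
  have DA: "cycle_deriv \<kappa> h y ?\<pi> ?A = h (map y (i # v))" for y
    unfolding cycle_deriv_orbit[OF assms(2) p] sp(1) ..
  have DB: "cycle_deriv \<kappa> h y ?\<pi> ?B = h (map y u)" for y
    unfolding cycle_deriv_orbit[OF assms(2) p] sp(2) ..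
  note AB = closed_under_Un[OF cA cB]
  have K: "cycle_prod \<kappa> y ?\<pi> ((?A \<union> ?B) \<union> ?R) = \<kappa> (map y (i # v)) * \<kappa> (map y u) * cycle_prod \<kappa> y \<sigma> ?R" for y
    unfolding cycle_prod_Un[OF p AB cR dis(2) f(4,3)] cycle_prod_Un[OF p cA cB dis(1) f(1,2)] KA KB KR ..
  then show "cycle_prod \<kappa> z ?\<pi> S = \<kappa> (map z (i # v)) * \<kappa> (map z u) * cycle_prod \<kappa> z \<sigma> ?R"
    using S(1) by simp
  have "cycle_deriv \<kappa> h z ?\<pi> ((?A \<union> ?B) \<union> ?R) =
      (h (map z (i # v)) * \<kappa> (map z u) + \<kappa> (map z (i # v)) * h (map z u)) * cycle_prod \<kappa> z \<sigma> ?R +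
      \<kappa> (map z (i # v)) * \<kappa> (map z u) * cycle_deriv \<kappa> h z \<sigma> ?R"
    unfolding cycle_deriv_Un[OF p AB cR dis(2) f(4,3)] cycle_deriv_Un[OF p cA cB dis(1) f(1,2)]
      cycle_prod_Un[OF p cA cB dis(1) f(1,2)] KA KB KR DA DB DR ..
  then show "cycle_deriv \<kappa> h z ?\<pi> S =
      (h (map z (i # v)) * \<kappa> (map z u) + \<kappa> (map z (i # v)) * h (map z u)) * cycle_prod \<kappa> z \<sigma> ?R +
      \<kappa> (map z (i # v)) * \<kappa> (map z u) * cycle_deriv \<kappa> h z \<sigma> ?R"
    using S(1) by simp
  show "cycle_prod \<kappa> z' ?\<pi> (S - set u) = \<kappa> (map z' (i # v)) * cycle_prod \<kappa> z' \<sigma> ?R"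
    unfolding S(2) cycle_prod_Un[OF p cA cR dis(3) f(1,3)] KA KR ..
  show "cycle_deriv \<kappa> h z' ?\<pi> (S - set u) =
      h (map z' (i # v)) * cycle_prod \<kappa> z' \<sigma> ?R + \<kappa> (map z' (i # v)) * cycle_deriv \<kappa> h z' \<sigma> ?R"
    unfolding S(2) cycle_deriv_Un[OF p cA cR dis(3) f(1,3)] KA KR DA DR ..
qed

text \<open>The summand \<open>k = i\<close> is \<sigma> itself, since the transposition is then the
  identity. Every other \<open>k\<close> is the end of exactly one initial segment of the cycle
  behind \<open>i\<close>, and that segment is what gets cut off.\<close>

lemma sum_orbit_transpose:
  fixes F :: "(nat \<Rightarrow> nat) \<Rightarrow> complex"
  assumes "cyc \<sigma> i = i # e # w"
  shows "(\<Sum>k\<in>orbit \<sigma> i. F (\<sigma> \<circ> transpose i k)) =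
    F \<sigma> + (\<Sum>j\<le>length w. F (\<sigma> \<circ> transpose i (last (e # take j w))))"
proof -
  have d: "distinct (i # e # w)" using distinct_cyc[OF perm, of i] assms by simp
  have orb: "orbit \<sigma> i = insert i (set (e # w))" using set_cyc[OF perm, of i] assms by simp
  have l: "last (e # take j w) = (e # w) ! j" if "j \<le> length w" for j
  proof (cases j)
    case (Suc l)
    then have "take j w \<noteq> []" using that by auto
    then show ?thesis using that Suc by (simp add: last_conv_nth)
  qed simp
  have "(\<Sum>k\<in>orbit \<sigma> i. F (\<sigma> \<circ> transpose i k)) = F \<sigma> + (\<Sum>k\<in>set (e # w). F (\<sigma> \<circ> transpose i k))"
    unfolding orb using d by (subst sum.insert) auto
  also have "(\<Sum>k\<in>set (e # w). F (\<sigma> \<circ> transpose i k)) = (\<Sum>j\<in>{..length w}. F (\<sigma> \<circ> transpose i ((e # w) ! j)))"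
  proof (rule sum.reindex_bij_betw[symmetric])
    show "bij_betw (\<lambda>j. (e # w) ! j) {..length w} (set (e # w))"
      using bij_betw_nth[of "e # w" "{..<length (e # w)}" "set (e # w)"] d
      by (simp add: lessThan_Suc_atMost)
  qed
  also have "\<dots> = (\<Sum>j\<le>length w. F (\<sigma> \<circ> transpose i (last (e # take j w))))"
    using l by (intro sum.cong) auto
  finally show ?thesis .
qed

end

text \<open>The failure of the formula for a free cumulant whose first argument is the product of
  \<open>a\<close> and \<open>b\<close>. When the two are separated, noncrossing cuts
  \<open>w\<close> into an initial segment, which stays with \<open>b\<close>, and a final segment,
  which stays with \<open>a\<close>.\<close>

definition merge_defect :: "('a :: times list \<Rightarrow> complex) \<Rightarrow> 'a \<Rightarrow> 'a \<Rightarrow> 'a list \<Rightarrow> complex" where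
  "merge_defect \<kappa> a b w = \<kappa> (a # b # w) +
     (\<Sum>j\<le>length w. \<kappa> (a # drop j w) * \<kappa> (b # take j w)) - \<kappa> ((a * b) # w)"

text \<open>The derivative of \<open>merge_defect\<close> at \<kappa> in direction
  \<open>h\<close>.\<close>

definition merge_defect_deriv ::
    "('a :: times list \<Rightarrow> complex) \<Rightarrow> ('a list \<Rightarrow> complex) \<Rightarrow> 'a \<Rightarrow> 'a \<Rightarrow> 'a list \<Rightarrow> complex" where
  "merge_defect_deriv \<kappa> h a b w = h (a # b # w) +
     (\<Sum>j\<le>length w. h (a # drop j w) * \<kappa> (b # take j w) + \<kappa> (a # drop j w) * h (b # take j w)) -
     h ((a * b) # w)"

text \<open>Only the cycle of \<open>i\<close> is affected, and the product over the other cycles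
  factors out. Differentiating the first identity gives a second term, the defect times the
  derivative of that product; it drops out because the defect is assumed to vanish.\<close>

lemma cycle_prod_merge:
  fixes z :: "nat \<Rightarrow> 'a :: times"
  assumes "permutation \<sigma>" "closed_under \<sigma> S" "finite S" "i \<in> S" "cyc \<sigma> i = i # e # w" "rotation_invariant \<kappa>"
  shows "(\<Sum>k\<in>orbit \<sigma> i. cycle_prod \<kappa> z (\<sigma> \<circ> transpose i k) S) -
      cycle_prod \<kappa> (z(i := z i * z e)) (\<sigma> \<circ> transpose i e) (S - {e}) =
    merge_defect \<kappa> (z i) (z e) (map z w) * cycle_prod \<kappa> z \<sigma> (S - orbit \<sigma> i)"
    and "rotation_invariant h \<Longrightarrow> merge_defect \<kappa> (z i) (z e) (map z w) = 0 \<Longrightarrow>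
      (\<Sum>k\<in>orbit \<sigma> i. cycle_deriv \<kappa> h z (\<sigma> \<circ> transpose i k) S) -
      cycle_deriv \<kappa> h (z(i := z i * z e)) (\<sigma> \<circ> transpose i e) (S - {e}) =
    merge_defect_deriv \<kappa> h (z i) (z e) (map z w) * cycle_prod \<kappa> z \<sigma> (S - orbit \<sigma> i)"
proof -
  let ?z = "z(i := z i * z e)" and ?R = "S - orbit \<sigma> i"
  note sum = sum_orbit_transpose[OF assms(1-5)]
  have cR: "closed_under \<sigma> ?R" using assms by (intro closed_under_Diff closed_under_is_orbit)
  have d: "distinct (i # e # w)" using distinct_cyc[OF assms(1), of i] assms(5) by simp
  have m: "map ?z (i # w) = (z i * z e) # map z w" using d by simp
  have iR: "i \<notin> ?R" using permutation_self_in_orbit[OF assms(1), of i] by simp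
  have KR: "cycle_prod \<kappa> ?z \<sigma> ?R = cycle_prod \<kappa> z \<sigma> ?R"
    by (rule cycle_prod_cong[OF assms(1) cR]) (use iR in auto)
  have s: "cyc \<sigma> i = i # (e # take j w) @ drop j w" for j using assms(5) by simp
  have s1: "cyc \<sigma> i = i # [e] @ w" using assms(5) by simp
  note ctx = assms(1-4)
  note split = cycle_prod_split[OF ctx assms(6)]
  have K: "cycle_prod \<kappa> z (\<sigma> \<circ> transpose i (last (e # take j w))) S =
      \<kappa> (z i # drop j (map z w)) * \<kappa> (z e # take j (map z w)) * cycle_prod \<kappa> z \<sigma> ?R" for j
    using split(1)[OF assms(6) s] by (simp add: drop_map take_map)
  have K0: "cycle_prod \<kappa> z \<sigma> S = \<kappa> (z i # z e # map z w) * cycle_prod \<kappa> z \<sigma> ?R"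
    using cycle_prod_remove[OF assms(6) ctx] assms(5) by simp
  have K1: "cycle_prod \<kappa> ?z (\<sigma> \<circ> transpose i e) (S - {e}) = \<kappa> ((z i * z e) # map z w) * cycle_prod \<kappa> z \<sigma> ?R"
    using split(3)[OF assms(6) s1, of ?z] unfolding m KR by simp
  show "(\<Sum>k\<in>orbit \<sigma> i. cycle_prod \<kappa> z (\<sigma> \<circ> transpose i k) S) - cycle_prod \<kappa> ?z (\<sigma> \<circ> transpose i e) (S - {e}) =
      merge_defect \<kappa> (z i) (z e) (map z w) * cycle_prod \<kappa> z \<sigma> ?R"
    unfolding sum[of "\<lambda>\<pi>. cycle_prod \<kappa> z \<pi> S"] K K0 K1 merge_defect_def
    by (simp add: algebra_simps sum_distrib_left sum_distrib_right)
  assume h: "rotation_invariant h" and md: "merge_defect \<kappa> (z i) (z e) (map z w) = 0"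
  have DR: "cycle_deriv \<kappa> h ?z \<sigma> ?R = cycle_deriv \<kappa> h z \<sigma> ?R"
    by (rule cycle_deriv_cong[OF assms(1) cR]) (use iR in auto)
  have D: "cycle_deriv \<kappa> h z (\<sigma> \<circ> transpose i (last (e # take j w))) S =
      (h (z i # drop j (map z w)) * \<kappa> (z e # take j (map z w)) +
       \<kappa> (z i # drop j (map z w)) * h (z e # take j (map z w))) * cycle_prod \<kappa> z \<sigma> ?R +
      \<kappa> (z i # drop j (map z w)) * \<kappa> (z e # take j (map z w)) * cycle_deriv \<kappa> h z \<sigma> ?R" for j
    using split(2)[OF h s] by (simp add: drop_map take_map)
  have D0: "cycle_deriv \<kappa> h z \<sigma> S = h (z i # z e # map z w) * cycle_prod \<kappa> z \<sigma> ?R +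
      \<kappa> (z i # z e # map z w) * cycle_deriv \<kappa> h z \<sigma> ?R"
    using cycle_deriv_remove[OF assms(6) h ctx] assms(5) by simp
  have D1: "cycle_deriv \<kappa> h ?z (\<sigma> \<circ> transpose i e) (S - {e}) =
      h ((z i * z e) # map z w) * cycle_prod \<kappa> z \<sigma> ?R + \<kappa> ((z i * z e) # map z w) * cycle_deriv \<kappa> h z \<sigma> ?R"
    using split(4)[OF h s1, of ?z] unfolding m KR DR by simp
  have "(\<Sum>k\<in>orbit \<sigma> i. cycle_deriv \<kappa> h z (\<sigma> \<circ> transpose i k) S) - cycle_deriv \<kappa> h ?z (\<sigma> \<circ> transpose i e) (S - {e}) =
      merge_defect_deriv \<kappa> h (z i) (z e) (map z w) * cycle_prod \<kappa> z \<sigma> ?R +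
      merge_defect \<kappa> (z i) (z e) (map z w) * cycle_deriv \<kappa> h z \<sigma> ?R"
    unfolding sum[of "\<lambda>\<pi>. cycle_deriv \<kappa> h z \<pi> S"] D D0 D1 merge_defect_def merge_defect_deriv_def
    by (simp add: algebra_simps sum_distrib_left sum_distrib_right sum.distrib)
  then show "(\<Sum>k\<in>orbit \<sigma> i. cycle_deriv \<kappa> h z (\<sigma> \<circ> transpose i k) S) - cycle_deriv \<kappa> h ?z (\<sigma> \<circ> transpose i e) (S - {e}) =
      merge_defect_deriv \<kappa> h (z i) (z e) (map z w) * cycle_prod \<kappa> z \<sigma> ?R" using md by simp
qed

text \<open>The fibre elements that change the genus: the cycle of \<open>k\<close> is inserted
  behind \<open>i\<close>.\<close>

lemma cycle_prod_join:
  assumes "permutation \<sigma>" "closed_under \<sigma> S" "finite S" "i \<in> S" "cyc \<sigma> i = i # v" "rotation_invariant \<kappa>"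
    "k \<in> S" "k \<notin> orbit \<sigma> i"
  shows "cycle_prod \<kappa> z (\<sigma> \<circ> transpose i k) S =
    \<kappa> (z i # map z (cyc \<sigma> (\<sigma> k)) @ map z v) * cycle_prod \<kappa> z \<sigma> (S - orbit \<sigma> i - orbit \<sigma> k)"
proof -
  let ?\<pi> = "\<sigma> \<circ> transpose i k"
  let ?R = "S - orbit \<sigma> i - orbit \<sigma> k"
  note j = cyc_join[OF assms(1,5,8) refl]
  have p: "permutation ?\<pi>" by (rule permutation_comp_transpose[OF assms(1)])
  have ki: "i \<in> orbit \<sigma> i" "k \<in> orbit \<sigma> k" using permutation_self_in_orbit[OF assms(1)] by blast+
  have agree: "?\<pi> c = \<sigma> c" if "c \<in> ?R" for c
  proof -
    have "c \<noteq> i" "c \<noteq> k" using that ki by auto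
    then show ?thesis by (simp add: transpose_def)
  qed
  have cR': "closed_under \<sigma> ?R" by (intro closed_under_Diff assms(1,2) closed_under_is_orbit)
  have c: "closed_under ?\<pi> S"
    using assms(2,4,7) unfolding closed_under_def by (auto simp: transpose_def)
  have "cycle_prod \<kappa> z ?\<pi> S = \<kappa> (map z (cyc ?\<pi> i)) * cycle_prod \<kappa> z ?\<pi> (S - orbit ?\<pi> i)"
    by (rule cycle_prod_remove[OF assms(6) p c assms(3,4)])
  also have "S - orbit ?\<pi> i = ?R" unfolding j(4) by blast
  also have "cycle_prod \<kappa> z ?\<pi> ?R = cycle_prod \<kappa> z \<sigma> ?R" by (rule cycle_prod_cong[OF assms(1) cR' agree refl])
  finally show ?thesis unfolding j(1) list.map map_append .
qed

lemma cyc_nth: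
  assumes "permutation \<sigma>" "l < length (cyc \<sigma> c)"
  shows "cyc \<sigma> (cyc \<sigma> c ! l) = rotate l (cyc \<sigma> c)"
proof -
  let ?cs = "cyc \<sigma> c"
  let ?r = "rotate l ?cs"
  have ne: "?cs \<noteq> []" by (rule cyc_nonempty[OF assms(1)])
  have "map \<sigma> ?r = rotate l (map \<sigma> ?cs)" by (simp add: rotate_map)
  also have "\<dots> = rotate1 ?r" unfolding map_cyc[OF assms(1)] by (simp add: rotate1_rotate_swap)
  finally have "cyc \<sigma> (hd ?r) = ?r" by (intro cyc_unique(1)) (use ne distinct_cyc[OF assms(1)] in auto)
  moreover have "hd ?r = ?cs ! l" using ne assms(2) by (simp add: hd_rotate_conv_nth)
  ultimately show ?thesis by simp
qed

text \<open>While \<open>k\<close> runs through one cycle, so does \<open>\<sigma> k\<close>, and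
  the cycle is read from each of its elements in turn.\<close>

lemma sum_cycles_rotate:
  fixes F :: "nat set \<Rightarrow> nat list \<Rightarrow> complex"
  assumes "permutation \<sigma>" "closed_under \<sigma> Q" "finite Q"
  shows "(\<Sum>k\<in>Q. F (orbit \<sigma> k) (cyc \<sigma> (\<sigma> k))) =
    (\<Sum>D\<in>cycle_partition \<sigma> Q. \<Sum>l<length (cyc \<sigma> (Min D)). F D (rotate l (cyc \<sigma> (Min D))))"
proof -
  note D = cycle_partition_memD[OF assms(1,2)]
  have "(\<Sum>k\<in>Q. F (orbit \<sigma> k) (cyc \<sigma> (\<sigma> k))) =
      (\<Sum>D\<in>cycle_partition \<sigma> Q. \<Sum>k\<in>{k \<in> Q. orbit \<sigma> k = D}. F (orbit \<sigma> k) (cyc \<sigma> (\<sigma> k)))"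
    by (rule sum.group[symmetric]) (use assms(3) in \<open>auto simp: cycle_partition_def\<close>)
  also have "\<dots> = (\<Sum>D\<in>cycle_partition \<sigma> Q. \<Sum>l<length (cyc \<sigma> (Min D)). F D (rotate l (cyc \<sigma> (Min D))))"
  proof (rule sum.cong[OF refl])
    fix D assume DQ: "D \<in> cycle_partition \<sigma> Q"
    let ?cs = "cyc \<sigma> (Min D)"
    have M: "Min D \<in> D" using D(2)[OF DQ] D(5)[OF DQ] by simp
    have sD: "set ?cs = D" using set_cyc[OF assms(1), of "Min D"] D(4)[OF DQ M] by simp
    have e: "{k \<in> Q. orbit \<sigma> k = D} = D"
      using D(1)[OF DQ] D(4)[OF DQ] permutation_self_in_orbit[OF assms(1)] by auto
    have inj: "inj \<sigma>" using assms(1) by (simp add: permutation bij_is_inj)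
    have im: "\<sigma> ` D = D"
    proof (rule endo_inj_surj)
      show "finite D" using D(5)[OF DQ] .
      show "\<sigma> ` D \<subseteq> D" using D(3)[OF DQ] by (auto simp: closed_under_def)
      show "inj_on \<sigma> D" using inj by (rule inj_on_subset) simp
    qed
    have "(\<Sum>k\<in>{k \<in> Q. orbit \<sigma> k = D}. F (orbit \<sigma> k) (cyc \<sigma> (\<sigma> k))) = (\<Sum>k\<in>D. F D (cyc \<sigma> (\<sigma> k)))"
      unfolding e using D(4)[OF DQ] by (intro sum.cong) auto
    also have "\<dots> = (\<Sum>k\<in>\<sigma> ` D. F D (cyc \<sigma> k))"
      using inj by (subst sum.reindex) (auto intro: inj_on_subset)
    also have "\<dots> = (\<Sum>k\<in>D. F D (cyc \<sigma> k))" unfolding im ..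
    also have "\<dots> = (\<Sum>l\<in>{..<length ?cs}. F D (cyc \<sigma> (?cs ! l)))"
      by (rule sum.reindex_bij_betw[symmetric], rule bij_betw_nth)
        (use distinct_cyc[OF assms(1)] sD in auto)
    also have "\<dots> = (\<Sum>l<length ?cs. F D (rotate l ?cs))"
      using cyc_nth[OF assms(1)] by (intro sum.cong) auto
    finally show "(\<Sum>k\<in>{k \<in> Q. orbit \<sigma> k = D}. F (orbit \<sigma> k) (cyc \<sigma> (\<sigma> k))) =
      (\<Sum>l<length ?cs. F D (rotate l ?cs))" .
  qed
  finally show ?thesis .
qed

section \<open>Relabelling\<close>

text \<open>Relabellings arise as bijections between finite label sets that may overlap, whereas
  conjugation uses a bijection of the whole type. The labels in \<open>B\<close> outside
  \<open>A\<close> are sent to those in \<open>A\<close> outside \<open>B\<close>; there are equally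
  many.\<close>

lemma finite_bij_extend:
  fixes f :: "'b \<Rightarrow> 'b"
  assumes "finite A" "bij_betw f A B"
  obtains g where "bij g" "\<And>x. x \<in> A \<Longrightarrow> g x = f x"
proof -
  have fB: "finite B" using assms by (metis bij_betw_finite)
  have "card (B - A) = card (A - B)"
    using bij_betw_same_card[OF assms(2)] assms(1) fB card_Diff_subset_Int[of B A] card_Diff_subset_Int[of A B]
    by (simp add: Int_commute)
  then obtain h where h: "bij_betw h (B - A) (A - B)"
    using assms(1) fB finite_same_card_bij[of "B - A" "A - B"] by auto
  define g where "g x = (if x \<in> A then f x else if x \<in> B then h x else x)" for x
  have "bij_betw g A B" using assms(2) by (rule iffD1[OF bij_betw_cong, rotated]) (simp add: g_def)
  moreover have "bij_betw g (B - A) (A - B)" using h by (rule iffD1[OF bij_betw_cong, rotated]) (simp add: g_def)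
  ultimately have "bij_betw g (A \<union> (B - A)) (B \<union> (A - B))" by (rule bij_betw_combine) blast
  then have "bij_betw g (A \<union> B) (A \<union> B)" by (simp add: Un_commute)
  then have "g permutes (A \<union> B)" by (rule bij_imp_permutes) (simp add: g_def)
  then show thesis using that[of g] by (simp add: permutes_bij g_def)
qed

lemma conj_eqI:
  fixes g :: "'b \<Rightarrow> 'b"
  assumes "bij g" "\<sigma> permutes T" "\<tau> permutes g ` T" "\<And>c. c \<in> T \<Longrightarrow> g (\<sigma> c) = \<tau> (g c)"
  shows "g \<circ> \<sigma> \<circ> inv g = \<tau>"
proof
  fix x
  obtain y where x: "x = g y" using assms(1) by (metis bij_pointE)
  have "g (\<sigma> y) = \<tau> (g y)"
  proof (cases "y \<in> T")
    case False
    then have "g y \<notin> g ` T" using assms(1) by (simp add: bij_is_inj inj_image_mem_iff)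
    then show ?thesis using False assms(2,3) by (simp add: permutes_not_in)
  qed (rule assms(4))
  then show "(g \<circ> \<sigma> \<circ> inv g) x = \<tau> x" unfolding x using assms(1) by (simp add: bij_is_inj)
qed

lemma cycle_partition_conj:
  fixes g :: "'b \<Rightarrow> 'b"
  assumes "permutation \<pi>" "bij g"
  shows "cycle_partition (g \<circ> \<pi> \<circ> inv g) (g ` S) = (`) g ` cycle_partition \<pi> S"
  unfolding cycle_partition_def image_image cyc_conj(2)[OF assms] ..

lemma inj_image_set: "bij g \<Longrightarrow> inj_on ((`) g) X"
  by (rule inj_onI) (simp add: inj_image_eq_iff[OF bij_is_inj])

lemma rotation_invariant_conj:
  fixes g :: "nat \<Rightarrow> nat"
  assumes "rotation_invariant h" "permutation \<pi>" "bij g" "C \<in> cycle_partition \<pi> S"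
  shows "h (map z (cyc (g \<circ> \<pi> \<circ> inv g) (Min (g ` C)))) = h (map (z \<circ> g) (cyc \<pi> (Min C)))"
proof -
  obtain c where c: "C = orbit \<pi> c" using assms(4) by (auto simp: cycle_partition_def)
  have p: "permutation (g \<circ> \<pi> \<circ> inv g)" by (rule permutation_conj[OF assms(2,3)])
  have "h (map z (cyc (g \<circ> \<pi> \<circ> inv g) (Min (g ` C)))) = h (map z (cyc (g \<circ> \<pi> \<circ> inv g) (g c)))"
    using rotation_invariant_Min[OF assms(1) p, of z "g c"] unfolding cyc_conj(2)[OF assms(2,3)] c .
  also have "\<dots> = h (map (z \<circ> g) (cyc \<pi> c))" unfolding cyc_conj(1)[OF assms(2,3)] by simp
  also have "\<dots> = h (map (z \<circ> g) (cyc \<pi> (Min C)))"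
    unfolding c by (rule rotation_invariant_Min[OF assms(1,2), symmetric])
  finally show ?thesis .
qed

lemma cycle_prod_conj:
  fixes g :: "nat \<Rightarrow> nat"
  assumes "rotation_invariant \<kappa>" "permutation \<pi>" "bij g"
  shows "cycle_prod \<kappa> z (g \<circ> \<pi> \<circ> inv g) (g ` S) = cycle_prod \<kappa> (z \<circ> g) \<pi> S"
  unfolding cycle_prod_def cycle_partition_conj[OF assms(2,3)] prod.reindex[OF inj_image_set[OF assms(3)]]
  using rotation_invariant_conj[OF assms] by (intro prod.cong refl) simp

lemma cycle_deriv_conj:
  fixes g :: "nat \<Rightarrow> nat"
  assumes "rotation_invariant \<kappa>" "rotation_invariant h" "permutation \<pi>" "bij g"
  shows "cycle_deriv \<kappa> h z (g \<circ> \<pi> \<circ> inv g) (g ` S) = cycle_deriv \<kappa> h (z \<circ> g) \<pi> S"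
  unfolding cycle_deriv_def cycle_partition_conj[OF assms(3,4)] sum.reindex[OF inj_image_set[OF assms(4)]]
proof (intro sum.cong refl, unfold o_def[of _ "(`) g"])
  fix C assume C: "C \<in> cycle_partition \<pi> S"
  have "g ` S - g ` C = g ` (S - C)" using assms(4) by (simp add: bij_is_inj image_set_diff)
  then show "h (map z (cyc (g \<circ> \<pi> \<circ> inv g) (Min (g ` C)))) * cycle_prod \<kappa> z (g \<circ> \<pi> \<circ> inv g) (g ` S - g ` C) =
      h (map (z \<circ> g) (cyc \<pi> (Min C))) * cycle_prod \<kappa> (z \<circ> g) \<pi> (S - C)"
    using rotation_invariant_conj[OF assms(2-4) C] cycle_prod_conj[OF assms(1,3,4)] by simp
qed

lemma cyc_Cons2:
  assumes "permutation f" "f x \<noteq> x"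
  obtains w where "cyc f x = x # f x # w"
proof -
  obtain w where w: "cyc f x = x # w" by (rule cyc_Cons[OF assms(1)])
  have "map f (x # w) = w @ [x]" using map_cyc[OF assms(1), of x] unfolding w by simp
  then show thesis using assms(2) w that by (cases w) auto
qed

lemma length_cyc: "permutation f \<Longrightarrow> length (cyc f x) = card (orbit f x)"
  using distinct_card[OF distinct_cyc, of f x] set_cyc[of f x] by simp

lemma cyc_inv:
  assumes "permutation f" "cyc f x = x # w"
  shows "cyc (inv f) x = x # rev w"
proof -
  have inj: "inj f" using assms(1) by (simp add: permutation bij_is_inj)
  have d: "distinct (x # w)" using distinct_cyc[OF assms(1), of x] assms(2) by simp
  have "map f (x # w) = w @ [x]" using map_cyc[OF assms(1), of x] unfolding assms(2) by simp
  then have "map (inv f) (map f (x # w)) = map (inv f) (w @ [x])" by (rule arg_cong)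
  then have m: "map (inv f) (w @ [x]) = x # w" using inj by (simp add: list.map_comp o_def)
  have "map (inv f) (rev (w @ [x])) = rev (x # w)" unfolding m[symmetric] by (rule rev_map[symmetric])
  then have "map (inv f) (x # rev w) = rotate1 (x # rev w)" by simp
  then show ?thesis using cyc_unique(1)[of "x # rev w" "inv f"] d by simp
qed

section \<open>First-order cumulants\<close>

text \<open>Truncation makes statements proved for short argument lists hold for all lists.\<close>

definition trunc :: "nat \<Rightarrow> ('a list \<Rightarrow> complex) \<Rightarrow> 'a list \<Rightarrow> complex" where
  "trunc n \<kappa> xs = (if length xs < n then \<kappa> xs else 0)"

lemma cycle_prod_trunc:
  assumes "permutation \<pi>" "closed_under \<pi> S" "\<And>C. C \<in> cycle_partition \<pi> S \<Longrightarrow> card C < n"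
  shows "cycle_prod (trunc n \<kappa>) z \<pi> S = cycle_prod \<kappa> z \<pi> S"
  unfolding cycle_prod_def
proof (rule prod.cong[OF refl])
  fix C assume C: "C \<in> cycle_partition \<pi> S"
  have "orbit \<pi> (Min C) = C"
    by (rule cycle_partition_memD(4)[OF assms(1,2) C Min_cycle_mem(1)[OF assms(1,2) C]])
  then show "trunc n \<kappa> (map z (cyc \<pi> (Min C))) = \<kappa> (map z (cyc \<pi> (Min C)))"
    using assms(3)[OF C] length_cyc[OF assms(1), of "Min C"] by (simp add: trunc_def)
qed

lemma single_cycle_card:
  assumes "permutation \<pi>" "closed_under \<pi> S" "finite S" "C \<in> cycle_partition \<pi> S" "card S \<le> card C"
  shows "C = S" "cycle_partition \<pi> S = {S}"
proof -
  note C = cycle_partition_memD[OF assms(1,2,4)]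
  show CS: "C = S" using C(1) assms(3,5) by (meson card_seteq)
  show "cycle_partition \<pi> S = {S}" using C(4) assms(4) unfolding CS by (auto simp: cycle_partition_def)
qed

lemma NCG_single_cycle:
  assumes "\<tau> permutes S" "finite S" "\<pi> \<in> NCG S \<tau> 1" "\<pi> \<noteq> \<tau>" "C \<in> cycle_partition \<pi> S"
  shows "card C < card S"
proof (rule ccontr)
  have p: "\<pi> permutes S" using assms(3) by (rule NCG_permutes)
  assume "\<not> ?thesis"
  then have "cycle_partition \<pi> S = {S}"
    by (intro single_cycle_card(2)[OF permutes_permutation[OF p assms(2)] closed_under_permutes[OF p] assms(2,5)]) simp
  then have "num_cycles \<pi> S = 1" by (simp add: num_cycles_def)
  then show False using NCG_top[OF assms(3,1,2)] assms(4) by simp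
qed

text \<open>Only \<tau> has a cycle of full length, so truncation removes exactly its term. Removing
  it this way leaves the index set intact, and the reindexing lemmas still apply to the lower
  terms.\<close>

lemma sum_NCG_top:
  assumes "\<tau> permutes S" "finite S" "cycle_partition \<tau> S = {S}"
  shows "(\<Sum>\<pi>\<in>NCG S \<tau> 1. cycle_prod \<kappa> z \<pi> S) =
    \<kappa> (map z (cyc \<tau> (Min S))) + (\<Sum>\<pi>\<in>NCG S \<tau> 1. cycle_prod (trunc (card S) \<kappa>) z \<pi> S)"
proof -
  have t: "\<tau> \<in> NCG S \<tau> 1" using assms by (intro NCG_self) (simp_all add: num_cycles_def)
  note pt = permutes_permutation[OF assms(1,2)]
  have "S \<noteq> {}" using assms(3) by (auto simp: cycle_partition_def)
  then have "orbit \<tau> (Min S) \<in> cycle_partition \<tau> S"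
    unfolding cycle_partition_def by (intro imageI Min_in assms(2))
  then have "orbit \<tau> (Min S) = S" using assms(3) by simp
  then have "length (cyc \<tau> (Min S)) = card S" using length_cyc[OF pt] by simp
  then have 0: "cycle_prod (trunc (card S) \<kappa>) z \<tau> S = 0"
    by (simp add: cycle_prod_def assms(3) trunc_def)
  have "cycle_prod (trunc (card S) \<kappa>) z \<pi> S = cycle_prod \<kappa> z \<pi> S" if "\<pi> \<in> NCG S \<tau> 1 - {\<tau>}" for \<pi>
  proof -
    have p: "\<pi> permutes S" using that by (auto dest: NCG_permutes)
    show ?thesis
      by (rule cycle_prod_trunc[OF permutes_permutation[OF p assms(2)] closed_under_permutes[OF p]])
        (use NCG_single_cycle[OF assms(1,2)] that in blast)
  qed
  then have "(\<Sum>\<pi>\<in>NCG S \<tau> 1 - {\<tau>}. cycle_prod (trunc (card S) \<kappa>) z \<pi> S) =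
      (\<Sum>\<pi>\<in>NCG S \<tau> 1 - {\<tau>}. cycle_prod \<kappa> z \<pi> S)" by (rule sum.cong[OF refl])
  moreover have "cycle_prod \<kappa> z \<tau> S = \<kappa> (map z (cyc \<tau> (Min S)))"
    by (simp add: cycle_prod_def assms(3))
  ultimately show ?thesis
    using 0 sum.remove[OF finite_NCG[OF assms(2)] t, of "\<lambda>\<pi>. cycle_prod \<kappa> z \<pi> S"]
      sum.remove[OF finite_NCG[OF assms(2)] t, of "\<lambda>\<pi>. cycle_prod (trunc (card S) \<kappa>) z \<pi> S"]
    by simp
qed

lemma cumulant_perm_cycle_prod: "cumulant_perm \<kappa> S \<pi> zs = cycle_prod \<kappa> (\<lambda>c. zs ! (c - 1)) \<pi> S"
  by (simp add: cumulant_perm_def cycle_prod_def cycle_args_def cyc_def)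

lemma S_nc_NCG: "S_nc n = NCG {1..n} (tau n) 1"
  by (simp add: S_nc_def NCG_def)

lemma tau_apply:
  assumes "c \<in> {1..n}"
  shows "tau n c = Suc (c mod n)"
proof -
  have "c - 1 < n" using assms by auto
  moreover have "[1..<Suc n] ! (c - 1) = c" using assms by (subst nth_upt) auto
  moreover have "cycle_of_list [1..<Suc n] ([1..<Suc n] ! (c - 1)) = [1..<Suc n] ! (c mod n)"
    using cycle_of_list_nth[of "[1..<Suc n]" "c - 1"] assms calculation(1) by (simp del: upt_Suc)
  moreover have "[1..<Suc n] ! (c mod n) = Suc (c mod n)"
  proof -
    have "c mod n < n" using assms by (intro mod_less_divisor) auto
    then show ?thesis by (subst nth_upt) auto
  qed
  ultimately show ?thesis using assms by (simp add: tau_def del: upt_Suc)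
qed

lemma cyc_tau: "n > 0 \<Longrightarrow> cyc (tau n) 1 = [1..<Suc n]"
  using tau_facts(3) by (simp add: cyc_def)

lemma map_nth_upt: "map (\<lambda>c. xs ! (c - 1)) [1..<Suc (length xs)] = xs"
  by (rule nth_equalityI) (simp_all del: upt_Suc)

locale tracial_cumulants =
  fixes \<phi>1 :: "'a :: monoid_mult \<Rightarrow> complex" and \<kappa> :: "'a list \<Rightarrow> complex"
  assumes tracial: "\<phi>1 (x * y) = \<phi>1 (y * x)"
    and unital: "\<phi>1 1 = 1"
    and cumulants: "free_cumulants \<phi>1 \<kappa>"
begin

lemma moment_std:
  assumes "xs \<noteq> []"
  shows "\<phi>1 (prod_list xs) =
    (\<Sum>\<pi>\<in>NCG {1..length xs} (tau (length xs)) 1. cycle_prod \<kappa> (\<lambda>c. xs ! (c - 1)) \<pi> {1..length xs})"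
  using cumulants assms by (simp add: free_cumulants_def cumulant_perm_cycle_prod S_nc_NCG)

lemma cumulant_recursion:
  assumes "xs \<noteq> []"
  shows "\<kappa> xs = \<phi>1 (prod_list xs) - (\<Sum>\<pi>\<in>NCG {1..length xs} (tau (length xs)) 1.
    cycle_prod (trunc (length xs) \<kappa>) (\<lambda>c. xs ! (c - 1)) \<pi> {1..length xs})"
proof -
  let ?n = "length xs"
  have n: "?n > 0" using assms by simp
  have "Min {1..?n} = 1" using n by (intro Min_eqI) (auto simp: Suc_le_eq)
  then show ?thesis
    using sum_NCG_top[OF tau_facts(1)[OF n] _ tau_facts(2)[OF n], of \<kappa> "\<lambda>c. xs ! (c - 1)"]
      moment_std[OF assms] cyc_tau[OF n] map_nth_upt[of xs] by simp
qed

lemma cyclic_rotate1: "\<phi>1 (prod_list (rotate1 xs)) = \<phi>1 (prod_list xs)"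
  by (cases xs) (simp_all add: tracial)

text \<open>Conjugation by \<tau> permutes the diagrams and rotates the arguments. Ignoring where
  the conjugated cycles start needs the very invariance to be proved, but only for lists shorter
  than \<open>xs\<close>; truncation turns the induction hypothesis into invariance on all
  lists.\<close>

lemma rotation_invariant: "rotation_invariant \<kappa>"
proof -
  have "\<kappa> (rotate1 xs) = \<kappa> xs" for xs
  proof (induction xs rule: length_induct)
    case (1 xs)
    show ?case
    proof (cases "xs = []")
      case False
      let ?n = "length xs"
      let ?S = "{1..?n}" and ?t = "tau ?n" and ?k = "trunc ?n \<kappa>" and ?z = "\<lambda>c. xs ! (c - 1)"
      have n: "?n > 0" using False by simp
      note t = tau_facts(1)[OF n]
      have ri: "rotation_invariant ?k" using 1 by (simp add: rotation_invariant_def trunc_def)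
      have tS: "?t ` ?S = ?S" by (rule permutes_image[OF t])
      have inv: "?t \<circ> ?t \<circ> inv ?t = ?t" using permutes_inv_o(1)[OF t] by (simp add: comp_assoc)
      have "(\<Sum>\<pi>\<in>NCG ?S ?t 1. cycle_prod ?k ?z \<pi> ?S) = (\<Sum>\<pi>\<in>NCG ?S ?t 1. cycle_prod ?k (\<lambda>c. rotate1 xs ! (c - 1)) \<pi> ?S)"
      proof -
        have "(\<Sum>\<pi>\<in>NCG ?S ?t 1. cycle_prod ?k ?z \<pi> ?S) = (\<Sum>\<pi>\<in>NCG ?S ?t 1. cycle_prod ?k ?z (?t \<circ> \<pi> \<circ> inv ?t) (?t ` ?S))"
          using sum_NCG_conj[OF permutes_bij[OF t] _ t, where m = 1 and f = "\<lambda>\<pi>. cycle_prod ?k ?z \<pi> ?S"] unfolding inv tS by simp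
        also have "\<dots> = (\<Sum>\<pi>\<in>NCG ?S ?t 1. cycle_prod ?k (\<lambda>c. rotate1 xs ! (c - 1)) \<pi> ?S)"
        proof (rule sum.cong[OF refl])
          fix \<pi> assume "\<pi> \<in> NCG ?S ?t 1"
          then have p: "\<pi> permutes ?S" by (rule NCG_permutes)
          note pp = permutes_permutation[OF p finite_atLeastAtMost]
          have "cycle_prod ?k ?z (?t \<circ> \<pi> \<circ> inv ?t) (?t ` ?S) = cycle_prod ?k (?z \<circ> ?t) \<pi> ?S"
            by (rule cycle_prod_conj[OF ri pp permutes_bij[OF t]])
          also have "\<dots> = cycle_prod ?k (\<lambda>c. rotate1 xs ! (c - 1)) \<pi> ?S"
          proof (rule cycle_prod_cong[OF pp closed_under_permutes[OF p] refl])
            fix c assume c: "c \<in> ?S"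
            then have "rotate1 xs ! (c - 1) = xs ! (Suc (c - 1) mod ?n)" by (intro nth_rotate1) auto
            then show "(?z \<circ> ?t) c = rotate1 xs ! (c - 1)" using c tau_apply[OF c] by simp
          qed
          finally show "cycle_prod ?k ?z (?t \<circ> \<pi> \<circ> inv ?t) (?t ` ?S) =
            cycle_prod ?k (\<lambda>c. rotate1 xs ! (c - 1)) \<pi> ?S" .
        qed
        finally show ?thesis .
      qed
      then show ?thesis
        using cumulant_recursion[OF False] cumulant_recursion[of "rotate1 xs"] False cyclic_rotate1[of xs] by simp
    qed simp
  qed
  then show ?thesis by (simp add: rotation_invariant_def)
qed

text \<open>The moment-cumulant relation on any labels with one cycle, read from any starting point.
  It is needed because deleting a merged label leaves a set that is no longer an initial
  segment.\<close>

lemma moment: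
  assumes "\<tau> permutes S" "finite S" "cycle_partition \<tau> S = {S}" "s \<in> S"
  shows "\<phi>1 (prod_list (map z (cyc \<tau> s))) = (\<Sum>\<pi>\<in>NCG S \<tau> 1. cycle_prod \<kappa> z \<pi> S)"
proof -
  note pt = permutes_permutation[OF assms(1,2)]
  let ?ls = "cyc \<tau> s"
  let ?n = "length ?ls"
  let ?T = "{1..?n}" and ?t = "tau ?n"
  have ne: "?ls \<noteq> []" by (rule cyc_nonempty[OF pt])
  then have n: "?n > 0" by simp
  have "orbit \<tau> s \<in> cycle_partition \<tau> S" using assms(4) by (simp add: cycle_partition_def)
  then have sls: "set ?ls = S" using assms(3) set_cyc[OF pt, of s] by simp
  note t = tau_facts(1)[OF n]
  have bb: "bij_betw (\<lambda>c. ?ls ! (c - 1)) ?T S"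
  proof -
    have "bij_betw (\<lambda>c. c - 1) ?T {..<?n}" by (rule bij_betw_byWitness[where f' = Suc]) auto
    moreover have "bij_betw ((!) ?ls) {..<?n} S" by (rule bij_betw_nth[OF distinct_cyc[OF pt] _ sls[symmetric]]) simp
    ultimately show ?thesis using bij_betw_trans unfolding o_def by blast
  qed
  then obtain g where g: "bij g" "\<And>c. c \<in> ?T \<Longrightarrow> g c = ?ls ! (c - 1)"
    using finite_bij_extend[of ?T] by auto
  have gT: "g ` ?T = S" using bb g(2) by (metis (no_types, lifting) bij_betw_imp_surj_on image_cong)
  have conj: "g \<circ> ?t \<circ> inv g = \<tau>"
  proof (rule conj_eqI[OF g(1) t])
    show "\<tau> permutes g ` ?T" unfolding gT by (rule assms(1))
    fix c assume c: "c \<in> ?T"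
    have "?t c \<in> ?T" using c unfolding permutes_in_image[OF t] .
    then have "g (?t c) = ?ls ! (?t c - 1)" by (rule g(2))
    also have "?t c - 1 = Suc (c - 1) mod ?n" using tau_apply[OF c] c by simp
    also have "?ls ! (Suc (c - 1) mod ?n) = rotate1 ?ls ! (c - 1)" using c by (intro nth_rotate1[symmetric]) auto
    also have "\<dots> = \<tau> (?ls ! (c - 1))" unfolding map_cyc[OF pt, symmetric] using c by (intro nth_map) auto
    finally show "g (?t c) = \<tau> (g c)" using g(2)[OF c] by simp
  qed
  have "(\<Sum>\<pi>\<in>NCG S \<tau> 1. cycle_prod \<kappa> z \<pi> S) = (\<Sum>\<pi>\<in>NCG ?T ?t 1. cycle_prod \<kappa> z (g \<circ> \<pi> \<circ> inv g) (g ` ?T))"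
    using sum_NCG_conj[OF g(1) _ t, where m = 1 and f = "\<lambda>\<pi>. cycle_prod \<kappa> z \<pi> S"] unfolding conj gT by simp
  also have "\<dots> = (\<Sum>\<pi>\<in>NCG ?T ?t 1. cycle_prod \<kappa> (\<lambda>c. map z ?ls ! (c - 1)) \<pi> ?T)"
  proof (rule sum.cong[OF refl])
    fix \<pi> assume "\<pi> \<in> NCG ?T ?t 1"
    then have p: "\<pi> permutes ?T" by (rule NCG_permutes)
    note pp = permutes_permutation[OF p finite_atLeastAtMost]
    have "cycle_prod \<kappa> z (g \<circ> \<pi> \<circ> inv g) (g ` ?T) = cycle_prod \<kappa> (z \<circ> g) \<pi> ?T"
      by (rule cycle_prod_conj[OF rotation_invariant pp g(1)])
    also have "\<dots> = cycle_prod \<kappa> (\<lambda>c. map z ?ls ! (c - 1)) \<pi> ?T"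
      by (rule cycle_prod_cong[OF pp closed_under_permutes[OF p] refl]) (use g(2) in auto)
    finally show "cycle_prod \<kappa> z (g \<circ> \<pi> \<circ> inv g) (g ` ?T) = cycle_prod \<kappa> (\<lambda>c. map z ?ls ! (c - 1)) \<pi> ?T" .
  qed
  also have "\<dots> = \<phi>1 (prod_list (map z ?ls))" using moment_std[of "map z ?ls"] ne by simp
  finally show ?thesis ..
qed

text \<open>The formula for cumulants with products as arguments, for a product of two factors.\<close>

lemma merge_defect_zero: "merge_defect \<kappa> a b w = 0"
proof (induction w arbitrary: a b rule: length_induct)
  case (1 w)
  let ?xs = "a # b # w"
  let ?n = "length ?xs"
  let ?S = "{1..?n}" and ?t = "tau ?n" and ?z = "\<lambda>c. ?xs ! (c - 1)"
  let ?e = "?t 1"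
  have n: "?n > 0" by simp
  note t = tau_facts(1)[OF n] and cpt = tau_facts(2)[OF n]
  note pt = permutes_permutation[OF t finite_atLeastAtMost]
  have e: "?e = 2" using tau_apply[of 1 ?n] by simp
  have i: "1 \<in> ?S" by simp
  have ne: "?t 1 \<noteq> 1" using e by simp
  obtain r where cyct: "cyc ?t 1 = 1 # ?e # r" by (rule cyc_Cons2[OF pt ne])
  have "map ?z (cyc ?t 1) = ?xs" unfolding cyc_tau[OF n] by (rule map_nth_upt)
  then have mw: "map ?z r = w" unfolding cyct by simp
  let ?t' = "?t \<circ> transpose 1 ?e" and ?S' = "?S - {?e}"
  let ?zz = "?z(1 := ?z 1 * ?z ?e)"
  have "cyc ?t 1 = 1 # [?e] @ r" unfolding cyct by simp
  note sp = cyc_split[OF pt this, of ?t']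
  have c': "cyc ?t' 1 = 1 # r" "orbit ?t' 1 = set (1 # r)" using sp(1,3) by simp_all
  have "set (1 # ?e # r) = ?S" "distinct (1 # ?e # r)"
    using set_cyc[OF pt, of 1] cpt distinct_cyc[OF pt, of 1] unfolding cyct cycle_partition_def by auto
  then have S': "?S' = orbit ?t' 1" unfolding c'(2) by auto
  have t': "?t' permutes ?S'"
  proof (rule permutes_superset)
    show "?t' permutes ?S" using e by (intro permutes_compose[OF permutes_swap_id t]) auto
    show "\<And>x. x \<in> ?S - ?S' \<Longrightarrow> ?t' x = x" using sp(2) by simp
  qed
  have cp': "cycle_partition ?t' ?S' = {?S'}"
    unfolding S' by (rule cycle_partition_orbit[OF permutation_comp_transpose[OF pt]])
  have "1 \<in> ?S'" using e by simp
  have m': "\<phi>1 (prod_list ?xs) = (\<Sum>\<rho>\<in>NCG ?S' ?t' 1. cycle_prod \<kappa> ?zz \<rho> ?S')"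
  proof -
    have "map ?zz r = map ?z r" by (rule map_cong) (use \<open>distinct (1 # ?e # r)\<close> in auto)
    then have "map ?zz (cyc ?t' 1) = (a * b) # w" unfolding c'(1) mw using mw e by simp
    then show ?thesis using moment[OF t' _ cp' \<open>1 \<in> ?S'\<close>, of ?zz] by (simp add: mult.assoc)
  qed
  have "(\<Sum>\<pi>\<in>NCG ?S ?t 1. cycle_prod \<kappa> ?z \<pi> ?S) =
      (\<Sum>\<sigma>\<in>NCGf ?S ?t 1 1. \<Sum>k\<in>orbit \<sigma> 1. cycle_prod \<kappa> ?z (\<sigma> \<circ> transpose 1 k) ?S)"
  proof -
    \<comment> \<open>A single cycle allows at most \<open>m = 1\<close>, so no diagram here comes
      from a fibre of smaller genus.\<close>
    have "NCGf ?S ?t 1 (1 + 2) = {}"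
    proof -
      have "\<sigma> \<notin> NCG ?S ?t (1 + 2)" for \<sigma>
        using genus_bound[of \<sigma> ?S ?t] t cpt by (auto simp: NCG_def num_cycles_def)
      then show ?thesis unfolding NCGf_def by blast
    qed
    then show ?thesis using sum_NCG_fibres[OF t finite_atLeastAtMost i, where m = 1 and f = "\<lambda>\<pi>. cycle_prod \<kappa> ?z \<pi> ?S"]
      by simp
  qed
  moreover have "(\<Sum>\<rho>\<in>NCG ?S' ?t' 1. cycle_prod \<kappa> ?zz \<rho> ?S') =
      (\<Sum>\<sigma>\<in>NCGf ?S ?t 1 1. cycle_prod \<kappa> ?zz (\<sigma> \<circ> transpose 1 ?e) ?S')"
    by (rule sum_NCG_merge[OF t finite_atLeastAtMost i ne])
  \<comment> \<open>By associativity, both argument lists have the same product and hence the same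
    moment.\<close>
  ultimately have "0 = (\<Sum>\<sigma>\<in>NCGf ?S ?t 1 1. (\<Sum>k\<in>orbit \<sigma> 1. cycle_prod \<kappa> ?z (\<sigma> \<circ> transpose 1 k) ?S) -
      cycle_prod \<kappa> ?zz (\<sigma> \<circ> transpose 1 ?e) ?S')"
    using m' moment_std[of ?xs] by (simp add: sum_subtractf)
  \<comment> \<open>For every \<sigma> other than \<tau> the cycle through 1 is shorter than the
    whole list, so its defect vanishes by induction. The remaining summand is the defect in
    question.\<close>
  also have "\<dots> = (\<Sum>\<sigma>\<in>NCGf ?S ?t 1 1. if \<sigma> = ?t then merge_defect \<kappa> a b w else 0)"
  proof (rule sum.cong[OF refl])
    fix \<sigma> assume "\<sigma> \<in> NCGf ?S ?t 1 1"
    then have s: "\<sigma> \<in> NCG ?S ?t 1" "\<sigma> 1 = ?e" by (auto simp: NCGf_def)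
    have p: "\<sigma> permutes ?S" using s(1) by (rule NCG_permutes)
    note pp = permutes_permutation[OF p finite_atLeastAtMost]
    have "\<sigma> 1 \<noteq> 1" using s(2) e by simp
    then obtain u where u: "cyc \<sigma> 1 = 1 # ?e # u" using cyc_Cons2[OF pp] s(2) by metis
    have *: "(\<Sum>k\<in>orbit \<sigma> 1. cycle_prod \<kappa> ?z (\<sigma> \<circ> transpose 1 k) ?S) -
      cycle_prod \<kappa> ?zz (\<sigma> \<circ> transpose 1 ?e) ?S' =
      merge_defect \<kappa> a b (map ?z u) * cycle_prod \<kappa> ?z \<sigma> (?S - orbit \<sigma> 1)"
      using cycle_prod_merge(1)[OF pp closed_under_permutes[OF p] _ i u rotation_invariant, of ?z] e by simp
    show "(\<Sum>k\<in>orbit \<sigma> 1. cycle_prod \<kappa> ?z (\<sigma> \<circ> transpose 1 k) ?S) -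
      cycle_prod \<kappa> ?zz (\<sigma> \<circ> transpose 1 ?e) ?S' = (if \<sigma> = ?t then merge_defect \<kappa> a b w else 0)"
    proof (cases "\<sigma> = ?t")
      case True
      have ur: "u = r" using u cyct e unfolding True by simp
      moreover have o: "?S - orbit ?t 1 = {}" using cpt by (auto simp: cycle_partition_def)
      have "cycle_prod \<kappa> ?z \<sigma> (?S - orbit \<sigma> 1) = 1" unfolding True o by (rule cycle_prod_empty)
      ultimately show ?thesis unfolding * using mw True by simp
    next
      case False
      have "orbit \<sigma> 1 \<in> cycle_partition \<sigma> ?S" unfolding cycle_partition_def by (rule imageI[OF i])
      from NCG_single_cycle[OF t _ s(1) False this] have "length (cyc \<sigma> 1) < ?n"
        using length_cyc[OF pp, of 1] by simp
      then have "length (map ?z u) < length w" unfolding u by simp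
      then have "merge_defect \<kappa> a b (map ?z u) = 0" using 1 by blast
      then show ?thesis using * False by simp
    qed
  qed
  also have "\<dots> = merge_defect \<kappa> a b w"
  proof -
    have "?t \<in> NCGf ?S ?t 1 1" using NCG_self[OF t] cpt by (simp add: NCGf_def num_cycles_def)
    moreover have "finite (NCGf ?S ?t 1 1)" using finite_NCG[of ?S ?t 1] by (simp add: NCGf_def)
    ultimately show ?thesis by (simp add: sum.delta')
  qed
  finally show ?case ..
qed

lemma cumulant_merge:
  "\<kappa> ((a * b) # w) = \<kappa> (a # b # w) + (\<Sum>j\<le>length w. \<kappa> (a # drop j w) * \<kappa> (b # take j w))"
  using merge_defect_zero[of a b w] by (simp add: merge_defect_def)

lemma cumulant_single: "\<kappa> [x] = \<phi>1 x"
proof -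
  have "\<pi> = tau 1" if "\<pi> \<in> S_nc 1" for \<pi>
  proof -
    have "\<pi> permutes {1}" "tau 1 permutes {1}" using that tau_facts(1)[of 1] by (simp_all add: S_nc_def)
    then show ?thesis by simp
  qed
  then have "S_nc (length [x]) - {tau (length [x])} = {}" by auto
  moreover have "\<kappa> [x] = \<phi>1 (prod_list [x]) - (\<Sum>\<pi>\<in>S_nc (length [x]) - {tau (length [x])}.
      cumulant_perm \<kappa> {1..length [x]} \<pi> [x])"
    using cumulants unfolding free_cumulants_iff by blast
  ultimately show ?thesis by (simp only: sum.empty) simp
qed

lemma cumulant_pair: "\<kappa> [x, y] = \<phi>1 (x * y) - \<phi>1 x * \<phi>1 y"
  using cumulant_merge[of x y "[]"] by (simp add: cumulant_single)

text \<open>Merging the unit with the next argument \<open>b\<close> leaves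
  \<open>\<kappa> (b # v)\<close> on the left. By induction the only split that survives is the one
  isolating the unit, and it contributes the same value, as \<open>\<kappa> [1] = 1\<close>.\<close>

lemma cumulant_unit: "w \<noteq> [] \<Longrightarrow> \<kappa> (1 # w) = 0"
proof (induction w rule: length_induct)
  case (1 w)
  then obtain b v where w: "w = b # v" by (cases w) auto
  have "(\<Sum>j\<le>length v. \<kappa> (1 # drop j v) * \<kappa> (b # take j v)) =
      (\<Sum>j\<le>length v. if j = length v then \<kappa> (b # v) else 0)"
  proof (rule sum.cong[OF refl])
    fix j assume "j \<in> {..length v}"
    then have j: "j \<le> length v" by simp
    show "\<kappa> (1 # drop j v) * \<kappa> (b # take j v) = (if j = length v then \<kappa> (b # v) else 0)"
    proof (cases "j = length v")
      case True
      then show ?thesis by (simp add: cumulant_single unital)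
    next
      case False
      then have "drop j v \<noteq> []" "length (drop j v) < length w" using j w by auto
      then have "\<kappa> (1 # drop j v) = 0" using 1 by blast
      then show ?thesis using False by simp
    qed
  qed
  then show ?case using cumulant_merge[of 1 b v] w by simp
qed

end

section \<open>Annular and disc sums\<close>

definition two_cycles :: "(nat \<Rightarrow> nat) \<Rightarrow> nat set \<Rightarrow> nat set \<Rightarrow> bool" where
  "two_cycles \<tau> P Q \<longleftrightarrow> \<tau> permutes P \<union> Q \<and> finite P \<and> finite Q \<and> P \<inter> Q = {} \<and>
     cycle_partition \<tau> P = {P} \<and> cycle_partition \<tau> Q = {Q}"

text \<open>Connectedness is put into the summand rather than the index set, so that the sum still
  runs over all of \<open>NCG\<close> and can be reindexed.\<close>

definition ann_sum ::
    "('a list \<Rightarrow> complex) \<Rightarrow> (nat \<Rightarrow> 'a) \<Rightarrow> (nat \<Rightarrow> nat) \<Rightarrow> nat set \<Rightarrow> nat set \<Rightarrow> complex" where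
  "ann_sum \<kappa> z \<tau> P Q =
     (\<Sum>\<pi>\<in>NCG (P \<union> Q) \<tau> 0. if closed_under \<pi> P then 0 else cycle_prod \<kappa> z \<pi> (P \<union> Q))"

text \<open>The nontrivial block is the union of a cycle \<open>D\<close> in \<open>Q\<close> and a
  cycle in \<open>P\<close>. The latter is chosen inside \<open>cycle_deriv\<close>, so that for
  fixed \<open>D\<close> merging in \<open>P\<close> is the derivative of the first-order
  computation.\<close>

definition disc_term ::
    "('a list \<Rightarrow> complex) \<Rightarrow> ('a list \<Rightarrow> 'a list \<Rightarrow> complex) \<Rightarrow> (nat \<Rightarrow> 'a) \<Rightarrow> (nat \<Rightarrow> nat) \<Rightarrow>
     nat set \<Rightarrow> nat set \<Rightarrow> complex" where
  "disc_term \<kappa> \<kappa>2 z \<pi> P Q = (\<Sum>D\<in>cycle_partition \<pi> Q.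
     cycle_prod \<kappa> z \<pi> (Q - D) * cycle_deriv \<kappa> (\<lambda>l. \<kappa>2 l (map z (cyc \<pi> (Min D)))) z \<pi> P)"

definition disc_sum ::
    "('a list \<Rightarrow> complex) \<Rightarrow> ('a list \<Rightarrow> 'a list \<Rightarrow> complex) \<Rightarrow> (nat \<Rightarrow> 'a) \<Rightarrow> (nat \<Rightarrow> nat) \<Rightarrow>
     nat set \<Rightarrow> nat set \<Rightarrow> complex" where
  "disc_sum \<kappa> \<kappa>2 z \<tau> P Q = (\<Sum>\<pi>\<in>NCG (P \<union> Q) \<tau> 2. disc_term \<kappa> \<kappa>2 z \<pi> P Q)"

lemma two_cyclesD:
  assumes "two_cycles \<tau> P Q"
  shows "\<tau> permutes P \<union> Q" "finite P" "finite Q" "P \<inter> Q = {}" "cycle_partition \<tau> P = {P}"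
    "cycle_partition \<tau> Q = {Q}" "finite (P \<union> Q)" "permutation \<tau>" "P \<noteq> {}" "Q \<noteq> {}"
    "closed_under \<tau> P" "closed_under \<tau> Q" "a \<in> P \<Longrightarrow> orbit \<tau> a = P" "b \<in> Q \<Longrightarrow> orbit \<tau> b = Q"
    "num_cycles \<tau> (P \<union> Q) = 2" "two_cycles \<tau> Q P"
proof -
  show *: "\<tau> permutes P \<union> Q" "finite P" "finite Q" "P \<inter> Q = {}" "cycle_partition \<tau> P = {P}"
    "cycle_partition \<tau> Q = {Q}" using assms by (auto simp: two_cycles_def)
  show f: "finite (P \<union> Q)" using *(2,3) by simp
  show p: "permutation \<tau>" by (rule permutes_permutation[OF *(1) f])
  show ne: "P \<noteq> {}" "Q \<noteq> {}" using *(5,6) by (auto simp: cycle_partition_def)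
  show oP: "orbit \<tau> a = P" if "a \<in> P" for a using that *(5) by (auto simp: cycle_partition_def)
  show oQ: "orbit \<tau> b = Q" if "b \<in> Q" for b using that *(6) by (auto simp: cycle_partition_def)
  show "closed_under \<tau> P" "closed_under \<tau> Q"
    using oP oQ orbit.base[of \<tau>] unfolding closed_under_def by blast+
  have "P \<noteq> Q" using ne *(4) by blast
  then show "num_cycles \<tau> (P \<union> Q) = 2" unfolding num_cycles_def cycle_partition_Un *(5,6) by simp
  show "two_cycles \<tau> Q P" using * by (simp add: two_cycles_def Un_commute Int_commute)
qed

lemma closed_under_other:
  assumes "\<pi> permutes P \<union> Q" "finite (P \<union> Q)" "P \<inter> Q = {}" "closed_under \<pi> P"
  shows "closed_under \<pi> Q"
proof -
  have "Q = (P \<union> Q) - P" using assms(3) by blast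
  then show ?thesis
    using closed_under_Diff[OF permutes_permutation[OF assms(1,2)] closed_under_permutes[OF assms(1)] assms(4)]
    by simp
qed

text \<open>If \<pi> connected the two cycles of \<tau>, the bound of
  \<open>genus_bound_connected\<close> would leave at most \<open>m = 0\<close>.\<close>

lemma NCG_disc_closed:
  assumes "two_cycles \<tau> P Q" "\<pi> \<in> NCG (P \<union> Q) \<tau> 2"
  shows "\<pi> permutes P \<union> Q" "permutation \<pi>" "closed_under \<pi> P" "closed_under \<pi> Q"
proof -
  note t = two_cyclesD[OF assms(1)]
  show p: "\<pi> permutes P \<union> Q" using assms(2) by (rule NCG_permutes)
  show pp: "permutation \<pi>" by (rule permutes_permutation[OF p t(7)])
  show "closed_under \<pi> P"
  proof (rule ccontr)
    assume "\<not> ?thesis"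
    then obtain c where c: "c \<in> P" "\<pi> c \<notin> P" by (auto simp: closed_under_def)
    then have "\<pi> c \<notin> orbit \<tau> c" using t(13) by blast
    from genus_bound_connected[OF p t(1,7) _ orbit.base this] show False
      using c assms(2) t(15) by (simp add: NCG_def)
  qed
  then show "closed_under \<pi> Q" by (rule closed_under_other[OF p t(7,4)])
qed

subsection \<open>Comparison with the moment-cumulant relation\<close>

lemma atLeastAtMost_split: "{1..p} \<union> {p+1..p+q} = {1..p+q :: nat}" "{1..p} \<inter> {p+1..p+q} = {}"
  by auto

lemma two_cycles_tau2:
  assumes "p > 0" "q > 0"
  shows "two_cycles (tau2 p q) {1..p} {p+1..p+q}"
proof -
  have "cycle_partition (tau2 p q) {1..p} = {{1..p}}"
    using tau2_facts(6)[OF assms] assms(1) by (force simp: cycle_partition_def)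
  moreover have "cycle_partition (tau2 p q) {p+1..p+q} = {{p+1..p+q}}"
  proof -
    have "orbit (tau2 p q) ` {p+1..p+q} = (\<lambda>_. {p+1..p+q}) ` {p+1..p+q}"
      using tau2_facts(7)[OF assms] by (rule image_cong[OF refl])
    then show ?thesis using assms(2) by (simp add: cycle_partition_def image_constant_conv)
  qed
  ultimately show ?thesis
    using tau2_facts(1)[OF assms] unfolding two_cycles_def atLeastAtMost_split by simp
qed

lemma S_ann_nc_iff:
  "\<pi> \<in> S_ann_nc p q \<longleftrightarrow> \<pi> \<in> NCG {1..p+q} (tau2 p q) 0 \<and> \<not> closed_under \<pi> {1..p}"
proof -
  have "(\<exists>C\<in>cycle_partition \<pi> {1..p+q}. C \<inter> {1..p} \<noteq> {} \<and> C \<inter> {p+1..p+q} \<noteq> {}) \<longleftrightarrow> \<not> closed_under \<pi> {1..p}"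
    if p: "\<pi> permutes {1..p+q}"
  proof -
    note pp = permutes_permutation[OF p finite_atLeastAtMost]
    have "False" if "closed_under \<pi> {1..p}" "C \<in> cycle_partition \<pi> {1..p+q}" "C \<inter> {1..p} \<noteq> {}"
      "C \<inter> {p+1..p+q} \<noteq> {}" for C
    proof -
      obtain c where c: "c \<in> C" "c \<in> {1..p}" using \<open>C \<inter> {1..p} \<noteq> {}\<close> by blast
      have "orbit \<pi> c = C" by (rule cycle_partition_memD(4)[OF pp closed_under_permutes[OF p] that(2) c(1)])
      then have "C \<subseteq> {1..p}" using closed_under_orbit[OF that(1) c(2)] by simp
      then show False using that(4) by fastforce
    qed
    moreover have "\<exists>C\<in>cycle_partition \<pi> {1..p+q}. C \<inter> {1..p} \<noteq> {} \<and> C \<inter> {p+1..p+q} \<noteq> {}"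
      if nc: "\<not> closed_under \<pi> {1..p}"
    proof -
      obtain c where c: "c \<in> {1..p}" "\<pi> c \<notin> {1..p}" using nc by (auto simp: closed_under_def)
      have cS: "c \<in> {1..p+q}" using c(1) by auto
      then have "\<pi> c \<in> {1..p+q}" using permutes_in_image[OF p, of c] by blast
      then have "\<pi> c \<in> {p+1..p+q}" using c(2) by auto
      then have "orbit \<pi> c \<inter> {p+1..p+q} \<noteq> {}" using orbit.base[of \<pi> c] by blast
      moreover have "orbit \<pi> c \<inter> {1..p} \<noteq> {}" using c(1) permutation_self_in_orbit[OF pp, of c] by blast
      moreover have "orbit \<pi> c \<in> cycle_partition \<pi> {1..p+q}" unfolding cycle_partition_def using cS by (rule imageI)
      ultimately show ?thesis by blast
    qed
    ultimately show ?thesis by blast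
  qed
  then show ?thesis by (auto simp: S_ann_nc_def NCG_def)
qed

lemma sum_S_ann_nc:
  "(\<Sum>\<pi>\<in>S_ann_nc p q. cumulant_perm \<kappa> {1..p+q} \<pi> zs) =
    ann_sum \<kappa> (\<lambda>c. zs ! (c - 1)) (tau2 p q) {1..p} {p+1..p+q}"
proof -
  have "S_ann_nc p q = {\<pi> \<in> NCG {1..p+q} (tau2 p q) 0. \<not> closed_under \<pi> {1..p}}"
    by (rule set_eqI) (simp add: S_ann_nc_iff)
  then show ?thesis unfolding ann_sum_def atLeastAtMost_split
    by (simp add: sum.inter_filter[OF finite_NCG] cumulant_perm_cycle_prod if_not_P cong: if_cong)
      (auto intro: sum.cong)
qed

lemma partition_on_cycles:
  assumes "\<pi> permutes S" "finite S"
  shows "partition_on S (cycle_partition \<pi> S)"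
proof -
  note pp = permutes_permutation[OF assms]
  note C = cycle_partition_memD[OF pp closed_under_permutes[OF assms(1)]]
  have "\<Union> (cycle_partition \<pi> S) = S"
    using C(1) permutation_self_in_orbit[OF pp] by (auto simp: cycle_partition_def)
  moreover have "disjoint (cycle_partition \<pi> S)"
    using C(4) by (intro disjointI) (metis disjoint_iff)
  moreover have "{} \<notin> cycle_partition \<pi> S" using C(2) by blast
  ultimately show ?thesis by (simp add: partition_on_def)
qed

lemma S_disc_nc_NCG:
  assumes "p > 0" "q > 0"
  shows "S_disc_nc p q = NCG {1..p+q} (tau2 p q) 2"
proof -
  note t = two_cycles_tau2[OF assms]
  have "refines {1..p+q} (cycle_partition \<pi> {1..p+q}) (cycle_partition (tau2 p q) {1..p+q})"
    if "\<pi> \<in> NCG {1..p+q} (tau2 p q) 2" for \<pi>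
  proof -
    note \<pi> = NCG_disc_closed[OF t, unfolded atLeastAtMost_split, OF that]
    have "\<exists>X\<in>cycle_partition (tau2 p q) {1..p+q}. C \<subseteq> X" if C: "C \<in> cycle_partition \<pi> {1..p+q}" for C
    proof -
      obtain c where c: "c \<in> {1..p+q}" "C = orbit \<pi> c" using C by (auto simp: cycle_partition_def)
      have "c \<in> {1..p} \<or> c \<in> {p+1..p+q}" using c(1) by auto
      then have "C \<subseteq> {1..p} \<or> C \<subseteq> {p+1..p+q}"
        using closed_under_orbit[OF \<pi>(3)] closed_under_orbit[OF \<pi>(4)] unfolding c(2) by blast
      then show ?thesis unfolding tau2_facts(2)[OF assms] by blast
    qed
    then show ?thesis
      using partition_on_cycles[OF \<pi>(1)] partition_on_cycles[OF tau2_facts(1)[OF assms]]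
      by (simp add: refines_def)
  qed
  then show ?thesis by (auto simp: S_disc_nc_def NCG_def)
qed

lemma Un_not_cycle:
  assumes "permutation \<pi>" "closed_under \<pi> S" "C \<in> cycle_partition \<pi> S" "D \<in> cycle_partition \<pi> S"
    "C \<inter> D = {}"
  shows "C \<union> D \<notin> cycle_partition \<pi> S"
proof
  assume a: "C \<union> D \<in> cycle_partition \<pi> S"
  note CC = cycle_partition_memD[OF assms(1,2)]
  obtain x y where xy: "x \<in> C" "y \<in> D" using CC(2) assms(3,4) by blast
  have "orbit \<pi> x = C \<union> D" "orbit \<pi> y = C \<union> D" using xy by (auto intro!: CC(4)[OF a])
  then have "C = D" using CC(4)[OF assms(3) xy(1)] CC(4)[OF assms(4) xy(2)] by simp
  then show False using assms(5) xy by blast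
qed

text \<open>A partitioned permutation of this kind is a disc permutation with one chosen cycle on
  each circle: their union is the nontrivial block, and all other blocks are cycles.
  \<open>mk\<close> and \<open>un\<close> are the two directions of this correspondence.\<close>

lemma sum_PS':
  assumes "xs \<noteq> []" "ys \<noteq> []"
  defines "p \<equiv> length xs" and "q \<equiv> length ys"
  shows "(\<Sum>V\<in>PS' p q. cumulant_PS \<kappa> \<kappa>2 V xs ys) =
    disc_sum \<kappa> \<kappa>2 (\<lambda>c. (xs @ ys) ! (c - 1)) (tau2 p q) {1..p} {p+1..p+q}"
proof -
  let ?P = "{1..p}" and ?Q = "{p+1..p+q}" and ?z = "\<lambda>c. (xs @ ys) ! (c - 1)" and ?S = "{1..p+q}"
  have pq: "p > 0" "q > 0" using assms by auto
  note t = two_cycles_tau2[OF pq]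
  let ?X = "NCG ?S (tau2 p q) 2"
  note cl = NCG_disc_closed[OF t, unfolded atLeastAtMost_split]
  let ?f = "\<lambda>\<pi> C D. \<kappa>2 (map ?z (cyc \<pi> (Min C))) (map ?z (cyc \<pi> (Min D))) *
    (cycle_prod \<kappa> ?z \<pi> (?P - C) * cycle_prod \<kappa> ?z \<pi> (?Q - D))"
  let ?I = "Sigma ?X (\<lambda>\<pi>. cycle_partition \<pi> ?Q \<times> cycle_partition \<pi> ?P)"
  have CD: "C \<subseteq> ?P" "D \<subseteq> ?Q" "C \<noteq> {}" "D \<noteq> {}" "C \<in> cycle_partition \<pi> ?S" "D \<in> cycle_partition \<pi> ?S"
      "closed_under \<pi> C" "closed_under \<pi> D" "C \<inter> D = {}"
    if "\<pi> \<in> ?X" "C \<in> cycle_partition \<pi> ?P" "D \<in> cycle_partition \<pi> ?Q" for \<pi> C D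
  proof -
    note c = cl[OF that(1)]
    note C = cycle_partition_memD[OF c(2,3) that(2)] and D = cycle_partition_memD[OF c(2,4) that(3)]
    show sub: "C \<subseteq> ?P" "D \<subseteq> ?Q" "C \<noteq> {}" "D \<noteq> {}" "closed_under \<pi> C" "closed_under \<pi> D" using C(1-3) D(1-3) by blast+
    show "C \<in> cycle_partition \<pi> ?S" "D \<in> cycle_partition \<pi> ?S"
      unfolding atLeastAtMost_split(1)[symmetric] cycle_partition_Un using that by blast+
    show "C \<inter> D = {}" using sub atLeastAtMost_split(2)[of p q] by blast
  qed
  define mk where "mk = (\<lambda>(\<pi>, D, C). (insert (C \<union> D) (cycle_partition \<pi> ?S - {C, D}), \<pi>))"
  define un where "un = (\<lambda>(\<U>, \<pi>). (\<pi>, nontrivial_block \<U> \<pi> \<inter> ?Q, nontrivial_block \<U> \<pi> \<inter> ?P))"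
  have PS: "(\<U>, \<pi>) = mk (\<pi>, D, C)" "un (\<U>, \<pi>) = (\<pi>, D, C)" "\<pi> \<in> ?X" "C \<in> cycle_partition \<pi> ?P"
      "D \<in> cycle_partition \<pi> ?Q"
    if V: "(\<U>, \<pi>) \<in> PS' p q" and cd: "C \<in> cycle_partition \<pi> ?S" "D \<in> cycle_partition \<pi> ?S" "C \<subseteq> ?P"
      "D \<subseteq> ?Q" "nontrivial_block \<U> \<pi> = C \<union> D" "C \<union> D \<in> \<U>" for \<U> \<pi> C D
  proof -
    show X: "\<pi> \<in> ?X" using V S_disc_nc_NCG[OF pq] by (auto simp: PS'_def)
    note c = cl[OF X]
    note CC = cycle_partition_memD[OF c(2) closed_under_permutes[OF c(1)]]
    have inP: "C \<in> cycle_partition \<pi> ?P"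
    proof -
      obtain x where x: "x \<in> C" using CC(2)[OF cd(1)] by blast
      then have "C = orbit \<pi> x" "x \<in> ?P" using CC(4)[OF cd(1)] cd(3) by auto
      then show ?thesis by (simp add: cycle_partition_def)
    qed
    have inQ: "D \<in> cycle_partition \<pi> ?Q"
    proof -
      obtain x where x: "x \<in> D" using CC(2)[OF cd(2)] by blast
      then have "D = orbit \<pi> x" "x \<in> ?Q" using CC(4)[OF cd(2)] cd(4) by auto
      then show ?thesis unfolding cycle_partition_def by blast
    qed
    show "C \<in> cycle_partition \<pi> ?P" "D \<in> cycle_partition \<pi> ?Q" by (rule inP, rule inQ)
    show "un (\<U>, \<pi>) = (\<pi>, D, C)"
      using cd(3,4) atLeastAtMost_split(2)[of p q] unfolding un_def split cd(5) by blast
    have ref: "partition_on ?S \<U>" "partition_on ?S (cycle_partition \<pi> ?S)"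
      "\<And>X. X \<in> cycle_partition \<pi> ?S \<Longrightarrow> \<exists>Y\<in>\<U>. X \<subseteq> Y"
      using V by (auto simp: PS'_def refines_def)
    have sub: "\<U> - {C \<union> D} \<subseteq> cycle_partition \<pi> ?S"
    proof
      fix U assume U: "U \<in> \<U> - {C \<union> D}"
      obtain U0 where U0: "U0 \<in> \<U>" "\<U> - {U0} \<subseteq> cycle_partition \<pi> ?S"
        and "\<exists>C\<in>cycle_partition \<pi> ?S. \<exists>D\<in>cycle_partition \<pi> ?S. C \<subseteq> ?P \<and> D \<subseteq> ?Q \<and> U0 = C \<union> D"
        using V by (auto simp: PS'_def)
      have "C \<union> D \<notin> cycle_partition \<pi> ?S"
        by (rule Un_not_cycle[OF c(2) closed_under_permutes[OF c(1)] cd(1,2)])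
          (use cd(3,4) atLeastAtMost_split(2)[of p q] in blast)
      then have "C \<union> D = U0" using U0(2) cd(6) by blast
      then show "U \<in> cycle_partition \<pi> ?S" using U U0(2) by blast
    qed
    have disj: "X = Y" if "X \<in> \<U>" "Y \<in> \<U>" "x \<in> X" "x \<in> Y" for X Y x
      using ref(1) that by (auto simp: partition_on_def disjoint_def)
    have "\<U> = insert (C \<union> D) (cycle_partition \<pi> ?S - {C, D})"
    proof (intro equalityI subsetI)
      fix U assume U: "U \<in> \<U>"
      show "U \<in> insert (C \<union> D) (cycle_partition \<pi> ?S - {C, D})"
      proof (cases "U = C \<union> D")
        case False
        then have "U \<in> cycle_partition \<pi> ?S" using sub U by blast
        moreover have "U \<noteq> C" "U \<noteq> D"
          using disj[OF U cd(6)] False CC(2)[OF cd(1)] CC(2)[OF cd(2)] by blast+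
        ultimately show ?thesis by blast
      qed simp
    next
      fix U assume "U \<in> insert (C \<union> D) (cycle_partition \<pi> ?S - {C, D})"
      then consider "U = C \<union> D" | "U \<in> cycle_partition \<pi> ?S" "U \<noteq> C" "U \<noteq> D" by blast
      then show "U \<in> \<U>"
      proof cases
        case 2
        then obtain Y where Y: "Y \<in> \<U>" "U \<subseteq> Y" using ref(3) by blast
        obtain x where x: "x \<in> U" using CC(2)[OF 2(1)] by blast
        have "x \<notin> C \<union> D" using CC(4)[OF 2(1) x] CC(4)[OF cd(1), of x] CC(4)[OF cd(2), of x] 2(2,3) by auto
        then have "Y \<in> cycle_partition \<pi> ?S" using sub Y x by blast
        then have "Y = U" using CC(4)[OF 2(1) x] CC(4)[of Y x] x Y(2) by auto
        then show ?thesis using Y(1) by simp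
      qed (use cd(6) in simp)
    qed
    then show "(\<U>, \<pi>) = mk (\<pi>, D, C)" by (simp add: mk_def)
  qed
  have mkPS: "mk (\<pi>, D, C) \<in> PS' p q" "un (mk (\<pi>, D, C)) = (\<pi>, D, C)"
    if X: "\<pi> \<in> ?X" and C: "C \<in> cycle_partition \<pi> ?P" and D: "D \<in> cycle_partition \<pi> ?Q" for \<pi> C D
  proof -
    note c = cl[OF X] and cd = CD[OF X C D]
    note CC = cycle_partition_memD[OF c(2) closed_under_permutes[OF c(1)]]
    let ?U = "insert (C \<union> D) (cycle_partition \<pi> ?S - {C, D})"
    have po: "partition_on ?S (cycle_partition \<pi> ?S)" by (rule partition_on_cycles[OF c(1)]) simp
    have dj: "X \<inter> Y = {}" if "X \<in> cycle_partition \<pi> ?S" "Y \<in> cycle_partition \<pi> ?S" "X \<noteq> Y" for X Y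
      using po that by (auto simp: partition_on_def disjoint_def)
    have "partition_on ?S ?U"
    proof (rule partition_onI)
      show "\<Union> ?U = ?S" using po cd(5,6) unfolding partition_on_def by blast
      fix X Y assume XY: "X \<in> ?U" "Y \<in> ?U" "X \<noteq> Y"
      then consider "X = C \<union> D" "Y \<in> cycle_partition \<pi> ?S - {C, D}" | "Y = C \<union> D" "X \<in> cycle_partition \<pi> ?S - {C, D}"
        | "X \<in> cycle_partition \<pi> ?S" "Y \<in> cycle_partition \<pi> ?S" by blast
      then have "X \<inter> Y = {}"
      proof cases
        case 1
        then have "C \<inter> Y = {}" "D \<inter> Y = {}" using dj[OF cd(5)] dj[OF cd(6)] by blast+
        then show ?thesis using 1 by blast
      next
        case 2
        then have "C \<inter> X = {}" "D \<inter> X = {}" using dj[OF cd(5)] dj[OF cd(6)] by blast+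
        then show ?thesis using 2 by blast
      qed (use dj XY(3) in blast)
      then show "disjnt X Y" by (simp add: disjnt_def)
    next
      show "{} \<notin> ?U" using cd(3) CC(2) by blast
    qed
    moreover have "\<exists>Y\<in>?U. X \<subseteq> Y" if "X \<in> cycle_partition \<pi> ?S" for X
      using that by (cases "X = C \<or> X = D") blast+
    ultimately have "refines ?S (cycle_partition \<pi> ?S) ?U" using po by (simp add: refines_def)
    moreover have "?U - {C \<union> D} \<subseteq> cycle_partition \<pi> ?S" by blast
    moreover have "\<pi> \<in> S_disc_nc p q" using X S_disc_nc_NCG[OF pq] by simp
    ultimately show in_PS: "mk (\<pi>, D, C) \<in> PS' p q"
      using cd(1,2,5,6) unfolding mk_def PS'_def split mem_Collect_eq by blast
    have "nontrivial_block ?U \<pi> = C \<union> D"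
    proof -
      obtain C' D' where CD': "C' \<in> cycle_partition \<pi> ?S" "D' \<in> cycle_partition \<pi> ?S" "C' \<subseteq> ?P" "D' \<subseteq> ?Q"
        "nontrivial_block ?U \<pi> = C' \<union> D'" "C' \<union> D' \<in> ?U"
        using in_PS unfolding mk_def split by (rule PS'_cases)
      have "C' \<union> D' \<notin> cycle_partition \<pi> ?S"
        by (rule Un_not_cycle[OF c(2) closed_under_permutes[OF c(1)] CD'(1,2)])
          (use CD'(3,4) atLeastAtMost_split(2)[of p q] in blast)
      then show ?thesis using CD'(5,6) by blast
    qed
    then show "un (mk (\<pi>, D, C)) = (\<pi>, D, C)"
      using cd(1,2) atLeastAtMost_split(2)[of p q] unfolding mk_def un_def split by blast
  qed
  have "(\<Sum>V\<in>PS' p q. cumulant_PS \<kappa> \<kappa>2 V xs ys) = (\<Sum>(\<pi>, D, C)\<in>?I. ?f \<pi> C D)"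
  proof (rule sum.reindex_bij_witness[where i = mk and j = un])
    fix V assume V: "V \<in> PS' p q"
    obtain \<U> \<pi> where Veq: "V = (\<U>, \<pi>)" by (cases V)
    obtain C D where cd: "C \<in> cycle_partition \<pi> ?S" "D \<in> cycle_partition \<pi> ?S" "C \<subseteq> ?P" "D \<subseteq> ?Q"
        "nontrivial_block \<U> \<pi> = C \<union> D" "C \<union> D \<in> \<U>"
      using V unfolding Veq by (rule PS'_cases)
    note ps = PS[OF V[unfolded Veq] cd]
    note c = cl[OF ps(3)] and k = CD[OF ps(3-5)]
    show "mk (un V) = V" unfolding Veq using ps(1,2) by simp
    show "un V \<in> ?I" unfolding Veq ps(2) using ps(3-5) by simp
    have U: "(C \<union> D) \<inter> ?P = C" "(C \<union> D) \<inter> ?Q = D" using cd(3,4) atLeastAtMost_split(2)[of p q] by blast+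
    have "?S - (C \<union> D) = (?P - C) \<union> (?Q - D)"
      using cd(3,4) atLeastAtMost_split[of p q] by blast
    moreover have "cycle_prod \<kappa> ?z \<pi> ((?P - C) \<union> (?Q - D)) =
        cycle_prod \<kappa> ?z \<pi> (?P - C) * cycle_prod \<kappa> ?z \<pi> (?Q - D)"
      using atLeastAtMost_split(2)[of p q]
      by (intro cycle_prod_Un c(2) closed_under_Diff c(3,4) k(7,8)) auto
    ultimately have "cumulant_PS \<kappa> \<kappa>2 V xs ys = ?f \<pi> C D"
      unfolding Veq cumulant_PS_def split Let_def p_def[symmetric] q_def[symmetric] cd(5) U
        cumulant_perm_cycle_prod cycle_args_def cyc_def by simp
    then show "(case un V of (\<pi>, D, C) \<Rightarrow> ?f \<pi> C D) = cumulant_PS \<kappa> \<kappa>2 V xs ys"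
      unfolding Veq ps(2) by simp
  next
    fix x assume "x \<in> ?I"
    then obtain \<pi> D C where x: "x = (\<pi>, D, C)" "\<pi> \<in> ?X" "C \<in> cycle_partition \<pi> ?P" "D \<in> cycle_partition \<pi> ?Q"
      by auto
    show "un (mk x) = x" "mk x \<in> PS' p q" using mkPS[OF x(2-4)] x(1) by simp_all
  qed
  also have "\<dots> = (\<Sum>\<pi>\<in>?X. \<Sum>(D, C)\<in>cycle_partition \<pi> ?Q \<times> cycle_partition \<pi> ?P. ?f \<pi> C D)"
    by (rule sum.Sigma[symmetric]) (simp_all add: finite_NCG finite_cycle_partition)
  also have "\<dots> = (\<Sum>\<pi>\<in>?X. \<Sum>D\<in>cycle_partition \<pi> ?Q. \<Sum>C\<in>cycle_partition \<pi> ?P. ?f \<pi> C D)"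
    by (simp only: sum.cartesian_product)
  also have "\<dots> = disc_sum \<kappa> \<kappa>2 ?z (tau2 p q) ?P ?Q"
    unfolding disc_sum_def disc_term_def cycle_deriv_def atLeastAtMost_split
    by (simp only: sum_distrib_left mult_ac)
  finally show ?thesis .
qed

section \<open>Separating the top term of the disc sum\<close>

lemma length_cyc_Min:
  assumes "permutation \<pi>" "closed_under \<pi> S" "C \<in> cycle_partition \<pi> S"
  shows "length (cyc \<pi> (Min C)) = card C"
  using length_cyc[OF assms(1), of "Min C"]
    cycle_partition_memD(4)[OF assms Min_cycle_mem(1)[OF assms]] by simp

definition trunc2 :: "nat \<Rightarrow> ('a list \<Rightarrow> 'a list \<Rightarrow> complex) \<Rightarrow> 'a list \<Rightarrow> 'a list \<Rightarrow> complex" where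
  "trunc2 n \<kappa>2 xs ys = (if length xs + length ys < n then \<kappa>2 xs ys else 0)"

lemma NCG_disc_cards:
  assumes "two_cycles \<tau> P Q" "\<pi> \<in> NCG (P \<union> Q) \<tau> 2" "\<pi> \<noteq> \<tau>" "C \<in> cycle_partition \<pi> P" "D \<in> cycle_partition \<pi> Q"
  shows "card C + card D < card P + card Q"
proof (rule ccontr)
  note t = two_cyclesD[OF assms(1)] and p = NCG_disc_closed[OF assms(1,2)]
  note C = cycle_partition_memD[OF p(2,3) assms(4)] and D = cycle_partition_memD[OF p(2,4) assms(5)]
  assume "\<not> ?thesis"
  moreover have "card C \<le> card P" "card D \<le> card Q" using C(1) D(1) t(2,3) by (simp_all add: card_mono)
  ultimately have "card P \<le> card C" "card Q \<le> card D" by linarith+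
  then have "cycle_partition \<pi> P = {P}" "cycle_partition \<pi> Q = {Q}"
    using single_cycle_card(2)[OF p(2,3) t(2) assms(4)] single_cycle_card(2)[OF p(2,4) t(3) assms(5)] by blast+
  moreover have "P \<noteq> Q" using t(4,9) by blast
  ultimately have "num_cycles \<pi> (P \<union> Q) = 2" by (simp add: num_cycles_def cycle_partition_Un)
  then show False using NCG_top[OF assms(2) t(1,7)] assms(3) by blast
qed

lemma disc_term_top:
  assumes "two_cycles \<tau> P Q"
  shows "disc_term \<kappa> \<kappa>2 z \<tau> P Q = \<kappa>2 (map z (cyc \<tau> (Min P))) (map z (cyc \<tau> (Min Q)))"
  using two_cyclesD(5,6)[OF assms] by (simp add: disc_term_def cycle_deriv_def)

lemma disc_sum_top:
  assumes "two_cycles \<tau> P Q"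
  shows "disc_sum \<kappa> \<kappa>2 z \<tau> P Q = \<kappa>2 (map z (cyc \<tau> (Min P))) (map z (cyc \<tau> (Min Q))) +
    disc_sum \<kappa> (trunc2 (card P + card Q) \<kappa>2) z \<tau> P Q"
proof -
  let ?k = "trunc2 (card P + card Q) \<kappa>2"
  note t = two_cyclesD[OF assms]
  have tN: "\<tau> \<in> NCG (P \<union> Q) \<tau> 2" by (rule NCG_self[OF t(1,15)])
  have "disc_term \<kappa> \<kappa>2 z \<pi> P Q = disc_term \<kappa> ?k z \<pi> P Q" if pi: "\<pi> \<in> NCG (P \<union> Q) \<tau> 2 - {\<tau>}" for \<pi>
    unfolding disc_term_def
  proof (rule sum.cong[OF refl])
    have pN: "\<pi> \<in> NCG (P \<union> Q) \<tau> 2" "\<pi> \<noteq> \<tau>" using pi by auto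
    note p = NCG_disc_closed[OF assms pN(1)]
    fix D assume D: "D \<in> cycle_partition \<pi> Q"
    have "cycle_deriv \<kappa> (\<lambda>l. \<kappa>2 l (map z (cyc \<pi> (Min D)))) z \<pi> P =
        cycle_deriv \<kappa> (\<lambda>l. ?k l (map z (cyc \<pi> (Min D)))) z \<pi> P"
      unfolding cycle_deriv_def
    proof (rule sum.cong[OF refl])
      fix C assume C: "C \<in> cycle_partition \<pi> P"
      show "\<kappa>2 (map z (cyc \<pi> (Min C))) (map z (cyc \<pi> (Min D))) * cycle_prod \<kappa> z \<pi> (P - C) =
          ?k (map z (cyc \<pi> (Min C))) (map z (cyc \<pi> (Min D))) * cycle_prod \<kappa> z \<pi> (P - C)"
        using NCG_disc_cards[OF assms pN C D]
        by (simp add: trunc2_def length_cyc_Min[OF p(2,3) C] length_cyc_Min[OF p(2,4) D])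
    qed
    then show "cycle_prod \<kappa> z \<pi> (Q - D) * cycle_deriv \<kappa> (\<lambda>l. \<kappa>2 l (map z (cyc \<pi> (Min D)))) z \<pi> P =
        cycle_prod \<kappa> z \<pi> (Q - D) * cycle_deriv \<kappa> (\<lambda>l. ?k l (map z (cyc \<pi> (Min D)))) z \<pi> P" by simp
  qed
  then have "(\<Sum>\<pi>\<in>NCG (P \<union> Q) \<tau> 2 - {\<tau>}. disc_term \<kappa> \<kappa>2 z \<pi> P Q) =
      (\<Sum>\<pi>\<in>NCG (P \<union> Q) \<tau> 2 - {\<tau>}. disc_term \<kappa> ?k z \<pi> P Q)" by (rule sum.cong[OF refl])
  moreover have "disc_term \<kappa> ?k z \<tau> P Q = 0"
  proof -
    have "length (cyc \<tau> (Min P)) = card P" "length (cyc \<tau> (Min Q)) = card Q"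
      using length_cyc_Min[OF t(8,11), of P] length_cyc_Min[OF t(8,12), of Q] t(5,6) by simp_all
    then show ?thesis unfolding disc_term_top[OF assms] by (simp add: trunc2_def)
  qed
  ultimately show ?thesis
    unfolding disc_sum_def sum.remove[OF finite_NCG[OF t(7)] tN] disc_term_top[OF assms, of \<kappa> \<kappa>2] by simp
qed

section \<open>Independence of the labels and of the starting points\<close>

definition rotation_invariant2 :: "('a list \<Rightarrow> 'a list \<Rightarrow> complex) \<Rightarrow> bool" where
  "rotation_invariant2 \<kappa>2 \<longleftrightarrow>
     (\<forall>xs ys. \<kappa>2 (rotate1 xs) ys = \<kappa>2 xs ys \<and> \<kappa>2 xs (rotate1 ys) = \<kappa>2 xs ys)"

lemma rotation_invariant2D:
  assumes "rotation_invariant2 \<kappa>2"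
  shows "rotation_invariant (\<lambda>l. \<kappa>2 l ys)" "rotation_invariant (\<kappa>2 xs)"
  using assms by (simp_all add: rotation_invariant2_def rotation_invariant_def)

lemma closed_under_conj:
  fixes g :: "'b \<Rightarrow> 'b"
  assumes "bij g"
  shows "closed_under (g \<circ> \<pi> \<circ> inv g) (g ` P) \<longleftrightarrow> closed_under \<pi> P"
  using assms by (simp add: closed_under_def bij_is_inj inj_image_mem_iff)

lemma ann_sum_conj:
  fixes g :: "nat \<Rightarrow> nat"
  assumes "rotation_invariant \<kappa>" "bij g" "\<tau> permutes P \<union> Q" "finite (P \<union> Q)"
  shows "ann_sum \<kappa> z (g \<circ> \<tau> \<circ> inv g) (g ` P) (g ` Q) = ann_sum \<kappa> (z \<circ> g) \<tau> P Q"
  unfolding ann_sum_def image_Un[symmetric] sum_NCG_conj[OF assms(2,4,3)]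
proof (rule sum.cong[OF refl])
  fix \<pi> assume "\<pi> \<in> NCG (P \<union> Q) \<tau> 0"
  then have "permutation \<pi>" by (intro permutes_permutation[OF NCG_permutes assms(4)])
  then show "(if closed_under (g \<circ> \<pi> \<circ> inv g) (g ` P) then 0 else cycle_prod \<kappa> z (g \<circ> \<pi> \<circ> inv g) (g ` (P \<union> Q))) =
      (if closed_under \<pi> P then 0 else cycle_prod \<kappa> (z \<circ> g) \<pi> (P \<union> Q))"
    unfolding closed_under_conj[OF assms(2)] using cycle_prod_conj[OF assms(1) _ assms(2)] by simp
qed

lemma disc_sum_conj:
  fixes g :: "nat \<Rightarrow> nat"
  assumes "rotation_invariant \<kappa>" "rotation_invariant2 \<kappa>2" "bij g" "\<tau> permutes P \<union> Q" "finite (P \<union> Q)"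
  shows "disc_sum \<kappa> \<kappa>2 z (g \<circ> \<tau> \<circ> inv g) (g ` P) (g ` Q) = disc_sum \<kappa> \<kappa>2 (z \<circ> g) \<tau> P Q"
  unfolding disc_sum_def image_Un[symmetric] sum_NCG_conj[OF assms(3,5,4)]
proof (rule sum.cong[OF refl])
  fix \<pi> assume "\<pi> \<in> NCG (P \<union> Q) \<tau> 2"
  then have p: "permutation \<pi>" by (intro permutes_permutation[OF NCG_permutes assms(5)])
  let ?\<pi> = "g \<circ> \<pi> \<circ> inv g"
  show "disc_term \<kappa> \<kappa>2 z ?\<pi> (g ` P) (g ` Q) = disc_term \<kappa> \<kappa>2 (z \<circ> g) \<pi> P Q"
    unfolding disc_term_def cycle_partition_conj[OF p assms(3)] sum.reindex[OF inj_image_set[OF assms(3)]]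
  proof (intro sum.cong refl, unfold o_def[of _ "(`) g"])
    fix D assume D: "D \<in> cycle_partition \<pi> Q"
    have "g ` Q - g ` D = g ` (Q - D)" using assms(3) by (simp add: bij_is_inj image_set_diff)
    moreover have "\<kappa>2 l (map z (cyc ?\<pi> (Min (g ` D)))) = \<kappa>2 l (map (z \<circ> g) (cyc \<pi> (Min D)))" for l
      by (rule rotation_invariant_conj[OF rotation_invariant2D(2)[OF assms(2)] p assms(3) D])
    ultimately show "cycle_prod \<kappa> z ?\<pi> (g ` Q - g ` D) *
        cycle_deriv \<kappa> (\<lambda>l. \<kappa>2 l (map z (cyc ?\<pi> (Min (g ` D))))) z ?\<pi> (g ` P) =
        cycle_prod \<kappa> (z \<circ> g) \<pi> (Q - D) * cycle_deriv \<kappa> (\<lambda>l. \<kappa>2 l (map (z \<circ> g) (cyc \<pi> (Min D)))) (z \<circ> g) \<pi> P"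
      using cycle_prod_conj[OF assms(1) p assms(3)]
        cycle_deriv_conj[OF assms(1) rotation_invariant2D(1)[OF assms(2)] p assms(3)] by simp
  qed
qed

lemma ann_sum_cong:
  assumes "finite (P \<union> Q)" "\<And>c. c \<in> P \<union> Q \<Longrightarrow> z' c = z c"
  shows "ann_sum \<kappa> z' \<tau> P Q = ann_sum \<kappa> z \<tau> P Q"
  unfolding ann_sum_def
proof (rule sum.cong[OF refl])
  fix \<pi> assume "\<pi> \<in> NCG (P \<union> Q) \<tau> 0"
  then have p: "\<pi> permutes P \<union> Q" by (rule NCG_permutes)
  show "(if closed_under \<pi> P then 0 else cycle_prod \<kappa> z' \<pi> (P \<union> Q)) =
      (if closed_under \<pi> P then 0 else cycle_prod \<kappa> z \<pi> (P \<union> Q))"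
    using cycle_prod_cong[OF permutes_permutation[OF p assms(1)] closed_under_permutes[OF p] refl assms(2)]
    by simp
qed

lemma map_cyc_Min_cong:
  assumes "permutation \<pi>" "closed_under \<pi> S" "C \<in> cycle_partition \<pi> S" "\<And>c. c \<in> S \<Longrightarrow> z' c = z c"
  shows "map z' (cyc \<pi> (Min C)) = map z (cyc \<pi> (Min C))"
  using set_cyc_closed[OF assms(1,2) Min_cycle_mem(2)[OF assms(1-3)]] assms(4) by (intro map_cong) auto

lemma disc_sum_cong:
  assumes "two_cycles \<tau> P Q" "\<And>c. c \<in> P \<union> Q \<Longrightarrow> z' c = z c"
  shows "disc_sum \<kappa> \<kappa>2 z' \<tau> P Q = disc_sum \<kappa> \<kappa>2 z \<tau> P Q"
  unfolding disc_sum_def disc_term_def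
proof (intro sum.cong[OF refl])
  fix \<pi> D assume \<pi>: "\<pi> \<in> NCG (P \<union> Q) \<tau> 2" and D: "D \<in> cycle_partition \<pi> Q"
  note p = NCG_disc_closed[OF assms(1) \<pi>]
  have "cycle_prod \<kappa> z' \<pi> (Q - D) = cycle_prod \<kappa> z \<pi> (Q - D)"
    using closed_under_Diff[OF p(2,4) cycle_partition_memD(3)[OF p(2,4) D]] assms(2)
    by (intro cycle_prod_cong[OF p(2)]) auto
  moreover have "map z' (cyc \<pi> (Min D)) = map z (cyc \<pi> (Min D))"
    by (rule map_cyc_Min_cong[OF p(2,4) D]) (use assms(2) in auto)
  moreover have "cycle_deriv \<kappa> h z' \<pi> P = cycle_deriv \<kappa> h z \<pi> P" for h
    by (rule cycle_deriv_cong[OF p(2,3)]) (use assms(2) in auto)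
  ultimately show "cycle_prod \<kappa> z' \<pi> (Q - D) * cycle_deriv \<kappa> (\<lambda>l. \<kappa>2 l (map z' (cyc \<pi> (Min D)))) z' \<pi> P =
      cycle_prod \<kappa> z \<pi> (Q - D) * cycle_deriv \<kappa> (\<lambda>l. \<kappa>2 l (map z (cyc \<pi> (Min D)))) z \<pi> P" by (simp only:)
qed

text \<open>The cycles are matched position by position from the chosen starting points. As these
  are arbitrary, the result covers rotations of a circle as well as new labels.\<close>

lemma two_cycles_relabel:
  assumes "two_cycles \<tau> P Q" "two_cycles \<sigma> P' Q'" "a \<in> P" "b \<in> Q" "a' \<in> P'" "b' \<in> Q'"
    "length (cyc \<tau> a) = length (cyc \<sigma> a')" "length (cyc \<tau> b) = length (cyc \<sigma> b')"
  obtains g where "bij g" "g ` P' = P" "g ` Q' = Q" "map g (cyc \<sigma> a') = cyc \<tau> a" "map g (cyc \<sigma> b') = cyc \<tau> b"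
    "g \<circ> \<sigma> \<circ> inv g = \<tau>"
proof -
  note t = two_cyclesD[OF assms(1)] and s = two_cyclesD[OF assms(2)]
  let ?L = "cyc \<sigma> a' @ cyc \<sigma> b'" and ?M = "cyc \<tau> a @ cyc \<tau> b"
  have sets: "set (cyc \<tau> a) = P" "set (cyc \<tau> b) = Q" "set (cyc \<sigma> a') = P'" "set (cyc \<sigma> b') = Q'"
    using set_cyc[OF t(8)] set_cyc[OF s(8)] t(13)[OF assms(3)] t(14)[OF assms(4)] s(13)[OF assms(5)] s(14)[OF assms(6)]
    by simp_all
  have d: "distinct ?L" "distinct ?M" using sets t(4) s(4) distinct_cyc[OF t(8)] distinct_cyc[OF s(8)] by simp_all
  have len: "length ?L = length ?M" using assms(7,8) by simp
  define f where "f = (\<lambda>c. the (map_of (zip ?L ?M) c))"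
  have f: "map f ?L = ?M"
  proof (rule nth_equalityI)
    fix j assume j: "j < length (map f ?L)"
    have "map_of (zip ?L ?M) (?L ! j) = Some (?M ! j)" using j len by (intro map_of_zip_nth[OF len d(1)]) simp
    then show "map f ?L ! j = ?M ! j" using j unfolding f_def by (simp only: nth_map length_map option.sel)
  qed (use len in simp)
  have "bij_betw f (set ?L) (set ?M)"
  proof (rule bij_betw_imageI)
    show "inj_on f (set ?L)" using d(2) unfolding f[symmetric] by (simp only: distinct_map)
    show "f ` set ?L = set ?M" unfolding f[symmetric] by (simp only: set_map)
  qed
  then obtain g where g: "bij g" "\<And>c. c \<in> set ?L \<Longrightarrow> g c = f c"
    using finite_bij_extend[OF finite_set] by blast
  have "map g ?L = ?M" using f g(2) map_cong[OF refl, of ?L g f] by simp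
  then have m: "map g (cyc \<sigma> a') = cyc \<tau> a" "map g (cyc \<sigma> b') = cyc \<tau> b" using assms(7) by simp_all
  have im: "g ` P' = P" "g ` Q' = Q" using arg_cong[OF m(1), of set] arg_cong[OF m(2), of set] unfolding sets by (simp_all add: sets)
  have *: "g (\<sigma> c) = \<tau> (g c)" if "map g (cyc \<sigma> x) = cyc \<tau> y" "c \<in> set (cyc \<sigma> x)" for x y c
  proof -
    have "map (\<lambda>c. g (\<sigma> c)) (cyc \<sigma> x) = map g (map \<sigma> (cyc \<sigma> x))" by simp
    also have "\<dots> = rotate1 (map g (cyc \<sigma> x))" unfolding map_cyc[OF s(8)] by (simp add: rotate1_map)
    also have "\<dots> = map \<tau> (map g (cyc \<sigma> x))" unfolding that(1) map_cyc[OF t(8)] ..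
    also have "\<dots> = map (\<lambda>c. \<tau> (g c)) (cyc \<sigma> x)" by simp
    finally show ?thesis using that(2) by simp
  qed
  have "g \<circ> \<sigma> \<circ> inv g = \<tau>"
  proof (rule conj_eqI[OF g(1) s(1)])
    show "\<tau> permutes g ` (P' \<union> Q')" unfolding image_Un im by (rule t(1))
    show "g (\<sigma> c) = \<tau> (g c)" if "c \<in> P' \<union> Q'" for c
      using that *[OF m(1)] *[OF m(2)] unfolding sets by blast
  qed
  with g(1) im m show thesis by (rule that)
qed

text \<open>The sums depend only on the two lists of arguments read along the circles, because equal
  lists provide a relabelling that carries one configuration to the other.\<close>

lemma ann_sum_lists:
  assumes "rotation_invariant \<kappa>" "two_cycles \<tau> P Q" "two_cycles \<sigma> P' Q'" "a \<in> P" "b \<in> Q" "a' \<in> P'" "b' \<in> Q'"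
    "map z (cyc \<tau> a) = map z' (cyc \<sigma> a')" "map z (cyc \<tau> b) = map z' (cyc \<sigma> b')"
  shows "ann_sum \<kappa> z \<tau> P Q = ann_sum \<kappa> z' \<sigma> P' Q'"
    and "rotation_invariant2 \<kappa>2 \<Longrightarrow> disc_sum \<kappa> \<kappa>2 z \<tau> P Q = disc_sum \<kappa> \<kappa>2 z' \<sigma> P' Q'"
proof -
  note s = two_cyclesD[OF assms(3)]
  have len: "length (cyc \<tau> a) = length (cyc \<sigma> a')" "length (cyc \<tau> b) = length (cyc \<sigma> b')"
    using arg_cong[OF assms(8), of length] arg_cong[OF assms(9), of length] by simp_all
  obtain g where g: "bij g" "g ` P' = P" "g ` Q' = Q" "map g (cyc \<sigma> a') = cyc \<tau> a" "map g (cyc \<sigma> b') = cyc \<tau> b"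
    "g \<circ> \<sigma> \<circ> inv g = \<tau>"
    by (rule two_cycles_relabel[OF assms(2-7) len])
  have sets: "set (cyc \<sigma> a') = P'" "set (cyc \<sigma> b') = Q'"
    using set_cyc[OF s(8)] s(13)[OF assms(6)] s(14)[OF assms(7)] by simp_all
  have z: "(z \<circ> g) c = z' c" if "c \<in> P' \<union> Q'" for c
  proof -
    have "map (z \<circ> g) (cyc \<sigma> a') = map z' (cyc \<sigma> a')" "map (z \<circ> g) (cyc \<sigma> b') = map z' (cyc \<sigma> b')"
      using assms(8,9) unfolding g(4,5)[symmetric] by simp_all
    then show ?thesis using that unfolding map_eq_conv sets by blast
  qed
  have "ann_sum \<kappa> z \<tau> P Q = ann_sum \<kappa> (z \<circ> g) \<sigma> P' Q'"
    using ann_sum_conj[OF assms(1) g(1) s(1,7), of z] unfolding g(2,3,6) .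
  also have "\<dots> = ann_sum \<kappa> z' \<sigma> P' Q'" by (rule ann_sum_cong[OF s(7) z])
  finally show "ann_sum \<kappa> z \<tau> P Q = ann_sum \<kappa> z' \<sigma> P' Q'" .
  assume r: "rotation_invariant2 \<kappa>2"
  have "disc_sum \<kappa> \<kappa>2 z \<tau> P Q = disc_sum \<kappa> \<kappa>2 (z \<circ> g) \<sigma> P' Q'"
    using disc_sum_conj[OF assms(1) r g(1) s(1,7), of z] unfolding g(2,3,6) .
  also have "\<dots> = disc_sum \<kappa> \<kappa>2 z' \<sigma> P' Q'" by (rule disc_sum_cong[OF assms(3) z])
  finally show "disc_sum \<kappa> \<kappa>2 z \<tau> P Q = disc_sum \<kappa> \<kappa>2 z' \<sigma> P' Q'" .
qed

definition annular :: "('a list \<Rightarrow> complex) \<Rightarrow> 'a list \<Rightarrow> 'a list \<Rightarrow> complex" where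
  "annular \<kappa> xs ys = ann_sum \<kappa> (\<lambda>c. (xs @ ys) ! (c - 1)) (tau2 (length xs) (length ys))
     {1..length xs} {length xs + 1..length xs + length ys}"

definition disc :: "('a list \<Rightarrow> complex) \<Rightarrow> ('a list \<Rightarrow> 'a list \<Rightarrow> complex) \<Rightarrow> 'a list \<Rightarrow> 'a list \<Rightarrow> complex" where
  "disc \<kappa> \<kappa>2 xs ys = disc_sum \<kappa> \<kappa>2 (\<lambda>c. (xs @ ys) ! (c - 1)) (tau2 (length xs) (length ys))
     {1..length xs} {length xs + 1..length xs + length ys}"

lemma map_cyc_tau2:
  assumes "xs \<noteq> []" "ys \<noteq> []"
  defines "t \<equiv> tau2 (length xs) (length ys)"
  shows "map (\<lambda>c. (xs @ ys) ! (c - 1)) (cyc t 1) = xs"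
    "map (\<lambda>c. (xs @ ys) ! (c - 1)) (cyc t (length xs + 1)) = ys"
proof -
  let ?p = "length xs" and ?q = "length ys"
  have pq: "?p > 0" "?q > 0" using assms by auto
  have "cyc t 1 = [1..<Suc ?p]" "cyc t (?p + 1) = [Suc ?p..<Suc (?p + ?q)]"
    unfolding t_def cyc_def using tau2_facts(3,4)[OF pq] .
  moreover have "map (\<lambda>c. (xs @ ys) ! (c - 1)) [1..<Suc ?p] = xs"
    by (rule nth_equalityI) (auto simp: nth_append simp del: upt_Suc)
  moreover have "map (\<lambda>c. (xs @ ys) ! (c - 1)) [Suc ?p..<Suc (?p + ?q)] = ys"
    by (rule nth_equalityI) (auto simp: nth_append simp del: upt_Suc)
  ultimately show "map (\<lambda>c. (xs @ ys) ! (c - 1)) (cyc t 1) = xs"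
    "map (\<lambda>c. (xs @ ys) ! (c - 1)) (cyc t (length xs + 1)) = ys" by simp_all
qed

lemma two_cycles_lists:
  assumes "rotation_invariant \<kappa>" "two_cycles \<tau> P Q" "a \<in> P" "b \<in> Q"
  shows "ann_sum \<kappa> z \<tau> P Q = annular \<kappa> (map z (cyc \<tau> a)) (map z (cyc \<tau> b))"
    and "rotation_invariant2 \<kappa>2 \<Longrightarrow> disc_sum \<kappa> \<kappa>2 z \<tau> P Q = disc \<kappa> \<kappa>2 (map z (cyc \<tau> a)) (map z (cyc \<tau> b))"
proof -
  note t = two_cyclesD[OF assms(2)]
  let ?xs = "map z (cyc \<tau> a)" and ?ys = "map z (cyc \<tau> b)"
  have ne: "?xs \<noteq> []" "?ys \<noteq> []" using cyc_nonempty[OF t(8)] by simp_all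
  then have pq: "length ?xs > 0" "length ?ys > 0" by blast+
  have len1: "1 \<le> length ?xs" "1 \<le> length ?ys" using pq by linarith+
  note m = map_cyc_tau2[OF ne]
  have mem: "1 \<in> {1..length ?xs}" "length ?xs + 1 \<in> {length ?xs + 1..length ?xs + length ?ys}" using len1 by auto
  show "ann_sum \<kappa> z \<tau> P Q = annular \<kappa> ?xs ?ys"
    unfolding annular_def
    by (rule ann_sum_lists(1)[OF assms(1,2) two_cycles_tau2[OF pq] assms(3,4) mem m[symmetric]])
  show "rotation_invariant2 \<kappa>2 \<Longrightarrow> disc_sum \<kappa> \<kappa>2 z \<tau> P Q = disc \<kappa> \<kappa>2 ?xs ?ys"
    unfolding disc_def
    by (rule ann_sum_lists(2)[OF assms(1,2) two_cycles_tau2[OF pq] assms(3,4) mem m[symmetric]])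
qed

lemma cyc_rotate1:
  assumes "permutation f"
  shows "cyc f (f x) = rotate1 (cyc f x)"
proof -
  let ?r = "rotate1 (cyc f x)"
  have ne: "cyc f x \<noteq> []" by (rule cyc_nonempty[OF assms])
  have "map f ?r = rotate1 ?r" by (simp add: rotate1_map[symmetric] map_cyc[OF assms])
  then have "cyc f (hd ?r) = ?r" by (intro cyc_unique(1)) (use ne distinct_cyc[OF assms] in auto)
  moreover have "hd ?r = f x" unfolding map_cyc[OF assms, symmetric] using ne hd_cyc[OF assms, of x] by (simp add: hd_map)
  ultimately show ?thesis by simp
qed

text \<open>Rotating a list amounts to reading the circle from the next label, and the sum does not
  depend on where the reading starts.\<close>

lemma annular_rotate:
  assumes "rotation_invariant \<kappa>" "xs \<noteq> []" "ys \<noteq> []"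
  shows "annular \<kappa> (rotate1 xs) ys = annular \<kappa> xs ys" "annular \<kappa> xs (rotate1 ys) = annular \<kappa> xs ys"
    "rotation_invariant2 \<kappa>2 \<Longrightarrow> disc \<kappa> \<kappa>2 (rotate1 xs) ys = disc \<kappa> \<kappa>2 xs ys"
    "rotation_invariant2 \<kappa>2 \<Longrightarrow> disc \<kappa> \<kappa>2 xs (rotate1 ys) = disc \<kappa> \<kappa>2 xs ys"
proof -
  let ?p = "length xs" and ?q = "length ys"
  let ?t = "tau2 ?p ?q" and ?z = "\<lambda>c. (xs @ ys) ! (c - 1)"
  have pq: "?p > 0" "?q > 0" using assms by auto
  note tc = two_cycles_tau2[OF pq]
  note t = two_cyclesD[OF tc]
  have "1 \<le> ?p" "1 \<le> ?q" using pq by linarith+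
  then have a: "1 \<in> {1..?p}" "?p + 1 \<in> {?p+1..?p+?q}" by auto
  have a': "?t 1 \<in> {1..?p}" "?t (?p + 1) \<in> {?p+1..?p+?q}"
    using t(11,12) a unfolding closed_under_def by blast+
  have m: "map ?z (cyc ?t (?t 1)) = rotate1 xs" "map ?z (cyc ?t (?t (?p + 1))) = rotate1 ys"
    unfolding cyc_rotate1[OF t(8)] rotate1_map[symmetric] map_cyc_tau2[OF assms(2,3)] by (rule refl)+
  note l = two_cycles_lists[OF assms(1) tc, where z = ?z]
  note l0 = l[OF a, unfolded map_cyc_tau2[OF assms(2,3)]]
  note l1 = l[OF a'(1) a(2), unfolded m map_cyc_tau2[OF assms(2,3)]]
  note l2 = l[OF a(1) a'(2), unfolded m map_cyc_tau2[OF assms(2,3)]]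
  show "annular \<kappa> (rotate1 xs) ys = annular \<kappa> xs ys" "annular \<kappa> xs (rotate1 ys) = annular \<kappa> xs ys"
    using l0(1) l1(1) l2(1) by simp_all
  show "disc \<kappa> \<kappa>2 (rotate1 xs) ys = disc \<kappa> \<kappa>2 xs ys" "disc \<kappa> \<kappa>2 xs (rotate1 ys) = disc \<kappa> \<kappa>2 xs ys"
    if "rotation_invariant2 \<kappa>2" using l0(2)[OF that] l1(2)[OF that] l2(2)[OF that] by simp_all
qed

lemma real_second_order_cumulants_lists:
  "real_second_order_cumulants tr \<phi>2 \<kappa> \<kappa>2 \<longleftrightarrow> (\<forall>xs ys. xs \<noteq> [] \<longrightarrow> ys \<noteq> [] \<longrightarrow>
     \<phi>2 (prod_list xs) (prod_list ys) =
       annular \<kappa> xs ys + annular \<kappa> xs (map tr (rev ys)) + disc \<kappa> \<kappa>2 xs ys)"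
  unfolding real_second_order_cumulants_def Let_def
proof (intro iff_allI imp_cong refl)
  fix xs ys :: "'a list" assume ne: "xs \<noteq> []" "ys \<noteq> []"
  have "(\<Sum>\<pi>\<in>S_ann_nc (length xs) (length ys). cumulant_perm \<kappa> {1..length xs + length ys} \<pi> (xs @ ys)) =
      annular \<kappa> xs ys" unfolding sum_S_ann_nc annular_def ..
  moreover have "(\<Sum>\<pi>\<in>S_ann_nc (length xs) (length ys).
      cumulant_perm \<kappa> {1..length xs + length ys} \<pi> (xs @ map tr (rev ys))) = annular \<kappa> xs (map tr (rev ys))"
    unfolding sum_S_ann_nc annular_def by simp
  moreover have "(\<Sum>V\<in>PS' (length xs) (length ys). cumulant_PS \<kappa> \<kappa>2 V xs ys) = disc \<kappa> \<kappa>2 xs ys"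
    unfolding sum_PS'[OF ne] disc_def ..
  ultimately show "(\<phi>2 (prod_list xs) (prod_list ys) =
      (\<Sum>\<pi>\<in>S_ann_nc (length xs) (length ys). cumulant_perm \<kappa> {1..length xs + length ys} \<pi> (xs @ ys)) +
      (\<Sum>\<pi>\<in>S_ann_nc (length xs) (length ys).
        cumulant_perm \<kappa> {1..length xs + length ys} \<pi> (xs @ map tr (rev ys))) +
      (\<Sum>V\<in>PS' (length xs) (length ys). cumulant_PS \<kappa> \<kappa>2 V xs ys)) =
    (\<phi>2 (prod_list xs) (prod_list ys) =
      annular \<kappa> xs ys + annular \<kappa> xs (map tr (rev ys)) + disc \<kappa> \<kappa>2 xs ys)" by simp
qed

section \<open>Reversing one circle\<close>

lemma closed_under_inv:
  assumes "permutation \<sigma>" "closed_under \<sigma> P"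
  shows "closed_under (inv \<sigma>) P"
  unfolding closed_under_def
proof
  fix c assume "c \<in> P"
  have "inv \<sigma> c \<in> orbit (inv \<sigma>) c" by (rule orbit.base)
  then show "inv \<sigma> c \<in> P"
    unfolding orbit_inv_eq[OF assms(1)] using closed_under_orbit[OF assms(2) \<open>c \<in> P\<close>] by blast
qed

text \<open>Reverses the orientation of the circle \<open>Q\<close>. Applied to \<tau>, it puts the
  annular sum with the reversed second list on the same labels as the other one, so that both can be
  merged at the same \<open>i\<close>.\<close>

definition rev_on :: "'b set \<Rightarrow> ('b \<Rightarrow> 'b) \<Rightarrow> 'b \<Rightarrow> 'b" where
  "rev_on Q \<sigma> x = (if x \<in> Q then inv \<sigma> x else \<sigma> x)"

context
  fixes P Q :: "'b set" and \<sigma> :: "'b \<Rightarrow> 'b"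
  assumes fin: "finite (P \<union> Q)" and disj: "P \<inter> Q = {}"
    and perm: "\<sigma> permutes P \<union> Q" and closed: "closed_under \<sigma> P" "closed_under \<sigma> Q"
begin

lemma rev_on_inverse: "rev_on Q \<sigma> \<circ> rev_on Q (inv \<sigma>) = id" "rev_on Q (inv \<sigma>) \<circ> rev_on Q \<sigma> = id"
proof -
  have b: "bij \<sigma>" by (rule permutes_bij[OF perm])
  note pp = permutes_permutation[OF perm fin]
  have cl: "\<sigma> x \<in> Q \<longleftrightarrow> x \<in> Q" "inv \<sigma> x \<in> Q \<longleftrightarrow> x \<in> Q" for x
  proof -
    have i: "closed_under (inv \<sigma>) Q" by (rule closed_under_inv[OF pp closed(2)])
    show "\<sigma> x \<in> Q \<longleftrightarrow> x \<in> Q" "inv \<sigma> x \<in> Q \<longleftrightarrow> x \<in> Q"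
      using closed(2) i permutes_inverses[OF perm, of x] unfolding closed_under_def by metis+
  qed
  show "rev_on Q \<sigma> \<circ> rev_on Q (inv \<sigma>) = id" "rev_on Q (inv \<sigma>) \<circ> rev_on Q \<sigma> = id"
    using cl permutes_inverses[OF perm] inv_inv_eq[OF b] by (auto simp: fun_eq_iff rev_on_def)
qed

lemma rev_on_permutes: "rev_on Q \<sigma> permutes P \<union> Q" "closed_under (rev_on Q \<sigma>) P" "closed_under (rev_on Q \<sigma>) Q"
proof -
  have "bij (rev_on Q \<sigma>)" using rev_on_inverse by (rule o_bij[rotated])
  moreover have "rev_on Q \<sigma> x = x" if "x \<notin> P \<union> Q" for x
    using that perm by (simp add: rev_on_def permutes_not_in)
  ultimately show "rev_on Q \<sigma> permutes P \<union> Q" unfolding permutes_def by (metis bij_pointE)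
  show "closed_under (rev_on Q \<sigma>) P" "closed_under (rev_on Q \<sigma>) Q"
    using closed disj closed_under_inv[OF permutes_permutation[OF perm fin] closed(2)]
    by (auto simp: closed_under_def rev_on_def)
qed

lemma rev_on_rev_on: "rev_on Q (rev_on Q \<sigma>) = \<sigma>"
proof -
  have "inv (rev_on Q \<sigma>) = rev_on Q (inv \<sigma>)" using rev_on_inverse by (intro inv_unique_comp)
  then show ?thesis using inv_inv_eq[OF permutes_bij[OF perm]] by (auto simp: fun_eq_iff rev_on_def)
qed

lemma rev_on_cyc:
  shows "c \<in> P \<Longrightarrow> cyc (rev_on Q \<sigma>) c = cyc \<sigma> c" "c \<in> Q \<Longrightarrow> cyc (rev_on Q \<sigma>) c = cyc (inv \<sigma>) c"
    and "c \<in> P \<union> Q \<Longrightarrow> orbit (rev_on Q \<sigma>) c = orbit \<sigma> c"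
proof -
  note pp = permutes_permutation[OF perm fin]
  have 1: "rev_on Q \<sigma> c = \<sigma> c" if "c \<in> P" for c using that disj by (auto simp: rev_on_def)
  have 2: "rev_on Q \<sigma> c = inv \<sigma> c" if "c \<in> Q" for c using that by (simp add: rev_on_def)
  note P = cyc_cong_closed[OF pp closed(1) 1]
  note Q = cyc_cong_closed[OF permutation_inverse[OF pp] closed_under_inv[OF pp closed(2)] 2]
  show "c \<in> P \<Longrightarrow> cyc (rev_on Q \<sigma>) c = cyc \<sigma> c" by (rule P(1))
  show "c \<in> Q \<Longrightarrow> cyc (rev_on Q \<sigma>) c = cyc (inv \<sigma>) c" by (rule Q(1))
  show "c \<in> P \<union> Q \<Longrightarrow> orbit (rev_on Q \<sigma>) c = orbit \<sigma> c"
    using P(2) Q(2) orbit_inv_eq[OF pp] by auto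
qed

end

section \<open>Genus under reversal of one circle\<close>

lemma num_cycles_closed_Un:
  assumes "permutation \<pi>" "closed_under \<pi> A" "closed_under \<pi> B" "A \<inter> B = {}" "finite A" "finite B"
  shows "num_cycles \<pi> (A \<union> B) = num_cycles \<pi> A + num_cycles \<pi> B"
  unfolding num_cycles_def cycle_partition_Un
  by (rule card_Un_disjoint[OF finite_cycle_partition[OF assms(5)] finite_cycle_partition[OF assms(6)]
        cycle_partition_disjoint_closed[OF assms(1-4)]])

lemma num_cycles_cong_closed:
  assumes "permutation \<pi>" "closed_under \<pi> S" "\<And>c. c \<in> S \<Longrightarrow> \<sigma> c = \<pi> c"
  shows "num_cycles \<sigma> S = num_cycles \<pi> S"
  by (simp only: num_cycles_def cycle_partition_cong_closed[OF assms])

lemma closed_under_comp: "closed_under f A \<Longrightarrow> closed_under g A \<Longrightarrow> closed_under (f \<circ> g) A"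
  by (simp add: closed_under_def)

text \<open>On \<open>P\<close> the complement is unchanged. On \<open>Q\<close> it becomes
  \<open>\<sigma> \<circ> inv \<tau>\<close>, which is conjugate by \<sigma> to the inverse of the
  old complement.\<close>

lemma rev_on_NCG:
  fixes P Q :: "'b set"
  assumes fin: "finite (P \<union> Q)" and disj: "P \<inter> Q = {}"
    and s: "\<sigma> permutes P \<union> Q" "closed_under \<sigma> P" "closed_under \<sigma> Q"
    and t: "\<tau> permutes P \<union> Q" "closed_under \<tau> P" "closed_under \<tau> Q"
  shows "rev_on Q \<sigma> \<in> NCG (P \<union> Q) (rev_on Q \<tau>) m \<longleftrightarrow> \<sigma> \<in> NCG (P \<union> Q) \<tau> m"
proof -
  let ?S = "P \<union> Q"
  have finPQ: "finite P" "finite Q" using fin by auto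
  note rs = rev_on_permutes[OF fin disj s] and rt = rev_on_permutes[OF fin disj t]
  note ps = permutes_permutation[OF s(1) fin] and pt = permutes_permutation[OF t(1) fin]
  have bs: "bij \<sigma>" "bij \<tau>" using s(1) t(1) by (auto intro: permutes_bij)
  have 1: "num_cycles (rev_on Q \<sigma>) ?S = num_cycles \<sigma> ?S"
  proof -
    have "orbit (rev_on Q \<sigma>) ` ?S = orbit \<sigma> ` ?S"
      by (rule image_cong[OF refl]) (rule rev_on_cyc(3)[OF fin disj s])
    then show ?thesis by (simp only: num_cycles_def cycle_partition_def)
  qed
  let ?e = "inv \<sigma> \<circ> \<tau>" and ?f = "inv (rev_on Q \<sigma>) \<circ> rev_on Q \<tau>" and ?h = "\<sigma> \<circ> inv \<tau>"
  have inv: "inv (rev_on Q \<sigma>) = rev_on Q (inv \<sigma>)"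
    using rev_on_inverse[OF fin disj s] by (intro inv_unique_comp)
  have ep: "?e permutes ?S" using s(1) t(1) by (intro permutes_compose permutes_inv)
  have hp: "?h permutes ?S" using s(1) t(1) by (intro permutes_compose permutes_inv)
  have fp: "?f permutes ?S" using rs(1) rt(1) by (intro permutes_compose permutes_inv)
  note pe = permutes_permutation[OF ep fin] and ph = permutes_permutation[OF hp fin]
    and pf = permutes_permutation[OF fp fin]
  have ce: "closed_under ?e P" "closed_under ?e Q" "closed_under ?h Q"
    using closed_under_inv[OF ps s(2)] closed_under_inv[OF ps s(3)] closed_under_inv[OF pt t(3)] s t
    by (auto intro!: closed_under_comp)
  have cf: "closed_under ?f P" "closed_under ?f Q"
    using closed_under_inv[OF permutes_permutation[OF rs(1) fin]] rs(2,3) rt(2,3) by (auto intro!: closed_under_comp)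
  have fP: "?f c = ?e c" if "c \<in> P" for c
  proof -
    have "c \<notin> Q" "\<tau> c \<notin> Q" using that disj t(2) by (auto simp: closed_under_def)
    then show ?thesis unfolding inv by (simp add: rev_on_def)
  qed
  have fQ: "?f c = ?h c" if "c \<in> Q" for c
  proof -
    have "inv \<tau> c \<in> Q" using that closed_under_inv[OF pt t(3)] by (simp add: closed_under_def)
    then show ?thesis unfolding inv using that by (simp add: rev_on_def inv_inv_eq[OF bs(1)])
  qed
  have "num_cycles ?h Q = num_cycles ?e Q"
  proof -
    have "?h = \<sigma> \<circ> (inv \<tau> \<circ> \<sigma>) \<circ> inv \<sigma>" using permutes_inv_o[OF s(1)] by (simp add: comp_assoc)
    moreover have "inv ?e = inv \<tau> \<circ> \<sigma>" using bs by (simp add: o_inv_distrib bij_imp_bij_inv inv_inv_eq)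
    moreover have "\<sigma> ` Q = Q"
      using s(3) finPQ(2) permutes_inj[OF s(1)] by (intro endo_inj_surj) (auto simp: closed_under_def intro: inj_on_subset)
    ultimately have "num_cycles ?h Q = num_cycles (inv ?e) Q"
      using num_cycles_conj[OF permutation_inverse[OF pe] bs(1), of Q] by simp
    then show ?thesis using num_cycles_inv[OF pe] by simp
  qed
  moreover have "num_cycles ?f ?S = num_cycles ?f P + num_cycles ?f Q"
    by (rule num_cycles_closed_Un[OF pf cf disj finPQ])
  moreover have "num_cycles ?e ?S = num_cycles ?e P + num_cycles ?e Q"
    by (rule num_cycles_closed_Un[OF pe ce(1,2) disj finPQ])
  moreover have "num_cycles ?f P = num_cycles ?e P" by (rule num_cycles_cong_closed[OF pe ce(1) fP])
  moreover have "num_cycles ?f Q = num_cycles ?h Q" by (rule num_cycles_cong_closed[OF ph ce(3) fQ])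
  ultimately have "num_cycles ?f ?S = num_cycles ?e ?S" by simp
  then show ?thesis using 1 s(1) rs(1) by (simp add: NCG_def)
qed

lemma two_cycles_rev_on:
  assumes "two_cycles \<tau> P Q"
  shows "two_cycles (rev_on Q \<tau>) P Q"
proof -
  note t = two_cyclesD[OF assms]
  have "cycle_partition (rev_on Q \<tau>) P = cycle_partition \<tau> P" "cycle_partition (rev_on Q \<tau>) Q = cycle_partition \<tau> Q"
    unfolding cycle_partition_def using rev_on_cyc(3)[OF t(7,4,1,11,12)] by (auto cong: image_cong)
  then show ?thesis using t rev_on_permutes(1)[OF t(7,4,1,11,12)] by (simp add: two_cycles_def)
qed

text \<open>Lets the extra terms of the reversed annular sum be indexed by the same disc diagrams as
  those of the other two sums. Reversal on \<open>Q\<close> keeps the condition at \<open>i\<close>,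
  which lies on \<open>P\<close>.\<close>

lemma sum_NCGf_rev_on:
  assumes "two_cycles \<tau> P Q" "i \<in> P"
  shows "(\<Sum>\<sigma>\<in>NCGf (P \<union> Q) (rev_on Q \<tau>) i 2. F \<sigma>) = (\<Sum>\<sigma>\<in>NCGf (P \<union> Q) \<tau> i 2. F (rev_on Q \<sigma>))"
proof -
  note t = two_cyclesD[OF assms(1)] and r = two_cyclesD[OF two_cycles_rev_on[OF assms(1)]]
  have iQ: "i \<notin> Q" using assms(2) t(4) by blast
  have i: "rev_on Q \<sigma> i = \<sigma> i" for \<sigma> using iQ by (simp add: rev_on_def)
  have tt: "rev_on Q (rev_on Q \<tau>) = \<tau>" by (rule rev_on_rev_on[OF t(7,4,1,11,12)])
  show ?thesis
  proof (rule sum.reindex_bij_witness[where i = "rev_on Q" and j = "rev_on Q"])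
    fix \<sigma> assume "\<sigma> \<in> NCGf (P \<union> Q) (rev_on Q \<tau>) i 2"
    then have s: "\<sigma> \<in> NCG (P \<union> Q) (rev_on Q \<tau>) 2" "\<sigma> i = \<tau> i" by (auto simp: NCGf_def i)
    note c = NCG_disc_closed[OF two_cycles_rev_on[OF assms(1)] s(1)]
    show "rev_on Q (rev_on Q \<sigma>) = \<sigma>" by (rule rev_on_rev_on[OF t(7,4) c(1,3,4)])
    then show "F (rev_on Q (rev_on Q \<sigma>)) = F \<sigma>" by simp
    show "rev_on Q \<sigma> \<in> NCGf (P \<union> Q) \<tau> i 2"
      using rev_on_NCG[OF t(7,4) c(1,3,4) r(1,11,12), of 2] s unfolding tt by (simp add: NCGf_def i)
  next
    fix \<sigma> assume "\<sigma> \<in> NCGf (P \<union> Q) \<tau> i 2"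
    then have s: "\<sigma> \<in> NCG (P \<union> Q) \<tau> 2" "\<sigma> i = \<tau> i" by (auto simp: NCGf_def)
    note c = NCG_disc_closed[OF assms(1) s(1)]
    show "rev_on Q (rev_on Q \<sigma>) = \<sigma>" by (rule rev_on_rev_on[OF t(7,4) c(1,3,4)])
    show "rev_on Q \<sigma> \<in> NCGf (P \<union> Q) (rev_on Q \<tau>) i 2"
      using rev_on_NCG[OF t(7,4) c(1,3,4) t(1,11,12), of 2] s by (simp add: NCGf_def i)
  qed
qed

lemma cyc_inv_rev:
  assumes "permutation f"
  shows "cyc (inv f) (inv f x) = rev (cyc f x)"
proof -
  obtain w where w: "cyc f x = x # w" by (rule cyc_Cons[OF assms])
  show ?thesis
    unfolding cyc_rotate1[OF permutation_inverse[OF assms]] cyc_inv[OF assms w] w by simp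
qed

section \<open>Second-order cumulants\<close>

text \<open>The values of \<open>\<kappa>2\<close> at empty lists are normalised to \<open>0\<close>, so that \<open>\<kappa>2\<close> is rotation invariant everywhere.\<close>

locale second_order_cumulants = tracial_cumulants \<phi>1 \<kappa>
  for \<phi>1 :: "'a :: monoid_mult \<Rightarrow> complex" and \<kappa> :: "'a list \<Rightarrow> complex" +
  fixes tr :: "'a \<Rightarrow> 'a" and \<phi>2 :: "'a \<Rightarrow> 'a \<Rightarrow> complex" and \<kappa>2 :: "'a list \<Rightarrow> 'a list \<Rightarrow> complex"
  assumes tr_tr: "tr (tr x) = x"
    and tr_mult: "tr (x * y) = tr y * tr x"
    and \<phi>1_tr: "\<phi>1 (tr x) = \<phi>1 x"
    and \<phi>2_one_left: "\<phi>2 1 y = 0"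
    and \<phi>2_one_right: "\<phi>2 x 1 = 0"
    and \<phi>2_tracial_left: "\<phi>2 (x * y) z = \<phi>2 (y * x) z"
    and \<phi>2_tracial_right: "\<phi>2 z (x * y) = \<phi>2 z (y * x)"
    and \<phi>2_tr_left: "\<phi>2 (tr x) y = \<phi>2 x y"
    and \<phi>2_tr_right: "\<phi>2 x (tr y) = \<phi>2 x y"
    and second_order: "real_second_order_cumulants tr \<phi>2 \<kappa> \<kappa>2"
    and \<kappa>2_Nil: "\<kappa>2 [] ys = 0" "\<kappa>2 xs [] = 0"
begin

section \<open>Transposition and exchange of circles in first-order terms\<close>

lemma tr_one: "tr 1 = 1"
  using tr_mult[of "tr 1" 1] tr_tr[of 1] by simp

lemma tr_prod_list: "tr (prod_list xs) = prod_list (map tr (rev xs))"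
  by (induction xs) (simp_all add: tr_one tr_mult)

lemma map_tr_rev_rev: "map tr (rev (map tr (rev xs))) = xs"
  by (simp add: rev_map tr_tr o_def)

lemma cycle_prod_tr_inv:
  assumes "permutation \<pi>"
  shows "cycle_prod \<kappa> (tr \<circ> z) (inv \<pi>) S = cycle_prod (\<lambda>xs. \<kappa> (map tr (rev xs))) z \<pi> S"
  unfolding cycle_prod_def cycle_partition_def orbit_inv_eq[OF assms]
proof (rule prod.cong[OF refl])
  fix C :: "nat set"
  obtain w where w: "cyc \<pi> (Min C) = Min C # w" by (rule cyc_Cons[OF assms])
  have "map tr (rev (map z (cyc \<pi> (Min C)))) = rotate1 (map (tr \<circ> z) (cyc (inv \<pi>) (Min C)))"
    unfolding cyc_inv[OF assms w] w by (simp add: rev_map)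
  then show "\<kappa> (map (tr \<circ> z) (cyc (inv \<pi>) (Min C))) = \<kappa> (map tr (rev (map z (cyc \<pi> (Min C)))))"
    using rotation_invariant by (simp add: rotation_invariant_def)
qed

text \<open>By uniqueness of the cumulants. The transposed functional satisfies the same relation:
  \<open>\<phi>1\<close> is invariant under transposition, and inversion of the diagrams reverses
  the cycles.\<close>

lemma cumulant_tr:
  assumes "xs \<noteq> []"
  shows "\<kappa> (map tr (rev xs)) = \<kappa> xs"
proof (rule free_cumulants_unique[OF _ cumulants assms])
  show "free_cumulants \<phi>1 (\<lambda>xs. \<kappa> (map tr (rev xs)))"
    unfolding free_cumulants_def
  proof (intro allI impI)
    fix xs :: "'a list" assume ne: "xs \<noteq> []"
    let ?n = "length xs"
    let ?S = "{1..?n}" and ?t = "tau ?n" and ?z = "\<lambda>c. xs ! (c - 1)"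
    have n: "?n > 0" using ne by simp
    note t = tau_facts(1)[OF n] and cpt = tau_facts(2)[OF n]
    note pt = permutes_permutation[OF t finite_atLeastAtMost]
    have cpi: "cycle_partition (inv ?t) ?S = {?S}"
      using cpt unfolding cycle_partition_def orbit_inv_eq[OF pt] .
    have "1 \<in> ?S" using ne by (cases xs) auto
    then have i: "inv ?t 1 \<in> ?S" using permutes_in_image[OF permutes_inv[OF t], of 1] by blast
    have "map (tr \<circ> ?z) (cyc (inv ?t) (inv ?t 1)) = map tr (rev (map ?z (cyc ?t 1)))"
      unfolding cyc_inv_rev[OF pt] by (simp add: rev_map)
    also have "\<dots> = map tr (rev xs)" unfolding cyc_tau[OF n] map_nth_upt ..
    finally have l: "map (tr \<circ> ?z) (cyc (inv ?t) (inv ?t 1)) = map tr (rev xs)" .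
    have "\<phi>1 (prod_list xs) = \<phi>1 (prod_list (map tr (rev xs)))"
      using \<phi>1_tr[of "prod_list xs"] by (simp add: tr_prod_list)
    also have "\<dots> = (\<Sum>\<pi>\<in>NCG ?S (inv ?t) 1. cycle_prod \<kappa> (tr \<circ> ?z) \<pi> ?S)"
      using moment[OF permutes_inv[OF t] _ cpi i, of "tr \<circ> ?z"] unfolding l by simp
    also have "\<dots> = (\<Sum>\<pi>\<in>NCG ?S ?t 1. cycle_prod \<kappa> (tr \<circ> ?z) (inv \<pi>) ?S)"
      by (rule sum_NCG_inv[OF t finite_atLeastAtMost])
    also have "\<dots> = (\<Sum>\<pi>\<in>NCG ?S ?t 1. cycle_prod (\<lambda>xs. \<kappa> (map tr (rev xs))) ?z \<pi> ?S)"
      by (intro sum.cong refl cycle_prod_tr_inv permutes_permutation[OF NCG_permutes]) auto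
    finally show "\<phi>1 (prod_list xs) = (\<Sum>\<pi>\<in>S_nc ?n. cumulant_perm (\<lambda>xs. \<kappa> (map tr (rev xs))) ?S \<pi> xs)"
      unfolding S_nc_NCG cumulant_perm_cycle_prod .
  qed
qed

lemma cycle_prod_tr:
  assumes "permutation \<pi>"
  shows "cycle_prod \<kappa> (tr \<circ> z) (inv \<pi>) S = cycle_prod \<kappa> z \<pi> S"
  unfolding cycle_prod_tr_inv[OF assms] unfolding cycle_prod_def
  using cyc_nonempty[OF assms] by (intro prod.cong refl cumulant_tr) simp

text \<open>Inverting the diagrams on both circles matches reversing and transposing both lists, and
  by \<open>cumulant_tr\<close> each factor keeps its value.\<close>

lemma annular_tr:
  assumes "xs \<noteq> []" "ys \<noteq> []"
  shows "annular \<kappa> (map tr (rev xs)) (map tr (rev ys)) = annular \<kappa> xs ys"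
proof -
  let ?p = "length xs" and ?q = "length ys"
  let ?t = "tau2 ?p ?q" and ?z = "\<lambda>c. (xs @ ys) ! (c - 1)" and ?P = "{1..?p}" and ?Q = "{?p+1..?p+?q}"
  have pq: "?p > 0" "?q > 0" using assms by auto
  note tc = two_cycles_tau2[OF pq]
  note t = two_cyclesD[OF tc]
  have "1 \<le> ?p" "1 \<le> ?q" using pq by linarith+
  then have a: "1 \<in> ?P" "?p + 1 \<in> ?Q" by auto
  have tci: "two_cycles (inv ?t) ?P ?Q"
    using t permutes_inv[OF t(1)] unfolding two_cycles_def cycle_partition_def orbit_inv_eq[OF t(8)] by simp
  have a': "inv ?t 1 \<in> ?P" "inv ?t (?p + 1) \<in> ?Q"
    using two_cyclesD(11,12)[OF tci] a unfolding closed_under_def by blast+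
  have l: "map (tr \<circ> ?z) (cyc (inv ?t) (inv ?t c)) = map tr (rev (map ?z (cyc ?t c)))" for c
    unfolding cyc_inv_rev[OF t(8)] by (simp add: rev_map)
  have "annular \<kappa> (map tr (rev xs)) (map tr (rev ys)) = ann_sum \<kappa> (tr \<circ> ?z) (inv ?t) ?P ?Q"
    using two_cycles_lists(1)[OF rotation_invariant tci a', of "tr \<circ> ?z"] unfolding l map_cyc_tau2[OF assms] ..
  also have "\<dots> = ann_sum \<kappa> ?z ?t ?P ?Q"
    unfolding ann_sum_def sum_NCG_inv[OF t(1,7)]
  proof (rule sum.cong[OF refl])
    fix \<pi> assume "\<pi> \<in> NCG (?P \<union> ?Q) ?t 0"
    then have p: "permutation \<pi>" by (intro permutes_permutation[OF NCG_permutes t(7)])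
    have "closed_under (inv \<pi>) ?P \<longleftrightarrow> closed_under \<pi> ?P"
      using closed_under_inv[OF p] closed_under_inv[OF permutation_inverse[OF p]] p
      by (auto simp: inv_inv_eq permutation)
    then show "(if closed_under (inv \<pi>) ?P then 0 else cycle_prod \<kappa> (tr \<circ> ?z) (inv \<pi>) (?P \<union> ?Q)) =
        (if closed_under \<pi> ?P then 0 else cycle_prod \<kappa> ?z \<pi> (?P \<union> ?Q))"
      using cycle_prod_tr[OF p] by simp
  qed
  also have "\<dots> = annular \<kappa> xs ys" unfolding annular_def ..
  finally show ?thesis .
qed

text \<open>Both sums run over the same diagrams on the same labels, since a permutation of the two
  circles preserves one of them if and only if it preserves the other.\<close>

lemma annular_commute:
  assumes "xs \<noteq> []" "ys \<noteq> []"
  shows "annular \<kappa> ys xs = annular \<kappa> xs ys"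
proof -
  let ?p = "length xs" and ?q = "length ys"
  let ?t = "tau2 ?p ?q" and ?z = "\<lambda>c. (xs @ ys) ! (c - 1)" and ?P = "{1..?p}" and ?Q = "{?p+1..?p+?q}"
  have pq: "?p > 0" "?q > 0" using assms by auto
  note tc = two_cycles_tau2[OF pq]
  note t = two_cyclesD[OF tc]
  have "1 \<le> ?p" "1 \<le> ?q" using pq by linarith+
  then have a: "1 \<in> ?P" "?p + 1 \<in> ?Q" by auto
  have "annular \<kappa> ys xs = ann_sum \<kappa> ?z ?t ?Q ?P"
    using two_cycles_lists(1)[OF rotation_invariant t(16) a(2,1), of ?z] unfolding map_cyc_tau2[OF assms] ..
  also have "\<dots> = ann_sum \<kappa> ?z ?t ?P ?Q"
    unfolding ann_sum_def Un_commute[of ?Q]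
  proof (rule sum.cong[OF refl])
    fix \<pi> assume "\<pi> \<in> NCG (?P \<union> ?Q) ?t 0"
    then have p: "\<pi> permutes ?P \<union> ?Q" by (rule NCG_permutes)
    have "closed_under \<pi> ?Q \<longleftrightarrow> closed_under \<pi> ?P"
      using closed_under_other[OF p t(7,4)] closed_under_other[of \<pi> ?Q ?P] p t(4,7)
      by (auto simp: Un_commute Int_commute)
    then show "(if closed_under \<pi> ?Q then 0 else cycle_prod \<kappa> ?z \<pi> (?P \<union> ?Q)) =
        (if closed_under \<pi> ?P then 0 else cycle_prod \<kappa> ?z \<pi> (?P \<union> ?Q))" by simp
  qed
  also have "\<dots> = annular \<kappa> xs ys" unfolding annular_def ..
  finally show ?thesis .
qed

section \<open>Rotation invariance of \<open>\<kappa>2\<close>, free choice of labels, and exchange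
  of the two lists\<close>

lemma disc_top:
  assumes "xs \<noteq> []" "ys \<noteq> []"
  shows "disc k k2 xs ys = k2 xs ys + disc k (trunc2 (length xs + length ys) k2) xs ys"
proof -
  let ?p = "length xs" and ?q = "length ys"
  have pq: "?p > 0" "?q > 0" using assms by auto
  have "Min {1..?p} = 1" "Min {?p+1..?p+?q} = ?p + 1"
    using pq by (auto intro!: Min_eqI simp: Suc_le_eq)
  moreover have "card {1..?p} + card {?p+1..?p+?q} = ?p + ?q" by simp
  ultimately show ?thesis
    unfolding disc_def using disc_sum_top[OF two_cycles_tau2[OF pq], of k k2] map_cyc_tau2[OF assms] by simp
qed

lemma moment2_lists:
  assumes "xs \<noteq> []" "ys \<noteq> []"
  shows "\<phi>2 (prod_list xs) (prod_list ys) =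
    annular \<kappa> xs ys + annular \<kappa> xs (map tr (rev ys)) + disc \<kappa> \<kappa>2 xs ys"
  using second_order assms unfolding real_second_order_cumulants_lists by blast

lemma cumulant2_recursion:
  assumes "xs \<noteq> []" "ys \<noteq> []"
  shows "\<kappa>2 xs ys = \<phi>2 (prod_list xs) (prod_list ys) - annular \<kappa> xs ys - annular \<kappa> xs (map tr (rev ys)) -
    disc \<kappa> (trunc2 (length xs + length ys) \<kappa>2) xs ys"
  using moment2_lists[OF assms] disc_top[OF assms, of \<kappa> \<kappa>2] by (simp add: algebra_simps)

lemma rotation_invariant2: "rotation_invariant2 \<kappa>2"
proof -
  have "\<kappa>2 (rotate1 xs) ys = \<kappa>2 xs ys \<and> \<kappa>2 xs (rotate1 ys) = \<kappa>2 xs ys" for xs ys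
  proof (induction "length xs + length ys" arbitrary: xs ys rule: less_induct)
    case less
    show ?case
    proof (cases "xs = [] \<or> ys = []")
      case True
      then show ?thesis by (auto simp: \<kappa>2_Nil)
    next
      case False
      then have ne: "xs \<noteq> []" "ys \<noteq> []" by auto
      let ?k = "trunc2 (length xs + length ys) \<kappa>2"
      have ri: "rotation_invariant2 ?k" using less by (simp add: rotation_invariant2_def trunc2_def)
      obtain y v where y: "ys = y # v" using ne by (cases ys) auto
      \<comment> \<open>Rotating \<open>ys\<close> rotates the reversed list in the opposite
        direction.\<close>
      have "map tr (rev ys) = rotate1 (map tr (rev (rotate1 ys)))" unfolding y by simp
      then have a: "annular \<kappa> xs (map tr (rev (rotate1 ys))) = annular \<kappa> xs (map tr (rev ys))"
        using annular_rotate(2)[OF rotation_invariant ne(1), of "map tr (rev (rotate1 ys))"] ne by simp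
      have p: "\<phi>2 (prod_list (rotate1 xs)) u = \<phi>2 (prod_list xs) u"
        "\<phi>2 u (prod_list (rotate1 ys)) = \<phi>2 u (prod_list ys)" for u
        by (cases xs; cases ys; simp add: \<phi>2_tracial_left \<phi>2_tracial_right)+
      note r = annular_rotate[OF rotation_invariant]
      show ?thesis
        using cumulant2_recursion[OF ne] cumulant2_recursion[of "rotate1 xs" ys]
          cumulant2_recursion[of xs "rotate1 ys"] ne p a r(1,2)[OF ne] r(3,4)[OF ne ri]
          r(1)[OF ne(1), of "map tr (rev ys)"] by simp
    qed
  qed
  then show ?thesis by (simp add: rotation_invariant2_def)
qed

definition transpose_on :: "nat set \<Rightarrow> (nat \<Rightarrow> 'a) \<Rightarrow> nat \<Rightarrow> 'a" where
  "transpose_on Q z c = (if c \<in> Q then tr (z c) else z c)"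

text \<open>The second-order relation on arbitrary labels. The second annular sum stays on the label
  set \<open>Q\<close>, with the orientation reversed and the arguments transposed in place.\<close>

lemma moment2:
  assumes "two_cycles \<tau> P Q" "a \<in> P" "b \<in> Q"
  shows "\<phi>2 (prod_list (map z (cyc \<tau> a))) (prod_list (map z (cyc \<tau> b))) =
    ann_sum \<kappa> z \<tau> P Q + ann_sum \<kappa> (transpose_on Q z) (rev_on Q \<tau>) P Q + disc_sum \<kappa> \<kappa>2 z \<tau> P Q"
proof -
  note t = two_cyclesD[OF assms(1)]
  note r = two_cycles_rev_on[OF assms(1)]
  note rc = rev_on_cyc[OF t(7,4,1,11,12)]
  have b': "rev_on Q \<tau> b \<in> Q" using two_cyclesD(12)[OF r] assms(3) by (simp add: closed_under_def)
  have P: "set (cyc \<tau> a) = P" and Q: "set (cyc \<tau> b) = Q"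
    using set_cyc[OF t(8)] t(13)[OF assms(2)] t(14)[OF assms(3)] by simp_all
  have "map (transpose_on Q z) (cyc (rev_on Q \<tau>) a) = map z (cyc \<tau> a)"
    unfolding rc(1)[OF assms(2)] using P t(4) by (intro map_cong) (auto simp: transpose_on_def)
  moreover have "map (transpose_on Q z) (cyc (rev_on Q \<tau>) (rev_on Q \<tau> b)) = map tr (rev (map z (cyc \<tau> b)))"
  proof -
    have "rev_on Q \<tau> b = inv \<tau> b" using assms(3) by (simp add: rev_on_def)
    then have "cyc (rev_on Q \<tau>) (rev_on Q \<tau> b) = rev (cyc \<tau> b)"
      using rc(2)[OF b'] cyc_inv_rev[OF t(8)] by simp
    moreover have "map (transpose_on Q z) (rev (cyc \<tau> b)) = map (tr \<circ> z) (rev (cyc \<tau> b))"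
      using Q by (intro map_cong) (auto simp: transpose_on_def)
    ultimately show ?thesis by (simp add: rev_map)
  qed
  ultimately have "ann_sum \<kappa> (transpose_on Q z) (rev_on Q \<tau>) P Q =
      annular \<kappa> (map z (cyc \<tau> a)) (map tr (rev (map z (cyc \<tau> b))))"
    using two_cycles_lists(1)[OF rotation_invariant r assms(2) b', of "transpose_on Q z"] by simp
  then show ?thesis
    using moment2_lists[of "map z (cyc \<tau> a)" "map z (cyc \<tau> b)"] cyc_nonempty[OF t(8)]
      two_cycles_lists(1)[OF rotation_invariant assms, of z]
      two_cycles_lists(2)[OF rotation_invariant assms rotation_invariant2, of z] by simp
qed

text \<open>Exchanging the circles exchanges the two choices of a cycle, which is an interchange of
  summations.\<close>

lemma disc_commute:
  assumes "xs \<noteq> []" "ys \<noteq> []"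
  shows "disc \<kappa> \<kappa>2 ys xs = disc \<kappa> (\<lambda>xs ys. \<kappa>2 ys xs) xs ys"
proof -
  let ?p = "length xs" and ?q = "length ys"
  let ?t = "tau2 ?p ?q" and ?z = "\<lambda>c. (xs @ ys) ! (c - 1)" and ?P = "{1..?p}" and ?Q = "{?p+1..?p+?q}"
  have pq: "?p > 0" "?q > 0" using assms by auto
  note tc = two_cycles_tau2[OF pq]
  note t = two_cyclesD[OF tc]
  have "1 \<le> ?p" "1 \<le> ?q" using pq by linarith+
  then have a: "1 \<in> ?P" "?p + 1 \<in> ?Q" by auto
  have "disc \<kappa> \<kappa>2 ys xs = disc_sum \<kappa> \<kappa>2 ?z ?t ?Q ?P"
    using two_cycles_lists(2)[OF rotation_invariant t(16) a(2,1) rotation_invariant2, of ?z]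
    unfolding map_cyc_tau2[OF assms] ..
  also have "\<dots> = disc_sum \<kappa> (\<lambda>xs ys. \<kappa>2 ys xs) ?z ?t ?P ?Q"
    unfolding disc_sum_def Un_commute[of ?Q]
  proof (rule sum.cong[OF refl])
    fix \<pi>
    show "disc_term \<kappa> \<kappa>2 ?z \<pi> ?Q ?P = disc_term \<kappa> (\<lambda>xs ys. \<kappa>2 ys xs) ?z \<pi> ?P ?Q"
      unfolding disc_term_def cycle_deriv_def sum_distrib_left
      by (subst sum.swap) (simp only: mult_ac)
  qed
  also have "\<dots> = disc \<kappa> (\<lambda>xs ys. \<kappa>2 ys xs) xs ys" unfolding disc_def ..
  finally show ?thesis .
qed

text \<open>Lets every statement about the first list be used for the second one, so that merging,
  centring and linearity need only be proved for the first.\<close>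

lemma flip: "second_order_cumulants \<phi>1 \<kappa> tr (\<lambda>x y. \<phi>2 y x) (\<lambda>xs ys. \<kappa>2 ys xs)"
proof unfold_locales
  show "real_second_order_cumulants tr (\<lambda>x y. \<phi>2 y x) \<kappa> (\<lambda>xs ys. \<kappa>2 ys xs)"
    unfolding real_second_order_cumulants_lists
  proof (intro allI impI)
    fix xs ys :: "'a list" assume ne: "xs \<noteq> []" "ys \<noteq> []"
    have ne': "map tr (rev xs) \<noteq> []" "map tr (rev ys) \<noteq> []" using ne by simp_all
    \<comment> \<open>The transposed term is not visibly symmetric: transposing both circles moves
      the transposition from \<open>xs\<close> to \<open>ys\<close>, and then the circles are
      exchanged.\<close>
    have "annular \<kappa> ys (map tr (rev xs)) = annular \<kappa> (map tr (rev ys)) xs"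
      using annular_tr[OF ne(2) ne'(1)] unfolding map_tr_rev_rev ..
    also have "\<dots> = annular \<kappa> xs (map tr (rev ys))" by (rule annular_commute[OF ne(1) ne'(2)])
    finally show "\<phi>2 (prod_list ys) (prod_list xs) =
        annular \<kappa> xs ys + annular \<kappa> xs (map tr (rev ys)) + disc \<kappa> (\<lambda>xs ys. \<kappa>2 ys xs) xs ys"
      using moment2_lists[OF ne(2,1)] annular_commute[OF ne] disc_commute[OF ne] by simp
  qed
qed (simp_all add: tr_tr tr_mult \<phi>1_tr \<phi>2_one_left \<phi>2_one_right \<phi>2_tr_left \<phi>2_tr_right \<kappa>2_Nil
    \<phi>2_tracial_left \<phi>2_tracial_right)

end

section \<open>Products as arguments of second-order cumulants\<close>

lemma sum_rotate_rotate1: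
  fixes G :: "'a list \<Rightarrow> complex"
  shows "(\<Sum>l<length L. G (rotate l (rotate1 L))) = (\<Sum>l<length L. G (rotate l L))"
proof (cases "length L")
  case (Suc n)
  have "(\<Sum>l<length L. G (rotate l (rotate1 L))) = (\<Sum>l<Suc n. G (rotate (Suc l) L))"
    unfolding Suc by (simp add: rotate1_rotate_swap)
  also have "\<dots> = (\<Sum>l<n. G (rotate (Suc l) L)) + G (rotate (Suc n) L)" by (rule sum.lessThan_Suc)
  also have "rotate (Suc n) L = L" using rotate_conv_mod[of "Suc n" L] Suc by simp
  also have "(\<Sum>l<n. G (rotate (Suc l) L)) + G L = (\<Sum>l<Suc n. G (rotate l L))"
    unfolding sum.lessThan_Suc_shift by simp
  finally show ?thesis unfolding Suc .
qed simp

context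
  fixes \<tau> :: "nat \<Rightarrow> nat" and P Q :: "nat set" and i :: nat
  assumes tc: "two_cycles \<tau> P Q" and iP: "i \<in> P" and ne: "\<tau> i \<noteq> i"
begin

lemma merged_point: "\<tau> i \<in> P" "\<tau> i \<notin> Q" "i \<notin> Q" "i \<in> P \<union> Q" "P \<union> Q - {\<tau> i} = (P - {\<tau> i}) \<union> Q"
proof -
  note t = two_cyclesD[OF tc]
  show e: "\<tau> i \<in> P" using t(11) iP by (simp add: closed_under_def)
  then show "\<tau> i \<notin> Q" "i \<notin> Q" "i \<in> P \<union> Q" "P \<union> Q - {\<tau> i} = (P - {\<tau> i}) \<union> Q"
    using t(4) iP by blast+
qed

text \<open>Tells which diagrams stay disconnected: joining \<open>i\<close> to \<open>k\<close>
  makes a disconnected \<sigma> annular exactly for \<open>k\<close> on the other circle, while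
  splitting the cycle of \<open>i\<close> and merging \<open>i\<close> with its neighbour change
  nothing.\<close>

lemma closed_under_transpose:
  assumes s: "\<sigma> permutes P \<union> Q" "\<sigma> i = \<tau> i" and k: "k \<in> P \<union> Q"
  shows "closed_under \<sigma> P \<Longrightarrow> closed_under (\<sigma> \<circ> transpose i k) P \<longleftrightarrow> k \<in> P"
    and "k \<in> orbit \<sigma> i \<Longrightarrow> closed_under (\<sigma> \<circ> transpose i k) P \<longleftrightarrow> closed_under \<sigma> P"
    and "closed_under (\<sigma> \<circ> transpose i (\<tau> i)) (P - {\<tau> i}) \<longleftrightarrow> closed_under \<sigma> P"
proof -
  note t = two_cyclesD[OF tc] and m = merged_point
  let ?\<pi> = "\<sigma> \<circ> transpose i k"
  have p: "?\<pi> permutes P \<union> Q" using s k m(4) by (intro permutes_compose permutes_swap_id)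
  have kP: "k \<in> P" if "closed_under ?\<pi> P"
  proof (rule ccontr)
    assume "k \<notin> P"
    then have "k \<in> Q" using k by blast
    moreover have "closed_under ?\<pi> Q" by (rule closed_under_other[OF p t(7,4) that])
    ultimately have "?\<pi> k \<in> Q" unfolding closed_under_def by blast
    then show False using s(2) m(2) by simp
  qed
  have 1: "closed_under ?\<pi> P" if "closed_under \<sigma> P" "k \<in> P"
    using that iP by (auto simp: closed_under_def transpose_def)
  show "closed_under \<sigma> P \<Longrightarrow> closed_under ?\<pi> P \<longleftrightarrow> k \<in> P" using kP 1 by blast
  have 2: "closed_under \<sigma> P" if "closed_under ?\<pi> P"
  proof -
    have "\<sigma> c \<in> P" if c: "c \<in> P" for c
    proof -
      have "transpose i k c \<in> P" using c iP kP[OF \<open>closed_under ?\<pi> P\<close>] by (auto simp: transpose_def)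
      then have "?\<pi> (transpose i k c) \<in> P" using \<open>closed_under ?\<pi> P\<close> unfolding closed_under_def by blast
      then show ?thesis by simp
    qed
    then show ?thesis by (simp add: closed_under_def)
  qed
  show "closed_under ?\<pi> P \<longleftrightarrow> closed_under \<sigma> P" if "k \<in> orbit \<sigma> i"
    using 1 2 closed_under_orbit[of \<sigma> P i] iP that by blast
  let ?e = "\<tau> i"
  let ?r = "\<sigma> \<circ> transpose i ?e"
  show "closed_under ?r (P - {?e}) \<longleftrightarrow> closed_under \<sigma> P"
  proof
    assume c: "closed_under \<sigma> P"
    have "?r x \<in> P - {?e}" if x: "x \<in> P - {?e}" for x
    proof -
      have "transpose i ?e x \<in> P" using x iP m(1) by (auto simp: transpose_def)
      then have "?r x \<in> P" using c by (simp add: closed_under_def)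
      moreover have "?r x \<noteq> ?e"
      proof
        assume "?r x = ?e"
        then have "\<sigma> (transpose i ?e x) = \<sigma> i" using s(2) by simp
        then have "transpose i ?e x = i" using permutes_inj[OF s(1)] by (simp add: inj_eq)
        then show False using x by (auto simp: transpose_def split: if_splits)
      qed
      ultimately show ?thesis by blast
    qed
    then show "closed_under ?r (P - {?e})" by (simp add: closed_under_def)
  next
    assume c: "closed_under ?r (P - {?e})"
    have "\<sigma> x \<in> P" if x: "x \<in> P" for x
    proof -
      consider "x = i" | "x = ?e" | "x \<noteq> i" "x \<noteq> ?e" by blast
      then show ?thesis
      proof cases
        case 1
        then show ?thesis using s(2) m(1) by simp
      next
        case 2
        have "i \<in> P - {?e}" using iP ne by simp
        then have "?r i \<in> P - {?e}" by (rule c[unfolded closed_under_def, rule_format])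
        then show ?thesis using 2 by simp
      next
        case 3
        have "x \<in> P - {?e}" using x 3 by simp
        then have "?r x \<in> P - {?e}" by (rule c[unfolded closed_under_def, rule_format])
        then show ?thesis using 3 by (simp add: transpose_def)
      qed
    qed
    then show "closed_under \<sigma> P" by (simp add: closed_under_def)
  qed
qed

lemma two_cycles_merge:
  assumes "cyc \<tau> i = i # \<tau> i # w"
  defines "\<tau>' \<equiv> \<tau> \<circ> transpose i (\<tau> i)"
  shows "two_cycles \<tau>' (P - {\<tau> i}) Q" "cyc \<tau>' i = i # w" "b \<in> Q \<Longrightarrow> cyc \<tau>' b = cyc \<tau> b"
    "rev_on Q \<tau>' = rev_on Q \<tau> \<circ> transpose i (\<tau> i)"
proof -
  note t = two_cyclesD[OF tc] and m = merged_point
  let ?e = "\<tau> i"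
  have c: "cyc \<tau> i = i # [?e] @ w" using assms(1) by simp
  note sp = cyc_split[OF t(8) c, of \<tau>', unfolded \<tau>'_def, simplified]
  have orb: "orbit \<tau> i = P" by (rule t(13)[OF iP])
  have sP: "set (i # ?e # w) = P" using set_cyc[OF t(8), of i] unfolding assms(1) orb .
  have d: "distinct (i # ?e # w)" using distinct_cyc[OF t(8), of i] unfolding assms(1) .
  have p: "\<tau>' permutes P \<union> Q - {?e}"
  proof (rule permutes_superset)
    show "\<tau>' permutes P \<union> Q" unfolding \<tau>'_def using t(1) m by (intro permutes_compose permutes_swap_id) auto
    show "\<tau>' x = x" if "x \<in> P \<union> Q - (P \<union> Q - {?e})" for x using that unfolding \<tau>'_def by auto
  qed
  have pp: "permutation \<tau>'" unfolding \<tau>'_def by (rule permutation_comp_transpose[OF t(8)])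
  show "cyc \<tau>' i = i # w" unfolding \<tau>'_def by (rule sp(1))
  have agree: "\<tau>' x = \<tau> x" if "x \<in> Q" for x
    using that m unfolding \<tau>'_def by (auto simp: transpose_def)
  show "b \<in> Q \<Longrightarrow> cyc \<tau>' b = cyc \<tau> b" by (rule cyc_cong_closed(1)[OF t(8,12) agree])
  have "orbit \<tau>' i = P - {?e}" unfolding \<tau>'_def sp(3) using sP d by auto
  then have "cycle_partition \<tau>' (P - {?e}) = {P - {?e}}" using cycle_partition_orbit[OF pp, of i] by simp
  moreover have "cycle_partition \<tau>' Q = {Q}" using cycle_partition_cong_closed[OF t(8,12) agree] t(6) by simp
  ultimately show "two_cycles \<tau>' (P - {?e}) Q" using p m(5) t by (auto simp: two_cycles_def)
  show "rev_on Q \<tau>' = rev_on Q \<tau> \<circ> transpose i ?e"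
  proof
    fix x
    show "rev_on Q \<tau>' x = (rev_on Q \<tau> \<circ> transpose i ?e) x"
    proof (cases "x \<in> Q")
      case True
      have "inv \<tau> x \<in> Q" using closed_under_inv[OF t(8,12)] True by (simp add: closed_under_def)
      then have "inv \<tau>' x = inv \<tau> x"
        unfolding \<tau>'_def inv_comp_transpose[OF permutes_bij[OF t(1)]] using m by (auto simp: transpose_def)
      moreover have "transpose i ?e x = x" using True m by (auto simp: transpose_def)
      ultimately show ?thesis using True by (simp add: rev_on_def)
    next
      case False
      then have "transpose i ?e x \<notin> Q" using m by (auto simp: transpose_def)
      then show ?thesis using False by (simp add: rev_on_def \<tau>'_def)
    qed
  qed
qed

end

context second_order_cumulants
begin

text \<open>The fibres of unchanged genus cancel against the merged sum by the first-order product
  formula. What is left are disc diagrams with \<open>i\<close> joined to a label \<open>k\<close>;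
  only \<open>k\<close> on the other circle makes them annular.\<close>

lemma ann_sum_merge:
  assumes "two_cycles \<tau> P Q" "i \<in> P" "\<tau> i \<noteq> i"
  shows "ann_sum \<kappa> z \<tau> P Q - ann_sum \<kappa> (z(i := z i * z (\<tau> i))) (\<tau> \<circ> transpose i (\<tau> i)) (P - {\<tau> i}) Q =
    (\<Sum>\<sigma>\<in>NCGf (P \<union> Q) \<tau> i 2. \<Sum>k\<in>Q. cycle_prod \<kappa> z (\<sigma> \<circ> transpose i k) (P \<union> Q))"
proof -
  note t = two_cyclesD[OF assms(1)] and m = merged_point[OF assms]
  note cu = closed_under_transpose[OF assms]
  let ?S = "P \<union> Q" and ?e = "\<tau> i"
  let ?z = "z(i := z i * z ?e)"
  let ?f = "\<lambda>\<pi>. if closed_under \<pi> P then 0 else cycle_prod \<kappa> z \<pi> ?S"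
  let ?f' = "\<lambda>\<pi>. if closed_under \<pi> (P - {?e}) then 0 else cycle_prod \<kappa> ?z \<pi> (?S - {?e})"
  have "ann_sum \<kappa> z \<tau> P Q = (\<Sum>\<sigma>\<in>NCGf ?S \<tau> i 0. \<Sum>k\<in>orbit \<sigma> i. ?f (\<sigma> \<circ> transpose i k)) +
      (\<Sum>\<sigma>\<in>NCGf ?S \<tau> i 2. \<Sum>k\<in>?S - orbit \<sigma> i. ?f (\<sigma> \<circ> transpose i k))"
    unfolding ann_sum_def using sum_NCG_fibres[OF t(1,7) m(4), where f = ?f and m = 0, unfolded add_0] .
  moreover have "ann_sum \<kappa> ?z (\<tau> \<circ> transpose i ?e) (P - {?e}) Q = (\<Sum>\<sigma>\<in>NCGf ?S \<tau> i 0. ?f' (\<sigma> \<circ> transpose i ?e))"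
    unfolding ann_sum_def m(5)[symmetric] by (rule sum_NCG_merge[OF t(1,7) m(4) assms(3)])
  moreover have "(\<Sum>k\<in>orbit \<sigma> i. ?f (\<sigma> \<circ> transpose i k)) = ?f' (\<sigma> \<circ> transpose i ?e)"
    if s: "\<sigma> \<in> NCGf ?S \<tau> i 0" for \<sigma>
  proof -
    have s': "\<sigma> permutes ?S" "\<sigma> i = ?e" using s by (auto simp: NCGf_def NCG_permutes)
    note sp = permutes_permutation[OF s'(1) t(7)]
    have sub: "orbit \<sigma> i \<subseteq> ?S" by (rule permutes_orbit_subset[OF s'(1) m(4)])
    have eS: "?e \<in> ?S" using m(1) by blast
    show ?thesis
    proof (cases "closed_under \<sigma> P")
      case True
      have "?f (\<sigma> \<circ> transpose i k) = 0" if "k \<in> orbit \<sigma> i" for k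
        using cu(2)[OF s' _ that] that sub True by auto
      then show ?thesis using cu(3)[OF s' eS] True by simp
    next
      case False
      have "(\<Sum>k\<in>orbit \<sigma> i. ?f (\<sigma> \<circ> transpose i k)) = (\<Sum>k\<in>orbit \<sigma> i. cycle_prod \<kappa> z (\<sigma> \<circ> transpose i k) ?S)"
        using cu(2)[OF s'] sub False by (intro sum.cong refl) auto
      moreover have "\<sigma> i \<noteq> i" using s'(2) assms(3) by simp
      then obtain w where "cyc \<sigma> i = i # ?e # w" using cyc_Cons2[OF sp] s'(2) by metis
      note cycle_prod_merge(1)[OF sp closed_under_permutes[OF s'(1)] t(7) m(4) this rotation_invariant, of z]
      ultimately show ?thesis using cu(3)[OF s' eS] False by (simp add: merge_defect_zero)
    qed
  qed
  moreover have "(\<Sum>k\<in>?S - orbit \<sigma> i. ?f (\<sigma> \<circ> transpose i k)) = (\<Sum>k\<in>Q. cycle_prod \<kappa> z (\<sigma> \<circ> transpose i k) ?S)"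
    if s: "\<sigma> \<in> NCGf ?S \<tau> i 2" for \<sigma>
  proof -
    have s': "\<sigma> \<in> NCG ?S \<tau> 2" "\<sigma> i = ?e" using s by (auto simp: NCGf_def)
    note c = NCG_disc_closed[OF assms(1) s'(1)]
    have sub: "orbit \<sigma> i \<subseteq> P" by (rule closed_under_orbit[OF c(3) assms(2)])
    have "(\<Sum>k\<in>?S - orbit \<sigma> i. ?f (\<sigma> \<circ> transpose i k)) = (\<Sum>k\<in>Q. ?f (\<sigma> \<circ> transpose i k))"
    proof (rule sum.mono_neutral_right)
      show "finite (?S - orbit \<sigma> i)" using t(7) by simp
      show "Q \<subseteq> ?S - orbit \<sigma> i" using sub t(4) by blast
      show "\<forall>k\<in>?S - orbit \<sigma> i - Q. ?f (\<sigma> \<circ> transpose i k) = 0" using cu(1)[OF c(1) s'(2) _ c(3)] by auto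
    qed
    also have "\<dots> = (\<Sum>k\<in>Q. cycle_prod \<kappa> z (\<sigma> \<circ> transpose i k) ?S)"
      using cu(1)[OF c(1) s'(2) _ c(3)] t(4) by (intro sum.cong refl) auto
    finally show ?thesis .
  qed
  ultimately show ?thesis by simp
qed

text \<open>Two circles allow at most \<open>m = 2\<close>, so no joined diagrams occur. The
  transposition acts on \<open>P\<close> alone, and for each fixed \<open>D\<close> the difference
  is the derivative of the first-order formula.\<close>

lemma disc_sum_merge:
  assumes "two_cycles \<tau> P Q" "i \<in> P" "\<tau> i \<noteq> i"
  shows "disc_sum \<kappa> \<kappa>2 z \<tau> P Q - disc_sum \<kappa> \<kappa>2 (z(i := z i * z (\<tau> i))) (\<tau> \<circ> transpose i (\<tau> i)) (P - {\<tau> i}) Q =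
    (\<Sum>\<sigma>\<in>NCGf (P \<union> Q) \<tau> i 2. \<Sum>D\<in>cycle_partition \<sigma> Q.
      merge_defect_deriv \<kappa> (\<lambda>l. \<kappa>2 l (map z (cyc \<sigma> (Min D)))) (z i) (z (\<tau> i)) (map z (drop 2 (cyc \<sigma> i))) *
      (cycle_prod \<kappa> z \<sigma> (P - orbit \<sigma> i) * cycle_prod \<kappa> z \<sigma> (Q - D)))"
proof -
  note t = two_cyclesD[OF assms(1)] and m = merged_point[OF assms]
  let ?S = "P \<union> Q" and ?e = "\<tau> i"
  let ?z = "z(i := z i * z ?e)"
  have "NCGf ?S \<tau> i (2 + 2) = {}"
  proof -
    have "\<sigma> \<notin> NCG ?S \<tau> (2 + 2)" for \<sigma>
      using genus_bound[of \<sigma> ?S \<tau>] t(1,7,15) by (auto simp: NCG_def)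
    then show ?thesis unfolding NCGf_def by blast
  qed
  then have "disc_sum \<kappa> \<kappa>2 z \<tau> P Q =
      (\<Sum>\<sigma>\<in>NCGf ?S \<tau> i 2. \<Sum>k\<in>orbit \<sigma> i. disc_term \<kappa> \<kappa>2 z (\<sigma> \<circ> transpose i k) P Q)"
    unfolding disc_sum_def
    using sum_NCG_fibres[OF t(1,7) m(4), where f = "\<lambda>\<pi>. disc_term \<kappa> \<kappa>2 z \<pi> P Q" and m = 2] by simp
  moreover have "disc_sum \<kappa> \<kappa>2 ?z (\<tau> \<circ> transpose i ?e) (P - {?e}) Q =
      (\<Sum>\<sigma>\<in>NCGf ?S \<tau> i 2. disc_term \<kappa> \<kappa>2 ?z (\<sigma> \<circ> transpose i ?e) (P - {?e}) Q)"
    unfolding disc_sum_def m(5)[symmetric] by (rule sum_NCG_merge[OF t(1,7) m(4) assms(3)])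
  moreover have "(\<Sum>k\<in>orbit \<sigma> i. disc_term \<kappa> \<kappa>2 z (\<sigma> \<circ> transpose i k) P Q) -
      disc_term \<kappa> \<kappa>2 ?z (\<sigma> \<circ> transpose i ?e) (P - {?e}) Q =
      (\<Sum>D\<in>cycle_partition \<sigma> Q.
        merge_defect_deriv \<kappa> (\<lambda>l. \<kappa>2 l (map z (cyc \<sigma> (Min D)))) (z i) (z ?e) (map z (drop 2 (cyc \<sigma> i))) *
        (cycle_prod \<kappa> z \<sigma> (P - orbit \<sigma> i) * cycle_prod \<kappa> z \<sigma> (Q - D)))"
    if s: "\<sigma> \<in> NCGf ?S \<tau> i 2" for \<sigma>
  proof -
    have s': "\<sigma> \<in> NCG ?S \<tau> 2" "\<sigma> i = ?e" using s by (auto simp: NCGf_def)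
    note c = NCG_disc_closed[OF assms(1) s'(1)]
    have sub: "orbit \<sigma> i \<subseteq> P" by (rule closed_under_orbit[OF c(3) assms(2)])
    have "\<sigma> i \<noteq> i" using s'(2) assms(3) by simp
    then obtain w where w: "cyc \<sigma> i = i # ?e # w" using cyc_Cons2[OF c(2)] s'(2) by metis
    have eo: "?e \<in> orbit \<sigma> i" using orbit.base[of \<sigma> i] s'(2) by simp
    have dt: "disc_term \<kappa> \<kappa>2 y (\<sigma> \<circ> transpose i k) P' Q = (\<Sum>D\<in>cycle_partition \<sigma> Q. cycle_prod \<kappa> z \<sigma> (Q - D) *
        cycle_deriv \<kappa> (\<lambda>l. \<kappa>2 l (map z (cyc \<sigma> (Min D)))) y (\<sigma> \<circ> transpose i k) P')"
      if k: "k \<in> orbit \<sigma> i" and y: "\<And>c. c \<in> Q \<Longrightarrow> y c = z c" for k y P'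
    proof -
      have agree: "(\<sigma> \<circ> transpose i k) c = \<sigma> c" if "c \<in> Q" for c
      proof -
        have "c \<noteq> i" "c \<noteq> k" using that m(3) k sub t(4) by auto
        then show ?thesis by (simp add: transpose_def)
      qed
      show ?thesis
        unfolding disc_term_def
      proof (rule sum.cong[OF cycle_partition_cong_closed[OF c(2,4) agree]])
        fix D assume D: "D \<in> cycle_partition \<sigma> Q"
        have "cyc (\<sigma> \<circ> transpose i k) (Min D) = cyc \<sigma> (Min D)"
          by (rule cyc_cong_closed(1)[OF c(2,4) agree Min_cycle_mem(2)[OF c(2,4) D]])
        moreover have "map y (cyc \<sigma> (Min D)) = map z (cyc \<sigma> (Min D))" by (rule map_cyc_Min_cong[OF c(2,4) D y])
        moreover have "cycle_prod \<kappa> y (\<sigma> \<circ> transpose i k) (Q - D) = cycle_prod \<kappa> z \<sigma> (Q - D)"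
          by (rule cycle_prod_cong[OF c(2) closed_under_Diff[OF c(2,4) cycle_partition_memD(3)[OF c(2,4) D]]])
            (use agree y in auto)
        ultimately show "cycle_prod \<kappa> y (\<sigma> \<circ> transpose i k) (Q - D) *
          cycle_deriv \<kappa> (\<lambda>l. \<kappa>2 l (map y (cyc (\<sigma> \<circ> transpose i k) (Min D)))) y (\<sigma> \<circ> transpose i k) P' =
          cycle_prod \<kappa> z \<sigma> (Q - D) *
          cycle_deriv \<kappa> (\<lambda>l. \<kappa>2 l (map z (cyc \<sigma> (Min D)))) y (\<sigma> \<circ> transpose i k) P'" by (simp only:)
      qed
    qed
    have "(\<Sum>k\<in>orbit \<sigma> i. disc_term \<kappa> \<kappa>2 z (\<sigma> \<circ> transpose i k) P Q) =
        (\<Sum>k\<in>orbit \<sigma> i. \<Sum>D\<in>cycle_partition \<sigma> Q. cycle_prod \<kappa> z \<sigma> (Q - D) *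
          cycle_deriv \<kappa> (\<lambda>l. \<kappa>2 l (map z (cyc \<sigma> (Min D)))) z (\<sigma> \<circ> transpose i k) P)"
      by (intro sum.cong refl dt)
    also have "\<dots> = (\<Sum>D\<in>cycle_partition \<sigma> Q. cycle_prod \<kappa> z \<sigma> (Q - D) *
        (\<Sum>k\<in>orbit \<sigma> i. cycle_deriv \<kappa> (\<lambda>l. \<kappa>2 l (map z (cyc \<sigma> (Min D)))) z (\<sigma> \<circ> transpose i k) P))"
      unfolding sum_distrib_left by (rule sum.swap)
    finally have 1: "(\<Sum>k\<in>orbit \<sigma> i. disc_term \<kappa> \<kappa>2 z (\<sigma> \<circ> transpose i k) P Q) = \<dots>" .
    have y: "?z c = z c" if "c \<in> Q" for c using that m(3) by auto
    have 2: "disc_term \<kappa> \<kappa>2 ?z (\<sigma> \<circ> transpose i ?e) (P - {?e}) Q = (\<Sum>D\<in>cycle_partition \<sigma> Q. cycle_prod \<kappa> z \<sigma> (Q - D) *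
        cycle_deriv \<kappa> (\<lambda>l. \<kappa>2 l (map z (cyc \<sigma> (Min D)))) ?z (\<sigma> \<circ> transpose i ?e) (P - {?e}))"
      by (rule dt[OF eo y])
    show ?thesis
      unfolding 1 2 sum_subtractf[symmetric] right_diff_distrib[symmetric]
    proof (rule sum.cong[OF refl])
      fix D
      show "cycle_prod \<kappa> z \<sigma> (Q - D) *
          ((\<Sum>k\<in>orbit \<sigma> i. cycle_deriv \<kappa> (\<lambda>l. \<kappa>2 l (map z (cyc \<sigma> (Min D)))) z (\<sigma> \<circ> transpose i k) P) -
           cycle_deriv \<kappa> (\<lambda>l. \<kappa>2 l (map z (cyc \<sigma> (Min D)))) ?z (\<sigma> \<circ> transpose i ?e) (P - {?e})) =
        merge_defect_deriv \<kappa> (\<lambda>l. \<kappa>2 l (map z (cyc \<sigma> (Min D)))) (z i) (z ?e) (map z (drop 2 (cyc \<sigma> i))) *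
        (cycle_prod \<kappa> z \<sigma> (P - orbit \<sigma> i) * cycle_prod \<kappa> z \<sigma> (Q - D))"
        unfolding cycle_prod_merge(2)[OF c(2,3) t(2) assms(2) w rotation_invariant
            rotation_invariant2D(1)[OF rotation_invariant2] merge_defect_zero]
        using w by simp
    qed
  qed
  ultimately show ?thesis by (simp add: sum_subtractf[symmetric])
qed

text \<open>Joining \<open>i\<close> to each label of a cycle \<open>D\<close> of the other circle
  inserts every rotation of \<open>D\<close> behind \<open>i\<close>.\<close>

lemma sum_join:
  assumes "permutation \<sigma>" "closed_under \<sigma> P" "closed_under \<sigma> Q" "finite P" "finite Q" "P \<inter> Q = {}" "i \<in> P"
    "cyc \<sigma> i = i # v"
  shows "(\<Sum>k\<in>Q. cycle_prod \<kappa> z (\<sigma> \<circ> transpose i k) (P \<union> Q)) =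
    (\<Sum>D\<in>cycle_partition \<sigma> Q. (\<Sum>l<length (cyc \<sigma> (Min D)).
      \<kappa> (z i # rotate l (map z (cyc \<sigma> (Min D))) @ map z v)) *
      (cycle_prod \<kappa> z \<sigma> (P - orbit \<sigma> i) * cycle_prod \<kappa> z \<sigma> (Q - D)))"
proof -
  let ?F = "\<lambda>D l. \<kappa> (z i # map z l @ map z v) * (cycle_prod \<kappa> z \<sigma> (P - orbit \<sigma> i) * cycle_prod \<kappa> z \<sigma> (Q - D))"
  have sub: "orbit \<sigma> i \<subseteq> P" by (rule closed_under_orbit[OF assms(2,7)])
  have "(\<Sum>k\<in>Q. cycle_prod \<kappa> z (\<sigma> \<circ> transpose i k) (P \<union> Q)) = (\<Sum>k\<in>Q. ?F (orbit \<sigma> k) (cyc \<sigma> (\<sigma> k)))"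
  proof (rule sum.cong[OF refl])
    fix k assume k: "k \<in> Q"
    have subk: "orbit \<sigma> k \<subseteq> Q" by (rule closed_under_orbit[OF assms(3) k])
    have "k \<notin> orbit \<sigma> i" using k sub assms(6) by blast
    then have "cycle_prod \<kappa> z (\<sigma> \<circ> transpose i k) (P \<union> Q) =
        \<kappa> (z i # map z (cyc \<sigma> (\<sigma> k)) @ map z v) * cycle_prod \<kappa> z \<sigma> (P \<union> Q - orbit \<sigma> i - orbit \<sigma> k)"
      using assms k by (intro cycle_prod_join rotation_invariant closed_under_Un) auto
    also have "P \<union> Q - orbit \<sigma> i - orbit \<sigma> k = (P - orbit \<sigma> i) \<union> (Q - orbit \<sigma> k)"
      using sub subk assms(6) by blast
    also have "cycle_prod \<kappa> z \<sigma> \<dots> = cycle_prod \<kappa> z \<sigma> (P - orbit \<sigma> i) * cycle_prod \<kappa> z \<sigma> (Q - orbit \<sigma> k)"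
      using assms by (intro cycle_prod_Un closed_under_Diff closed_under_is_orbit) auto
    finally show "cycle_prod \<kappa> z (\<sigma> \<circ> transpose i k) (P \<union> Q) = ?F (orbit \<sigma> k) (cyc \<sigma> (\<sigma> k))" .
  qed
  also have "\<dots> = (\<Sum>D\<in>cycle_partition \<sigma> Q. \<Sum>l<length (cyc \<sigma> (Min D)). ?F D (rotate l (cyc \<sigma> (Min D))))"
    by (rule sum_cycles_rotate[OF assms(1,3,5)])
  finally show ?thesis by (simp add: rotate_map sum_distrib_right)
qed

text \<open>The failure of the product formula for \<open>\<kappa>2\<close>. The two extra sums come
  from annular diagrams in which the whole second circle, in either orientation, sits between
  \<open>a\<close> and \<open>b\<close>; undoing the join turns these into disc diagrams.\<close>

definition merge_defect2 :: "'a \<Rightarrow> 'a \<Rightarrow> 'a list \<Rightarrow> 'a list \<Rightarrow> complex" where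
  "merge_defect2 a b w y = merge_defect_deriv \<kappa> (\<lambda>l. \<kappa>2 l y) a b w +
     (\<Sum>l<length y. \<kappa> (a # rotate l y @ b # w)) +
     (\<Sum>l<length y. \<kappa> (a # rotate l (map tr (rev y)) @ b # w))"

lemma sum_join_rev_on:
  assumes "two_cycles \<tau> P Q" "\<sigma> \<in> NCG (P \<union> Q) \<tau> 2" "i \<in> P" "cyc \<sigma> i = i # v"
  shows "(\<Sum>k\<in>Q. cycle_prod \<kappa> (transpose_on Q z) (rev_on Q \<sigma> \<circ> transpose i k) (P \<union> Q)) =
    (\<Sum>D\<in>cycle_partition \<sigma> Q. (\<Sum>l<length (cyc \<sigma> (Min D)).
      \<kappa> (z i # rotate l (map tr (rev (map z (cyc \<sigma> (Min D))))) @ map z v)) *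
      (cycle_prod \<kappa> z \<sigma> (P - orbit \<sigma> i) * cycle_prod \<kappa> z \<sigma> (Q - D)))"
proof -
  note t = two_cyclesD[OF assms(1)] and c = NCG_disc_closed[OF assms(1,2)]
  let ?s = "rev_on Q \<sigma>" and ?y = "transpose_on Q z"
  note r = rev_on_permutes[OF t(7,4) c(1,3,4)] and rc = rev_on_cyc[OF t(7,4) c(1,3,4)]
  note rp = permutes_permutation[OF r(1) t(7)]
  have iQ: "i \<notin> Q" using assms(3) t(4) by blast
  have yP: "?y x = z x" if "x \<in> P" for x using that t(4) by (auto simp: transpose_on_def)
  have yQ: "?y x = (tr \<circ> z) x" if "x \<in> Q" for x using that by (simp add: transpose_on_def)
  have sP: "?s x = \<sigma> x" if "x \<in> P" for x using that t(4) by (auto simp: rev_on_def)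
  have sQ: "?s x = inv \<sigma> x" if "x \<in> Q" for x using that by (simp add: rev_on_def)
  have "cyc ?s i = i # v" using rc(1)[OF assms(3)] assms(4) by simp
  note J = sum_join[OF rp r(2,3) t(2,3,4) assms(3) this, of ?y]
  have cp: "cycle_partition ?s Q = cycle_partition \<sigma> Q"
    unfolding cycle_partition_def using rc(3) by (auto cong: image_cong)
  have o: "orbit ?s i = orbit \<sigma> i" using rc(3) assms(3) by blast
  have "set (i # v) \<subseteq> P" using set_cyc_closed[OF c(2,3) assms(3)] assms(4) by simp
  then have mv: "map ?y v = map z v" "?y i = z i" using yP by auto
  have KP: "cycle_prod \<kappa> ?y ?s (P - orbit \<sigma> i) = cycle_prod \<kappa> z \<sigma> (P - orbit \<sigma> i)"
    by (rule cycle_prod_cong[OF c(2) closed_under_Diff[OF c(2,3) closed_under_is_orbit]]) (use yP sP in auto)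
  show ?thesis
    unfolding J cp o mv KP
  proof (rule sum.cong[OF refl])
    fix D assume D: "D \<in> cycle_partition \<sigma> Q"
    note DD = cycle_partition_memD[OF c(2,4) D] and M = Min_cycle_mem[OF c(2,4) D]
    have ci: "closed_under (inv \<sigma>) (Q - D)"
      by (rule closed_under_inv[OF c(2) closed_under_Diff[OF c(2,4) DD(3)]])
    have "cycle_prod \<kappa> ?y ?s (Q - D) = cycle_prod \<kappa> (tr \<circ> z) (inv \<sigma>) (Q - D)"
      by (rule cycle_prod_cong[OF permutation_inverse[OF c(2)] ci]) (use yQ sQ in auto)
    then have KQ: "cycle_prod \<kappa> ?y ?s (Q - D) = cycle_prod \<kappa> z \<sigma> (Q - D)" using cycle_prod_tr[OF c(2)] by simp
    obtain u where u: "cyc \<sigma> (Min D) = Min D # u" by (rule cyc_Cons[OF c(2)])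
    have uQ: "set (Min D # u) \<subseteq> Q" using set_cyc_closed[OF c(2,4) M(2)] u by simp
    have L: "cyc ?s (Min D) = Min D # rev u" using rc(2)[OF M(2)] cyc_inv[OF c(2) u] by simp
    have "map ?y (rev u) = map (tr \<circ> z) (rev u)" "?y (Min D) = tr (z (Min D))"
      using yQ uQ by (auto intro: map_cong)
    \<comment> \<open>The inverted cycle is also read from \<open>Min D\<close>, so it differs from
      the reversed list by one rotation. This does not matter, since all rotations are summed
      over.\<close>
    then have L': "rotate1 (map ?y (cyc ?s (Min D))) = map tr (rev (map z (cyc \<sigma> (Min D))))"
      unfolding L u by (simp add: rev_map)
    have len: "length (map ?y (cyc ?s (Min D))) = length (cyc \<sigma> (Min D))" unfolding L u by simp
    have "(\<Sum>l<length (cyc ?s (Min D)). \<kappa> (z i # rotate l (map ?y (cyc ?s (Min D))) @ map z v)) =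
        (\<Sum>l<length (cyc \<sigma> (Min D)). \<kappa> (z i # rotate l (map tr (rev (map z (cyc \<sigma> (Min D))))) @ map z v))"
      using sum_rotate_rotate1[of "\<lambda>L. \<kappa> (z i # L @ map z v)" "map ?y (cyc ?s (Min D))"]
      unfolding L' len[symmetric] by simp
    then show "(\<Sum>l<length (cyc ?s (Min D)). \<kappa> (z i # rotate l (map ?y (cyc ?s (Min D))) @ map z v)) *
        (cycle_prod \<kappa> z \<sigma> (P - orbit \<sigma> i) * cycle_prod \<kappa> ?y ?s (Q - D)) =
      (\<Sum>l<length (cyc \<sigma> (Min D)). \<kappa> (z i # rotate l (map tr (rev (map z (cyc \<sigma> (Min D))))) @ map z v)) *
        (cycle_prod \<kappa> z \<sigma> (P - orbit \<sigma> i) * cycle_prod \<kappa> z \<sigma> (Q - D))"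
      unfolding KQ by simp
  qed
qed

text \<open>The second-order counterpart of \<open>merge_defect_zero\<close>: both argument lists
  have the same moment, so the differences of the two annular sums and the disc sum add up to zero.
  All of them are sums over disc diagrams \<sigma>, and collecting the terms of each pair \<sigma>,
  \<open>D\<close> leaves a defect times first-order factors.\<close>

lemma merge_defect2_zero: "merge_defect2 a b w y = 0"
proof (induction "length w + length y" arbitrary: a b w y rule: less_induct)
  case less
  show ?case
  proof (cases "y = []")
    case True
    then show ?thesis by (simp add: merge_defect2_def merge_defect_deriv_def \<kappa>2_Nil)
  next
    case False
    let ?xs = "a # b # w"
    let ?p = "length ?xs" and ?q = "length y"
    define \<tau> where "\<tau> = tau2 ?p ?q"
    define z where "z = (\<lambda>c. (?xs @ y) ! (c - 1))"
    define P where "P = {1..?p}"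
    define Q where "Q = {?p+1..?p+?q}"
    define i where "i = (1::nat)"
    define b0 where "b0 = ?p + 1"
    have pq: "?p > 0" "?q > 0" using False by auto
    have tc: "two_cycles \<tau> P Q" unfolding \<tau>_def P_def Q_def by (rule two_cycles_tau2[OF pq])
    note t = two_cyclesD[OF tc]
    have "1 \<le> ?q" using pq by linarith
    then have iP: "i \<in> P" and bQ: "b0 \<in> Q" by (auto simp: i_def P_def Q_def b0_def)
    have "Min Q = b0" using \<open>1 \<le> ?q\<close> unfolding Q_def b0_def by (intro Min_eqI) auto
    have mx: "map z (cyc \<tau> i) = ?xs" and my: "map z (cyc \<tau> b0) = y"
      using map_cyc_tau2[of ?xs y] False unfolding \<tau>_def z_def i_def b0_def by simp_all
    have ne: "\<tau> i \<noteq> i"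
    proof
      assume "\<tau> i = i"
      then have "orbit \<tau> i = {i}" by (simp add: orbit_eq_singleton_iff)
      then have "length (cyc \<tau> i) = 1" using length_cyc[OF t(8), of i] by simp
      then show False using arg_cong[OF mx, of length] by simp
    qed
    define e where "e = \<tau> i"
    obtain r where r: "cyc \<tau> i = i # e # r" unfolding e_def by (rule cyc_Cons2[OF t(8) ne])
    have zi: "z i = a" "z e = b" "map z r = w" using mx unfolding r by simp_all
    define z' where "z' = z(i := z i * z e)"
    define \<tau>' where "\<tau>' = \<tau> \<circ> transpose i e"
    note mg = two_cycles_merge[OF tc iP ne r[unfolded e_def], folded e_def, folded \<tau>'_def]
    note m = merged_point[OF tc iP ne, folded e_def]
    have dr: "distinct (i # e # r)" using distinct_cyc[OF t(8), of i] unfolding r .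
    have iP': "i \<in> P - {e}" using iP ne e_def by simp
    have "map z' (cyc \<tau>' i) = (a * b) # w"
    proof -
      have "map z' r = map z r" using dr by (intro map_cong) (auto simp: z'_def)
      then show ?thesis unfolding mg(2) using zi by (simp add: z'_def)
    qed
    moreover have "map z' (cyc \<tau>' b0) = y"
    proof -
      have "set (cyc \<tau> b0) \<subseteq> Q" by (rule set_cyc_closed[OF t(8,12) bQ])
      then have "map z' (cyc \<tau> b0) = map z (cyc \<tau> b0)" using m(3) by (intro map_cong) (auto simp: z'_def)
      then show ?thesis unfolding mg(3)[OF bQ] my .
    qed
    ultimately have M': "\<phi>2 (prod_list ?xs) (prod_list y) = ann_sum \<kappa> z' \<tau>' (P - {e}) Q +
        ann_sum \<kappa> (transpose_on Q z') (rev_on Q \<tau>') (P - {e}) Q + disc_sum \<kappa> \<kappa>2 z' \<tau>' (P - {e}) Q"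
      using moment2[OF mg(1) iP' bQ, of z'] by (simp add: mult.assoc)
    have M: "\<phi>2 (prod_list ?xs) (prod_list y) = ann_sum \<kappa> z \<tau> P Q +
        ann_sum \<kappa> (transpose_on Q z) (rev_on Q \<tau>) P Q + disc_sum \<kappa> \<kappa>2 z \<tau> P Q"
      using moment2[OF tc iP bQ, of z] unfolding mx my .
    let ?S = "P \<union> Q"
    let ?N = "NCGf ?S \<tau> i 2"
    have A: "ann_sum \<kappa> z \<tau> P Q - ann_sum \<kappa> z' \<tau>' (P - {e}) Q =
        (\<Sum>\<sigma>\<in>?N. \<Sum>k\<in>Q. cycle_prod \<kappa> z (\<sigma> \<circ> transpose i k) ?S)"
      using ann_sum_merge[OF tc iP ne, of z] unfolding e_def z'_def \<tau>'_def .
    have R: "ann_sum \<kappa> (transpose_on Q z) (rev_on Q \<tau>) P Q - ann_sum \<kappa> (transpose_on Q z') (rev_on Q \<tau>') (P - {e}) Q =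
        (\<Sum>\<sigma>\<in>?N. \<Sum>k\<in>Q. cycle_prod \<kappa> (transpose_on Q z) (rev_on Q \<sigma> \<circ> transpose i k) ?S)"
    proof -
      have ri: "rev_on Q \<tau> i = e" using m(3) by (simp add: rev_on_def e_def)
      have "transpose_on Q z' = (transpose_on Q z)(i := transpose_on Q z i * transpose_on Q z e)"
        using m(2,3) by (auto simp: transpose_on_def z'_def fun_eq_iff)
      then show ?thesis
        using ann_sum_merge[OF two_cycles_rev_on[OF tc] iP, of "transpose_on Q z"] ne
        unfolding ri mg(4) sum_NCGf_rev_on[OF tc iP] e_def by simp
    qed
    have B: "disc_sum \<kappa> \<kappa>2 z \<tau> P Q - disc_sum \<kappa> \<kappa>2 z' \<tau>' (P - {e}) Q =
      (\<Sum>\<sigma>\<in>?N. \<Sum>D\<in>cycle_partition \<sigma> Q.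
        merge_defect_deriv \<kappa> (\<lambda>l. \<kappa>2 l (map z (cyc \<sigma> (Min D)))) a b (map z (drop 2 (cyc \<sigma> i))) *
        (cycle_prod \<kappa> z \<sigma> (P - orbit \<sigma> i) * cycle_prod \<kappa> z \<sigma> (Q - D)))"
      using disc_sum_merge[OF tc iP ne, of z] zi(1,2) unfolding e_def z'_def \<tau>'_def by simp
    \<comment> \<open>Subtracting the two expansions of the common moment; the three inner sums are
      those of \<open>A\<close>, \<open>R\<close> and \<open>B\<close>.\<close>
    have "0 = (\<Sum>\<sigma>\<in>?N. (\<Sum>k\<in>Q. cycle_prod \<kappa> z (\<sigma> \<circ> transpose i k) ?S) +
        (\<Sum>k\<in>Q. cycle_prod \<kappa> (transpose_on Q z) (rev_on Q \<sigma> \<circ> transpose i k) ?S) +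
        (\<Sum>D\<in>cycle_partition \<sigma> Q.
          merge_defect_deriv \<kappa> (\<lambda>l. \<kappa>2 l (map z (cyc \<sigma> (Min D)))) a b (map z (drop 2 (cyc \<sigma> i))) *
          (cycle_prod \<kappa> z \<sigma> (P - orbit \<sigma> i) * cycle_prod \<kappa> z \<sigma> (Q - D))))"
      unfolding sum.distrib A[symmetric] R[symmetric] B[symmetric] using M M' by (simp add: algebra_simps)
    also have "\<dots> = (\<Sum>\<sigma>\<in>?N. \<Sum>D\<in>cycle_partition \<sigma> Q.
        merge_defect2 a b (map z (drop 2 (cyc \<sigma> i))) (map z (cyc \<sigma> (Min D))) *
        (cycle_prod \<kappa> z \<sigma> (P - orbit \<sigma> i) * cycle_prod \<kappa> z \<sigma> (Q - D)))"
    proof (rule sum.cong[OF refl])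
      fix \<sigma> assume "\<sigma> \<in> ?N"
      then have s: "\<sigma> \<in> NCG ?S \<tau> 2" "\<sigma> i = e" by (auto simp: NCGf_def e_def)
      note c = NCG_disc_closed[OF tc s(1)]
      have "\<sigma> i \<noteq> i" using s(2) ne e_def by simp
      then obtain v where v: "cyc \<sigma> i = i # e # v" using cyc_Cons2[OF c(2)] s(2) by metis
      show "(\<Sum>k\<in>Q. cycle_prod \<kappa> z (\<sigma> \<circ> transpose i k) ?S) +
        (\<Sum>k\<in>Q. cycle_prod \<kappa> (transpose_on Q z) (rev_on Q \<sigma> \<circ> transpose i k) ?S) +
        (\<Sum>D\<in>cycle_partition \<sigma> Q.
          merge_defect_deriv \<kappa> (\<lambda>l. \<kappa>2 l (map z (cyc \<sigma> (Min D)))) a b (map z (drop 2 (cyc \<sigma> i))) *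
          (cycle_prod \<kappa> z \<sigma> (P - orbit \<sigma> i) * cycle_prod \<kappa> z \<sigma> (Q - D))) =
        (\<Sum>D\<in>cycle_partition \<sigma> Q.
          merge_defect2 a b (map z (drop 2 (cyc \<sigma> i))) (map z (cyc \<sigma> (Min D))) *
          (cycle_prod \<kappa> z \<sigma> (P - orbit \<sigma> i) * cycle_prod \<kappa> z \<sigma> (Q - D)))"
        unfolding sum_join[OF c(2,3,4) t(2,3,4) iP v] sum_join_rev_on[OF tc s(1) iP v] sum.distrib[symmetric]
        by (rule sum.cong[OF refl]) (simp add: merge_defect2_def v zi(1,2) distrib_right)
    qed
    \<comment> \<open>Unless \<sigma> is \<tau>, the cycle of \<open>i\<close> and the cycle
      \<open>D\<close> do not both fill their circles, and the induction hypothesis makes the defect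
      vanish.\<close>
    also have "\<dots> = (\<Sum>\<sigma>\<in>?N. if \<sigma> = \<tau> then merge_defect2 a b w y else 0)"
    proof (rule sum.cong[OF refl])
      fix \<sigma> assume "\<sigma> \<in> ?N"
      then have s: "\<sigma> \<in> NCG ?S \<tau> 2" "\<sigma> i = e" by (auto simp: NCGf_def e_def)
      note c = NCG_disc_closed[OF tc s(1)]
      show "(\<Sum>D\<in>cycle_partition \<sigma> Q.
          merge_defect2 a b (map z (drop 2 (cyc \<sigma> i))) (map z (cyc \<sigma> (Min D))) *
          (cycle_prod \<kappa> z \<sigma> (P - orbit \<sigma> i) * cycle_prod \<kappa> z \<sigma> (Q - D))) =
        (if \<sigma> = \<tau> then merge_defect2 a b w y else 0)"
      proof (cases "\<sigma> = \<tau>")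
        case True
        have "map z (drop 2 (cyc \<tau> i)) = w" unfolding r using zi(3) by simp
        then show ?thesis
          unfolding True t(6) t(13)[OF iP] using my by (simp add: \<open>Min Q = b0\<close>)
      next
        case False
        have "merge_defect2 a b (map z (drop 2 (cyc \<sigma> i))) (map z (cyc \<sigma> (Min D))) = 0"
          if D: "D \<in> cycle_partition \<sigma> Q" for D
        proof (rule less.hyps)
          have o: "orbit \<sigma> i \<in> cycle_partition \<sigma> P" unfolding cycle_partition_def by (rule imageI[OF iP])
          have "card (orbit \<sigma> i) + card D < card P + card Q" by (rule NCG_disc_cards[OF tc s(1) False o D])
          moreover have "card P = length w + 2" "card Q = length y" by (simp_all add: P_def Q_def)
          moreover have "\<sigma> i \<noteq> i" using s(2) ne e_def by simp
          then have "length (cyc \<sigma> i) \<ge> 2" using cyc_Cons2[OF c(2)] by (metis le_add2 length_Cons numeral_2_eq_2 plus_1_eq_Suc Suc_le_mono le0)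
          ultimately show "length (map z (drop 2 (cyc \<sigma> i))) + length (map z (cyc \<sigma> (Min D))) < length w + length y"
            using length_cyc[OF c(2), of i] length_cyc_Min[OF c(2,4) D] by simp
        qed
        then show ?thesis using False by simp
      qed
    qed
    also have "\<dots> = merge_defect2 a b w y"
    proof -
      have "\<tau> \<in> ?N" using NCG_self[OF t(1,15)] by (simp add: NCGf_def)
      moreover have "finite ?N" using finite_NCG[OF t(7), of \<tau> 2] by (simp add: NCGf_def)
      ultimately show ?thesis by (simp add: sum.delta')
    qed
    finally show ?thesis ..
  qed
qed

lemma cumulant2_merge:
  "\<kappa>2 ((a * b) # w) y = \<kappa>2 (a # b # w) y +
    (\<Sum>j\<le>length w. \<kappa>2 (a # drop j w) y * \<kappa> (b # take j w) + \<kappa> (a # drop j w) * \<kappa>2 (b # take j w) y) +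
    (\<Sum>l<length y. \<kappa> (a # rotate l y @ b # w)) +
    (\<Sum>l<length y. \<kappa> (a # rotate l (map tr (rev y)) @ b # w))"
  using merge_defect2_zero[of a b w y] by (simp add: merge_defect2_def merge_defect_deriv_def algebra_simps)

end

section \<open>Linearity and units\<close>

text \<open>Linearity for one relation, to be thought of as \<open>x = y + c u\<close>. It is stated
  through the values of \<open>k\<close> because the arguments of the cumulants are only assumed to
  form a monoid.\<close>

definition head_linear :: "'a \<Rightarrow> 'a \<Rightarrow> complex \<Rightarrow> 'a \<Rightarrow> ('a list \<Rightarrow> complex) \<Rightarrow> bool" where
  "head_linear x y c u k \<longleftrightarrow> (\<forall>w. k (x # w) = k (y # w) + c * k (u # w))"

context
  fixes \<pi> :: "nat \<Rightarrow> nat" and S :: "nat set" and i :: nat and x y u :: 'a and c :: complex and k :: "'a list \<Rightarrow> complex"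
  assumes perm: "permutation \<pi>" and closed: "closed_under \<pi> S" and fin: "finite S" and iS: "i \<in> S"
    and k: "rotation_invariant k" "head_linear x y c u k"
begin

lemma cycle_prod_update:
  "cycle_prod k' (z(i := v)) \<pi> (S - orbit \<pi> i) = cycle_prod k' z \<pi> (S - orbit \<pi> i)"
  "cycle_deriv k' h (z(i := v)) \<pi> (S - orbit \<pi> i) = cycle_deriv k' h z \<pi> (S - orbit \<pi> i)"
proof -
  have c: "closed_under \<pi> (S - orbit \<pi> i)" by (rule closed_under_Diff[OF perm closed closed_under_is_orbit])
  have "(z(i := v)) c = z c" if "c \<in> S - orbit \<pi> i" for c
    using that permutation_self_in_orbit[OF perm, of i] by auto
  note upd = this
  show "cycle_prod k' (z(i := v)) \<pi> (S - orbit \<pi> i) = cycle_prod k' z \<pi> (S - orbit \<pi> i)"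
    by (rule cycle_prod_cong[OF perm c refl upd])
  show "cycle_deriv k' h (z(i := v)) \<pi> (S - orbit \<pi> i) = cycle_deriv k' h z \<pi> (S - orbit \<pi> i)"
    by (rule cycle_deriv_cong[OF perm c refl upd])
qed

lemma map_cyc_update:
  obtains w where "\<And>v. map (z(i := v)) (cyc \<pi> i) = v # w"
proof -
  obtain r where r: "cyc \<pi> i = i # r" by (rule cyc_Cons[OF perm])
  have "i \<notin> set r" using distinct_cyc[OF perm, of i] r by simp
  then have "map (z(i := v)) (cyc \<pi> i) = v # map z r" for v unfolding r by simp
  then show thesis by (rule that)
qed

lemma cycle_prod_head_linear:
  "cycle_prod k (z(i := x)) \<pi> S = cycle_prod k (z(i := y)) \<pi> S + c * cycle_prod k (z(i := u)) \<pi> S"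
proof -
  obtain w where w: "\<And>v. map (z(i := v)) (cyc \<pi> i) = v # w" using map_cyc_update[of z] by blast
  have "cycle_prod k (z(i := v)) \<pi> S = k (v # w) * cycle_prod k z \<pi> (S - orbit \<pi> i)" for v
    unfolding cycle_prod_remove[OF k(1) perm closed fin iS] w cycle_prod_update(1) ..
  moreover have "k (x # w) = k (y # w) + c * k (u # w)" using k(2) by (simp add: head_linear_def)
  ultimately show ?thesis by (simp add: algebra_simps)
qed

lemma cycle_deriv_head_linear:
  assumes h: "rotation_invariant h" "head_linear x y c u h"
  shows "cycle_deriv k h (z(i := x)) \<pi> S = cycle_deriv k h (z(i := y)) \<pi> S + c * cycle_deriv k h (z(i := u)) \<pi> S"
proof -
  obtain w where w: "\<And>v. map (z(i := v)) (cyc \<pi> i) = v # w" using map_cyc_update[of z] by blast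
  have "cycle_deriv k h (z(i := v)) \<pi> S = h (v # w) * cycle_prod k z \<pi> (S - orbit \<pi> i) +
      k (v # w) * cycle_deriv k h z \<pi> (S - orbit \<pi> i)" for v
    unfolding cycle_deriv_remove[OF k(1) h(1) perm closed fin iS] w cycle_prod_update ..
  moreover have "k (x # w) = k (y # w) + c * k (u # w)" "h (x # w) = h (y # w) + c * h (u # w)"
    using k(2) h(2) by (simp_all add: head_linear_def)
  ultimately show ?thesis by (simp add: algebra_simps)
qed

end

lemma rotation_invariant_trunc: "rotation_invariant k \<Longrightarrow> rotation_invariant (trunc n k)"
  by (simp add: rotation_invariant_def trunc_def)

lemma rotation_invariant2_trunc2: "rotation_invariant2 k \<Longrightarrow> rotation_invariant2 (trunc2 n k)"
  by (simp add: rotation_invariant2_def trunc2_def)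

lemma nth_update_head:
  assumes "c \<ge> 1"
  shows "(v # w) ! (c - 1) = ((\<lambda>c. (u # w) ! (c - 1))(1 := v)) c"
  using assms by (auto simp: nth_Cons')

context tracial_cumulants
begin

text \<open>The relation between \<open>x\<close>, \<open>y\<close> and \<open>u\<close> is only
  visible in moments. In the recursion the moment has the head as its first factor, and the lower
  terms are linear by induction, since the head lies on exactly one cycle of each diagram.\<close>

lemma cumulant_linear:
  assumes "\<And>v. \<phi>1 (x * v) = \<phi>1 (y * v) + c * \<phi>1 (u * v)"
  shows "head_linear x y c u \<kappa>"
proof -
  have "\<kappa> (x # w) = \<kappa> (y # w) + c * \<kappa> (u # w)" for w
  proof (induction w rule: length_induct)
    case (1 w)
    let ?n = "Suc (length w)"
    let ?k = "trunc ?n \<kappa>"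
    let ?z = "\<lambda>c. (u # w) ! (c - 1)" and ?S = "{1..?n}"
    have ri: "rotation_invariant ?k" by (rule rotation_invariant_trunc[OF rotation_invariant])
    have hl: "head_linear x y c u ?k" using 1 by (simp add: head_linear_def trunc_def)
    have R: "\<kappa> (v # w) = \<phi>1 (v * prod_list w) -
        (\<Sum>\<pi>\<in>NCG ?S (tau ?n) 1. cycle_prod ?k (?z(1 := v)) \<pi> ?S)" for v
    proof -
      have "(\<Sum>\<pi>\<in>NCG ?S (tau ?n) 1. cycle_prod ?k (\<lambda>c. (v # w) ! (c - 1)) \<pi> ?S) =
          (\<Sum>\<pi>\<in>NCG ?S (tau ?n) 1. cycle_prod ?k (?z(1 := v)) \<pi> ?S)"
      proof (rule sum.cong[OF refl])
        fix \<pi> assume "\<pi> \<in> NCG ?S (tau ?n) 1"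
        then have p: "\<pi> permutes ?S" by (rule NCG_permutes)
        show "cycle_prod ?k (\<lambda>c. (v # w) ! (c - 1)) \<pi> ?S = cycle_prod ?k (?z(1 := v)) \<pi> ?S"
          by (rule cycle_prod_cong[OF permutes_permutation[OF p finite_atLeastAtMost] closed_under_permutes[OF p] refl nth_update_head]) auto
      qed
      then show ?thesis using cumulant_recursion[of "v # w"] by simp
    qed
    have "(\<Sum>\<pi>\<in>NCG ?S (tau ?n) 1. cycle_prod ?k (?z(1 := x)) \<pi> ?S) =
        (\<Sum>\<pi>\<in>NCG ?S (tau ?n) 1. cycle_prod ?k (?z(1 := y)) \<pi> ?S + c * cycle_prod ?k (?z(1 := u)) \<pi> ?S)"
    proof (rule sum.cong[OF refl])
      fix \<pi> assume "\<pi> \<in> NCG ?S (tau ?n) 1"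
      then have p: "\<pi> permutes ?S" by (rule NCG_permutes)
      show "cycle_prod ?k (?z(1 := x)) \<pi> ?S =
          cycle_prod ?k (?z(1 := y)) \<pi> ?S + c * cycle_prod ?k (?z(1 := u)) \<pi> ?S"
        by (rule cycle_prod_head_linear[OF permutes_permutation[OF p finite_atLeastAtMost] closed_under_permutes[OF p] _ _ ri hl]) auto
    qed
    then show ?case
      unfolding R assms by (simp add: sum.distrib sum_distrib_left algebra_simps)
  qed
  then show ?thesis by (simp add: head_linear_def)
qed

end

context second_order_cumulants
begin

text \<open>In the recursion the annular terms are linear by the first-order statement. The disc
  terms are linear by induction, where the head lies either in the truncated
  \<open>\<kappa>2\<close> or in a first-order factor.\<close>

lemma cumulant2_linear:
  assumes "\<And>v. \<phi>1 (x * v) = \<phi>1 (y * v) + c * \<phi>1 (u * v)"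
    and "\<And>v r. \<phi>2 (x * v) r = \<phi>2 (y * v) r + c * \<phi>2 (u * v) r"
  shows "\<kappa>2 (x # w) ys = \<kappa>2 (y # w) ys + c * \<kappa>2 (u # w) ys"
proof (induction "length w + length ys" arbitrary: w ys rule: less_induct)
  case less
  note hl = cumulant_linear[OF assms(1)]
  show ?case
  proof (cases "ys = []")
    case True
    then show ?thesis by (simp add: \<kappa>2_Nil)
  next
    case False
    let ?p = "Suc (length w)"
    let ?k2 = "trunc2 (?p + length ys) \<kappa>2"
    let ?P = "{1..?p}"
    have ri2: "rotation_invariant2 ?k2" by (rule rotation_invariant2_trunc2[OF rotation_invariant2])
    have hl2: "head_linear x y c u (\<lambda>l. ?k2 l ls)" for ls
      using less by (simp add: head_linear_def trunc2_def)
    have ann: "annular \<kappa> (x # w) ls = annular \<kappa> (y # w) ls + c * annular \<kappa> (u # w) ls" for ls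
    proof -
      let ?q = "length ls"
      let ?Q = "{?p+1..?p+?q}" and ?t = "tau2 ?p ?q" and ?z = "\<lambda>c. (u # (w @ ls)) ! (c - 1)"
      have A: "annular \<kappa> (v # w) ls = ann_sum \<kappa> (?z(1 := v)) ?t ?P ?Q" for v
      proof -
        have "annular \<kappa> (v # w) ls = ann_sum \<kappa> (\<lambda>c. (v # (w @ ls)) ! (c - 1)) ?t ?P ?Q"
          by (simp add: annular_def)
        also have "\<dots> = ann_sum \<kappa> (?z(1 := v)) ?t ?P ?Q"
          by (rule ann_sum_cong, simp, rule nth_update_head) auto
        finally show ?thesis .
      qed
      have "ann_sum \<kappa> (?z(1 := x)) ?t ?P ?Q =
          ann_sum \<kappa> (?z(1 := y)) ?t ?P ?Q + c * ann_sum \<kappa> (?z(1 := u)) ?t ?P ?Q"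
        unfolding ann_sum_def sum_distrib_left sum.distrib[symmetric]
      proof (rule sum.cong[OF refl])
        fix \<pi> assume "\<pi> \<in> NCG (?P \<union> ?Q) ?t 0"
        then have p: "\<pi> permutes ?P \<union> ?Q" by (rule NCG_permutes)
        have f: "finite (?P \<union> ?Q)" by simp
        have "cycle_prod \<kappa> (?z(1 := x)) \<pi> (?P \<union> ?Q) =
            cycle_prod \<kappa> (?z(1 := y)) \<pi> (?P \<union> ?Q) + c * cycle_prod \<kappa> (?z(1 := u)) \<pi> (?P \<union> ?Q)"
          by (rule cycle_prod_head_linear[OF permutes_permutation[OF p f] closed_under_permutes[OF p] f _ rotation_invariant hl]) auto
        then show "(if closed_under \<pi> ?P then 0 else cycle_prod \<kappa> (?z(1 := x)) \<pi> (?P \<union> ?Q)) =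
            (if closed_under \<pi> ?P then 0 else cycle_prod \<kappa> (?z(1 := y)) \<pi> (?P \<union> ?Q)) +
            c * (if closed_under \<pi> ?P then 0 else cycle_prod \<kappa> (?z(1 := u)) \<pi> (?P \<union> ?Q))" by simp
      qed
      then show ?thesis unfolding A .
    qed
    have "disc \<kappa> ?k2 (x # w) ys = disc \<kappa> ?k2 (y # w) ys + c * disc \<kappa> ?k2 (u # w) ys"
    proof -
      let ?q = "length ys"
      let ?Q = "{?p+1..?p+?q}" and ?t = "tau2 ?p ?q" and ?z = "\<lambda>c. (u # (w @ ys)) ! (c - 1)"
      have pq: "?p > 0" "?q > 0" using False by auto
      note tc = two_cycles_tau2[OF pq]
      note t = two_cyclesD[OF tc]
      have A: "disc \<kappa> ?k2 (v # w) ys = disc_sum \<kappa> ?k2 (?z(1 := v)) ?t ?P ?Q" for v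
      proof -
        have "disc \<kappa> ?k2 (v # w) ys = disc_sum \<kappa> ?k2 (\<lambda>c. (v # (w @ ys)) ! (c - 1)) ?t ?P ?Q"
          by (simp add: disc_def)
        also have "\<dots> = disc_sum \<kappa> ?k2 (?z(1 := v)) ?t ?P ?Q"
          by (rule disc_sum_cong[OF tc nth_update_head]) auto
        finally show ?thesis .
      qed
      have "disc_term \<kappa> ?k2 (?z(1 := x)) \<pi> ?P ?Q =
          disc_term \<kappa> ?k2 (?z(1 := y)) \<pi> ?P ?Q + c * disc_term \<kappa> ?k2 (?z(1 := u)) \<pi> ?P ?Q"
        if pN: "\<pi> \<in> NCG (?P \<union> ?Q) ?t 2" for \<pi>
      proof -
        note cl = NCG_disc_closed[OF tc pN]
        have upd: "(?z(1 := v)) d = ?z d" if "d \<in> ?Q" for v d using that by auto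
        have T: "disc_term \<kappa> ?k2 (?z(1 := v)) \<pi> ?P ?Q = (\<Sum>D\<in>cycle_partition \<pi> ?Q. cycle_prod \<kappa> ?z \<pi> (?Q - D) *
            cycle_deriv \<kappa> (\<lambda>l. ?k2 l (map ?z (cyc \<pi> (Min D)))) (?z(1 := v)) \<pi> ?P)" for v
          unfolding disc_term_def
        proof (rule sum.cong[OF refl])
          fix D assume D: "D \<in> cycle_partition \<pi> ?Q"
          have "cycle_prod \<kappa> (?z(1 := v)) \<pi> (?Q - D) = cycle_prod \<kappa> ?z \<pi> (?Q - D)"
            by (rule cycle_prod_cong[OF cl(2) closed_under_Diff[OF cl(2,4) cycle_partition_memD(3)[OF cl(2,4) D]] refl upd]) auto
          moreover have "map (?z(1 := v)) (cyc \<pi> (Min D)) = map ?z (cyc \<pi> (Min D))"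
            by (rule map_cyc_Min_cong[OF cl(2,4) D upd])
          ultimately show "cycle_prod \<kappa> (?z(1 := v)) \<pi> (?Q - D) *
              cycle_deriv \<kappa> (\<lambda>l. ?k2 l (map (?z(1 := v)) (cyc \<pi> (Min D)))) (?z(1 := v)) \<pi> ?P =
            cycle_prod \<kappa> ?z \<pi> (?Q - D) *
              cycle_deriv \<kappa> (\<lambda>l. ?k2 l (map ?z (cyc \<pi> (Min D)))) (?z(1 := v)) \<pi> ?P" by (simp only:)
        qed
        have "cycle_deriv \<kappa> (\<lambda>l. ?k2 l ls) (?z(1 := x)) \<pi> ?P =
            cycle_deriv \<kappa> (\<lambda>l. ?k2 l ls) (?z(1 := y)) \<pi> ?P + c * cycle_deriv \<kappa> (\<lambda>l. ?k2 l ls) (?z(1 := u)) \<pi> ?P" for ls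
          by (rule cycle_deriv_head_linear[OF cl(2,3) t(2) _ rotation_invariant hl rotation_invariant2D(1)[OF ri2] hl2]) auto
        then show ?thesis unfolding T by (simp add: sum.distrib[symmetric] sum_distrib_left algebra_simps)
      qed
      then have "disc_sum \<kappa> ?k2 (?z(1 := x)) ?t ?P ?Q =
          disc_sum \<kappa> ?k2 (?z(1 := y)) ?t ?P ?Q + c * disc_sum \<kappa> ?k2 (?z(1 := u)) ?t ?P ?Q"
        unfolding disc_sum_def sum_distrib_left sum.distrib[symmetric] by (rule sum.cong[OF refl])
      then show ?thesis unfolding A .
    qed
    moreover have "\<kappa>2 (v # w) ys = \<phi>2 (v * prod_list w) (prod_list ys) - annular \<kappa> (v # w) ys -
        annular \<kappa> (v # w) (map tr (rev ys)) - disc \<kappa> ?k2 (v # w) ys" for v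
      using cumulant2_recursion[of "v # w" ys] False by simp
    ultimately show ?thesis by (simp only: ann assms(2)) (simp add: algebra_simps)
  qed
qed

text \<open>In an annular diagram the only label of the first circle is not a fixed point, so the
  unit is an argument of a cumulant of length at least two.\<close>

lemma annular_unit: "annular \<kappa> [1] ys = 0"
proof -
  let ?q = "length ys"
  let ?P = "{1..1::nat}" and ?Q = "{1+1..1+?q}" and ?t = "tau2 1 ?q" and ?z = "\<lambda>c. ([1] @ ys) ! (c - 1)"
  let ?S = "?P \<union> ?Q"
  have f: "finite ?S" by simp
  have "(if closed_under \<pi> ?P then 0 else cycle_prod \<kappa> ?z \<pi> ?S) = 0" if pN: "\<pi> \<in> NCG ?S ?t 0" for \<pi>
  proof (cases "closed_under \<pi> ?P")
    case False
    have p: "\<pi> permutes ?S" using pN by (rule NCG_permutes)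
    note pp = permutes_permutation[OF p f]
    have "\<pi> 1 \<noteq> 1" using False by (auto simp: closed_under_def)
    then obtain w where w: "cyc \<pi> 1 = 1 # \<pi> 1 # w" by (rule cyc_Cons2[OF pp])
    have "\<kappa> (map ?z (cyc \<pi> 1)) = 0" unfolding w using cumulant_unit[of "?z (\<pi> 1) # map ?z w"] by simp
    then show ?thesis
      using False cycle_prod_remove[OF rotation_invariant pp closed_under_permutes[OF p] f, of 1 ?z] by simp
  qed simp
  then have "ann_sum \<kappa> ?z ?t ?P ?Q = 0" unfolding ann_sum_def by (intro sum.neutral ballI)
  then show ?thesis by (simp add: annular_def)
qed

text \<open>A disc diagram fixes the only label of the first circle, so every lower term contains a
  shorter \<open>\<kappa>2 [1] l\<close>. The moment vanishes because \<open>\<phi>2\<close> does at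
  the unit.\<close>

lemma cumulant2_unit_single: "\<kappa>2 [1] ys = 0"
proof (induction ys rule: length_induct)
  case (1 ys)
  show ?case
  proof (cases "ys = []")
    case False
    let ?q = "length ys"
    let ?k2 = "trunc2 (1 + ?q) \<kappa>2"
    have k2: "?k2 [1] l = 0" for l using 1 by (simp add: trunc2_def)
    let ?P = "{1..1::nat}" and ?Q = "{1+1..1+?q}" and ?t = "tau2 1 ?q" and ?z = "\<lambda>c. ([1] @ ys) ! (c - 1)"
    have pq: "1 > (0::nat)" "?q > 0" using False by auto
    note tc = two_cycles_tau2[OF pq]
    have "disc_term \<kappa> ?k2 ?z \<pi> ?P ?Q = 0" if pN: "\<pi> \<in> NCG (?P \<union> ?Q) ?t 2" for \<pi>
    proof -
      note cl = NCG_disc_closed[OF tc pN]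
      have f: "\<pi> 1 = 1" using cl(3) by (simp add: closed_under_def)
      then have o: "orbit \<pi> 1 = {1}" by (simp add: orbit_eq_singleton_iff)
      obtain w where w: "cyc \<pi> 1 = 1 # w" by (rule cyc_Cons[OF cl(2)])
      have "length (cyc \<pi> 1) = 1" using length_cyc[OF cl(2), of 1] o by simp
      then have "cyc \<pi> 1 = [1]" using w by simp
      moreover have "cycle_partition \<pi> ?P = {{1}}" using o by (simp add: cycle_partition_def)
      ultimately have "cycle_deriv \<kappa> (\<lambda>l. ?k2 l ls) ?z \<pi> ?P = 0" for ls
        using k2 by (simp add: cycle_deriv_def)
      then show ?thesis by (simp add: disc_term_def)
    qed
    then have "disc_sum \<kappa> ?k2 ?z ?t ?P ?Q = 0" unfolding disc_sum_def by (intro sum.neutral ballI)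
    then have "disc \<kappa> ?k2 [1] ys = 0" by (simp add: disc_def)
    then show ?thesis
      using cumulant2_recursion[of "[1]" ys] False annular_unit \<phi>2_one_left by simp
  qed (simp add: \<kappa>2_Nil)
qed

text \<open>As in \<open>cumulant_unit\<close>, merging the unit with the next argument leaves the
  same value on both sides; the additional terms are first-order cumulants of length at least two
  with an argument 1.\<close>

lemma cumulant2_unit: "\<kappa>2 (1 # w) ys = 0"
proof (induction w rule: length_induct)
  case (1 w)
  show ?case
  proof (cases w)
    case Nil
    then show ?thesis using cumulant2_unit_single by simp
  next
    case (Cons b v)
    have "(\<Sum>j\<le>length v. \<kappa>2 (1 # drop j v) ys * \<kappa> (b # take j v) + \<kappa> (1 # drop j v) * \<kappa>2 (b # take j v) ys) =
        (\<Sum>j\<le>length v. if j = length v then \<kappa>2 (b # v) ys else 0)"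
    proof (rule sum.cong[OF refl])
      fix j assume "j \<in> {..length v}"
      then have j: "j \<le> length v" by simp
      have "length (drop j v) < length w" using Cons by simp
      then have "\<kappa>2 (1 # drop j v) ys = 0" using 1 by blast
      moreover have "\<kappa> (1 # drop j v) = (if j = length v then 1 else 0)"
        using j cumulant_unit[of "drop j v"] by (simp add: cumulant_single unital)
      ultimately show "\<kappa>2 (1 # drop j v) ys * \<kappa> (b # take j v) + \<kappa> (1 # drop j v) * \<kappa>2 (b # take j v) ys =
          (if j = length v then \<kappa>2 (b # v) ys else 0)" by simp
    qed
    then show ?thesis using cumulant2_merge[of 1 b v ys] Cons by (simp add: cumulant_unit)
  qed
qed

end

section \<open>Counting cycles and fixed points\<close>

context
  fixes \<pi> :: "nat \<Rightarrow> nat" and S :: "nat set"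
  assumes perm: "permutation \<pi>" and closed: "closed_under \<pi> S" and fin: "finite S"
begin

lemma sum_over_cycles: "(\<Sum>i\<in>S. f i) = (\<Sum>C\<in>cycle_partition \<pi> S. \<Sum>i\<in>C. (f i :: nat))"
proof -
  note C = cycle_partition_memD[OF perm closed]
  have "(\<Sum>i\<in>S. f i) = (\<Sum>C\<in>cycle_partition \<pi> S. \<Sum>i\<in>{i \<in> S. orbit \<pi> i = C}. f i)"
    by (rule sum.group[symmetric]) (use fin in \<open>auto simp: cycle_partition_def\<close>)
  also have "\<dots> = (\<Sum>C\<in>cycle_partition \<pi> S. \<Sum>i\<in>C. f i)"
  proof (rule sum.cong[OF refl])
    fix C assume CS: "C \<in> cycle_partition \<pi> S"
    have "{i \<in> S. orbit \<pi> i = C} = C"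
      using C(1)[OF CS] C(4)[OF CS] permutation_self_in_orbit[OF perm] by auto
    then show "(\<Sum>i\<in>{i \<in> S. orbit \<pi> i = C}. f i) = (\<Sum>i\<in>C. f i)" by simp
  qed
  finally show ?thesis .
qed

lemma card_over_cycles: "card S = (\<Sum>C\<in>cycle_partition \<pi> S. card C)"
  using sum_over_cycles[of "\<lambda>_. 1"] by simp

lemma cycle_card_ge_2:
  assumes "C \<in> cycle_partition \<pi> S" "\<And>i. i \<in> C \<Longrightarrow> \<pi> i \<noteq> i"
  shows "2 \<le> card C"
proof -
  note C = cycle_partition_memD[OF perm closed assms(1)]
  obtain i where i: "i \<in> C" using C(2) by blast
  have "\<pi> i \<in> C" using C(3) i by (simp add: closed_under_def)
  then have "{i, \<pi> i} \<subseteq> C" using i by simp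
  then have "card {i, \<pi> i} \<le> card C" by (rule card_mono[OF C(5)])
  moreover have "card {i, \<pi> i} = 2" using assms(2)[OF i] by (intro card_2_iff[THEN iffD2]) auto
  ultimately show ?thesis by simp
qed

text \<open>Give every point weight one and every fixed point weight two; then each cycle has weight
  at least two.\<close>

lemma num_cycles_le_fixed: "2 * num_cycles \<pi> S \<le> card S + card {i \<in> S. \<pi> i = i}"
proof -
  have "card {i \<in> S. \<pi> i = i} = (\<Sum>i\<in>S. if \<pi> i = i then 1 else 0)"
    using sum.inter_filter[OF fin, of "\<lambda>_. 1 :: nat" "\<lambda>i. \<pi> i = i"] by simp
  then have "card S + card {i \<in> S. \<pi> i = i} = (\<Sum>i\<in>S. 1 + (if \<pi> i = i then 1 else 0))"
    by (simp add: sum.distrib del: One_nat_def)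
  also have "\<dots> = (\<Sum>C\<in>cycle_partition \<pi> S. \<Sum>i\<in>C. 1 + (if \<pi> i = i then 1 else 0))" by (rule sum_over_cycles)
  also have "\<dots> \<ge> (\<Sum>C\<in>cycle_partition \<pi> S. 2)"
  proof (rule sum_mono)
    fix C assume CS: "C \<in> cycle_partition \<pi> S"
    note C = cycle_partition_memD[OF perm closed CS]
    show "(2::nat) \<le> (\<Sum>i\<in>C. 1 + (if \<pi> i = i then 1 else 0))"
    proof (cases "\<exists>i\<in>C. \<pi> i = i")
      case True
      then obtain i where i: "i \<in> C" "\<pi> i = i" by blast
      have "(\<Sum>i\<in>{i}. 1 + (if \<pi> i = i then 1 else 0)) \<le> (\<Sum>i\<in>C. 1 + (if \<pi> i = i then 1 else (0::nat)))"
        by (rule sum_mono2[OF C(5)]) (use i in auto)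
      then show ?thesis using i(2) by simp
    next
      case False
      then have "2 \<le> card C" by (intro cycle_card_ge_2[OF CS]) blast
      also have "card C = (\<Sum>i\<in>C. 1)" by simp
      also have "\<dots> \<le> (\<Sum>i\<in>C. 1 + (if \<pi> i = i then 1 else 0))" by (rule sum_mono) simp
      finally show ?thesis .
    qed
  qed
  finally show ?thesis by (simp add: num_cycles_def mult.commute)
qed

text \<open>Every cycle has at least two points and the average is two, so each has exactly
  two.\<close>

lemma involution_if_half_cycles:
  assumes "\<And>i. i \<in> S \<Longrightarrow> \<pi> i \<noteq> i" "2 * num_cycles \<pi> S = card S" "i \<in> S"
  shows "\<pi> (\<pi> i) = i"
proof -
  note C = cycle_partition_memD[OF perm closed]
  have ge: "2 \<le> card C" if "C \<in> cycle_partition \<pi> S" for C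
    using C(1)[OF that] assms(1) by (intro cycle_card_ge_2[OF that]) blast
  have o: "orbit \<pi> i \<in> cycle_partition \<pi> S" using assms(3) by (simp add: cycle_partition_def)
  have "card (orbit \<pi> i) = 2"
  proof (rule ccontr)
    assume "card (orbit \<pi> i) \<noteq> 2"
    then have "2 < card (orbit \<pi> i)" using ge[OF o] by simp
    then have "(\<Sum>C\<in>cycle_partition \<pi> S. 2) < (\<Sum>C\<in>cycle_partition \<pi> S. card C)"
      using ge o finite_cycle_partition[OF fin] by (intro sum_strict_mono_ex1) auto
    then show False using assms(2) card_over_cycles by (simp add: num_cycles_def)
  qed
  then have "length (cyc \<pi> i) = 2" using length_cyc[OF perm] by simp
  moreover obtain w where w: "cyc \<pi> i = i # \<pi> i # w" by (rule cyc_Cons2[OF perm assms(1)[OF assms(3)]])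
  ultimately have "cyc \<pi> i = [i, \<pi> i]" by simp
  then show ?thesis using map_cyc[OF perm, of i] by simp
qed

end

lemma involution_cyc:
  assumes "\<pi> (\<pi> i) = i" "\<pi> i \<noteq> i"
  shows "cyc \<pi> i = [i, \<pi> i]" "orbit \<pi> i = {i, \<pi> i}"
  using cyc_unique(1)[of "[i, \<pi> i]" \<pi>] cyc_unique(2)[of "[i, \<pi> i]" \<pi> i] assms by auto

lemma half_cycles_if_involution:
  fixes \<pi> :: "nat \<Rightarrow> nat"
  assumes "permutation \<pi>" "closed_under \<pi> S" "finite S" "\<And>i. i \<in> S \<Longrightarrow> \<pi> i \<noteq> i" "\<And>i. i \<in> S \<Longrightarrow> \<pi> (\<pi> i) = i"
  shows "2 * num_cycles \<pi> S = card S"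
proof -
  have "card C = 2" if C: "C \<in> cycle_partition \<pi> S" for C
  proof -
    obtain i where i: "i \<in> S" "C = orbit \<pi> i" using C by (auto simp: cycle_partition_def)
    have "i \<noteq> \<pi> i" using assms(4)[OF i(1)] by simp
    then show ?thesis unfolding i(2) involution_cyc(2)[OF assms(5,4)[OF i(1)]] by simp
  qed
  then show ?thesis using card_over_cycles[OF assms(1-3)] by (simp add: num_cycles_def)
qed

lemma inv_comp_fixed:
  assumes "\<pi> permutes S" "(inv \<pi> \<circ> \<tau>) i = i"
  shows "\<pi> i = \<tau> i"
  using assms by (simp add: permutes_inv_eq)

section \<open>Vanishing of mixed terms\<close>

text \<open>\<open>c\<close> gives the colour of a label, that is, the index of the subalgebra its argument comes from.\<close>

definition vanishes_mixed :: "('a list \<Rightarrow> complex) \<Rightarrow> (nat \<Rightarrow> 'a) \<Rightarrow> (nat \<Rightarrow> nat) \<Rightarrow> nat set \<Rightarrow> bool" where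
  "vanishes_mixed k z c S \<longleftrightarrow> (\<forall>i\<in>S. k [z i] = 0) \<and>
     (\<forall>L. set L \<subseteq> S \<longrightarrow> (\<exists>i\<in>set L. \<exists>j\<in>set L. c i \<noteq> c j) \<longrightarrow> k (map z L) = 0)"

lemma cycle_prod_vanish:
  assumes "permutation \<pi>" "closed_under \<pi> S" "finite S" "i \<in> S" "\<pi> i = i \<or> c i \<noteq> c (\<pi> i)"
    "vanishes_mixed k z c S"
  shows "cycle_prod k z \<pi> S = 0"
proof -
  let ?C = "orbit \<pi> i"
  have C: "?C \<in> cycle_partition \<pi> S" using assms(4) by (simp add: cycle_partition_def)
  note CD = cycle_partition_memD[OF assms(1,2) C] and M = Min_cycle_mem[OF assms(1,2) C]
  have set: "set (cyc \<pi> (Min ?C)) = ?C" using set_cyc[OF assms(1)] CD(4)[OF M(1)] by simp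
  have "k (map z (cyc \<pi> (Min ?C))) = 0"
  proof (cases "\<pi> i = i")
    case True
    then have o: "?C = {i}" by (simp add: orbit_eq_singleton_iff)
    obtain w where w: "cyc \<pi> i = i # w" by (rule cyc_Cons[OF assms(1)])
    have "length (cyc \<pi> i) = 1" using length_cyc[OF assms(1), of i] o by simp
    then show ?thesis using w o assms(4,6) by (simp add: vanishes_mixed_def)
  next
    case False
    have "i \<in> ?C" "\<pi> i \<in> ?C" using permutation_self_in_orbit[OF assms(1)] orbit.base by fast+
    then show ?thesis
      using assms(5,6) False set CD(1) unfolding vanishes_mixed_def by blast
  qed
  then show ?thesis
    unfolding cycle_prod_def using C finite_cycle_partition[OF assms(3)] by (intro prod_zero) auto
qed

lemma vanishes_mixed_subset: "vanishes_mixed k z c S \<Longrightarrow> T \<subseteq> S \<Longrightarrow> vanishes_mixed k z c T"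
  unfolding vanishes_mixed_def by blast

text \<open>If \<pi> had no fixed point and its complement at most the fixed point \<open>n\<close>,
  together they would have at most n + 1/2 cycles instead of n + 1. A fixed point
  \<open>i < n\<close> of the complement means that \<pi> joins the differently coloured
  \<open>i\<close> and \<open>Suc i\<close>. The label \<open>n\<close> is set apart because nothing
  is assumed about the colours of \<open>n\<close> and 1.\<close>

lemma NC_sum_vanish:
  assumes "n > 0" "\<And>i. 1 \<le> i \<Longrightarrow> i < n \<Longrightarrow> c i \<noteq> c (Suc i)" "vanishes_mixed k z c {1..n}"
  shows "(\<Sum>\<pi>\<in>NCG {1..n} (tau n) 1. cycle_prod k z \<pi> {1..n}) = 0"
proof (rule sum.neutral, rule ballI)
  fix \<pi> assume pN: "\<pi> \<in> NCG {1..n} (tau n) 1"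
  let ?S = "{1..n}" and ?e = "inv \<pi> \<circ> tau n"
  have p: "\<pi> permutes ?S" using pN by (rule NCG_permutes)
  have e: "?e permutes ?S" using p tau_facts(1)[OF assms(1)] by (intro permutes_compose permutes_inv)
  note pp = permutes_permutation[OF p finite_atLeastAtMost] and pe = permutes_permutation[OF e finite_atLeastAtMost]
  note cp = closed_under_permutes[OF p] and ce = closed_under_permutes[OF e]
  have "\<exists>i\<in>?S. \<pi> i = i \<or> (?e i = i \<and> i < n)"
  proof (rule ccontr)
    assume "\<not> ?thesis"
    then have "{i \<in> ?S. \<pi> i = i} = {}" "{i \<in> ?S. ?e i = i} \<subseteq> {n}" by force+
    then have "card {i \<in> ?S. \<pi> i = i} = 0" "card {i \<in> ?S. ?e i = i} \<le> 1"
      using card_mono[of "{n}" "{i \<in> ?S. ?e i = i}"] by simp_all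
    moreover have "card ?S = n" by simp
    moreover have "num_cycles \<pi> ?S + num_cycles ?e ?S = card ?S + 1" using pN by (simp add: NCG_def)
    ultimately show False
      using num_cycles_le_fixed[OF pp cp finite_atLeastAtMost] num_cycles_le_fixed[OF pe ce finite_atLeastAtMost]
      by linarith
  qed
  then obtain i where i: "i \<in> ?S" "\<pi> i = i \<or> (?e i = i \<and> i < n)" by blast
  have "\<pi> i = i \<or> c i \<noteq> c (\<pi> i)"
  proof (cases "\<pi> i = i")
    case False
    then have "?e i = i" "i < n" using i(2) by blast+
    then have "\<pi> i = Suc i" using inv_comp_fixed[OF p] tau_apply[OF i(1)] by simp
    then show ?thesis using assms(2)[of i] i(1) \<open>i < n\<close> by simp
  qed simp
  then show "cycle_prod k z \<pi> ?S = 0" by (rule cycle_prod_vanish[OF pp cp finite_atLeastAtMost i(1) _ assms(3)])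
qed

section \<open>Vanishing of disc sums and rigidity of annular diagrams\<close>

lemma perm_restrict_permutes:
  assumes "\<pi> permutes S" "finite Q" "closed_under \<pi> Q"
  shows "perm_restrict \<pi> Q permutes Q"
proof (rule bij_imp_permutes)
  have "inj_on \<pi> Q" using permutes_inj[OF assms(1)] by (rule inj_on_subset) simp
  then have "bij_betw \<pi> Q Q"
    using assms(2,3) endo_inj_surj[of Q \<pi>] by (auto simp: bij_betw_def closed_under_def)
  then show "bij_betw (perm_restrict \<pi> Q) Q Q"
    by (rule iffD1[OF bij_betw_cong, rotated]) (simp add: perm_restrict_def)
qed (simp add: perm_restrict_def)

text \<open>The bound for the restrictions to \<open>Q\<close>; it allows the counts of the two
  circles to be separated.\<close>

lemma genus_bound_closed:
  assumes "\<pi> permutes S" "\<tau> permutes S" "finite S" "Q \<subseteq> S" "closed_under \<pi> Q" "closed_under \<tau> Q"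
  shows "num_cycles \<pi> Q + num_cycles (inv \<pi> \<circ> \<tau>) Q \<le> card Q + num_cycles \<tau> Q"
proof -
  have fQ: "finite Q" using assms(3,4) by (rule rev_finite_subset)
  let ?p = "perm_restrict \<pi> Q" and ?t = "perm_restrict \<tau> Q"
  note p = perm_restrict_permutes[OF assms(1) fQ assms(5)] and t = perm_restrict_permutes[OF assms(2) fQ assms(6)]
  note pp = permutes_permutation[OF assms(1,3)] and pt = permutes_permutation[OF assms(2,3)]
  have ci: "closed_under (inv \<pi>) Q" by (rule closed_under_inv[OF pp assms(5)])
  have e: "inv \<pi> \<circ> \<tau> permutes S" using assms by (intro permutes_compose permutes_inv)
  have 1: "num_cycles ?p Q = num_cycles \<pi> Q"
    by (rule num_cycles_cong_closed[OF pp assms(5)]) (simp add: perm_restrict_def)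
  have 2: "num_cycles ?t Q = num_cycles \<tau> Q"
    by (rule num_cycles_cong_closed[OF pt assms(6)]) (simp add: perm_restrict_def)
  have 3: "num_cycles (inv ?p \<circ> ?t) Q = num_cycles (inv \<pi> \<circ> \<tau>) Q"
  proof (rule num_cycles_cong_closed[OF permutes_permutation[OF e assms(3)] closed_under_comp[OF ci assms(6)]])
    fix x assume x: "x \<in> Q"
    then have "\<tau> x \<in> Q" using assms(6) by (simp add: closed_under_def)
    then have "inv \<pi> (\<tau> x) \<in> Q" using ci by (simp add: closed_under_def)
    then have "?p (inv \<pi> (\<tau> x)) = \<tau> x" using permutes_inverses(1)[OF assms(1)] by (simp add: perm_restrict_def)
    then have "inv ?p (\<tau> x) = inv \<pi> (\<tau> x)" using permutes_inv_eq[OF p] by blast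
    then show "(inv ?p \<circ> ?t) x = (inv \<pi> \<circ> \<tau>) x" using x by (simp add: perm_restrict_def)
  qed
  show ?thesis using genus_bound[OF p t fQ] unfolding 1 2 3 .
qed

text \<open>Of the \<open>card P + card Q + 2\<close> cycles of \<pi> and its complement, at most
  \<open>card Q + 1\<close> lie on \<open>Q\<close>, so at least \<open>card P + 1\<close> lie on
  \<open>P\<close>. If the claim failed, the complement would have no fixed point in
  \<open>P\<close> and \<pi> at most one, leaving at most \<open>card P\<close> + 1/2. A fixed point
  in \<open>C\<close> is excluded because its argument goes into the second-order factor.\<close>

lemma disc_side:
  assumes "two_cycles \<tau> P Q" "\<pi> \<in> NCG (P \<union> Q) \<tau> 2" "C \<in> cycle_partition \<pi> P"
  shows "\<exists>i\<in>P. \<pi> i = \<tau> i \<or> (\<pi> i = i \<and> i \<notin> C)"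
proof (rule ccontr)
  note t = two_cyclesD[OF assms(1)] and c = NCG_disc_closed[OF assms(1,2)]
  let ?e = "inv \<pi> \<circ> \<tau>"
  have e: "?e permutes P \<union> Q" using c(1) t(1) by (intro permutes_compose permutes_inv)
  note pe = permutes_permutation[OF e t(7)]
  have ce: "closed_under ?e P" "closed_under ?e Q"
    using closed_under_inv[OF c(2)] c(3,4) t(11,12) by (auto intro: closed_under_comp)
  assume neg: "\<not> ?thesis"
  have no: "{i \<in> P. ?e i = i} = {}" using neg inv_comp_fixed[OF c(1)] by blast
  have 1: "2 * num_cycles ?e P \<le> card P" using num_cycles_le_fixed[OF pe ce(1) t(2)] unfolding no by simp
  have "i = j" if "i \<in> P" "\<pi> i = i" "j \<in> P" "\<pi> j = j" for i j
  proof -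
    have "i \<in> C" "j \<in> C" using neg that by blast+
    then have "orbit \<pi> i = orbit \<pi> j" using cycle_partition_memD(4)[OF c(2,3) assms(3)] by simp
    moreover have "orbit \<pi> i = {i}" "orbit \<pi> j = {j}" using that by (simp_all add: orbit_eq_singleton_iff)
    ultimately show ?thesis by simp
  qed
  then have "card {i \<in> P. \<pi> i = i} \<le> 1" using t(2) by (intro card_le_Suc0_iff_eq[THEN iffD2, unfolded One_nat_def[symmetric]]) auto
  then have 2: "2 * num_cycles \<pi> P \<le> card P + 1" using num_cycles_le_fixed[OF c(2,3) t(2)] by simp
  have "num_cycles \<tau> Q = 1" using t(6) by (simp add: num_cycles_def)
  then have 3: "num_cycles \<pi> Q + num_cycles ?e Q \<le> card Q + 1"
    using genus_bound_closed[OF c(1) t(1,7) _ c(4) t(12)] by simp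
  have "num_cycles \<pi> (P \<union> Q) = num_cycles \<pi> P + num_cycles \<pi> Q"
    by (rule num_cycles_closed_Un[OF c(2,3,4) t(4,2,3)])
  moreover have "num_cycles ?e (P \<union> Q) = num_cycles ?e P + num_cycles ?e Q"
    by (rule num_cycles_closed_Un[OF pe ce t(4,2,3)])
  moreover have "card (P \<union> Q) = card P + card Q" by (rule card_Un_disjoint[OF t(2,3,4)])
  ultimately show False using assms(2) 1 2 3 by (simp add: NCG_def)
qed

text \<open>A circle with more than one label supplies a vanishing factor by
  \<open>disc_side\<close>. A one-point circle supplies none, since its label is its own neighbour;
  when both circles have one point, the second-order factor has differently coloured arguments by
  \<open>single\<close>.\<close>

lemma disc_sum_vanish:
  assumes "two_cycles \<tau> P Q" "vanishes_mixed \<kappa> z c (P \<union> Q)"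
    and k2: "\<And>L L'. \<lbrakk>L \<noteq> []; L' \<noteq> []; set L \<subseteq> P; set L' \<subseteq> Q; \<exists>i\<in>set L \<union> set L'. \<exists>j\<in>set L \<union> set L'. c i \<noteq> c j\<rbrakk> \<Longrightarrow>
        k2 (map z L) (map z L') = 0"
    and alt: "\<And>i. i \<in> P \<union> Q \<Longrightarrow> \<tau> i \<noteq> i \<Longrightarrow> c i \<noteq> c (\<tau> i)"
    and single: "\<And>a b. P = {a} \<Longrightarrow> Q = {b} \<Longrightarrow> c a \<noteq> c b"
  shows "disc_sum \<kappa> k2 z \<tau> P Q = 0"
proof -
  note t = two_cyclesD[OF assms(1)]
  have nofix: "\<tau> i \<noteq> i" if "i \<in> X" "X \<noteq> {i}" "X = P \<or> X = Q" for i X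
  proof
    assume "\<tau> i = i"
    then have "orbit \<tau> i = {i}" by (simp add: orbit_eq_singleton_iff)
    then show False using that t(13,14) by auto
  qed
  have "k2 (map z (cyc \<pi> (Min C))) (map z (cyc \<pi> (Min D))) * cycle_prod \<kappa> z \<pi> (P - C) * cycle_prod \<kappa> z \<pi> (Q - D) = 0"
    if pN: "\<pi> \<in> NCG (P \<union> Q) \<tau> 2" and C: "C \<in> cycle_partition \<pi> P" and D: "D \<in> cycle_partition \<pi> Q" for \<pi> C D
  proof -
    note p = NCG_disc_closed[OF assms(1) pN]
    note CC = cycle_partition_memD[OF p(2,3) C] and DD = cycle_partition_memD[OF p(2,4) D]
    note MC = Min_cycle_mem[OF p(2,3) C] and MD = Min_cycle_mem[OF p(2,4) D]
    have sets: "set (cyc \<pi> (Min C)) = C" "set (cyc \<pi> (Min D)) = D"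
      using set_cyc[OF p(2)] CC(4)[OF MC(1)] DD(4)[OF MD(1)] by simp_all
    have k0: "k2 (map z (cyc \<pi> (Min C))) (map z (cyc \<pi> (Min D))) = 0"
      if "i \<in> C \<union> D" "j \<in> C \<union> D" "c i \<noteq> c j" for i j
      using k2[OF cyc_nonempty[OF p(2)] cyc_nonempty[OF p(2)], of "Min C" "Min D"] that CC(1) DD(1)
      unfolding sets by blast
    \<comment> \<open>\<open>X\<close> is a circle with more than one label and \<open>Y\<close> its
      chosen cycle. A bad label in \<open>Y\<close> is joined there to a neighbour of another
      colour, so the second-order factor is mixed; a bad label outside makes a first-order factor
      vanish.\<close>
    have side: "k2 (map z (cyc \<pi> (Min C))) (map z (cyc \<pi> (Min D))) = 0 \<or> cycle_prod \<kappa> z \<pi> (X - Y) = 0"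
      if X: "\<exists>i\<in>X. \<pi> i = \<tau> i \<or> (\<pi> i = i \<and> i \<notin> Y)" and XP: "X = P \<or> X = Q" "\<nexists>a. X = {a}"
        and Y: "Y \<subseteq> C \<union> D" "closed_under \<pi> Y" and cX: "closed_under \<pi> X" for X Y
    proof -
      obtain i where i: "i \<in> X" "\<pi> i = \<tau> i \<or> (\<pi> i = i \<and> i \<notin> Y)" using X by blast
      have iS: "i \<in> P \<union> Q" and fX: "finite X" and XS: "X \<subseteq> P \<union> Q" using i(1) XP(1) t(2,3) by auto
      have col: "\<pi> i = \<tau> i \<Longrightarrow> c i \<noteq> c (\<pi> i)" using alt[OF iS nofix[OF i(1) _ XP(1)]] XP(2) by auto
      show ?thesis
      proof (cases "i \<in> Y")
        case True
        then have "c i \<noteq> c (\<pi> i)" "\<pi> i \<in> Y" using i(2) col Y(2) by (auto simp: closed_under_def)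
        then show ?thesis using k0[of i "\<pi> i"] True Y(1) by blast
      next
        case False
        have "cycle_prod \<kappa> z \<pi> (X - Y) = 0"
          by (rule cycle_prod_vanish[where i = i and c = c])
            (use p(2) i False col fX cX Y(2) XS in \<open>auto intro: closed_under_Diff vanishes_mixed_subset[OF assms(2)]\<close>)
        then show ?thesis by simp
      qed
    qed
    have sP: "\<exists>i\<in>P. \<pi> i = \<tau> i \<or> (\<pi> i = i \<and> i \<notin> C)" by (rule disc_side[OF assms(1) pN C])
    have sQ: "\<exists>i\<in>Q. \<pi> i = \<tau> i \<or> (\<pi> i = i \<and> i \<notin> D)"
      using disc_side[OF t(16) _ D] pN by (simp add: Un_commute)
    consider "\<nexists>a. P = {a}" | "\<nexists>a. Q = {a}" | a b where "P = {a}" "Q = {b}" by blast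
    then show ?thesis
    proof cases
      case 1
      then show ?thesis using side[OF sP _ 1 _ CC(3) p(3)] by auto
    next
      case 2
      then show ?thesis using side[OF sQ _ 2 _ DD(3) p(4)] by auto
    next
      case 3
      then have "C = {a}" "D = {b}" using CC(1,2) DD(1,2) by auto
      then show ?thesis using k0[of a b] single[OF 3] by simp
    qed
  qed
  then have "cycle_prod \<kappa> z \<pi> (Q - D) * (k2 (map z (cyc \<pi> (Min C))) (map z (cyc \<pi> (Min D))) * cycle_prod \<kappa> z \<pi> (P - C)) = 0"
    if "\<pi> \<in> NCG (P \<union> Q) \<tau> 2" "C \<in> cycle_partition \<pi> P" "D \<in> cycle_partition \<pi> Q" for \<pi> C D
    using that by (simp add: mult_ac)
  then show ?thesis
    unfolding disc_sum_def disc_term_def cycle_deriv_def sum_distrib_left by (intro sum.neutral ballI)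
qed

text \<open>
  If neither \<open>\<pi>\<close> nor \<open>\<pi>\<^sup>-\<^sup>1\<tau>\<close> has a fixed point, each has at most half as many cycles as there are labels;
  annularity forces equality, so both are involutions and \<open>\<pi>\<close> conjugates \<open>\<tau>\<close> to its inverse.
\<close>

lemma ann_involution:
  assumes "two_cycles \<tau> P Q" "\<pi> \<in> NCG (P \<union> Q) \<tau> 0"
    and "\<And>i. i \<in> P \<union> Q \<Longrightarrow> \<pi> i \<noteq> i" "\<And>i. i \<in> P \<union> Q \<Longrightarrow> \<pi> i \<noteq> \<tau> i" "i \<in> P \<union> Q"
  shows "\<pi> (\<pi> i) = i" "\<tau> (\<pi> (\<tau> i)) = \<pi> i"
proof -
  note t = two_cyclesD[OF assms(1)]
  let ?S = "P \<union> Q"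
  let ?e = "inv \<pi> \<circ> \<tau>"
  have p: "\<pi> permutes ?S" using assms(2) by (rule NCG_permutes)
  have e: "?e permutes ?S" using p t(1) by (intro permutes_compose permutes_inv)
  note pp = permutes_permutation[OF p t(7)] and pe = permutes_permutation[OF e t(7)]
  note cp = closed_under_permutes[OF p] and ce = closed_under_permutes[OF e]
  have ef: "?e i \<noteq> i" if "i \<in> ?S" for i using assms(4)[OF that] inv_comp_fixed[OF p] by blast
  have no: "{i \<in> ?S. \<pi> i = i} = {}" "{i \<in> ?S. ?e i = i} = {}" using assms(3) ef by blast+
  have le: "2 * num_cycles \<pi> ?S \<le> card ?S" "2 * num_cycles ?e ?S \<le> card ?S"
    using num_cycles_le_fixed[OF pp cp t(7)] num_cycles_le_fixed[OF pe ce t(7)] unfolding no by simp_all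
  moreover have "num_cycles \<pi> ?S + num_cycles ?e ?S = card ?S" using assms(2) by (simp add: NCG_def)
  ultimately have eq: "2 * num_cycles \<pi> ?S = card ?S" "2 * num_cycles ?e ?S = card ?S" by linarith+
  have inv: "\<pi> (\<pi> i) = i" if "i \<in> ?S" for i by (rule involution_if_half_cycles[OF pp cp t(7) assms(3) eq(1) that])
  then show "\<pi> (\<pi> i) = i" using assms(5) .
  have pi: "inv \<pi> j = \<pi> j" if "j \<in> ?S" for j using inv[OF that] permutes_inv_eq[OF p] by blast
  have ti: "\<tau> i \<in> ?S" using assms(5) permutes_in_image[OF t(1)] by blast
  have "?e (?e i) = i" by (rule involution_if_half_cycles[OF pe ce t(7) ef eq(2) assms(5)])
  then have "inv \<pi> (\<tau> (\<pi> (\<tau> i))) = i" using pi[OF ti] by simp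
  then show "\<tau> (\<pi> (\<tau> i)) = \<pi> i" using permutes_inv_eq[OF p] by metis
qed

section \<open>Spoke diagrams\<close>

text \<open>Labels \<open>b + 1, \<dots>, b + n\<close> of one circle, indexed cyclically by the integers.\<close>

definition lab :: "nat \<Rightarrow> nat \<Rightarrow> int \<Rightarrow> nat" where
  "lab b n a = b + 1 + nat (a mod int n)"

lemma lab_mem: "n > 0 \<Longrightarrow> lab b n a \<in> {b+1..b+n}"
  by (simp add: lab_def nat_less_iff Suc_le_eq)

lemma lab_of:
  assumes "x \<in> {b+1..b+n}"
  shows "lab b n (int x - int b - 1) = x"
proof -
  have "(int x - int b - 1) mod int n = int x - int b - 1"
    using assms by (intro mod_pos_pos_trivial) auto
  then show ?thesis using assms by (simp add: lab_def nat_diff_distrib)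
qed

lemma lab_eq_iff:
  assumes "n > 0"
  shows "lab b n a = lab b n a' \<longleftrightarrow> a mod int n = a' mod int n"
  using assms by (simp add: lab_def eq_nat_nat_iff)

lemma int_lab: "n > 0 \<Longrightarrow> int (lab b n a) = int b + 1 + a mod int n"
  by (simp add: lab_def)

lemma step_lab:
  assumes "permutation \<tau>" "cyc \<tau> s = [b+1..<Suc (b+n)]" "n > 0"
  shows "\<tau> (lab b n a) = lab b n (a + 1)"
proof -
  let ?cs = "[b+1..<Suc (b+n)]"
  define j where "j = nat (a mod int n)"
  have j: "j < n" using assms(3) by (simp add: j_def nat_less_iff)
  have "?cs ! j = lab b n a" using j by (subst nth_upt) (auto simp: lab_def j_def)
  moreover have "\<tau> (?cs ! j) = rotate1 ?cs ! j"
    using arg_cong[OF map_cyc[OF assms(1), of s], of "\<lambda>l. l ! j"] j unfolding assms(2) by (simp del: upt_Suc)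
  moreover have "rotate1 ?cs ! j = ?cs ! (Suc j mod n)" using j by (subst nth_rotate1) (auto simp del: upt_Suc)
  moreover have "Suc j mod n = nat ((a + 1) mod int n)"
  proof -
    have "int (Suc j mod n) = (int j + 1) mod int n" by (simp add: zmod_int add.commute)
    also have "int j = a mod int n" using assms(3) by (simp add: j_def)
    also have "(a mod int n + 1) mod int n = (a + 1) mod int n" by (simp add: mod_simps)
    finally show ?thesis by simp
  qed
  moreover have "?cs ! (Suc j mod n) = b + 1 + Suc j mod n"
    using assms(3) mod_less_divisor[of n "Suc j"] by (subst nth_upt) auto
  ultimately show ?thesis by (simp add: lab_def)
qed

lemma tau2_lab:
  assumes "p > 0" "q > 0"
  shows "tau2 p q (lab 0 p a) = lab 0 p (a + 1)" "tau2 p q (lab p q a) = lab p q (a + 1)"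
proof -
  note t = two_cyclesD[OF two_cycles_tau2[OF assms]]
  have "cyc (tau2 p q) 1 = [0+1..<Suc (0+p)]" "cyc (tau2 p q) (p + 1) = [p+1..<Suc (p+q)]"
    unfolding cyc_def using tau2_facts(3,4)[OF assms] by simp_all
  then show "tau2 p q (lab 0 p a) = lab 0 p (a + 1)" "tau2 p q (lab p q a) = lab p q (a + 1)"
    using step_lab[OF t(8) _ assms(1)] step_lab[OF t(8) _ assms(2)] by blast+
qed

definition spoke :: "nat \<Rightarrow> int \<Rightarrow> nat \<Rightarrow> nat" where
  "spoke p k x = (if x \<in> {1..p} then lab p p (k - int x - 1)
     else if x \<in> {p+1..p+p} then lab 0 p (k - int x + int p - 1) else x)"

context
  fixes p :: nat
  assumes p: "p > 0"
begin

lemma spoke_lab: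
  "spoke p k (lab 0 p a) = lab p p (k - a - 2)" "spoke p k (lab p p a) = lab 0 p (k - a - 2)"
proof -
  have m: "lab 0 p a \<in> {1..p}" "lab p p a \<in> {p+1..p+p}" "lab p p a \<notin> {1..p}"
    using lab_mem[OF p, of 0 a] lab_mem[OF p, of p a] by auto
  have e: "k - (1 + a mod int p) - 1 = k - 2 - a mod int p" "k - (int p + 1 + a mod int p) + int p - 1 = k - 2 - a mod int p"
    by simp_all
  have "(k - 2 - a mod int p) mod int p = (k - 2 - a) mod int p" by (rule mod_diff_right_eq)
  also have "k - 2 - a = k - a - 2" by simp
  finally have "(k - 2 - a mod int p) mod int p = (k - a - 2) mod int p" .
  then have l: "lab b p (k - 2 - a mod int p) = lab b p (k - a - 2)" for b by (simp add: lab_def)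
  show "spoke p k (lab 0 p a) = lab p p (k - a - 2)"
    using m(1) l[of p] unfolding spoke_def int_lab[OF p] by (simp add: e)
  show "spoke p k (lab p p a) = lab 0 p (k - a - 2)"
    using m(2,3) l[of 0] unfolding spoke_def int_lab[OF p] e by simp
qed

lemma label_cases:
  assumes "x \<in> {1..p} \<union> {p+1..p+p}"
  obtains a where "x = lab 0 p a" | a where "x = lab p p a"
  using assms lab_of[of x 0 p] lab_of[of x p p] by (metis Un_iff add_0)

lemma spoke_spoke: "spoke p k (spoke p k x) = x"
proof (cases "x \<in> {1..p} \<union> {p+1..p+p}")
  case True
  then show ?thesis by (cases rule: label_cases) (simp_all add: spoke_lab)
next
  case False
  then show ?thesis by (auto simp: spoke_def)
qed

lemma spoke_permutes: "spoke p k permutes {1..p} \<union> {p+1..p+p}"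
proof -
  have "bij (spoke p k)" by (rule o_bij[of "spoke p k"]) (simp_all add: fun_eq_iff spoke_spoke)
  moreover have "spoke p k x = x" if "x \<notin> {1..p} \<union> {p+1..p+p}" for x using that by (auto simp: spoke_def)
  ultimately show ?thesis unfolding permutes_def by (metis bij_pointE)
qed

lemma spoke_image: "x \<in> {1..p} \<Longrightarrow> spoke p k x \<in> {p+1..p+p}"
  using lab_mem[OF p, of p] by (auto simp: spoke_def)

text \<open>Both the spoke diagram and its complement are involutions without fixed points, so each
  has half as many cycles as there are labels.\<close>

lemma spoke_NCG: "spoke p k \<in> NCG ({1..p} \<union> {p+1..p+p}) (tau2 p p) 0" "\<not> closed_under (spoke p k) {1..p}"
proof -
  let ?S = "{1..p} \<union> {p+1..p+p}"
  let ?s = "spoke p k"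
  let ?e = "inv ?s \<circ> tau2 p p"
  note t = two_cyclesD[OF two_cycles_tau2[OF p p]]
  note pp = permutes_permutation[OF spoke_permutes t(7), of k]
  have i: "inv ?s = ?s" by (rule inv_unique_comp) (simp_all add: fun_eq_iff spoke_spoke)
  have e: "?e permutes ?S" by (rule permutes_compose[OF t(1) permutes_inv[OF spoke_permutes]])
  note pe = permutes_permutation[OF e t(7)]
  have el: "?e (lab 0 p a) = lab p p (k - a - 3)" "?e (lab p p a) = lab 0 p (k - a - 3)" for a
    unfolding i by (simp_all add: tau2_lab[OF p p] spoke_lab algebra_simps)
  have neq: "lab 0 p a \<noteq> lab p p b" for a b using lab_mem[OF p, of 0 a] lab_mem[OF p, of p b] by auto
  have "2 * num_cycles ?s ?S = card ?S"
  proof (rule half_cycles_if_involution[OF pp closed_under_permutes[OF spoke_permutes] t(7)])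
    fix x assume x: "x \<in> ?S"
    show "?s (?s x) = x" by (rule spoke_spoke)
    show "?s x \<noteq> x" using x
    proof (cases rule: label_cases)
      case (1 a)
      then show ?thesis using neq[of a "k - a - 2"] unfolding 1 spoke_lab by simp
    next
      case (2 a)
      then show ?thesis using neq[of "k - a - 2" a] unfolding 2 spoke_lab by simp
    qed
  qed
  moreover have "2 * num_cycles ?e ?S = card ?S"
  proof (rule half_cycles_if_involution[OF pe closed_under_permutes[OF e] t(7)])
    fix x assume x: "x \<in> ?S"
    show "?e (?e x) = x" using x
    proof (cases rule: label_cases)
      case (1 a)
      show ?thesis unfolding 1 el by simp
    next
      case (2 a)
      show ?thesis unfolding 2 el by simp
    qed
    show "?e x \<noteq> x" using x
    proof (cases rule: label_cases)
      case (1 a)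
      then show ?thesis using neq[of a "k - a - 3"] unfolding 1 el by simp
    next
      case (2 a)
      then show ?thesis using neq[of "k - a - 3" a] unfolding 2 el by simp
    qed
  qed
  ultimately show "?s \<in> NCG ?S (tau2 p p) 0" using spoke_permutes[of k] by (simp add: NCG_def)
  have "1 \<in> {1..p}" using p by (simp add: Suc_le_eq)
  then show "\<not> closed_under ?s {1..p}" using spoke_image[of 1 k] unfolding closed_under_def by fastforce
qed

lemma spoke_inj: "inj_on (\<lambda>k. spoke p (int k)) {1..p}"
proof (rule inj_onI)
  fix k l assume kl: "k \<in> {1..p}" "l \<in> {1..p}" "spoke p (int k) = spoke p (int l)"
  have "lab p p (int k - 2) = lab p p (int l - 2)"
    using fun_cong[OF kl(3), of "lab 0 p 0"] by (simp add: spoke_lab)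
  then have "(int k - 2) mod int p = (int l - 2) mod int p" by (simp add: lab_eq_iff[OF p])
  then have "int p dvd (int k - 2) - (int l - 2)" by (simp add: mod_eq_dvd_iff)
  then have "int p dvd int k - int l" by simp
  moreover have "\<bar>int k - int l\<bar> < int p" using kl(1,2) by auto
  ultimately have "int k - int l = 0" using dvd_imp_le_int[of "int k - int l" "int p"] by fastforce
  then show "k = l" by simp
qed

lemma cycle_prod_spoke:
  "cycle_prod \<kappa> z (spoke p k) ({1..p} \<union> {p+1..p+p}) = (\<Prod>i=1..p. \<kappa> [z i, z (spoke p k i)])"
proof -
  let ?s = "spoke p k" and ?S = "{1..p} \<union> {p+1..p+p}"
  have lt: "i < ?s i" if "i \<in> {1..p}" for i using spoke_image[OF that, of k] that by auto
  have o: "orbit ?s i = {i, ?s i}" "cyc ?s i = [i, ?s i]" if "i \<in> {1..p}" for i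
    using involution_cyc[of ?s i] spoke_spoke lt[OF that] by auto
  have cp: "cycle_partition ?s ?S = orbit ?s ` {1..p}"
  proof -
    have pp: "permutation ?s" by (rule permutes_permutation[OF spoke_permutes]) simp
    have "orbit ?s x \<in> orbit ?s ` {1..p}" if "x \<in> {p+1..p+p}" for x
    proof -
      obtain a where a: "x = lab p p a" using lab_of[of x p p] \<open>x \<in> {p+1..p+p}\<close> by metis
      have "?s x \<in> {1..p}" unfolding a spoke_lab using lab_mem[OF p, of 0] by simp
      then show ?thesis using permutation_orbit_step[OF pp, of x] by blast
    qed
    then show ?thesis unfolding cycle_partition_def by blast
  qed
  have inj: "inj_on (orbit ?s) {1..p}"
  proof (rule inj_onI)
    fix i j assume ij: "i \<in> {1..p}" "j \<in> {1..p}" "orbit ?s i = orbit ?s j"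
    then have "i = j \<or> i = ?s j" using o by blast
    then show "i = j" using ij(1,2) spoke_image[of j k] by auto
  qed
  have "cycle_prod \<kappa> z ?s ?S = (\<Prod>i=1..p. \<kappa> (map z (cyc ?s (Min (orbit ?s i)))))"
    unfolding cycle_prod_def cp by (subst prod.reindex[OF inj]) simp
  also have "\<dots> = (\<Prod>i=1..p. \<kappa> [z i, z (?s i)])"
  proof (rule prod.cong[OF refl])
    fix i assume i: "i \<in> {1..p}"
    have "Min (orbit ?s i) = i" unfolding o(1)[OF i] using lt[OF i] by (intro Min_eqI) auto
    then show "\<kappa> (map z (cyc ?s (Min (orbit ?s i)))) = \<kappa> [z i, z (?s i)]" using o(2)[OF i] by simp
  qed
  finally show ?thesis .
qed

end

text \<open>The relation \<open>\<tau> \<circ> \<pi> \<circ> \<tau> = \<pi>\<close> on the labels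
  makes one step forward on the first circle a step back on the second. A single label that crosses
  between the circles therefore determines the whole diagram.\<close>

lemma ann_is_spoke:
  assumes pq: "p > 0" "q > 0" and N: "\<pi> \<in> NCG ({1..p} \<union> {p+1..p+q}) (tau2 p q) 0"
    and nc: "\<not> closed_under \<pi> {1..p}"
    and nf: "\<And>i. i \<in> {1..p} \<union> {p+1..p+q} \<Longrightarrow> \<pi> i \<noteq> i"
      "\<And>i. i \<in> {1..p} \<union> {p+1..p+q} \<Longrightarrow> \<pi> i \<noteq> tau2 p q i"
  shows "p = q \<and> (\<exists>k\<in>{1..p}. \<pi> = spoke p (int k))"
proof -
  let ?S = "{1..p} \<union> {p+1..p+q}" and ?t = "tau2 p q"
  note tc = two_cycles_tau2[OF pq]
  note t = two_cyclesD[OF tc] and tl = tau2_lab[OF pq]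
  have inv: "\<pi> (\<pi> i) = i" "?t (\<pi> (?t i)) = \<pi> i" if "i \<in> ?S" for i
    using ann_involution[OF tc N _ _ that] nf by simp_all
  have per: "\<pi> permutes ?S" using N by (rule NCG_permutes)
  have lS: "lab 0 p a \<in> ?S" "lab p q a \<in> ?S" for a using lab_mem[OF pq(1), of 0 a] lab_mem[OF pq(2), of p a] by auto
  obtain x where x: "x \<in> {1..p}" "\<pi> x \<notin> {1..p}" using nc by (auto simp: closed_under_def)
  have "\<pi> x \<in> {p+1..p+q}" using x permutes_in_image[OF per, of x] by blast
  then obtain b0 where b0: "\<pi> x = lab p q b0" using lab_of[of "\<pi> x" p q] by metis
  obtain a0 where a0: "x = lab 0 p a0" using lab_of[of x 0 p] x(1) by (metis add_0)
  have tinj: "u = v" if "?t u = ?t v" for u v using that permutes_inj[OF t(1)] by (simp add: inj_eq)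
  have step: "\<pi> (lab 0 p (a0 + int n)) = lab p q (b0 - int n)" for n
  proof (induction n)
    case 0
    then show ?case using a0 b0 by simp
  next
    case (Suc n)
    have "?t (\<pi> (?t (lab 0 p (a0 + int n)))) = lab p q (b0 - int n)" using inv(2)[OF lS(1)] Suc by simp
    also have "\<dots> = ?t (lab p q (b0 - int (Suc n)))" unfolding tl by simp
    finally have "\<pi> (?t (lab 0 p (a0 + int n))) = lab p q (b0 - int (Suc n))" by (rule tinj)
    moreover have "a0 + int n + 1 = a0 + int (Suc n)" by simp
    ultimately show ?case unfolding tl by (simp only:)
  qed
  have ret: "\<pi> (lab p q (b0 - int n)) = lab 0 p (a0 + int n)" for n
    using inv(1)[OF lS(1), of "a0 + int n"] unfolding step .
  have "lab p q (b0 - int p) = lab p q b0"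
  proof -
    have "lab 0 p (a0 + int p) = lab 0 p (a0 + int 0)" by (simp add: lab_eq_iff[OF pq(1)])
    then show ?thesis using step[of p] step[of 0] by simp
  qed
  \<comment> \<open>After \<open>p\<close> steps the first circle closes up, so the second must as
    well; the reverse divisibility comes from \<open>q\<close> steps on the second.\<close>
  then have "int q dvd int p" by (simp add: lab_eq_iff[OF pq(2)] mod_eq_dvd_iff)
  moreover have "lab 0 p (a0 + int q) = lab 0 p a0"
  proof -
    have "lab p q (b0 - int q) = lab p q (b0 - int 0)" by (simp add: lab_eq_iff[OF pq(2)])
    then show ?thesis using ret[of q] ret[of 0] by simp
  qed
  then have "int p dvd int q" by (simp add: lab_eq_iff[OF pq(1)] mod_eq_dvd_iff)
  ultimately have eq: "p = q" by (simp add: dvd_antisym)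
  \<comment> \<open>In \<open>spoke_lab\<close> the two indices add up to \<open>k - 2\<close>, so
    \<open>k\<close> has to be congruent to \<open>a0 + b0 + 2\<close>. This is its representative
    between 1 and \<open>p\<close>.\<close>
  define k where "k = Suc (nat ((a0 + b0 + 1) mod int p))"
  have k: "k \<in> {1..p}" using pq(1) by (simp add: k_def nat_less_iff Suc_le_eq)
  have kk: "int k = 1 + (a0 + b0 + 1) mod int p" using pq(1) by (simp add: k_def)
  have P: "\<pi> (lab 0 p a) = lab p p (int k - a - 2)" for a
  proof -
    define n where "n = nat ((a - a0) mod int p)"
    have n: "int n = (a - a0) mod int p" using pq(1) by (simp add: n_def)
    have "lab 0 p a = lab 0 p (a0 + int n)" unfolding n by (simp add: lab_eq_iff[OF pq(1)] mod_simps)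
    moreover have "lab p p (b0 - int n) = lab p p (int k - a - 2)"
    proof -
      have "(b0 - int n) mod int p = (b0 - (a - a0)) mod int p" unfolding n by (simp add: mod_simps)
      also have "\<dots> = ((a0 + b0 + 1) - (a + 1)) mod int p" by (simp add: algebra_simps)
      also have "\<dots> = ((a0 + b0 + 1) mod int p - (a + 1)) mod int p" by (simp add: mod_simps)
      also have "\<dots> = (int k - a - 2) mod int p" unfolding kk by (simp add: algebra_simps)
      finally show ?thesis by (simp add: lab_eq_iff[OF pq(1)])
    qed
    ultimately show ?thesis using step[of n] eq by simp
  qed
  have "\<pi> = spoke p (int k)"
  proof
    fix y
    show "\<pi> y = spoke p (int k) y"
    proof (cases "y \<in> {1..p} \<union> {p+1..p+p}")
      case True
      show ?thesis
      proof (rule label_cases[OF pq(1) True])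
        fix a assume "y = lab 0 p a"
        then show ?thesis using P spoke_lab[OF pq(1)] by simp
      next
        fix a assume 2: "y = lab p p a"
        have "y = \<pi> (lab 0 p (int k - a - 2))" unfolding P 2 by simp
        then have "\<pi> y = lab 0 p (int k - a - 2)" using inv(1)[OF lS(1)] by simp
        then show ?thesis unfolding 2 spoke_lab[OF pq(1)] .
      qed
    next
      case False
      then have "\<pi> y = y" using permutes_not_in[OF per] eq by simp
      moreover have "spoke p (int k) y = y" using False by (auto simp: spoke_def)
      ultimately show ?thesis by simp
    qed
  qed
  then show ?thesis using eq k by blast
qed

lemma ann_sum_spokes:
  assumes pq: "p > 0" "q > 0" and vm: "vanishes_mixed k z c ({1..p} \<union> {p+1..p+q})"
    and alt: "\<And>i. i \<in> {1..p} \<union> {p+1..p+q} \<Longrightarrow> tau2 p q i \<noteq> i \<Longrightarrow> c i \<noteq> c (tau2 p q i)"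
  shows "ann_sum k z (tau2 p q) {1..p} {p+1..p+q} =
    (if p = q then \<Sum>l=1..p. \<Prod>i=1..p. k [z i, z (lab p p (int l - int i - 1))] else 0)"
proof -
  let ?S = "{1..p} \<union> {p+1..p+q}" and ?t = "tau2 p q"
  let ?f = "\<lambda>\<pi>. if closed_under \<pi> {1..p} then 0 else cycle_prod k z \<pi> ?S"
  have fin: "finite ?S" by simp
  have zero: "?f \<pi> = 0" if N: "\<pi> \<in> NCG ?S ?t 0" and ns: "\<not> (p = q \<and> (\<exists>l\<in>{1..p}. \<pi> = spoke p (int l)))" for \<pi>
  proof (cases "closed_under \<pi> {1..p}")
    case False
    have per: "\<pi> permutes ?S" using N by (rule NCG_permutes)
    obtain i where i: "i \<in> ?S" "\<pi> i = i \<or> \<pi> i = ?t i" using ann_is_spoke[OF pq N False] ns by blast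
    have "\<pi> i = i \<or> c i \<noteq> c (\<pi> i)" using i(2) alt[OF i(1)] by auto
    then have "cycle_prod k z \<pi> ?S = 0"
      by (rule cycle_prod_vanish[OF permutes_permutation[OF per fin] closed_under_permutes[OF per] fin i(1) _ vm])
    then show ?thesis by simp
  qed simp
  show ?thesis
  proof (cases "p = q")
    case False
    then show ?thesis unfolding ann_sum_def using zero by (simp add: sum.neutral)
  next
    case True
    have "ann_sum k z ?t {1..p} {p+1..p+q} = (\<Sum>\<pi>\<in>(\<lambda>l. spoke p (int l)) ` {1..p}. ?f \<pi>)"
      unfolding ann_sum_def
    proof (rule sum.mono_neutral_right[OF finite_NCG[OF fin]])
      show "(\<lambda>l. spoke p (int l)) ` {1..p} \<subseteq> NCG ?S ?t 0"
        using spoke_NCG(1)[OF pq(1)] True by blast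
      show "\<forall>\<pi>\<in>NCG ?S ?t 0 - (\<lambda>l. spoke p (int l)) ` {1..p}. ?f \<pi> = 0"
        using zero by blast
    qed
    also have "\<dots> = (\<Sum>l=1..p. ?f (spoke p (int l)))" by (subst sum.reindex[OF spoke_inj[OF pq(1)]]) simp
    also have "\<dots> = (\<Sum>l=1..p. \<Prod>i=1..p. k [z i, z (lab p p (int l - int i - 1))])"
    proof (rule sum.cong[OF refl])
      fix l
      have "?f (spoke p (int l)) = cycle_prod k z (spoke p (int l)) ({1..p} \<union> {p+1..p+p})"
        using spoke_NCG(2)[OF pq(1)] True by simp
      also have "\<dots> = (\<Prod>i=1..p. k [z i, z (lab p p (int l - int i - 1))])"
        unfolding cycle_prod_spoke[OF pq(1)] by (rule prod.cong[OF refl]) (simp add: spoke_def)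
      finally show "?f (spoke p (int l)) = (\<Prod>i=1..p. k [z i, z (lab p p (int l - int i - 1))])" .
    qed
    finally show ?thesis using True by simp
  qed
qed

section \<open>Colours\<close>

lemma card_gt_1_iff: "finite S \<Longrightarrow> card S > 1 \<longleftrightarrow> (\<exists>a\<in>S. \<exists>b\<in>S. a \<noteq> b)"
  using card_le_Suc0_iff_eq[of S] by (auto simp: not_le[symmetric])

lemma comes_from_nth:
  "comes_from A m js xs \<longleftrightarrow> length js = length xs \<and> (\<forall>i<length xs. js ! i \<in> {1..m} \<and> xs ! i \<in> A (js ! i))"
  unfolding comes_from_def list_all2_conv_all_nth by (auto simp: in_set_conv_nth subset_iff) metis+

lemma comes_from_simps [simp]:
  "comes_from A m [] xs \<longleftrightarrow> xs = []" "comes_from A m js [] \<longleftrightarrow> js = []"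
  "comes_from A m (j # js) (x # xs) \<longleftrightarrow> j \<in> {1..m} \<and> x \<in> A j \<and> comes_from A m js xs"
  by (auto simp: comes_from_def)

lemma comes_from_length: "comes_from A m js xs \<Longrightarrow> length js = length xs"
  by (simp add: comes_from_nth)

lemma comes_from_append:
  "comes_from A m js xs \<Longrightarrow> comes_from A m ks ys \<Longrightarrow> comes_from A m (js @ ks) (xs @ ys)"
  by (auto simp: comes_from_def list_all2_appendI)

lemma comes_from_take: "comes_from A m js xs \<Longrightarrow> comes_from A m (take n js) (take n xs)"
  and comes_from_drop: "comes_from A m js xs \<Longrightarrow> comes_from A m (drop n js) (drop n xs)"
  by (auto simp: comes_from_def list_all2_takeI list_all2_dropI dest: in_set_takeD in_set_dropD)

lemma comes_from_rotate:
  assumes "comes_from A m js xs"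
  shows "comes_from A m (rotate n js) (rotate n xs)"
  using assms comes_from_length[OF assms]
  by (simp add: rotate_drop_take comes_from_append comes_from_take comes_from_drop)

lemma comes_from_map:
  assumes "comes_from A m js xs" "\<And>j x. j \<in> {1..m} \<Longrightarrow> x \<in> A j \<Longrightarrow> f x \<in> A j"
  shows "comes_from A m js (map f xs)"
  using assms by (simp add: comes_from_nth)

lemma comes_from_rev: "comes_from A m js xs \<Longrightarrow> comes_from A m (rev js) (rev xs)"
  by (simp add: comes_from_def)

lemma cyclically_alternating_nth:
  assumes "cyclically_alternating js" "k < length js" "length js \<ge> 2"
  shows "js ! k \<noteq> js ! (Suc k mod length js)"
proof (cases "Suc k = length js")
  case True
  then have "js ! k = last js" "js ! 0 = hd js"
    using assms(3) by (metis diff_Suc_1 last_conv_nth list.size(3) not_numeral_le_zero, metis hd_conv_nth list.size(3) not_numeral_le_zero)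
  then show ?thesis using assms(1,3) True by (simp add: cyclically_alternating_def)
next
  case False
  then have "Suc k < length js" using assms(2) by simp
  then show ?thesis using assms(1) by (simp add: cyclically_alternating_def alternating_def distinct_adj_conv_nth)
qed

lemma cyclically_alternating_rev: "cyclically_alternating (rev js) = cyclically_alternating js"
  by (auto simp: cyclically_alternating_def alternating_def last_rev hd_rev)

text \<open>A single colour counts as cyclically alternating, so failure means two equal neighbours
  at different positions, possibly the last and the first. Rotation brings them to the
  front.\<close>

lemma not_cyclically_alternating_rotate:
  assumes "\<not> cyclically_alternating js"
  obtains n j w where "rotate n js = j # j # w"
proof (cases "distinct_adj js")
  case False
  have "\<exists>u j v. js = u @ j # j # v" using False
  proof (induction js)
    case (Cons a js)
    show ?case
    proof (cases "js \<noteq> [] \<and> hd js = a")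
      case True
      then have "a # js = [] @ a # a # tl js" by (cases js) auto
      then show ?thesis by blast
    next
      case False
      then have "\<not> distinct_adj js" using Cons.prems by (cases js) auto
      then obtain u j v where "js = u @ j # j # v" using Cons.IH by blast
      then have "a # js = (a # u) @ j # j # v" by simp
      then show ?thesis by blast
    qed
  qed simp
  then obtain u j v where "js = u @ j # j # v" by blast
  then have "rotate (length u) js = j # j # v @ u" by (simp add: rotate_append)
  then show thesis by (rule that)
next
  case True
  then have l: "length js \<ge> 2" "last js = hd js"
    using assms by (auto simp: cyclically_alternating_def alternating_def)
  then obtain j v where js: "js = j # v" "v \<noteq> []" by (cases js; cases "tl js") auto
  then have "v = butlast v @ [j]" using l(2) by (metis append_butlast_last_id last_ConsR list.sel(1))
  then have "js = (j # butlast v) @ [j]" using js(1) by simp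
  then have "rotate (length (j # butlast v)) js = j # j # butlast v" by (metis append_Cons append_Nil rotate_append)
  then show thesis by (rule that)
qed

lemma cyclically_alternating_ge_2:
  assumes "cyclically_alternating js" "length js \<ge> 2"
  shows "card (set js) > 1"
proof -
  have "js \<noteq> []" using assms(2) by auto
  then have "hd js \<in> set js" "last js \<in> set js" by simp_all
  then show ?thesis using assms card_gt_1_iff[of "set js"] unfolding cyclically_alternating_def by blast
qed

lemma vanishes_mixedI:
  assumes "mixed_free_cumulants_vanish k A m" "comes_from A m js xs" "\<And>x. x \<in> set xs \<Longrightarrow> k [x] = 0"
  shows "vanishes_mixed k (\<lambda>c. xs ! (c - 1)) (\<lambda>c. js ! (c - 1)) {1..length xs}"
  unfolding vanishes_mixed_def
proof (intro conjI ballI allI impI)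
  fix i assume "i \<in> {1..length xs}"
  then show "k [xs ! (i - 1)] = 0" by (intro assms(3) nth_mem) auto
next
  fix L assume L: "set L \<subseteq> {1..length xs}" "\<exists>i\<in>set L. \<exists>j\<in>set L. js ! (i - 1) \<noteq> js ! (j - 1)"
  let ?c = "\<lambda>c. js ! (c - 1)" and ?z = "\<lambda>c. xs ! (c - 1)"
  have "comes_from A m (map ?c L) (map ?z L)"
    unfolding comes_from_nth
  proof (intro conjI allI impI)
    fix i assume i: "i < length (map ?z L)"
    then have "L ! i \<in> {1..length xs}" using L(1) nth_mem[of i L] by (simp only: length_map) blast
    then have "L ! i - 1 < length xs" by auto
    then show "map ?c L ! i \<in> {1..m}" "map ?z L ! i \<in> A (map ?c L ! i)"
      using assms(2) i unfolding comes_from_nth by simp_all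
  qed simp
  moreover have "card (set (map ?c L)) > 1"
    using L(2) card_gt_1_iff[of "set (map ?c L)"] by auto
  ultimately show "k (map ?z L) = 0" using assms(1) unfolding mixed_free_cumulants_vanish_def by blast
qed

section \<open>Cyclic indices of reversed lists\<close>

lemma neg_mod_int:
  assumes "p > 0"
  shows "(- a - 1) mod int p = int p - 1 - a mod int p"
proof -
  have "0 \<le> a mod int p" "a mod int p < int p" using assms by simp_all
  then have "int p - 1 - a mod int p = (int p - 1 - a mod int p) mod int p"
    by (intro mod_pos_pos_trivial[symmetric]) auto
  also have "\<dots> = (int p - 1 - a) mod int p" by (rule mod_diff_right_eq)
  also have "\<dots> = (int p + (- a - 1)) mod int p" by (simp add: algebra_simps)
  also have "\<dots> = (- a - 1) mod int p" by (rule mod_add_self1)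
  finally show ?thesis ..
qed

lemma cyc_nth_rev:
  assumes "ys \<noteq> []"
  shows "cyc_nth (rev ys) a = cyc_nth ys (1 - a)"
proof -
  let ?p = "length ys"
  have p: "?p > 0" using assms by simp
  have "nat ((a - 1) mod int ?p) < ?p" using p by (simp add: nat_less_iff)
  then have "cyc_nth (rev ys) a = ys ! (?p - Suc (nat ((a - 1) mod int ?p)))" by (simp add: cyc_nth_def rev_nth)
  also have "?p - Suc (nat ((a - 1) mod int ?p)) = nat (int ?p - 1 - (a - 1) mod int ?p)"
    using p by (simp add: nat_diff_distrib)
  also have "int ?p - 1 - (a - 1) mod int ?p = (1 - a - 1) mod int ?p"
    using neg_mod_int[OF p, of "a - 1"] by simp
  finally show ?thesis by (simp add: cyc_nth_def)
qed

text \<open>Reversal turns the index \<open>k - i\<close> into \<open>1 - k + i\<close>; replacing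
  \<open>k\<close> by \<open>p + 1 - k\<close> gives \<open>k + i\<close> modulo \<open>p\<close>.
  This is why the transposed terms run in the same direction on both circles.\<close>

lemma sum_spokes_rev:
  assumes "ys \<noteq> []" "length ys = p"
  shows "(\<Sum>k=1..p. \<Prod>i=1..p. f i (cyc_nth (rev ys) (int k - int i))) =
    (\<Sum>k=1..p. \<Prod>i=1..p. (f i (cyc_nth ys (int k + int i)) :: complex))"
proof (rule sum.reindex_bij_witness[where i = "\<lambda>k. p + 1 - k" and j = "\<lambda>k. p + 1 - k"])
  fix k assume k: "k \<in> {1..p}"
  show "p + 1 - (p + 1 - k) = k" "p + 1 - k \<in> {1..p}" using k by auto
  show "(\<Prod>i=1..p. f i (cyc_nth ys (int (p + 1 - k) + int i))) = (\<Prod>i=1..p. f i (cyc_nth (rev ys) (int k - int i)))"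
  proof (rule prod.cong[OF refl])
    fix i
    have "int (p + 1 - k) + int i - 1 = int p + (1 - (int k - int i) - 1)" using k by auto
    then have "(int (p + 1 - k) + int i - 1) mod int p = (1 - (int k - int i) - 1) mod int p"
      by (metis mod_add_self1)
    then show "f i (cyc_nth ys (int (p + 1 - k) + int i)) = f i (cyc_nth (rev ys) (int k - int i))"
      unfolding cyc_nth_rev[OF assms(1)] by (simp add: cyc_nth_def assms(2))
  qed
qed auto

lemma cyc_nth_map: "ys \<noteq> [] \<Longrightarrow> cyc_nth (map f ys) a = f (cyc_nth ys a)"
  by (simp add: cyc_nth_def nat_less_iff)

section \<open>Freeness and vanishing of mixed cumulants\<close>

text \<open>\<open>cen x\<close> stands for x minus \<open>\<phi>1 x\<close> times the unit, which
  cannot be written in a monoid; its properties are therefore given as identities between moments.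
  The factors \<open>1 * v\<close> have the form that \<open>cumulant_linear\<close> expects for
  \<open>u = 1\<close>.\<close>

locale coloured_cumulants = second_order_cumulants \<phi>1 \<kappa> tr \<phi>2 \<kappa>2
  for \<phi>1 :: "'a :: monoid_mult \<Rightarrow> complex" and \<kappa> tr \<phi>2 \<kappa>2 +
  fixes A :: "nat \<Rightarrow> 'a set" and m :: nat and cen :: "'a \<Rightarrow> 'a"
  assumes cen_centred: "\<phi>1 (cen x) = 0"
    and cen_\<phi>1: "\<phi>1 (x * v) = \<phi>1 (cen x * v) + \<phi>1 x * \<phi>1 (1 * v)"
    and cen_\<phi>2_left: "\<phi>2 (x * v) r = \<phi>2 (cen x * v) r + \<phi>1 x * \<phi>2 (1 * v) r"
    and cen_\<phi>2_right: "\<phi>2 r (x * v) = \<phi>2 r (cen x * v) + \<phi>1 x * \<phi>2 r (1 * v)"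
    and A_cen: "j \<in> {1..m} \<Longrightarrow> x \<in> A j \<Longrightarrow> cen x \<in> A j"
    and A_tr: "j \<in> {1..m} \<Longrightarrow> x \<in> A j \<Longrightarrow> tr x \<in> A j"
    and A_mult: "j \<in> {1..m} \<Longrightarrow> x \<in> A j \<Longrightarrow> y \<in> A j \<Longrightarrow> x * y \<in> A j"
begin

lemma flip_coloured: "coloured_cumulants \<phi>1 \<kappa> tr (\<lambda>x y. \<phi>2 y x) (\<lambda>xs ys. \<kappa>2 ys xs) A m cen"
proof -
  interpret F: second_order_cumulants \<phi>1 \<kappa> tr "\<lambda>x y. \<phi>2 y x" "\<lambda>xs ys. \<kappa>2 ys xs" by (rule flip)
  show ?thesis
    by unfold_locales
      (rule cen_centred cen_\<phi>1 cen_\<phi>2_left cen_\<phi>2_right A_cen A_tr A_mult | assumption)+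
qed

lemma cumulant_append_commute: "\<kappa> (u @ v) = \<kappa> (v @ u)"
  using rotation_invariantD[OF rotation_invariant, of "length u" "u @ v"] by (simp add: rotate_append)

text \<open>Centring changes an argument by a multiple of the unit, where cumulants of length at
  least two vanish. The list \<open>u\<close> collects the arguments that are already
  centred.\<close>

lemma cumulant_cen: "length (u @ xs) \<ge> 2 \<Longrightarrow> \<kappa> (u @ xs) = \<kappa> (u @ map cen xs)"
proof (induction xs arbitrary: u)
  case (Cons x xs)
  have ne: "xs @ u \<noteq> []" using Cons.prems by auto
  have "\<kappa> (x # xs @ u) = \<kappa> (cen x # xs @ u) + \<phi>1 x * \<kappa> (1 # xs @ u)"
    using cumulant_linear[of x "cen x" "\<phi>1 x" 1, OF cen_\<phi>1] by (simp add: head_linear_def)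
  then have "\<kappa> (u @ x # xs) = \<kappa> (u @ cen x # xs)"
    using cumulant_append_commute[of u "x # xs"] cumulant_append_commute[of u "cen x # xs"] cumulant_unit[OF ne] by simp
  then show ?case using Cons.IH[of "u @ [cen x]"] Cons.prems by simp
qed simp

lemma cumulant2_append_commute: "\<kappa>2 (u @ v) ys = \<kappa>2 (v @ u) ys"
  using rotation_invariantD[OF rotation_invariant2D(1)[OF rotation_invariant2], of "length u" "u @ v" ys]
  by (simp add: rotate_append)

lemma cumulant2_cen: "\<kappa>2 (u @ xs) ys = \<kappa>2 (u @ map cen xs) ys"
proof (induction xs arbitrary: u)
  case (Cons x xs)
  have "\<kappa>2 (x # xs @ u) ys = \<kappa>2 (cen x # xs @ u) ys + \<phi>1 x * \<kappa>2 (1 # xs @ u) ys"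
    by (rule cumulant2_linear[OF cen_\<phi>1 cen_\<phi>2_left])
  then have "\<kappa>2 (u @ x # xs) ys = \<kappa>2 (u @ cen x # xs) ys"
    using cumulant2_append_commute[of u "x # xs"] cumulant2_append_commute[of u "cen x # xs"] cumulant2_unit by simp
  then show ?case using Cons.IH[of "u @ [cen x]"] by simp
qed simp

lemma free_if_mixed_vanish:
  assumes "mixed_free_cumulants_vanish \<kappa> A m"
  shows "free_subalgebras \<phi>1 A m"
  unfolding free_subalgebras_def
proof (intro allI impI)
  fix js xs assume h: "xs \<noteq> []" "comes_from A m js xs" "alternating js" "\<forall>x\<in>set xs. centred \<phi>1 x"
  have "(\<Sum>\<pi>\<in>NCG {1..length xs} (tau (length xs)) 1. cycle_prod \<kappa> (\<lambda>c. xs ! (c - 1)) \<pi> {1..length xs}) = 0"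
  proof (rule NC_sum_vanish)
    show "vanishes_mixed \<kappa> (\<lambda>c. xs ! (c - 1)) (\<lambda>c. js ! (c - 1)) {1..length xs}"
      using h by (intro vanishes_mixedI[OF assms]) (auto simp: cumulant_single centred_def)
    show "js ! (i - 1) \<noteq> js ! (Suc i - 1)" if "1 \<le> i" "i < length xs" for i
    proof -
      have "Suc (i - 1) < length js" using that comes_from_length[OF h(2)] by simp
      then have "js ! (i - 1) \<noteq> js ! Suc (i - 1)" using h(3) by (simp add: alternating_def distinct_adj_conv_nth)
      then show ?thesis using that by simp
    qed
  qed (use h(1) in simp)
  then show "\<phi>1 (prod_list xs) = 0" using moment_std[OF h(1)] by simp
qed

lemma mixed_vanish_if_free:
  assumes free: "free_subalgebras \<phi>1 A m"
  shows "mixed_free_cumulants_vanish \<kappa> A m"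
proof -
  have "\<kappa> xs = 0" if "comes_from A m js xs" "card (set js) > 1" for js xs
    using that
  proof (induction "length xs" arbitrary: js xs rule: less_induct)
    case less
    have len: "length js = length xs" using less.prems(1) by (rule comes_from_length)
    have l2: "length xs \<ge> 2" using less.prems(2) card_length[of js] len by simp
    show ?case
    proof (cases "cyclically_alternating js")
      case False
      obtain n j ws where rj: "rotate n js = j # j # ws" by (rule not_cyclically_alternating_rotate[OF False])
      have cr: "comes_from A m (j # j # ws) (rotate n xs)" using comes_from_rotate[OF less.prems(1), of n] unfolding rj .
      then obtain a b w where rx: "rotate n xs = a # b # w"
        using comes_from_length[OF cr] by (metis length_Suc_conv)
      have c: "j \<in> {1..m}" "a \<in> A j" "b \<in> A j" "comes_from A m ws w" using cr unfolding rx by simp_all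
      have set: "set js = insert j (set ws)" using arg_cong[OF rj, of set] by simp
      have lw: "length xs = length w + 2" using arg_cong[OF rx, of length] by simp
      obtain i where i: "i \<in> set ws" "i \<noteq> j"
        using less.prems(2) card_gt_1_iff[of "set js"] unfolding set by auto
      have "\<kappa> ((a * b) # w) = 0"
      proof (rule less.hyps)
        show "comes_from A m (j # ws) ((a * b) # w)" using c A_mult by simp
        show "card (set (j # ws)) > 1" using less.prems(2) set by simp
      qed (simp add: lw)
      \<comment> \<open>Both factors contain colour \<open>j\<close>, and the other colour
        \<open>i\<close> occurs in one of the two parts of \<open>w\<close>, so that factor is mixed
        and shorter.\<close>
      moreover have "\<kappa> (a # drop l w) * \<kappa> (b # take l w) = 0" for l
      proof -
        have cd: "comes_from A m (j # drop l ws) (a # drop l w)" "comes_from A m (j # take l ws) (b # take l w)"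
          using c comes_from_take comes_from_drop by simp_all
        have "i \<in> set (take l ws) \<or> i \<in> set (drop l ws)"
          using i(1) by (metis Un_iff append_take_drop_id set_append)
        then show ?thesis
        proof
          assume "i \<in> set (take l ws)"
          then have "card (set (j # take l ws)) > 1" using i(2) by (subst card_gt_1_iff) auto
          then have "\<kappa> (b # take l w) = 0" using less.hyps[OF _ cd(2)] lw by simp
          then show ?thesis by simp
        next
          assume "i \<in> set (drop l ws)"
          then have "card (set (j # drop l ws)) > 1" using i(2) by (subst card_gt_1_iff) auto
          then have "\<kappa> (a # drop l w) = 0" using less.hyps[OF _ cd(1)] lw by simp
          then show ?thesis by simp
        qed
      qed
      ultimately have "\<kappa> (a # b # w) = 0" using cumulant_merge[of a b w] by simp
      then show ?thesis using rotation_invariantD[OF rotation_invariant, of n xs] rx by simp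
    next
      case True
      let ?ys = "map cen xs"
      let ?n = "length xs"
      have c: "comes_from A m js ?ys" by (rule comes_from_map[OF less.prems(1)]) (rule A_cen)
      have ne: "?ys \<noteq> []" using l2 by auto
      have "\<phi>1 (prod_list ?ys) = 0"
        using free ne c True cen_centred
        unfolding free_subalgebras_def cyclically_alternating_def centred_def by auto
      moreover have "(\<Sum>\<pi>\<in>NCG {1..?n} (tau ?n) 1. cycle_prod (trunc ?n \<kappa>) (\<lambda>c. ?ys ! (c - 1)) \<pi> {1..?n}) = 0"
      proof (rule NC_sum_vanish)
        \<comment> \<open>Only shorter mixed cumulants are known to vanish so far, which truncation
          turns into the unrestricted hypothesis that \<open>NC_sum_vanish\<close> needs.\<close>
        have "mixed_free_cumulants_vanish (trunc ?n \<kappa>) A m"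
          unfolding mixed_free_cumulants_vanish_def trunc_def using less.hyps by auto
        then have "vanishes_mixed (trunc ?n \<kappa>) (\<lambda>c. ?ys ! (c - 1)) (\<lambda>c. js ! (c - 1)) {1..length ?ys}"
          by (rule vanishes_mixedI[OF _ c]) (auto simp: trunc_def cumulant_single cen_centred)
        then show "vanishes_mixed (trunc ?n \<kappa>) (\<lambda>c. ?ys ! (c - 1)) (\<lambda>c. js ! (c - 1)) {1..?n}" by simp
        show "js ! (i - 1) \<noteq> js ! (Suc i - 1)" if "1 \<le> i" "i < ?n" for i
        proof -
          have "Suc (i - 1) < length js" using that len by simp
          then have "js ! (i - 1) \<noteq> js ! Suc (i - 1)"
            using True by (simp add: cyclically_alternating_def alternating_def distinct_adj_conv_nth)
          then show ?thesis using that by simp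
        qed
      qed (use l2 in auto)
      ultimately have "\<kappa> ?ys = 0" using cumulant_recursion[OF ne] by simp
      then show ?thesis using cumulant_cen[of "[]" xs] l2 by simp
    qed
  qed
  then show ?thesis unfolding mixed_free_cumulants_vanish_def by blast
qed

text \<open>Two cyclic neighbours of equal colour \<open>j\<close> are multiplied, and each term of
  \<open>cumulant2_merge\<close> has a mixed factor. In split terms the other colour
  \<open>i\<close> lies in \<open>ys\<close> or in one part of \<open>w\<close>; if
  \<open>\<kappa>2\<close> misses it, the first-order factor has it. The inserted terms contain all
  arguments at once.\<close>

lemma cumulant2_merge_vanish:
  assumes mv: "mixed_free_cumulants_vanish \<kappa> A m"
    and cx: "comes_from A m js xs" and cy: "comes_from A m ks ys"
    and na: "\<not> cyclically_alternating js" and mixed: "card (set js \<union> set ks) > 1"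
    and IH: "\<And>js' xs'. \<lbrakk>comes_from A m js' xs'; xs' \<noteq> []; length xs' < length xs; card (set js' \<union> set ks) > 1\<rbrakk> \<Longrightarrow>
      \<kappa>2 xs' ys = 0"
  shows "\<kappa>2 xs ys = 0"
proof -
  obtain n j ws where rj: "rotate n js = j # j # ws" by (rule not_cyclically_alternating_rotate[OF na])
  have cr: "comes_from A m (j # j # ws) (rotate n xs)" using comes_from_rotate[OF cx, of n] unfolding rj .
  then obtain a b w where rx: "rotate n xs = a # b # w"
    using comes_from_length[OF cr] by (metis length_Suc_conv)
  have c: "j \<in> {1..m}" "a \<in> A j" "b \<in> A j" "comes_from A m ws w" using cr unfolding rx by simp_all
  have set: "set js = insert j (set ws)" using arg_cong[OF rj, of set] by simp
  have lw: "length xs = length w + 2" using arg_cong[OF rx, of length] by simp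
  have "\<exists>a\<in>set js \<union> set ks. \<exists>b\<in>set js \<union> set ks. a \<noteq> b"
    using mixed by (simp only: card_gt_1_iff finite_Un finite_set simp_thms)
  then have "\<exists>i\<in>set js \<union> set ks. i \<noteq> j" by metis
  then obtain i where i: "i \<in> set ws \<union> set ks" "i \<noteq> j" unfolding set by auto
  have gt1: "card X > 1" if "finite X" "i \<in> X" "j \<in> X" for X using that i(2) by (subst card_gt_1_iff) auto
  have k0: "\<kappa> l = 0" if "comes_from A m is l" "i \<in> set is" "j \<in> set is" for "is" l
    using mv that gt1[of "set is"] unfolding mixed_free_cumulants_vanish_def by auto
  have "\<kappa>2 ((a * b) # w) ys = 0"
  proof (rule IH)
    show "comes_from A m (j # ws) ((a * b) # w)" using c A_mult by simp
    show "card (set (j # ws) \<union> set ks) > 1" using i(1) by (intro gt1) auto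
  qed (simp_all add: lw)
  moreover have "\<kappa>2 (a # drop l w) ys * \<kappa> (b # take l w) = 0 \<and> \<kappa> (a # drop l w) * \<kappa>2 (b # take l w) ys = 0" for l
  proof -
    have cd: "comes_from A m (j # drop l ws) (a # drop l w)" "comes_from A m (j # take l ws) (b # take l w)"
      using c comes_from_take comes_from_drop by simp_all
    have 1: "\<kappa>2 (a # drop l w) ys = 0" if "i \<in> set (drop l ws) \<union> set ks"
      using that lw by (intro IH[OF cd(1)] gt1) auto
    have 2: "\<kappa>2 (b # take l w) ys = 0" if "i \<in> set (take l ws) \<union> set ks"
      using that lw by (intro IH[OF cd(2)] gt1) auto
    have 3: "\<kappa> (a # drop l w) = 0" if "i \<in> set (drop l ws)" using that by (intro k0[OF cd(1)]) auto
    have 4: "\<kappa> (b # take l w) = 0" if "i \<in> set (take l ws)" using that by (intro k0[OF cd(2)]) auto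
    have "i \<in> set (take l ws) \<or> i \<in> set (drop l ws) \<or> i \<in> set ks"
      using i(1) by (metis Un_iff append_take_drop_id set_append)
    then show ?thesis using 1 2 3 4 by auto
  qed
  moreover have "\<kappa> (a # rotate l ys @ b # w) = 0" for l
  proof (rule k0)
    show "comes_from A m (j # rotate l ks @ j # ws) (a # rotate l ys @ b # w)"
      using c comes_from_append[OF comes_from_rotate[OF cy, of l], of "j # ws" "b # w"] by simp
  qed (use i(1) in auto)
  moreover have "\<kappa> (a # rotate l (map tr (rev ys)) @ b # w) = 0" for l
  proof (rule k0)
    have "comes_from A m (rev ks) (map tr (rev ys))" by (rule comes_from_map[OF comes_from_rev[OF cy]]) (rule A_tr)
    then show "comes_from A m (j # rotate l (rev ks) @ j # ws) (a # rotate l (map tr (rev ys)) @ b # w)"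
      using c comes_from_append[OF comes_from_rotate[of A m "rev ks" _ l], of _ "j # ws" "b # w"] by simp
  qed (use i(1) in auto)
  ultimately have "\<kappa>2 (a # b # w) ys = 0" using cumulant2_merge[of a b w ys] by simp
  then show ?thesis
    using rotation_invariantD[OF rotation_invariant2D(1)[OF rotation_invariant2], of n xs ys] rx by simp
qed

section \<open>Moments of centred, cyclically alternating arguments\<close>

context
  fixes js ks :: "nat list" and xs ys :: "'a list"
  assumes mv: "mixed_free_cumulants_vanish \<kappa> A m"
    and ne: "xs \<noteq> []" "ys \<noteq> []"
    and cx: "comes_from A m js xs" and cy: "comes_from A m ks ys"
    and alt: "cyclically_alternating js" "cyclically_alternating ks"
    and cen: "\<forall>x\<in>set xs. centred \<phi>1 x" "\<forall>y\<in>set ys. centred \<phi>1 y"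
begin

lemma colouring:
  defines "p \<equiv> length xs" and "q \<equiv> length ys"
  defines "z \<equiv> \<lambda>c. (xs @ ys) ! (c - 1)" and "col \<equiv> \<lambda>c. (js @ ks) ! (c - 1)"
  shows "vanishes_mixed \<kappa> z col ({1..p} \<union> {p+1..p+q})"
    and "i \<in> {1..p} \<union> {p+1..p+q} \<Longrightarrow> tau2 p q i \<noteq> i \<Longrightarrow> col i \<noteq> col (tau2 p q i)"
    and "p > 0" "q > 0"
proof -
  show pq: "p > 0" "q > 0" using ne by (simp_all add: p_def q_def)
  have "vanishes_mixed \<kappa> z col {1..length (xs @ ys)}"
    unfolding z_def col_def
    by (rule vanishes_mixedI[OF mv comes_from_append[OF cx cy]]) (use cen in \<open>auto simp: cumulant_single centred_def\<close>)
  then show "vanishes_mixed \<kappa> z col ({1..p} \<union> {p+1..p+q})" unfolding atLeastAtMost_split by (simp add: p_def q_def)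
  have len: "length js = p" "length ks = q" using comes_from_length[OF cx] comes_from_length[OF cy] by (simp_all add: p_def q_def)
  note tl = tau2_lab[OF pq]
  assume i: "i \<in> {1..p} \<union> {p+1..p+q}" and ti: "tau2 p q i \<noteq> i"
  have md: "nat (int k mod int n) = k mod n" for k n by (simp add: zmod_int[symmetric])
  from i show "col i \<noteq> col (tau2 p q i)"
  proof
    assume i: "i \<in> {1..p}"
    have t: "tau2 p q i = 1 + i mod p"
      using tl(1)[of "int i - 1"] lab_of[of i 0 p] i by (simp add: lab_def md)
    have "p \<noteq> 1" using t ti i by auto
    then have "i - 1 < length js" "2 \<le> length js" using i pq by (auto simp: len)
    from cyclically_alternating_nth[OF alt(1) this] have "js ! (i - 1) \<noteq> js ! (Suc (i - 1) mod p)"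
      by (simp add: len)
    moreover have "i mod p < p" using pq by simp
    ultimately show ?thesis using i unfolding t col_def by (auto simp: nth_append len)
  next
    assume i: "i \<in> {p+1..p+q}"
    have t: "tau2 p q i = p + 1 + (i - p) mod q"
    proof -
      have "int i - int p - 1 + 1 = int (i - p)" using i by auto
      then have "lab p q (int i - int p - 1 + 1) = p + 1 + (i - p) mod q" by (simp only: lab_def md)
      moreover have "lab p q (int i - int p - 1) = i" using lab_of[of i p q] i by simp
      ultimately show ?thesis using tl(2)[of "int i - int p - 1"] by simp
    qed
    have "q \<noteq> 1" using t ti i by auto
    then have "i - p - 1 < length ks" "2 \<le> length ks" using i pq by (auto simp: len)
    from cyclically_alternating_nth[OF alt(2) this] have "ks ! (i - p - 1) \<noteq> ks ! (Suc (i - p - 1) mod q)"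
      by (simp add: len)
    moreover have "Suc (i - p - 1) = i - p" "i - 1 - p = i - p - 1" "\<not> i - 1 < p" using i by auto
    ultimately show ?thesis unfolding t col_def by (simp add: nth_append len)
  qed
qed

lemma annular_value:
  "annular \<kappa> xs ys = (if length xs = length ys then
     \<Sum>k=1..length xs. \<Prod>i=1..length xs. \<phi>1 (cyc_nth xs (int i) * cyc_nth ys (int k - int i)) else 0)"
proof -
  let ?p = "length xs" and ?q = "length ys"
  let ?z = "\<lambda>c. (xs @ ys) ! (c - 1)"
  note c = colouring
  have "annular \<kappa> xs ys = (if ?p = ?q then
      \<Sum>l=1..?p. \<Prod>i=1..?p. \<kappa> [?z i, ?z (lab ?p ?p (int l - int i - 1))] else 0)"
    unfolding annular_def by (rule ann_sum_spokes[OF c(3,4,1,2)])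
  moreover have "\<kappa> [?z i, ?z (lab ?p ?p (int l - int i - 1))] = \<phi>1 (cyc_nth xs (int i) * cyc_nth ys (int l - int i))"
    if "?p = ?q" "i \<in> {1..?p}" for l i
  proof -
    have "(int i - 1) mod int ?p = int i - 1" using that(2) by (intro mod_pos_pos_trivial) auto
    then have 1: "?z i = cyc_nth xs (int i)" using that(2) by (simp add: cyc_nth_def nth_append nat_diff_distrib) auto
    have 2: "?z (lab ?p ?p (int l - int i - 1)) = cyc_nth ys (int l - int i)"
      using that(1) by (simp add: cyc_nth_def lab_def nth_append)
    have "?z i \<in> set xs" using that(2) by (auto simp: nth_append)
    then show ?thesis using cen(1) unfolding 1[symmetric] 2[symmetric] by (simp add: cumulant_pair centred_def)
  qed
  ultimately show ?thesis by (auto intro!: sum.cong prod.cong)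
qed

text \<open>Here \<open>k2\<close> is arbitrary because one direction of the equivalence uses
  \<open>\<kappa>2\<close> itself and the other one its truncation.\<close>

lemma disc_vanish:
  assumes k2: "mixed_second_order_cumulants_vanish k2 A m" and mixed: "card (set js \<union> set ks) > 1"
  shows "disc \<kappa> k2 xs ys = 0"
proof -
  let ?p = "length xs" and ?q = "length ys"
  let ?z = "\<lambda>c. (xs @ ys) ! (c - 1)" and ?c = "\<lambda>c. (js @ ks) ! (c - 1)"
  let ?P = "{1..?p}" and ?Q = "{?p+1..?p+?q}"
  note c = colouring
  have len: "length js = ?p" "length ks = ?q" using comes_from_length[OF cx] comes_from_length[OF cy] by simp_all
  have cf: "comes_from A m (map ?c L) (map ?z L)" if "set L \<subseteq> ?P \<union> ?Q" for L
    unfolding comes_from_nth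
  proof (intro conjI allI impI)
    fix i assume i: "i < length (map ?z L)"
    then have "L ! i \<in> ?P \<union> ?Q" using that nth_mem[of i L] by (simp only: length_map) blast
    then have "L ! i - 1 < length (xs @ ys)" by auto
    then show "map ?c L ! i \<in> {1..m}" "map ?z L ! i \<in> A (map ?c L ! i)"
      using comes_from_append[OF cx cy] i unfolding comes_from_nth by simp_all
  qed simp
  show ?thesis
    unfolding disc_def
  proof (rule disc_sum_vanish[OF two_cycles_tau2[OF c(3,4)] c(1) _ c(2)])
    fix L L' assume L: "L \<noteq> []" "L' \<noteq> []" "set L \<subseteq> ?P" "set L' \<subseteq> ?Q"
      "\<exists>i\<in>set L \<union> set L'. \<exists>j\<in>set L \<union> set L'. ?c i \<noteq> ?c j"
    have "card (set (map ?c L) \<union> set (map ?c L')) > 1"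
      using L(5) by (subst card_gt_1_iff) (simp, auto)
    then show "k2 (map ?z L) (map ?z L') = 0"
      using k2 cf[of L] cf[of L'] L(1-4) unfolding mixed_second_order_cumulants_vanish_def by blast
  next
    fix a b assume ab: "?P = {a}" "?Q = {b}"
    have "card ?P = 1" "card ?Q = 1" unfolding ab by simp_all
    then have pq: "?p = 1" "?q = 1" by simp_all
    have "a = 1" "b = 2" using ab unfolding pq by auto
    obtain j k where jk: "js = [j]" "ks = [k]" using len unfolding pq by (auto simp: length_Suc_conv)
    then have "j \<noteq> k" using mixed by auto
    then show "?c a \<noteq> ?c b" unfolding jk \<open>a = 1\<close> \<open>b = 2\<close> by simp
  qed
qed

text \<open>The lists are fixed in this context, so \<open>annular_value\<close> cannot be applied
  to the reversed transposed list here; the required instance is the premise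
  \<open>r\<close>.\<close>

lemma moment_formula:
  "\<phi>2 (prod_list xs) (prod_list ys) =
    (if length xs = length ys then
      (\<Sum>k=1..length xs. \<Prod>i=1..length xs. \<phi>1 (cyc_nth xs (int i) * cyc_nth ys (int k - int i))) +
      (\<Sum>k=1..length xs. \<Prod>i=1..length xs. \<phi>1 (cyc_nth xs (int i) * tr (cyc_nth ys (int k + int i))))
     else 0) + disc \<kappa> \<kappa>2 xs ys"
  if r: "annular \<kappa> xs (map tr (rev ys)) = (if length xs = length (map tr (rev ys)) then
     \<Sum>k=1..length xs. \<Prod>i=1..length xs. \<phi>1 (cyc_nth xs (int i) * cyc_nth (map tr (rev ys)) (int k - int i)) else 0)"
proof -
  have "annular \<kappa> xs (map tr (rev ys)) = (if length xs = length ys then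
     \<Sum>k=1..length xs. \<Prod>i=1..length xs. \<phi>1 (cyc_nth xs (int i) * tr (cyc_nth ys (int k + int i))) else 0)"
  proof (cases "length xs = length ys")
    case True
    have "rev ys \<noteq> []" using ne(2) by simp
    then have "annular \<kappa> xs (map tr (rev ys)) =
        (\<Sum>k=1..length xs. \<Prod>i=1..length xs. \<phi>1 (cyc_nth xs (int i) * tr (cyc_nth (rev ys) (int k - int i))))"
      unfolding r using True by (simp only: cyc_nth_map length_map length_rev if_True simp_thms)
    also have "\<dots> = (\<Sum>k=1..length xs. \<Prod>i=1..length xs. \<phi>1 (cyc_nth xs (int i) * tr (cyc_nth ys (int k + int i))))"
      by (rule sum_spokes_rev[OF ne(2) True[symmetric]])
    finally show ?thesis using True by simp
  qed (simp add: r)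
  then show ?thesis unfolding moment2_lists[OF ne] annular_value by simp
qed

end

lemma second_order_moment:
  assumes mv: "mixed_free_cumulants_vanish \<kappa> A m"
    and ne: "xs \<noteq> []" "ys \<noteq> []"
    and cx: "comes_from A m js xs" and cy: "comes_from A m ks ys"
    and alt: "cyclically_alternating js" "cyclically_alternating ks"
    and cen: "\<forall>x\<in>set xs. centred \<phi>1 x" "\<forall>y\<in>set ys. centred \<phi>1 y"
  shows "\<phi>2 (prod_list xs) (prod_list ys) =
    (if length xs = length ys then
      (\<Sum>k=1..length xs. \<Prod>i=1..length xs. \<phi>1 (cyc_nth xs (int i) * cyc_nth ys (int k - int i))) +
      (\<Sum>k=1..length xs. \<Prod>i=1..length xs. \<phi>1 (cyc_nth xs (int i) * tr (cyc_nth ys (int k + int i))))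
     else 0) + disc \<kappa> \<kappa>2 xs ys"
proof (rule moment_formula[OF assms])
  show "annular \<kappa> xs (map tr (rev ys)) = (if length xs = length (map tr (rev ys)) then
     \<Sum>k=1..length xs. \<Prod>i=1..length xs. \<phi>1 (cyc_nth xs (int i) * cyc_nth (map tr (rev ys)) (int k - int i)) else 0)"
  proof (rule annular_value[OF mv ne(1) _ cx _ alt(1) _ cen(1)])
    show "comes_from A m (rev ks) (map tr (rev ys))" by (rule comes_from_map[OF comes_from_rev[OF cy]]) (rule A_tr)
    show "cyclically_alternating (rev ks)" using alt(2) by (simp add: cyclically_alternating_rev)
    show "\<forall>y\<in>set (map tr (rev ys)). centred \<phi>1 y" using cen(2) by (auto simp: centred_def \<phi>1_tr)
  qed (use ne(2) in simp)
qed

text \<open>A cyclically alternating list of length at least two already has two colours; two single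
  arguments have different colours by the last assumption.\<close>

lemma mixed_if_alternating:
  assumes "comes_from A m js xs" "comes_from A m ks ys" "xs \<noteq> []" "ys \<noteq> []"
    "cyclically_alternating js" "cyclically_alternating ks" "length xs = 1 \<and> length ys = 1 \<longrightarrow> js \<noteq> ks"
  shows "card (set js \<union> set ks) > 1"
proof -
  have len: "length js = length xs" "length ks = length ys" using comes_from_length assms(1,2) by blast+
  consider "length js \<ge> 2" | "length ks \<ge> 2" | "length js = 1" "length ks = 1"
    using len assms(3,4) by (cases "length js \<ge> 2"; cases "length ks \<ge> 2") (auto simp: not_le less_2_cases_iff)
  then show ?thesis
  proof cases
    case 1
    then have "card (set js) > 1" by (rule cyclically_alternating_ge_2[OF assms(5)])
    then show ?thesis using card_mono[of "set js \<union> set ks" "set js"] by simp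
  next
    case 2
    then have "card (set ks) > 1" by (rule cyclically_alternating_ge_2[OF assms(6)])
    then show ?thesis using card_mono[of "set js \<union> set ks" "set ks"] by simp
  next
    case 3
    then obtain j k where jk: "js = [j]" "ks = [k]" by (auto simp: length_Suc_conv)
    then show ?thesis using assms(7) len by (subst card_gt_1_iff) auto
  qed
qed

theorem second_order_free_iff:
  "real_second_order_free tr \<phi>1 \<phi>2 A m \<longleftrightarrow>
    mixed_free_cumulants_vanish \<kappa> A m \<and> mixed_second_order_cumulants_vanish \<kappa>2 A m"
proof
  assume v: "mixed_free_cumulants_vanish \<kappa> A m \<and> mixed_second_order_cumulants_vanish \<kappa>2 A m"
  show "real_second_order_free tr \<phi>1 \<phi>2 A m"
    unfolding real_second_order_free_def Let_def
  proof (intro conjI allI impI)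
    show "free_subalgebras \<phi>1 A m" using v free_if_mixed_vanish by blast
    fix js xs ks ys
    assume h: "xs \<noteq> []" "ys \<noteq> []" "comes_from A m js xs" "comes_from A m ks ys" "cyclically_alternating js"
      "cyclically_alternating ks" "length xs = 1 \<and> length ys = 1 \<longrightarrow> js \<noteq> ks"
      "\<forall>x\<in>set xs. centred \<phi>1 x" "\<forall>y\<in>set ys. centred \<phi>1 y"
    have mixed: "card (set js \<union> set ks) > 1" by (rule mixed_if_alternating[OF h(3,4,1,2,5,6,7)])
    have "disc \<kappa> \<kappa>2 xs ys = 0" using v by (intro disc_vanish[OF _ h(1-6,8,9) _ mixed]) auto
    then show "\<phi>2 (prod_list xs) (prod_list ys) =
      (if length xs = length ys then
        (\<Sum>k=1..length xs. \<Prod>i=1..length xs. \<phi>1 (cyc_nth xs (int i) * cyc_nth ys (int k - int i))) +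
        (\<Sum>k=1..length xs. \<Prod>i=1..length xs. \<phi>1 (cyc_nth xs (int i) * tr (cyc_nth ys (int k + int i))))
       else 0)"
      using second_order_moment[OF _ h(1-6,8,9)] v by simp
  qed
next
  assume f: "real_second_order_free tr \<phi>1 \<phi>2 A m"
  then have mv: "mixed_free_cumulants_vanish \<kappa> A m"
    unfolding real_second_order_free_def using mixed_vanish_if_free by blast
  \<comment> \<open>The data with the arguments of \<open>\<phi>2\<close> exchanged, for merging and
    centring in the second list.\<close>
  interpret F: coloured_cumulants \<phi>1 \<kappa> tr "\<lambda>x y. \<phi>2 y x" "\<lambda>xs ys. \<kappa>2 ys xs" A m cen by (rule flip_coloured)
  have "\<kappa>2 xs ys = 0"
    if "xs \<noteq> []" "ys \<noteq> []" "comes_from A m js xs" "comes_from A m ks ys" "card (set js \<union> set ks) > 1" for js xs ks ys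
    using that
  proof (induction "length xs + length ys" arbitrary: js xs ks ys rule: less_induct)
    case less
    note ne = less.prems(1,2) and cx = less.prems(3) and cy = less.prems(4) and mixed = less.prems(5)
    consider "\<not> cyclically_alternating js" | "\<not> cyclically_alternating ks"
      | "cyclically_alternating js" "cyclically_alternating ks" by blast
    then show ?case
    proof cases
      case 1
      show ?thesis
        by (rule cumulant2_merge_vanish[OF mv cx cy 1 mixed]) (use less.hyps ne(2) cy in auto)
    next
      case 2
      have m': "card (set ks \<union> set js) > 1" using mixed by (simp add: Un_commute)
      show ?thesis
        by (rule F.cumulant2_merge_vanish[OF mv cy cx 2 m']) (use less.hyps ne(1) cx in \<open>auto simp: Un_commute\<close>)
    next
      case 3
      let ?xs = "map cen xs" and ?ys = "map cen ys"
      let ?n = "length xs + length ys"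
      have ne': "?xs \<noteq> []" "?ys \<noteq> []" using ne by simp_all
      have c: "comes_from A m js ?xs" "comes_from A m ks ?ys" by (rule comes_from_map[OF cx] comes_from_map[OF cy], rule A_cen, assumption+)+
      have ce: "\<forall>x\<in>set ?xs. centred \<phi>1 x" "\<forall>y\<in>set ?ys. centred \<phi>1 y" by (auto simp: centred_def cen_centred)
      have diff: "length ?xs = 1 \<and> length ?ys = 1 \<longrightarrow> js \<noteq> ks"
        using mixed comes_from_length[OF cx] by (auto simp: length_Suc_conv)
      have "\<phi>2 (prod_list ?xs) (prod_list ?ys) =
        (if length ?xs = length ?ys then
          (\<Sum>k=1..length ?xs. \<Prod>i=1..length ?xs. \<phi>1 (cyc_nth ?xs (int i) * cyc_nth ?ys (int k - int i))) +
          (\<Sum>k=1..length ?xs. \<Prod>i=1..length ?xs. \<phi>1 (cyc_nth ?xs (int i) * tr (cyc_nth ?ys (int k + int i))))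
         else 0)"
        using f ne' c 3 diff ce unfolding real_second_order_free_def Let_def by blast
      \<comment> \<open>Freeness prescribes exactly the two annular sums, so the disc sum must
        vanish. Its lower terms vanish by induction, and the top term is the cumulant.\<close>
      then have "disc \<kappa> \<kappa>2 ?xs ?ys = 0" using second_order_moment[OF mv ne' c 3 ce] by simp
      moreover have "mixed_second_order_cumulants_vanish (trunc2 (length ?xs + length ?ys) \<kappa>2) A m"
        unfolding mixed_second_order_cumulants_vanish_def trunc2_def using less.hyps by auto
      then have "disc \<kappa> (trunc2 (length ?xs + length ?ys) \<kappa>2) ?xs ?ys = 0"
        by (rule disc_vanish[OF mv ne' c 3 ce _ mixed])
      ultimately have "\<kappa>2 ?xs ?ys = 0" using disc_top[OF ne', of \<kappa> \<kappa>2] by simp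
      then show ?thesis
        using cumulant2_cen[of "[]" xs ys] F.cumulant2_cen[where u = "[]" and xs = ys and ys = ?xs] by (simp only: append_Nil)
    qed
  qed
  then show "mixed_free_cumulants_vanish \<kappa> A m \<and> mixed_second_order_cumulants_vanish \<kappa>2 A m"
    using mv unfolding mixed_second_order_cumulants_vanish_def by blast
qed

end

text \<open>The recursion says nothing about \<open>\<kappa>2\<close> at empty lists, so these values may be set to zero.\<close>

lemma real_second_order_cumulants_normalised:
  assumes "real_second_order_cumulants tr \<phi>2 \<kappa> \<kappa>2"
  shows "real_second_order_cumulants tr \<phi>2 \<kappa> (\<lambda>xs ys. if xs = [] \<or> ys = [] then 0 else \<kappa>2 xs ys)"
    (is "real_second_order_cumulants _ _ _ ?k")
proof -
  have "cumulant_PS \<kappa> ?k V xs ys = cumulant_PS \<kappa> \<kappa>2 V xs ys"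
    if "V \<in> PS' (length xs) (length ys) - {({{1..length xs + length ys}}, tau2 (length xs) (length ys))}"
    for V xs ys
    using that by (cases V) (auto intro!: cumulant_PS_cong)
  then show ?thesis using assms unfolding real_second_order_cumulants_iff Let_def by simp
qed

lemma (in real_second_order_ncps) coloured_cumulants:
  assumes A: "\<And>j. j \<in> {1..m} \<Longrightarrow> involutive_subalgebra scale tr (A j)"
    and "free_cumulants \<phi>1 \<kappa>" "real_second_order_cumulants tr \<phi>2 \<kappa> \<kappa>2"
    and "\<And>ys. \<kappa>2 [] ys = 0" "\<And>xs. \<kappa>2 xs [] = 0"
  shows "coloured_cumulants \<phi>1 \<kappa> tr \<phi>2 \<kappa>2 A m (\<lambda>x. x - scale (\<phi>1 x) 1)"
proof
  interpret l1: Vector_Spaces.linear scale "(*)" \<phi>1 by (rule \<phi>1_linear)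
  interpret l2: Vector_Spaces.linear scale "(*)" "\<lambda>x. \<phi>2 x y" for y by (rule \<phi>2_linear_left)
  interpret l3: Vector_Spaces.linear scale "(*)" "\<phi>2 x" for x by (rule \<phi>2_linear_right)
  have dec: "x * v = (x - scale (\<phi>1 x) 1) * v + scale (\<phi>1 x) (1 * v)" for x v
    unfolding scale_mult_left by (simp add: left_diff_distrib)
  show "\<phi>1 (x - scale (\<phi>1 x) 1) = 0" for x by (simp add: l1.diff l1.scale \<phi>1_one)
  show "\<phi>1 (x * v) = \<phi>1 ((x - scale (\<phi>1 x) 1) * v) + \<phi>1 x * \<phi>1 (1 * v)" for x v
    by (subst dec) (simp only: l1.add l1.scale)
  show "\<phi>2 (x * v) r = \<phi>2 ((x - scale (\<phi>1 x) 1) * v) r + \<phi>1 x * \<phi>2 (1 * v) r" for x v r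
    by (subst dec) (simp only: l2.add l2.scale)
  show "\<phi>2 r (x * v) = \<phi>2 r ((x - scale (\<phi>1 x) 1) * v) + \<phi>1 x * \<phi>2 r (1 * v)" for x v r
    by (subst dec) (simp only: l3.add l3.scale)
  fix j x y assume j: "j \<in> {1..m}" "x \<in> A j"
  show "x - scale (\<phi>1 x) 1 \<in> A j" "tr x \<in> A j"
    using A[OF j(1)] j(2) unfolding involutive_subalgebra_def by (auto intro: subspace_diff subspace_scale)
  show "x * y \<in> A j" if "y \<in> A j"
    using A[OF j(1)] j(2) that unfolding involutive_subalgebra_def by blast
qed (fact assms \<phi>1_tracial \<phi>1_one tr_tr tr_mult \<phi>1_tr \<phi>2_one_left \<phi>2_one_right \<phi>2_tracial_left
  \<phi>2_tracial_right \<phi>2_tr_left \<phi>2_tr_right)+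

theorem theorem3p4:
  fixes scale :: "complex \<Rightarrow> 'a :: ring_1 \<Rightarrow> 'a"
    and tr :: "'a \<Rightarrow> 'a" and \<phi>1 :: "'a \<Rightarrow> complex" and \<phi>2 :: "'a \<Rightarrow> 'a \<Rightarrow> complex"
    and A :: "nat \<Rightarrow> 'a set" and m :: nat
    and \<kappa> :: "'a list \<Rightarrow> complex" and \<kappa>2 :: "'a list \<Rightarrow> 'a list \<Rightarrow> complex"
  assumes "real_second_order_ncps scale tr \<phi>1 \<phi>2"
    and "\<And>j. j \<in> {1..m} \<Longrightarrow> involutive_subalgebra scale tr (A j)"
    and "free_cumulants \<phi>1 \<kappa>"
    and "real_second_order_cumulants tr \<phi>2 \<kappa> \<kappa>2"
  shows "real_second_order_free tr \<phi>1 \<phi>2 A m \<longleftrightarrow>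
    mixed_free_cumulants_vanish \<kappa> A m \<and> mixed_second_order_cumulants_vanish \<kappa>2 A m"
proof -
  let ?k = "\<lambda>xs ys. if xs = [] \<or> ys = [] then 0 else \<kappa>2 xs ys"
  interpret coloured_cumulants \<phi>1 \<kappa> tr \<phi>2 ?k A m "\<lambda>x. x - scale (\<phi>1 x) 1"
    by (rule real_second_order_ncps.coloured_cumulants[OF assms(1-3)
          real_second_order_cumulants_normalised[OF assms(4)]]) simp_all
  have "mixed_second_order_cumulants_vanish ?k A m = mixed_second_order_cumulants_vanish \<kappa>2 A m"
    unfolding mixed_second_order_cumulants_vanish_def by simp
  then show ?thesis using second_order_free_iff by simp
qed

end
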